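(* Let $\gamma>0$, $\Omega=(-1,1)\times(0,1)$ and $\omega=(a,b)\times(0,1)$ with $0<a<b<1$. Consider the control system $$\partial_t f-\partial_x^2 f-|x|^{2\gamma}\partial_y^2 f=u(t,x,y)1_\omega(x,y)\ \text{in }(0,T)\times\Omega,\qquad f=0\ \text{on }(0,T)\times\partial\Omega,\qquad f(0,\cdot)=f_0 .$$ Then: (1) if $\gamma\in(0,1)$, the system is null controllable in any time $T>0$; (2) if $\gamma=1$, there exists $T^*>0$ such that the system is null controllable in time $T$ for every $T>T^*$, and is not null controllable in time $T$ for every $T<T^*$; (3) if $\gamma>1$, the system is not null controllable in any time $T>0$.
   Context: Let $H=L^2(\Omega;\mathbb{R})$. Let $V$ be the completion of $C_c^\infty(\Omega)$ for the norm $|f|_V=\big(\int_\Omega (f_x^2+|x|^{2\gamma}f_y^2)\,dx\,dy\big)^{1/2}$. Let $A$ be the self-adjoint operator on $H$ associated with the bilinear form $a(f,g)=-\int_\Omega (f_xg_x+|x|^{2\gamma}f_yg_y)$ on $V$, i.e. $D(A)=\{f\in V:\exists c,\ |a(f,h)|\le c\|h\|_H\ \forall h\in V\}$ and $\langle Af,h\rangle=a(f,h)$ for all $h\in V$; then $Af=\partial_x^2f+|x|^{2\gamma}\partial_y^2 f$ a.e., and $A$ generates an analytic contraction semigroup $S(t)$ on $H$. For $f_0\in H$ and $u\in L^2((0,T)\times\Omega)$, the solution of the system is $f(t)=S(t)f_0+\int_0^tS(t-s)(1_\omega u(s))\,ds\in C([0,T];H)$ (equivalently, the unique weak solution: $\frac{d}{dt}\langle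 f(t),h\rangle=\langle f(t),Ah\rangle+\langle 1_\omega u(t),h\rangle$ for all $h\in D(A)$). The system is null controllable in time $T$ if for every $f_0\in L^2(\Omega)$ there exists $u\in L^2((0,T)\times\Omega)$ such that the solution satisfies $f(T,\cdot,\cdot)=0$. *)

theory Defs
  imports "HOL-Analysis.Analysis"
begin

definition Omega :: "(real \<times> real) set" where
  "Omega = {-1<..<1} \<times> {0<..<1}"

definition omega :: "real \<Rightarrow> real \<Rightarrow> (real \<times> real) set" where
  "omega a b = {a<..<b} \<times> {0<..<1}"

text \<open>Membership in L2(Omega) (functions considered up to a.e. equality).\<close>
definition L2 :: "(real \<times> real \<Rightarrow> real) \<Rightarrow> bool" where
  "L2 g \<longleftrightarrow> g \<in> borel_measurable (lebesgue_on Omega)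
     \<and> integrable (lebesgue_on Omega) (\<lambda>p. (g p)\<^sup>2)"

definition ip :: "(real \<times> real \<Rightarrow> real) \<Rightarrow> (real \<times> real \<Rightarrow> real) \<Rightarrow> real" where
  "ip g h = integral\<^sup>L (lebesgue_on Omega) (\<lambda>p. g p * h p)"

definition dist2 :: "(real \<times> real \<Rightarrow> real) \<Rightarrow> (real \<times> real \<Rightarrow> real) \<Rightarrow> real" where
  "dist2 g h = integral\<^sup>L (lebesgue_on Omega) (\<lambda>p. (g p - h p)\<^sup>2)"

definition dx :: "(real \<times> real \<Rightarrow> real) \<Rightarrow> real \<times> real \<Rightarrow> real" where
  "dx f p = deriv (\<lambda>s. f (s, snd p)) (fst p)"

definition dy :: "(real \<times> real \<Rightarrow> real) \<Rightarrow> real \<times> real \<Rightarrow> real" where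
  "dy f p = deriv (\<lambda>s. f (fst p, s)) (snd p)"

fun pd :: "bool list \<Rightarrow> (real \<times> real \<Rightarrow> real) \<Rightarrow> real \<times> real \<Rightarrow> real" where
  "pd [] f = f"
| "pd (b # w) f = (if b then dx (pd w f) else dy (pd w f))"

definition smooth2 :: "(real \<times> real \<Rightarrow> real) \<Rightarrow> bool" where
  "smooth2 f \<longleftrightarrow> (\<forall>w. continuous_on UNIV (pd w f)
     \<and> (\<forall>p. (\<lambda>s. pd w f (s, snd p)) differentiable (at (fst p))
          \<and> (\<lambda>s. pd w f (fst p, s)) differentiable (at (snd p))))"

definition Cc_inf :: "(real \<times> real \<Rightarrow> real) set" where
  "Cc_inf = {f. smooth2 f \<and> compact (closure {p. f p \<noteq> 0})
                 \<and> closure {p. f p \<noteq> 0} \<subseteq> Omega}"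

definition weight :: "real \<Rightarrow> real \<times> real \<Rightarrow> real" where
  "weight \<gamma> p = \<bar>fst p\<bar> powr (2 * \<gamma>)"

text \<open>Bform gives minus the form a on smooth functions: a(f,g) = - Bform f g; |f|_V^2 = Bform f f.\<close>
definition Bform :: "real \<Rightarrow> (real \<times> real \<Rightarrow> real) \<Rightarrow> (real \<times> real \<Rightarrow> real) \<Rightarrow> real" where
  "Bform \<gamma> f g = integral\<^sup>L (lebesgue_on Omega)
      (\<lambda>p. dx f p * dx g p + weight \<gamma> p * dy f p * dy g p)"

text \<open>phi is a V-Cauchy sequence in C_c^infinity(Omega) representing the element f of V
  (f being its limit in H).\<close>
definition V_approx :: "real \<Rightarrow> (nat \<Rightarrow> real \<times> real \<Rightarrow> real) \<Rightarrow> (real \<times> real \<Rightarrow> real) \<Rightarrow> bool" where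
  "V_approx \<gamma> \<phi> f \<longleftrightarrow> L2 f \<and> (\<forall>n. \<phi> n \<in> Cc_inf)
     \<and> (\<forall>\<epsilon>>0. \<exists>N. \<forall>m\<ge>N. \<forall>n\<ge>N.
           Bform \<gamma> (\<lambda>p. \<phi> m p - \<phi> n p) (\<lambda>p. \<phi> m p - \<phi> n p) < \<epsilon>)
     \<and> (\<lambda>n. dist2 (\<phi> n) f) \<longlonglongrightarrow> 0"

definition V :: "real \<Rightarrow> (real \<times> real \<Rightarrow> real) set" where
  "V \<gamma> = {f. \<exists>\<phi>. V_approx \<gamma> \<phi> f}"

text \<open>is_A gamma h g: h is in D(A) and A h = g, i.e. h in V, g in H and
  a(h,k) = <g,k> for all k in V, where a(h,k) = - lim Bform (phi n) (psi n).\<close>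
definition is_A :: "real \<Rightarrow> (real \<times> real \<Rightarrow> real) \<Rightarrow> (real \<times> real \<Rightarrow> real) \<Rightarrow> bool" where
  "is_A \<gamma> h g \<longleftrightarrow> h \<in> V \<gamma> \<and> L2 g \<and>
     (\<forall>k \<phi> \<psi>. V_approx \<gamma> \<phi> h \<longrightarrow> V_approx \<gamma> \<psi> k \<longrightarrow>
        (\<lambda>n. Bform \<gamma> (\<phi> n) (\<psi> n)) \<longlonglongrightarrow> - ip g k)"

definition control_L2 :: "real \<Rightarrow> (real \<Rightarrow> real \<times> real \<Rightarrow> real) \<Rightarrow> bool" where
  "control_L2 T u \<longleftrightarrow>
     (\<lambda>(t, p). u t p) \<in> borel_measurable (lebesgue_on ({0<..<T} \<times> Omega))
     \<and> integrable (lebesgue_on ({0<..<T} \<times> Omega)) (\<lambda>(t, p). (u t p)\<^sup>2)"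

text \<open>Weak solution in C([0,T];H), with the derivative identity written in integrated form.\<close>
definition weak_sol :: "real \<Rightarrow> real \<Rightarrow> real \<Rightarrow> real \<Rightarrow> (real \<times> real \<Rightarrow> real)
     \<Rightarrow> (real \<Rightarrow> real \<times> real \<Rightarrow> real) \<Rightarrow> (real \<Rightarrow> real \<times> real \<Rightarrow> real) \<Rightarrow> bool" where
  "weak_sol \<gamma> a b T f0 u f \<longleftrightarrow>
     (\<forall>t\<in>{0..T}. L2 (f t))
     \<and> (\<forall>t\<in>{0..T}. ((\<lambda>s. dist2 (f s) (f t)) \<longlongrightarrow> 0) (at t within {0..T}))
     \<and> (AE p in lebesgue_on Omega. f 0 p = f0 p)
     \<and> (\<forall>h g. is_A \<gamma> h g \<longrightarrow> (\<forall>t\<in>{0..T}.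
          set_integrable lborel {0..t}
            (\<lambda>s. ip (f s) g + ip (\<lambda>p. indicator (omega a b) p * u s p) h)
          \<and> ip (f t) h = ip f0 h + (LINT s:{0..t}|lborel.
               ip (f s) g + ip (\<lambda>p. indicator (omega a b) p * u s p) h)))"

definition null_controllable :: "real \<Rightarrow> real \<Rightarrow> real \<Rightarrow> real \<Rightarrow> bool" where
  "null_controllable \<gamma> a b T \<longleftrightarrow>
     (\<forall>f0. L2 f0 \<longrightarrow> (\<exists>u. control_L2 T u
        \<and> (\<exists>f. weak_sol \<gamma> a b T f0 u f)
        \<and> (\<forall>f. weak_sol \<gamma> a b T f0 u f \<longrightarrow> (AE p in lebesgue_on Omega. f T p = 0))))"

end

theory Submission
  imports Defs "HOL-Complex_Analysis.Complex_Analysis"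
begin

text \<open>
  Separation of variables in \<open>y\<close> and then in \<open>x\<close> diagonalises the operator: the eigenfunctions are \<open>v\<^sub>m\<^sub>,\<^sub>k(x) s\<^sub>m(y)\<close>, where the \<open>s\<^sub>m\<close>
  are the Dirichlet eigenfunctions on \<open>(0,1)\<close> with eigenvalues \<open>\<nu>\<^sub>m\<close> and the \<open>v\<^sub>m\<^sub>,\<^sub>k\<close> those of \<open>- v'' + \<nu>\<^sub>m |x|^(2\<gamma>) v = \<lambda> v\<close>
  on \<open>(-1,1)\<close>. By scaling, \<open>\<lambda>\<^sub>m\<^sub>,\<^sub>0\<close> is comparable with \<open>\<nu>\<^sub>m^(1/(1+\<gamma>))\<close>, whereas both the cost of controlling mode \<open>m\<close> through
  \<open>(a,b)\<close> and the smallness of its ground state on \<open>(a,b)\<close> are governed by \<open>exp (c \<surd>\<nu>\<^sub>m)\<close>. Hence the dissipation \<open>exp (- \<lambda> T)\<close> beats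
  the cost for every \<open>T\<close> if \<open>\<gamma> < 1\<close>, for large \<open>T\<close> only if \<open>\<gamma> = 1\<close>, and never if \<open>\<gamma> > 1\<close>.

  For the positive results each mode is first left to dissipate and then driven to zero by flatness: on either side of the control
  region the solution is a series in iterated solutions of the Volterra equation with Gevrey coefficients in time, cut off by a bump
  function, and the two series are glued inside \<open>(a,b)\<close>. For the negative results the maximum principle bounds the ground
  states on \<open>(a,b)\<close>, and the evolution of a single coefficient of the solution contradicts controllability as \<open>m\<close> tends to infinity.
\<close>

section \<open>Gevrey bump functions\<close>

text \<open>The control strip has full height, so a control of one x-mode times s_m is admissible:
  the modes decouple, the same two cutoffs steer all of them, and by linearity only the convergence
  of a sum is left. The cutoffs enter through constants common to all modes. The mode itself enters,
  up to polynomial factors, through exp(2 K), with K^2 = \<nu> + \<lambda> and 2 the length of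
  (-1,1), because the iterated Volterra equations share one exponential. The series converges when
  the j-th time derivative of the cutoff grows more slowly than (2j)!, that is for Gevrey order
  below 2; the bump used has order 3/2. No eigenvalue asymptotics are used: bounds on the sums of
  1/\<nu> and 1/\<lambda> yield both completeness and summability over the modes. Completeness of
  the products also gives uniqueness of weak solutions, which matters because
  \<open>null_controllable\<close> speaks of all of them. In the negative results the constant
  depends on the unknown control, so one initial datum must work for every m. For \<gamma> = 1 the
  critical time is not computed: it is the infimum of the controllable times, a set that extension
  by zero makes upward closed.\<close>

definition bump_hol :: "complex \<Rightarrow> complex" where
  "bump_hol z = exp (- (1 / z^2) - 1 / (1 - z)^2)"

text \<open>All derivatives are read off one holomorphic function, so that Cauchy's inequality can
  bound them. Outside (0,1) the value is 0, which makes \<open>bump_deriv j\<close> a candidate for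
  the j-th derivative on the whole line.\<close>

definition bump_deriv :: "nat \<Rightarrow> real \<Rightarrow> real" where
  "bump_deriv j x = (if 0 < x \<and> x < 1 then Re ((deriv ^^ j) bump_hol (complex_of_real x)) else 0)"

text \<open>On the disc of radius x/4 around x, (Re z)^2 - (Im z)^2 is at least x^2/2 and |z| is at
  most 5x/4, so Re (1/z^2) is at least (128/625)/x^2; the 5 rounds this off.\<close>

lemma Re_inverse_square_ge:
  assumes x: "x > 0" and z: "cmod (z - complex_of_real x) \<le> x / 4"
  shows "Re (1 / z^2) \<ge> 1 / (5 * x^2)"
proof -
  define u v where "u = Re z" and "v = Im z"
  have zuv: "z = Complex u v" by (simp add: u_def v_def)
  have "\<bar>u - x\<bar> \<le> x / 4" using abs_Re_le_cmod[of "z - complex_of_real x"] z by (simp add: u_def)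
  then have u: "3 * x / 4 \<le> u" by linarith
  have v: "\<bar>v\<bar> \<le> x / 4" using abs_Im_le_cmod[of "z - complex_of_real x"] z by (simp add: v_def)
  have v2: "v^2 \<le> x^2 / 16" using power_mono[OF v, of 2] by (simp add: power_divide)
  have u2: "9 * x^2 / 16 \<le> u^2"
    using power_mono[OF u, of 2] x by (simp add: power_divide power_mult_distrib)
  have x2: "x^2 > 0" using x by simp
  have s: "0 < u^2 + v^2" using u2 x2 zero_le_power2[of v] by linarith
  have "cmod z \<le> cmod (z - complex_of_real x) + cmod (complex_of_real x)"
    using norm_triangle_ineq[of "z - complex_of_real x" "complex_of_real x"] by simp
  then have "cmod z \<le> 5 * x / 4" using z x by simp
  then have "(cmod z)^2 \<le> (5 * x / 4)^2" by (intro power_mono) auto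
  then have s2: "u^2 + v^2 \<le> 25 / 16 * x^2"
    by (simp add: cmod_power2 u_def v_def power_divide power_mult_distrib)
  have "(u^2 + v^2)^2 \<le> (25 / 16 * x^2)^2" using s2 s by (intro power_mono) auto
  then have "(u^2 - v^2) / (u^2 + v^2)^2 \<ge> (x^2 / 2) / (25 / 16 * x^2)^2"
    using u2 v2 s x2 by (intro frac_le) auto
  moreover have "(x^2 / 2) / (25 / 16 * x^2)^2 = (1 / (25/16)^2 / 2) / x^2"
    using x2 by (simp add: power2_eq_square)
  moreover have "1 / (5 * x^2) = (1 / 5) / x^2" by simp
  moreover have "(1 / 5) / x^2 \<le> (1 / (25/16)^2 / 2) / x^2"
    using x2 by (intro divide_right_mono) (auto simp: power2_eq_square)
  moreover have "Re (1 / z^2) = (u^2 - v^2) / (u^2 + v^2)^2"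
    by (simp add: zuv Re_divide power2_eq_square) (simp add: algebra_simps power2_eq_square)
  ultimately show ?thesis by linarith
qed

lemma bump_hol_holomorphic: "bump_hol holomorphic_on (- {0, 1})"
  unfolding bump_hol_def by (intro holomorphic_intros) auto

text \<open>Cauchy's inequality on the circle of radius d/4, where d is the distance to the nearer
  endpoint. On this circle both terms of the exponent have real part of the right sign, and the one
  belonging to the nearer endpoint supplies exp(-1/(5 d^2)).\<close>

lemma norm_deriv_bump_hol_le:
  assumes x: "0 < x" "x < 1" and d: "d = min x (1 - x)"
  shows "cmod ((deriv ^^ j) bump_hol (complex_of_real x)) \<le> fact j * exp (- (1 / (5 * d^2))) / (d / 4) ^ j"
proof (rule Cauchy_inequality)
  have d0: "d > 0" "d \<le> x" "d \<le> 1 - x" using x d by auto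
  have sub: "cball (complex_of_real x) (d / 4) \<subseteq> - {0, 1}"
  proof
    fix z assume "z \<in> cball (complex_of_real x) (d / 4)"
    then have z: "cmod (complex_of_real x - z) \<le> d / 4" by (simp add: dist_norm)
    have "z \<noteq> 0" using z d0 by auto
    moreover have "z \<noteq> 1"
    proof
      assume "z = 1"
      then have "cmod (complex_of_real (x - 1)) \<le> d / 4" using z by simp
      then have "\<bar>x - 1\<bar> \<le> d / 4" by (simp only: norm_of_real)
      then show False using d0 x by linarith
    qed
    ultimately show "z \<in> - {0, 1}" by simp
  qed
  show "bump_hol holomorphic_on ball (complex_of_real x) (d / 4)"
    using sub ball_subset_cball by (intro holomorphic_on_subset[OF bump_hol_holomorphic]) blast
  show "continuous_on (cball (complex_of_real x) (d / 4)) bump_hol"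
    by (rule holomorphic_on_imp_continuous_on[OF holomorphic_on_subset[OF bump_hol_holomorphic sub]])
  show "0 < d / 4" using d0 by simp
  fix z assume z: "cmod (complex_of_real x - z) = d / 4"
  have "Re (1 / z^2) \<ge> 1 / (5 * x^2)"
    using z d0 by (intro Re_inverse_square_ge x) (simp add: norm_minus_commute)
  moreover have "Re (1 / (1 - z)^2) \<ge> 1 / (5 * (1 - x)^2)"
  proof (rule Re_inverse_square_ge)
    have "1 - z - complex_of_real (1 - x) = complex_of_real x - z" by simp
    then show "cmod (1 - z - complex_of_real (1 - x)) \<le> (1 - x) / 4" using z d0 by simp
  qed (use x in simp)
  moreover have "1 / (5 * d^2) \<le> 1 / (5 * x^2) + 1 / (5 * (1 - x)^2)"
  proof -
    have "0 \<le> 1 / (5 * x^2)" "0 \<le> 1 / (5 * (1 - x)^2)" by auto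
    then show ?thesis using d by (auto simp: min_def)
  qed
  ultimately have "- Re (1 / z^2) - Re (1 / (1 - z)^2) \<le> - (1 / (5 * d^2))" by linarith
  then show "cmod (bump_hol z) \<le> exp (- (1 / (5 * d^2)))"
    by (simp only: bump_hol_def norm_exp_eq_Re exp_le_cancel_iff minus_complex.sel uminus_complex.sel)
qed

lemma power_over_fact_le_exp:
  fixes s :: real
  assumes "s \<ge> 0"
  shows "s ^ j / fact j \<le> exp s"
proof -
  have "(\<Sum>n\<in>{j}. s ^ n /\<^sub>R fact n) \<le> (\<Sum>n. s ^ n /\<^sub>R fact n)"
    using assms by (intro sum_le_suminf summable_exp_generic) auto
  then show ?thesis by (simp add: exp_def field_simps)
qed

text \<open>Trades the exponential smallness for j powers of d. They cancel the factor (d/4)^(-j) of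
  the Cauchy estimate at the price of sqrt(j!), which is where the Gevrey order 3/2 comes
  from.\<close>

lemma exp_inverse_square_le:
  fixes d :: real
  assumes "d > 0"
  shows "exp (- (1 / (5 * d^2))) \<le> sqrt (5 ^ j * fact j) * d ^ j"
proof -
  define s where "s = 1 / (5 * d^2)"
  have s: "s > 0" using assms by (simp add: s_def)
  have "s ^ j / fact j \<le> exp s" using s by (intro power_over_fact_le_exp) simp
  \<comment> \<open>The exponent is doubled because the bound is extracted as a square root: exp(-2
    s) is the square of the quantity sought.\<close>
  also have "\<dots> \<le> exp (2 * s)" using s by simp
  finally have "s ^ j \<le> fact j * exp (2 * s)" by (simp add: field_simps)
  then have "exp (- (2 * s)) \<le> fact j * (1 / s) ^ j"
    using s by (simp add: exp_minus field_simps power_divide)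
  also have "1 / s = 5 * d^2" by (simp add: s_def)
  finally have *: "(exp (- s))^2 \<le> 5 ^ j * fact j * (d ^ j)^2"
    by (simp add: power2_eq_square exp_add[symmetric] power_mult_distrib algebra_simps)
  have "exp (- s) \<le> sqrt (5 ^ j * fact j * (d ^ j)^2)"
    using * by (intro real_le_rsqrt)
  also have "\<dots> = sqrt (5 ^ j * fact j) * d ^ j"
    using assms by (simp add: real_sqrt_mult)
  finally show ?thesis by (simp add: s_def)
qed

lemma abs_bump_deriv_le: "\<bar>bump_deriv j x\<bar> \<le> fact j * 4 ^ j * sqrt (5 ^ j * fact j)"
proof (cases "0 < x \<and> x < 1")
  case True
  define d where "d = min x (1 - x)"
  have d: "d > 0" using True by (simp add: d_def)
  have "\<bar>bump_deriv j x\<bar> \<le> fact j * exp (- (1 / (5 * d^2))) / (d / 4) ^ j"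
    using norm_deriv_bump_hol_le[OF _ _ d_def, of j] True abs_Re_le_cmod order_trans
    by (fastforce simp: bump_deriv_def)
  also have "\<dots> \<le> fact j * (sqrt (5 ^ j * fact j) * d ^ j) / (d / 4) ^ j"
    using d by (intro divide_right_mono mult_left_mono exp_inverse_square_le) auto
  also have "\<dots> = fact j * 4 ^ j * sqrt (5 ^ j * fact j)"
    using d by (simp add: power_divide)
  finally show ?thesis .
qed (auto simp: bump_deriv_def)

text \<open>Using the smallness at order j + 2 instead of j leaves two spare powers of d. The
  resulting quadratic bound at 0 and 1 makes the extension by zero differentiable there, with
  derivative 0.\<close>

lemma abs_bump_deriv_le_square:
  assumes "x0 \<le> 0 \<or> 1 \<le> x0"
  shows "\<bar>bump_deriv j x\<bar> \<le> fact j * 4 ^ j * sqrt (5 ^ (j + 2) * fact (j + 2)) * (x - x0)^2"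
proof (cases "0 < x \<and> x < 1")
  case True
  define d where "d = min x (1 - x)"
  have d: "d > 0" using True by (simp add: d_def)
  have "\<bar>bump_deriv j x\<bar> \<le> fact j * exp (- (1 / (5 * d^2))) / (d / 4) ^ j"
    using norm_deriv_bump_hol_le[OF _ _ d_def, of j] True abs_Re_le_cmod order_trans
    by (fastforce simp: bump_deriv_def)
  also have "\<dots> \<le> fact j * (sqrt (5 ^ (j + 2) * fact (j + 2)) * d ^ (j + 2)) / (d / 4) ^ j"
    using d by (intro divide_right_mono mult_left_mono exp_inverse_square_le) auto
  also have "\<dots> = fact j * 4 ^ j * sqrt (5 ^ (j + 2) * fact (j + 2)) * d^2"
    using d by (simp add: power_divide power_add power2_eq_square)
  also have "\<dots> \<le> fact j * 4 ^ j * sqrt (5 ^ (j + 2) * fact (j + 2)) * \<bar>x - x0\<bar>^2"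
  proof (intro mult_left_mono power_mono)
    show "d \<le> \<bar>x - x0\<bar>" using assms True by (auto simp: d_def)
  qed (use d in auto)
  finally show ?thesis by simp
qed (auto simp: bump_deriv_def)

lemma has_real_derivative_zero_of_quadratic_bound:
  fixes f :: "real \<Rightarrow> real"
  assumes "\<And>x. \<bar>f x\<bar> \<le> C * (x - x0)^2"
  shows "(f has_real_derivative 0) (at x0)"
proof -
  have f0: "f x0 = 0" using assms[of x0] by simp
  have "((\<lambda>h. C * \<bar>h\<bar>) \<longlongrightarrow> C * \<bar>0\<bar>) (at 0)" by (intro tendsto_intros)
  then have lim: "((\<lambda>h. C * \<bar>h\<bar>) \<longlongrightarrow> 0) (at 0)" by simp
  have "((\<lambda>h. (f (x0 + h) - f x0) / h) \<longlongrightarrow> 0) (at 0)"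
  proof (rule Lim_null_comparison[OF _ lim])
    show "\<forall>\<^sub>F h in at 0. norm ((f (x0 + h) - f x0) / h) \<le> C * \<bar>h\<bar>"
      using assms[of "x0 + _"] f0 
      by (intro always_eventually allI) (auto simp: divide_le_eq power2_eq_square mult.assoc)
  qed
  then show ?thesis by (simp add: DERIV_def)
qed

lemma bump_deriv_has_real_derivative:
  "(bump_deriv j has_real_derivative bump_deriv (Suc j) x) (at x)"
proof (cases "0 < x \<and> x < 1")
  case True
  have op: "open (- {0, 1 :: complex})" by auto
  have "complex_of_real x \<in> - {0, 1}" using True by auto
  then have "((deriv ^^ j) bump_hol has_field_derivative (deriv ^^ Suc j) bump_hol (complex_of_real x)) (at (complex_of_real x))"
    using holomorphic_derivI[OF holomorphic_higher_deriv[OF bump_hol_holomorphic op] op] by simp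
  then have "((\<lambda>t. Re ((deriv ^^ j) bump_hol (complex_of_real t))) has_vector_derivative Re ((deriv ^^ Suc j) bump_hol (complex_of_real x))) (at x)"
    by (intro bounded_linear.has_vector_derivative[OF bounded_linear_Re] has_vector_derivative_real_field)
  then have "((\<lambda>t. Re ((deriv ^^ j) bump_hol (complex_of_real t))) has_real_derivative bump_deriv (Suc j) x) (at x)"
    using True by (simp add: has_real_derivative_iff_has_vector_derivative bump_deriv_def)
  then show ?thesis
  proof (rule has_field_derivative_transform_within_open[of _ _ _ "{0<..<1}"])
  qed (use True in \<open>auto simp: bump_deriv_def\<close>)
next
  case False
  show ?thesis
  proof -
    have "(bump_deriv j has_real_derivative 0) (at x)"
      by (rule has_real_derivative_zero_of_quadratic_bound[OF abs_bump_deriv_le_square]) (use False in auto)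
    moreover have "bump_deriv (Suc j) x = 0" using False by (auto simp: bump_deriv_def)
    ultimately show ?thesis by simp
  qed
qed

lemma bump_deriv_0_pos: assumes "0 < x" "x < 1" shows "bump_deriv 0 x > 0"
proof -
  have "bump_hol (complex_of_real x) = complex_of_real (exp (- (1 / x^2) - 1 / (1 - x)^2))"
    by (simp add: bump_hol_def exp_of_real[symmetric])
  then show ?thesis using assms by (simp add: bump_deriv_def)
qed

lemma bump_deriv_0_nonneg: "bump_deriv 0 x \<ge> 0"
  using bump_deriv_0_pos[of x] by (cases "0 < x \<and> x < 1") (auto simp: bump_deriv_def)

text \<open>One minus the normalised primitive of the bump, rescaled to [T1,T2]; the higher
  \<open>D j\<close> are its exact derivatives. It serves as the cutoff in time, as the gluing
  function in x and, in the approximation by test functions, as the cutoff near the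
  boundary.\<close>

lemma gevrey_step_exists:
  fixes T1 T2 :: real
  assumes "T1 < T2"
  obtains D :: "nat \<Rightarrow> real \<Rightarrow> real" and C R :: real
  where "\<And>j t. (D j has_real_derivative D (Suc j) t) (at t)"
    and "\<And>t. t \<le> T1 \<Longrightarrow> D 0 t = 1" and "\<And>t. t \<ge> T2 \<Longrightarrow> D 0 t = 0"
    and "\<And>j t. t \<le> T1 \<or> T2 \<le> t \<Longrightarrow> D (Suc j) t = 0"
    and "C > 0" "R > 0" "\<And>j t. \<bar>D j t\<bar> \<le> C * R ^ j * (fact j * sqrt (fact j))"
    and "\<And>t. 0 \<le> D 0 t" "\<And>t. D 0 t \<le> 1"
proof -
  let ?b = "bump_deriv 0"
  have contb: "continuous_on A ?b" for A
    using bump_deriv_has_real_derivative[of 0] by (intro DERIV_continuous_on[of A _ "bump_deriv 1"]) (auto intro: has_field_derivative_at_within)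
  have intb: "?b integrable_on {x..y}" for x y by (intro integrable_continuous_real contb)
  define B where "B x = integral {-1..x} ?b" for x
  have B0: "B x = 0" if "x \<le> 0" for x
    unfolding B_def using that by (intro integral_unique has_integral_is_0) (auto simp: bump_deriv_def)
  have Bmono: "B x \<le> B y" if "x \<le> y" for x y
    unfolding B_def using that bump_deriv_0_nonneg by (intro integral_subset_le intb) auto
  have B1: "B x = B 1" if "x \<ge> 1" for x
  proof -
    have "integral {-1..1} ?b + integral {1..x} ?b = integral {-1..x} ?b"
      using that by (intro Henstock_Kurzweil_Integration.integral_combine intb) auto
    moreover have "integral {1..x} ?b = 0"
      by (intro integral_unique has_integral_is_0) (auto simp: bump_deriv_def)
    ultimately show ?thesis by (simp add: B_def)
  qed
  define c where "c = B 1"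
  have c: "c > 0"
  proof -
    have "c \<noteq> 0"
    proof
      assume "c = 0"
      then have "\<forall>x\<in>{-1..1}. ?b x = 0"
        using integral_eq_0_iff[of "-1" 1 ?b] contb bump_deriv_0_nonneg by (auto simp: c_def B_def)
      then show False using bump_deriv_0_pos[of "1/2"] by force
    qed
    moreover have "c \<ge> 0" using Bmono[of 0 1] B0[of 0] by (simp add: c_def)
    ultimately show ?thesis by simp
  qed
  have B_range: "0 \<le> B x" "B x \<le> c" for x
    using B0[of "min x 0"] Bmono[of "min x 0" x] B1[of "max x 1"] Bmono[of x "max x 1"] by (auto simp: c_def)
  have dB: "(B has_real_derivative ?b x) (at x)" for x
  proof (cases "x > -1")
    case True
    have "((\<lambda>u. integral {-1..u} ?b) has_real_derivative ?b x) (at x within {-1..x+1})"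
      using True by (intro integral_has_real_derivative contb) auto
    moreover have "at x within {-1..x+1} = at x" using True by (intro at_within_interior) auto
    ultimately show ?thesis unfolding B_def by simp
  next
    case False
    have "((\<lambda>x. 0) has_real_derivative ?b x) (at x)" using False by (simp add: bump_deriv_def)
    then show ?thesis
      by (rule has_field_derivative_transform_within_open[of _ _ _ "{..<0}"]) (use False B0 in auto)
  qed
  define L where "L = T2 - T1"
  have L: "L > 0" using assms by (simp add: L_def)
  define D where "D j t = (case j of 0 \<Rightarrow> 1 - B ((t - T1) / L) / c
      | Suc i \<Rightarrow> - bump_deriv i ((t - T1) / L) / (c * L ^ Suc i))" for j t
  show thesis
  proof
    show "(D j has_real_derivative D (Suc j) t) (at t)" for j t
    proof (cases j)
      case 0
      have "((\<lambda>t. 1 - B ((t - T1) / L) / c) has_real_derivative - (?b ((t - T1) / L) * (1 / L) / c)) (at t)"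
        using L c by (auto intro!: derivative_eq_intros DERIV_chain'[OF _ dB])
      then show ?thesis using 0 L c by (simp add: D_def[abs_def] field_simps)
    next
      case (Suc i)
      have "((\<lambda>t. - bump_deriv i ((t - T1) / L) / (c * L ^ Suc i)) has_real_derivative
         - (bump_deriv (Suc i) ((t - T1) / L) * (1 / L)) / (c * L ^ Suc i)) (at t)"
        using L c by (auto intro!: derivative_eq_intros DERIV_chain'[OF _ bump_deriv_has_real_derivative])
      then show ?thesis using Suc L c by (simp add: D_def[abs_def] field_simps)
    qed
    show "D 0 t = 1" if "t \<le> T1" for t using B0[of "(t - T1) / L"] that L by (simp add: D_def divide_nonpos_pos)
    show "D 0 t = 0" if "t \<ge> T2" for t using B1[of "(t - T1) / L"] that L c by (simp add: D_def L_def c_def)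
    show "D (Suc j) t = 0" if "t \<le> T1 \<or> T2 \<le> t" for j t
    proof -
      have "(t - T1) / L \<le> 0 \<or> (t - T1) / L \<ge> 1" using that L by (auto simp: L_def divide_nonpos_pos)
      then show ?thesis by (auto simp: D_def bump_deriv_def)
    qed
    \<comment> \<open>C = 1 + 1/c covers \<open>D 0\<close>, which is bounded by 1, and the
      derivatives, which carry the normalisation 1/c; R = 12/L comes from 4 * sqrt 5 \<le>
      12.\<close>
    show "0 < 1 + 1 / c" "0 < 12 / L" using c L by (auto intro: add_pos_pos)
    show D0: "0 \<le> D 0 t" "D 0 t \<le> 1" for t using B_range[of "(t - T1) / L"] c by (auto simp: D_def)
    show "\<bar>D j t\<bar> \<le> (1 + 1 / c) * (12 / L) ^ j * (fact j * sqrt (fact j))" for j t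
    proof (cases j)
      case 0
      have "\<bar>D 0 t\<bar> \<le> 1" using D0[of t] by simp
      also have "1 \<le> 1 + 1 / c" using c by simp
      finally show ?thesis using 0 by simp
    next
      case (Suc i)
      have s5: "sqrt 5 ^ i \<le> (3::real) ^ i" by (intro power_mono real_le_lsqrt) auto
      have "\<bar>D j t\<bar> = \<bar>bump_deriv i ((t - T1) / L)\<bar> / (c * L ^ j)" using Suc L c by (simp add: D_def abs_mult)
      also have "\<dots> \<le> fact i * 4 ^ i * sqrt (5 ^ i * fact i) / (c * L ^ j)"
        using L c by (intro divide_right_mono abs_bump_deriv_le) auto
      also have "\<dots> = (1 / c) * (4 ^ i * sqrt 5 ^ i / L ^ j) * (fact i * sqrt (fact i))"
        by (simp add: real_sqrt_mult real_sqrt_power)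
      also have "\<dots> \<le> (1 + 1 / c) * (12 / L) ^ j * (fact j * sqrt (fact j))"
      proof (intro mult_mono)
        have "4 ^ i * sqrt 5 ^ i \<le> 4 ^ i * (3::real) ^ i" using s5 by (intro mult_left_mono) auto
        also have "\<dots> = 12 ^ i" by (simp add: power_mult_distrib[symmetric])
        also have "\<dots> \<le> (12::real) ^ j" using Suc by (intro power_increasing) auto
        finally show "4 ^ i * sqrt 5 ^ i / L ^ j \<le> (12 / L) ^ j" using L by (simp add: power_divide divide_right_mono)
        show "fact i \<le> (fact j :: real)" using Suc by (intro fact_mono) auto
        then show "sqrt (fact i) \<le> sqrt (fact j)" by simp
      qed (use c L in auto)
      finally show ?thesis .
    qed
  qed
qed

text \<open>Since (j!)^2 \<le> (2j)!, the terms are at most B^j / sqrt(j!), and comparing (4 B^2)^j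
  / j! with exp(4 B^2) leaves a geometric series of ratio 1/2. This is where an order below 2 is
  decisive.\<close>

lemma summable_gevrey:
  fixes B :: real
  assumes "B \<ge> 0"
  shows "summable (\<lambda>j. B ^ j * (fact j * sqrt (fact j)) / fact (2 * j))"
proof (rule summable_comparison_test')
  have ex: "(4 * B^2) ^ j / fact j \<le> exp (4 * B^2)" for j
    by (rule power_over_fact_le_exp) simp
  show "summable (\<lambda>j. sqrt (exp (4 * B^2)) * (1 / 2) ^ j)" by (intro summable_mult summable_geometric) auto
  fix j :: nat assume "0 \<le> j"
  have "(fact j * fact j :: real) \<le> fact (2 * j)"
  proof -
    have "fact j * fact j dvd (fact (2 * j) :: nat)" using fact_fact_dvd_fact[of j j] by (simp add: mult_2)
    then have "fact j * fact j \<le> (fact (2 * j) :: nat)" by (rule dvd_imp_le) simp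
    then have "real (fact j * fact j) \<le> real (fact (2 * j))" by (simp only: of_nat_le_iff)
    then show ?thesis by simp
  qed
  then have "B ^ j * (fact j * sqrt (fact j)) / fact (2 * j) \<le> B ^ j * (fact j * sqrt (fact j)) / (fact j * fact j)"
    using assms by (intro divide_left_mono) auto
  also have "\<dots> = B ^ j / sqrt (fact j)"
    by (simp add: field_simps)
  also have "\<dots> = sqrt ((4 * B^2) ^ j / fact j) * (1 / 2) ^ j"
    using assms by (simp add: real_sqrt_divide real_sqrt_power real_sqrt_mult power_mult_distrib power_divide)
  also have "\<dots> \<le> sqrt (exp (4 * B^2)) * (1 / 2) ^ j"
    using ex[of j] by (intro mult_right_mono) auto
  finally show "norm (B ^ j * (fact j * sqrt (fact j)) / fact (2 * j)) \<le> sqrt (exp (4 * B^2)) * (1 / 2) ^ j"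
    using assms by simp
qed

section \<open>Volterra equations on an interval\<close>

text \<open>Derivatives are one-sided at the endpoints and appear as arguments, so that a second
  order equation is expressed by writing its right-hand side in the place of
  \<open>w2\<close>.\<close>

definition C2_on :: "real \<Rightarrow> real \<Rightarrow> (real \<Rightarrow> real) \<Rightarrow> (real \<Rightarrow> real) \<Rightarrow> (real \<Rightarrow> real) \<Rightarrow> bool" where
  "C2_on l r w w1 w2 \<longleftrightarrow>
     (\<forall>x\<in>{l..r}. (w has_real_derivative w1 x) (at x within {l..r})
        \<and> (w1 has_real_derivative w2 x) (at x within {l..r}))
     \<and> continuous_on {l..r} w2"

definition Jint :: "real \<Rightarrow> (real \<Rightarrow> real) \<Rightarrow> real \<Rightarrow> real" where
  "Jint l f x = integral {l..x} f"

lemma C2_onD: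
  assumes "C2_on l r w w1 w2"
  shows "\<And>x. x \<in> {l..r} \<Longrightarrow> (w has_real_derivative w1 x) (at x within {l..r})"
    and "\<And>x. x \<in> {l..r} \<Longrightarrow> (w1 has_real_derivative w2 x) (at x within {l..r})"
    and "continuous_on {l..r} w" "continuous_on {l..r} w1" "continuous_on {l..r} w2"
proof -
  show *: "\<And>x. x \<in> {l..r} \<Longrightarrow> (w has_real_derivative w1 x) (at x within {l..r})"
    "\<And>x. x \<in> {l..r} \<Longrightarrow> (w1 has_real_derivative w2 x) (at x within {l..r})"
    "continuous_on {l..r} w2" using assms by (auto simp: C2_on_def)
  show "continuous_on {l..r} w" "continuous_on {l..r} w1"
    using DERIV_continuous_on[OF *(1)] DERIV_continuous_on[OF *(2)] by auto
qed

lemma C2_on_cong: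
  assumes "C2_on l r w w1 w2" "\<And>x. x \<in> {l..r} \<Longrightarrow> w2 x = w3 x"
  shows "C2_on l r w w1 w3"
  using assms continuous_on_cong[of "{l..r}" "{l..r}" w2 w3] by (auto simp: C2_on_def)

lemma Jint_deriv:
  assumes "continuous_on {l..r} f" "x \<in> {l..r}"
  shows "(Jint l f has_real_derivative f x) (at x within {l..r})"
  using integral_has_real_derivative[OF assms] by (simp add: Jint_def[abs_def])

lemma Jint_continuous:
  assumes "continuous_on {l..r} f"
  shows "continuous_on {l..r} (Jint l f)"
  using DERIV_continuous_on[OF Jint_deriv[OF assms]] by auto

lemma Jint_left [simp]: "Jint l f l = 0"
  by (simp add: Jint_def)

lemma Jint_bound:
  assumes f: "continuous_on {l..r} f" and x: "x \<in> {l..r}"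
    and G: "\<And>x. x \<in> {l..r} \<Longrightarrow> (G has_real_derivative g x) (at x within {l..r})"
    and fg: "\<And>x. x \<in> {l..r} \<Longrightarrow> \<bar>f x\<bar> \<le> g x" and G0: "0 \<le> G l"
  shows "\<bar>Jint l f x\<bar> \<le> G x"
proof -
  have "(g has_integral (G x - G l)) {l..x}"
    using x by (intro fundamental_theorem_of_calculus)
      (auto simp: has_real_derivative_iff_has_vector_derivative[symmetric] intro!: has_field_derivative_subset[OF G])
  moreover have "norm (integral {l..x} f) \<le> integral {l..x} g"
    using x calculation fg by (intro integral_norm_bound_integral integrable_continuous_real[OF continuous_on_subset[OF f]]) auto
  ultimately show ?thesis using G0 by (simp add: Jint_def integral_unique)
qed

text \<open>Majorant principle for the double primitive: if |f| is dominated by W'' and both W and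
  W' start nonnegative, integrating twice keeps the domination.\<close>

lemma Jint2_bound:
  assumes f: "continuous_on {l..r} f" and x: "x \<in> {l..r}" and W: "C2_on l r W W1 W2"
    and fg: "\<And>x. x \<in> {l..r} \<Longrightarrow> \<bar>f x\<bar> \<le> W2 x" and G0: "0 \<le> W l" "0 \<le> W1 l"
  shows "\<bar>Jint l (Jint l f) x\<bar> \<le> W x"
  by (rule Jint_bound[OF Jint_continuous[OF f] x C2_onD(1)[OF W] Jint_bound[OF f _ C2_onD(2)[OF W] fg]])
     (use G0 in auto)

lemma Jint_C2_on:
  assumes "continuous_on {l..r} f"
  shows "C2_on l r (Jint l (Jint l f)) (Jint l f) f"
  using assms by (auto simp: C2_on_def intro!: Jint_deriv Jint_continuous)

lemma power_over_fact_deriv: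
  "((\<lambda>x. (x - l) ^ Suc n / fact (Suc n)) has_real_derivative (x - l) ^ n / fact n) (at x within S)"
  for l x :: real
proof -
  have "((\<lambda>x. (x - l) ^ Suc n / fact (Suc n)) has_real_derivative (real (Suc n) * (x - l) ^ n) / fact (Suc n)) (at x within S)"
    by (intro DERIV_cdivide) (rule derivative_eq_intros refl | simp)+
  also have "(real (Suc n) * (x - l) ^ n) / fact (Suc n) = (x - l) ^ n / fact n"
    unfolding fact_Suc by (rule nonzero_mult_divide_mult_cancel_left) simp
  finally show ?thesis .
qed

lemma C2_on_power:
  "C2_on l r (\<lambda>x. A * ((x - l) ^ Suc (Suc n) / fact (Suc (Suc n)))) (\<lambda>x. A * ((x - l) ^ Suc n / fact (Suc n)))
     (\<lambda>x. A * ((x - l) ^ n / fact n))"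
  unfolding C2_on_def
  by (intro conjI ballI DERIV_cmult power_over_fact_deriv) (auto intro!: continuous_intros)

text \<open>The majorant of the Volterra iteration. For nonnegative A and K its second derivative
  dominates K^2 times itself plus the source A exp(K (x - l)) (x - l)^n / n!, the middle term being
  nonnegative.\<close>

lemma C2_on_exp_power:
  "C2_on l r (\<lambda>x. A * exp (K * (x - l)) * ((x - l) ^ Suc (Suc n) / fact (Suc (Suc n))))
     (\<lambda>x. A * exp (K * (x - l)) * (K * ((x - l) ^ Suc (Suc n) / fact (Suc (Suc n))) + (x - l) ^ Suc n / fact (Suc n)))
     (\<lambda>x. A * exp (K * (x - l)) * (K^2 * ((x - l) ^ Suc (Suc n) / fact (Suc (Suc n)))
        + 2 * K * ((x - l) ^ Suc n / fact (Suc n)) + (x - l) ^ n / fact n))"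
proof -
  have e: "((\<lambda>x. A * exp (K * (x - l))) has_real_derivative A * exp (K * (x - l)) * K) (at x within {l..r})" for x
    by (auto intro!: derivative_eq_intros)
  show ?thesis
    unfolding C2_on_def
  proof (intro conjI ballI)
    fix x
    note d1 = power_over_fact_deriv[of l n x "{l..r}"] and d2 = power_over_fact_deriv[of l "Suc n" x "{l..r}"]
    show "((\<lambda>x. A * exp (K * (x - l)) * ((x - l) ^ Suc (Suc n) / fact (Suc (Suc n)))) has_real_derivative
       A * exp (K * (x - l)) * (K * ((x - l) ^ Suc (Suc n) / fact (Suc (Suc n))) + (x - l) ^ Suc n / fact (Suc n))) (at x within {l..r})"
      by (rule DERIV_cong[OF DERIV_mult[OF e d2]]) (simp only: algebra_simps)
    show "((\<lambda>x. A * exp (K * (x - l)) * (K * ((x - l) ^ Suc (Suc n) / fact (Suc (Suc n))) + (x - l) ^ Suc n / fact (Suc n)))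
       has_real_derivative A * exp (K * (x - l)) * (K^2 * ((x - l) ^ Suc (Suc n) / fact (Suc (Suc n)))
         + 2 * K * ((x - l) ^ Suc n / fact (Suc n)) + (x - l) ^ n / fact n)) (at x within {l..r})"
      by (rule DERIV_cong[OF DERIV_mult[OF e DERIV_add[OF DERIV_cmult[OF d2, of K] d1]]])
         (simp add: algebra_simps power2_eq_square del: power_Suc fact_Suc)
  qed (auto intro!: continuous_intros)
qed

text \<open>Picard iteration for the double primitive of p w + f. The majorant in the conclusion is
  preserved by every iterate, because its second derivative exceeds K^2 times itself plus the bound
  on f. The factor M exp(K (x - l)) is the same in the hypothesis on f and in the conclusion, so
  repeated use gains powers over factorials but pays only one exponential.\<close>

lemma volterra_exists:
  fixes p f :: "real \<Rightarrow> real" and l r K M :: real and m :: nat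
  assumes lr: "l \<le> r" and p: "continuous_on {l..r} p" and f: "continuous_on {l..r} f"
    and K: "K \<ge> 0" and pK: "\<And>x. x \<in> {l..r} \<Longrightarrow> \<bar>p x\<bar> \<le> K^2"
    and fM: "\<And>x. x \<in> {l..r} \<Longrightarrow> \<bar>f x\<bar> \<le> M * exp (K * (x - l)) * ((x - l) ^ m / fact m)"
    and M: "M \<ge> 0"
  obtains w w1 where "C2_on l r w w1 (\<lambda>x. p x * w x + f x)" "w l = 0" "w1 l = 0"
    "\<And>x. x \<in> {l..r} \<Longrightarrow> \<bar>w x\<bar> \<le> M * exp (K * (x - l)) * ((x - l) ^ Suc (Suc m) / fact (Suc (Suc m)))"
proof -
  define w where "w = rec_nat (\<lambda>x. 0) (\<lambda>_ w. Jint l (Jint l (\<lambda>x. p x * w x + f x)))"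
  have w0: "w 0 = (\<lambda>x. 0)" and wS: "w (Suc n) = Jint l (Jint l (\<lambda>x. p x * w n x + f x))" for n
    by (simp_all add: w_def)
  have cw: "continuous_on {l..r} (w n)" for n
    by (induction n) (auto simp: w0 wS intro!: Jint_continuous continuous_intros p f)
  have cpw: "continuous_on {l..r} (\<lambda>x. p x * w n x + f x)" for n
    by (intro continuous_intros p f cw)
  let ?W = "\<lambda>x. M * exp (K * (x - l)) * ((x - l) ^ Suc (Suc m) / fact (Suc (Suc m)))"
  have wW: "\<bar>w n x\<bar> \<le> ?W x" if "x \<in> {l..r}" for n x
    using that
  proof (induction n arbitrary: x)
    case 0
    then show ?case using M by (auto simp: w0)
  next
    case (Suc n)
    have "\<bar>Jint l (Jint l (\<lambda>x. p x * w n x + f x)) x\<bar> \<le> ?W x"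
    proof (rule Jint2_bound[OF cpw Suc.prems C2_on_exp_power])
      fix y assume y: "y \<in> {l..r}"
      have "\<bar>p y * w n y + f y\<bar> \<le> \<bar>p y\<bar> * \<bar>w n y\<bar> + \<bar>f y\<bar>" by (metis abs_mult abs_triangle_ineq)
      also have "\<dots> \<le> K^2 * ?W y + M * exp (K * (y - l)) * ((y - l) ^ m / fact m)"
        using y by (intro add_mono mult_mono pK fM Suc.IH) auto
      also have "\<dots> \<le> K^2 * ?W y + M * exp (K * (y - l)) * ((y - l) ^ m / fact m)
          + M * exp (K * (y - l)) * (2 * K * ((y - l) ^ Suc m / fact (Suc m)))"
        using y M K by simp
      finally show "\<bar>p y * w n y + f y\<bar> \<le> M * exp (K * (y - l)) * (K^2 * ((y - l) ^ Suc (Suc m) / fact (Suc (Suc m))) + 2 * K * ((y - l) ^ Suc m / fact (Suc m)) + (y - l) ^ m / fact m)"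
        by (simp add: algebra_simps)
    qed (use M K in auto)
    then show ?case by (simp add: wS)
  qed
  define L where "L = r - l"
  have L: "L \<ge> 0" using lr by (simp add: L_def)
  define A where "A = M * exp (K * L) * (L ^ Suc (Suc m) / fact (Suc (Suc m)))"
  have A: "A \<ge> 0" using M L by (simp add: A_def)
  have WA: "?W x \<le> A" if "x \<in> {l..r}" for x
    unfolding A_def using that K M by (intro mult_mono divide_right_mono power_mono) (auto simp: L_def mult_left_mono)
  \<comment> \<open>The majorant alone gives no convergence. For the increments each step gains a
    factor K^2 and two integrations, which makes them summable uniformly in x.\<close>
  have dw: "\<bar>w (Suc n) x - w n x\<bar> \<le> A * K ^ (2 * n) * ((x - l) ^ (2 * n) / fact (2 * n))" if "x \<in> {l..r}" for n x
    using that
  proof (induction n arbitrary: x)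
    case 0
    have "\<bar>w 1 x\<bar> \<le> A" using wW[OF 0, of 1] WA[OF 0] by linarith
    then show ?case by (simp add: w0)
  next
    case (Suc n)
    have J: "Jint l (Jint l (\<lambda>x. p x * w (Suc n) x + f x)) x - Jint l (Jint l (\<lambda>x. p x * w n x + f x)) x
       = Jint l (Jint l (\<lambda>x. p x * (w (Suc n) x - w n x))) x"
    proof -
      have 1: "Jint l (\<lambda>x. p x * w (Suc n) x + f x) y - Jint l (\<lambda>x. p x * w n x + f x) y
          = Jint l (\<lambda>x. p x * (w (Suc n) x - w n x)) y" if "y \<in> {l..r}" for y
      proof -
        have "integral {l..y} (\<lambda>x. p x * (w (Suc n) x - w n x)) = integral {l..y} (\<lambda>x. (p x * w (Suc n) x + f x) - (p x * w n x + f x))"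
          by (simp add: algebra_simps)
        also have "\<dots> = integral {l..y} (\<lambda>x. p x * w (Suc n) x + f x) - integral {l..y} (\<lambda>x. p x * w n x + f x)"
          using that by (intro Henstock_Kurzweil_Integration.integral_diff integrable_continuous_real continuous_on_subset[OF cpw]) auto
        finally show ?thesis by (simp add: Jint_def)
      qed
      have "Jint l (Jint l (\<lambda>x. p x * w (Suc n) x + f x)) x - Jint l (Jint l (\<lambda>x. p x * w n x + f x)) x
        = integral {l..x} (\<lambda>y. Jint l (\<lambda>x. p x * w (Suc n) x + f x) y - Jint l (\<lambda>x. p x * w n x + f x) y)"
        using Suc.prems by (subst Henstock_Kurzweil_Integration.integral_diff)
          (auto simp: Jint_def[of _ "Jint _ _"] intro!: integrable_continuous_real continuous_on_subset[OF Jint_continuous[OF cpw]])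
      also have "\<dots> = integral {l..x} (Jint l (\<lambda>x. p x * (w (Suc n) x - w n x)))"
        using Suc.prems by (intro Henstock_Kurzweil_Integration.integral_cong 1) auto
      finally show ?thesis by (simp add: Jint_def[of _ "Jint _ _"])
    qed
    have "\<bar>Jint l (Jint l (\<lambda>x. p x * (w (Suc n) x - w n x))) x\<bar> \<le> A * K ^ (2 * Suc n) * ((x - l) ^ Suc (Suc (2 * n)) / fact (Suc (Suc (2 * n))))"
    proof (rule Jint2_bound[OF _ Suc.prems C2_on_power])
      show "continuous_on {l..r} (\<lambda>x. p x * (w (Suc n) x - w n x))" by (intro continuous_intros p cw)
      fix y assume y: "y \<in> {l..r}"
      have "\<bar>p y * (w (Suc n) y - w n y)\<bar> \<le> K^2 * (A * K ^ (2 * n) * ((y - l) ^ (2 * n) / fact (2 * n)))"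
        unfolding abs_mult using y by (intro mult_mono pK Suc.IH) auto
      then show "\<bar>p y * (w (Suc n) y - w n y)\<bar> \<le> A * K ^ (2 * Suc n) * ((y - l) ^ (2 * n) / fact (2 * n))"
        by (simp add: power2_eq_square algebra_simps)
    qed auto
    then show ?case using J by (simp add: wS)
  qed
  have "uniformly_convergent_on {l..r} (\<lambda>n x. \<Sum>i<n. w (Suc i) x - w i x)"
  proof (rule Weierstrass_m_test')
    show "summable (\<lambda>n. A * ((K * L)\<^sup>2 ^ n /\<^sub>R fact n))" by (intro summable_mult summable_exp_generic)
    fix n x assume x: "x \<in> {l..r}"
    have "\<bar>w (Suc n) x - w n x\<bar> \<le> A * K ^ (2 * n) * (L ^ (2 * n) / fact n)"
      using dw[OF x, of n]
    proof (rule order_trans)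
      show "A * K ^ (2 * n) * ((x - l) ^ (2 * n) / fact (2 * n)) \<le> A * K ^ (2 * n) * (L ^ (2 * n) / fact n)"
        using x A K by (intro mult_left_mono frac_le power_mono fact_mono) (auto simp: L_def)
    qed
    then show "norm (w (Suc n) x - w n x) \<le> A * ((K * L)\<^sup>2 ^ n /\<^sub>R fact n)"
      by (simp add: power_mult[symmetric] power_mult_distrib field_simps)
  qed
  moreover have "(\<Sum>i<n. w (Suc i) x - w i x) = w n x" for n x
    using sum_lessThan_telescope[of "\<lambda>i. w i x" n] by (simp add: w0)
  ultimately have "uniformly_convergent_on {l..r} w" by simp
  then obtain v where v: "uniform_limit {l..r} w v sequentially"
    by (auto simp: uniformly_convergent_on_def)
  have cv: "continuous_on {l..r} v"
    by (rule uniform_limit_theorem[OF _ v]) (simp_all add: cw)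
  have cpv: "continuous_on {l..r} (\<lambda>x. p x * v x + f x)" by (intro continuous_intros p f cv)
  have lim: "(\<lambda>n. w n x) \<longlonglongrightarrow> v x" if "x \<in> {l..r}" for x
    using tendsto_uniform_limitI[OF v that] .
  \<comment> \<open>Uniform convergence passes through both integrations, so the limit satisfies the
    fixed point equation on [l,r]. The solution returned is its right-hand side, which is C^2 by
    construction.\<close>
  have veq: "v x = Jint l (Jint l (\<lambda>x. p x * v x + f x)) x" if x: "x \<in> {l..r}" for x
  proof (rule LIMSEQ_unique)
    show "(\<lambda>n. w (Suc n) x) \<longlonglongrightarrow> v x" using lim[OF x] by (rule LIMSEQ_Suc)
    have u1: "uniform_limit {l..r} (\<lambda>n x. p x * w n x + f x) (\<lambda>x. p x * v x + f x) sequentially"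
    proof (rule uniform_limitI)
      fix e :: real assume e: "e > 0"
      then have e': "e / (K^2 + 1) > 0" by (simp add: add_nonneg_pos)
      show "\<forall>\<^sub>F n in sequentially. \<forall>x\<in>{l..r}. dist (p x * w n x + f x) (p x * v x + f x) < e"
        using uniform_limitD[OF v e']
      proof eventually_elim
        case (elim n)
        show ?case
        proof
          fix x assume x: "x \<in> {l..r}"
          have "dist (p x * w n x + f x) (p x * v x + f x) = \<bar>p x\<bar> * \<bar>w n x - v x\<bar>"
            by (simp add: dist_real_def abs_mult[symmetric] right_diff_distrib)
          also have "\<dots> \<le> K^2 * (e / (K^2 + 1))"
            using x elim by (intro mult_mono pK) (auto simp: dist_real_def intro: less_imp_le)
          also have "\<dots> < (K^2 + 1) * (e / (K^2 + 1))" using e' by (intro mult_strict_right_mono) auto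
          also have "\<dots> = e" using add_nonneg_pos[OF zero_le_power2[of K] zero_less_one] by simp
          finally show "dist (p x * w n x + f x) (p x * v x + f x) < e" .
        qed
      qed
    qed
    have Jlim: "(\<lambda>n. Jint l (g n) y) \<longlonglongrightarrow> Jint l h y"
      if "uniform_limit {l..r} g h sequentially" "\<And>n. continuous_on {l..r} (g n)" "y \<in> {l..r}" for g h y
    proof -
      have u: "uniform_limit {l..y} g h sequentially"
        using that by (intro uniform_limit_on_subset[OF that(1)]) auto
      have c: "continuous_on {l..y} (g n)" for n
        using that(3) by (intro continuous_on_subset[OF that(2)]) auto
      obtain I J where IJ: "\<And>n. (g n has_integral I n) {l..y}" "(h has_integral J) {l..y}" "I \<longlonglongrightarrow> J"
        by (rule uniform_limit_integral[OF u c]) auto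
      have "integral {l..y} (g n) = I n" "integral {l..y} h = J" for n
        using IJ by (auto intro: integral_unique)
      then show ?thesis using IJ(3) by (simp add: Jint_def)
    qed
    have "uniform_limit {l..r} (\<lambda>n. Jint l (\<lambda>x. p x * w n x + f x)) (Jint l (\<lambda>x. p x * v x + f x)) sequentially"
    proof (rule uniform_limitI)
      fix e :: real assume e: "e > 0"
      have e': "e / (2 * (L + 1)) > 0" using e L by auto
      show "\<forall>\<^sub>F n in sequentially. \<forall>x\<in>{l..r}. dist (Jint l (\<lambda>x. p x * w n x + f x) x) (Jint l (\<lambda>x. p x * v x + f x) x) < e"
        using uniform_limitD[OF u1 e']
      proof eventually_elim
        case (elim n)
        show ?case
        proof
          fix x assume x: "x \<in> {l..r}"
          have "Jint l (\<lambda>x. p x * w n x + f x) x - Jint l (\<lambda>x. p x * v x + f x) x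
             = integral {l..x} (\<lambda>x. (p x * w n x + f x) - (p x * v x + f x))"
            using x unfolding Jint_def by (intro Henstock_Kurzweil_Integration.integral_diff[symmetric] integrable_continuous_real continuous_on_subset[OF cpw] continuous_on_subset[OF cpv]) auto
          moreover have "norm (integral {l..x} (\<lambda>x. (p x * w n x + f x) - (p x * v x + f x))) \<le> e / (2 * (L + 1)) * (x - l)"
            using x elim by (intro integral_bound continuous_on_diff continuous_on_subset[OF cpw] continuous_on_subset[OF cpv]) (auto simp: dist_norm intro: less_imp_le)
          moreover have "e / (2 * (L + 1)) * (x - l) < e"
          proof -
            have "e / (2 * (L + 1)) * (x - l) \<le> e / (2 * (L + 1)) * (L + 1)" using x e' by (intro mult_left_mono) (auto simp: L_def)
            also have "\<dots> = e / 2" using L by (simp add: field_simps)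
            also have "\<dots> < e" using e by simp
            finally show ?thesis .
          qed
          ultimately show "dist (Jint l (\<lambda>x. p x * w n x + f x) x) (Jint l (\<lambda>x. p x * v x + f x) x) < e"
            by (simp add: dist_norm)
        qed
      qed
    qed
    from Jlim[OF this Jint_continuous[OF cpw] x] show "(\<lambda>n. w (Suc n) x) \<longlonglongrightarrow> Jint l (Jint l (\<lambda>x. p x * v x + f x)) x"
      by (simp add: wS)
  qed
  let ?v = "Jint l (Jint l (\<lambda>x. p x * v x + f x))"
  show thesis
  proof
    show "C2_on l r ?v (Jint l (\<lambda>x. p x * v x + f x)) (\<lambda>x. p x * ?v x + f x)"
      by (rule C2_on_cong[OF Jint_C2_on[OF cpv]]) (simp add: veq[symmetric])
    show "\<bar>?v x\<bar> \<le> ?W x" if "x \<in> {l..r}" for x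
    proof (rule LIMSEQ_le_const2)
      show "(\<lambda>n. \<bar>w n x\<bar>) \<longlonglongrightarrow> \<bar>?v x\<bar>" using lim[OF that] veq[OF that] by (intro tendsto_intros) simp
    qed (use wW that in auto)
  qed auto
qed

section \<open>Compact positive operators\<close>

lemma nonneg_quadratic_discriminant:
  fixes a b c :: real
  assumes pos: "\<And>t. 0 \<le> a + 2 * t * b + t^2 * c" and c: "c \<ge> 0"
  shows "b^2 \<le> a * c"
proof (cases "c = 0")
  case True
  have "b = 0"
  proof (rule ccontr)
    assume "b \<noteq> 0"
    then show False using pos[of "- (a + 1) / (2 * b)"] True by (simp add: field_simps)
  qed
  then show ?thesis using True by simp
next
  case False
  then have "c > 0" using c by simp
  then show ?thesis using pos[of "- b / c"] by (simp add: field_simps power2_eq_square)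
qed

text \<open>Only semidefinite: the vectors will be bounded continuous functions on the whole line,
  while the form sees them on [l,r] alone. In the spectral statements equality of vectors is
  therefore replaced by vanishing of \<open>ip\<close> on the difference.\<close>

locale semi_inner_product =
  fixes ip :: "'a::real_vector \<Rightarrow> 'a \<Rightarrow> real"
  assumes ip_add_left: "ip (x + y) z = ip x z + ip y z"
    and ip_scale_left: "ip (c *\<^sub>R x) z = c * ip x z"
    and ip_commute: "ip x y = ip y x"
    and ip_nonneg: "ip x x \<ge> 0"
begin

lemma ip_add_right: "ip x (y + z) = ip x y + ip x z"
  using ip_add_left ip_commute by metis

lemma ip_scale_right: "ip x (c *\<^sub>R z) = c * ip x z"
  using ip_scale_left ip_commute by metis

lemma ip_minus_left: "ip (- x) z = - ip x z"
  using ip_scale_left[of "-1"] by simp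

lemma ip_minus_right: "ip x (- z) = - ip x z"
  using ip_scale_right[of _ "-1"] by simp

lemma ip_diff_left: "ip (x - y) z = ip x z - ip y z"
  using ip_add_left[of x "- y"] by (simp add: ip_minus_left)

lemma ip_diff_right: "ip x (y - z) = ip x y - ip x z"
  using ip_add_right[of x y "- z"] by (simp add: ip_minus_right)

lemma ip_zero_left [simp]: "ip 0 x = 0"
  using ip_scale_left[of 0] by simp

lemma ip_zero_right [simp]: "ip x 0 = 0"
  using ip_scale_right[of _ 0] by simp

lemma ip_sum_left: "ip (sum f A) z = (\<Sum>i\<in>A. ip (f i) z)"
  by (induction A rule: infinite_finite_induct) (auto simp: ip_add_left)

lemma ip_sum_right: "ip z (sum f A) = (\<Sum>i\<in>A. ip z (f i))"
  by (induction A rule: infinite_finite_induct) (auto simp: ip_add_right)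

lemmas ip_simps = ip_add_left ip_add_right ip_diff_left ip_diff_right ip_scale_left ip_scale_right

lemma cauchy_schwarz: "(ip x y)^2 \<le> ip x x * ip y y"
proof (rule nonneg_quadratic_discriminant)
  show "0 \<le> ip x x + 2 * t * ip x y + t^2 * ip y y" for t
    using ip_nonneg[of "x + t *\<^sub>R y"] ip_commute[of y x] by (simp add: ip_simps algebra_simps power2_eq_square)
qed (rule ip_nonneg)

lemma ip_eq_0_of_null: "ip y y = 0 \<Longrightarrow> ip x y = 0"
  using cauchy_schwarz[of x y] by simp

lemma ip_sum_square_le: "ip (x + y) (x + y) \<le> 2 * ip x x + 2 * ip y y"
  using ip_nonneg[of "x - y"] ip_commute[of x y] by (simp add: ip_simps)

end

text \<open>The space need not be complete; \<open>G_compact\<close> supplies the limit y of the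
  images inside the space itself. \<open>infinite_dim\<close> says that no finite orthonormal family
  is maximal, which keeps the construction of eigenvectors from stopping.\<close>

locale compact_positive_operator = semi_inner_product ip
  for ip :: "'a::real_vector \<Rightarrow> 'a \<Rightarrow> real" +
  fixes G :: "'a \<Rightarrow> 'a" and B :: real
  assumes G_add: "G (x + y) = G x + G y" and G_scale: "G (c *\<^sub>R x) = c *\<^sub>R G x"
    and G_sym: "ip (G x) y = ip x (G y)" and G_nonneg: "ip (G x) x \<ge> 0"
    and G_inj: "ip (G x) (G x) = 0 \<Longrightarrow> ip x x = 0"
    and G_bounded: "ip (G x) (G x) \<le> B * ip x x"
    and G_compact: "(\<And>n::nat. ip (X n) (X n) \<le> 1) \<Longrightarrow>
        \<exists>y k. strict_mono (k :: nat \<Rightarrow> nat) \<and> (\<lambda>n. ip (G (X (k n)) - y) (G (X (k n)) - y)) \<longlonglongrightarrow> 0"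
    and infinite_dim: "(\<And>i j. i < n \<Longrightarrow> j < n \<Longrightarrow> ip (e i) (e j) = (if i = j then 1 else 0)) \<Longrightarrow>
        \<exists>x. ip x x > 0 \<and> (\<forall>j<(n::nat). ip x (e j) = 0)"
begin

lemma G_diff: "G (x - y) = G x - G y"
  using G_add[of x "- y"] G_scale[of "-1" y] by simp

text \<open>Makes Cauchy-Schwarz available for the form of G, which turns bounds on
  \<open>ip (G x) x\<close> into bounds on the norm of G x.\<close>

sublocale form: semi_inner_product "\<lambda>x y. ip (G x) y"
  by unfold_locales (auto simp: G_add G_scale ip_simps G_nonneg, metis G_sym ip_commute)

text \<open>Maximise \<open>ip (G y) y\<close> over the unit ball of the complement X of the
  eigenvectors already found, with supremum m. Along a maximising sequence G x_i - m x_i tends to 0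
  and a subsequence of G x_i converges to some y; since m x_i is close to y, it is this y, and not a
  limit of the x_i, that is the eigenvector. The final clause bounds G on X by m and later measures
  how good a finite eigenfunction expansion is.\<close>

lemma eigenvector_step:
  fixes n :: nat
  assumes on: "\<And>i j. i < n \<Longrightarrow> j < n \<Longrightarrow> ip (e i) (e j) = (if i = j then 1 else 0)"
    and e: "\<And>j. j < n \<Longrightarrow> ip (G (e j) - \<mu> j *\<^sub>R e j) (G (e j) - \<mu> j *\<^sub>R e j) = 0"
  shows "\<exists>x m. m > 0 \<and> ip x x = 1 \<and> (\<forall>j<n. ip x (e j) = 0) \<and> ip (G x - m *\<^sub>R x) (G x - m *\<^sub>R x) = 0
    \<and> (\<forall>y. (\<forall>j<n. ip y (e j) = 0) \<longrightarrow> ip (G y) (G y) \<le> m^2 * ip y y)"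
proof -
  define X where "X = {y. \<forall>j<n. ip y (e j) = 0}"
  have GX: "G y \<in> X" if "y \<in> X" for y
    unfolding X_def
  proof (intro CollectI allI impI)
    fix j assume j: "j < n"
    have "ip (G y) (e j) = ip y (G (e j) - \<mu> j *\<^sub>R e j) + \<mu> j * ip y (e j)"
      by (simp add: G_sym ip_simps)
    then show "ip (G y) (e j) = 0" using ip_eq_0_of_null[OF e[OF j]] that j by (simp add: X_def)
  qed
  have sX: "c *\<^sub>R y \<in> X" if "y \<in> X" for c y using that by (simp add: X_def ip_simps)
  obtain x0 where x0: "ip x0 x0 > 0" "x0 \<in> X" using infinite_dim[OF on] by (auto simp: X_def)
  have Gpos: "ip (G x) x > 0" if "ip x x > 0" for x
  proof (rule ccontr)
    assume "\<not> ip (G x) x > 0"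
    then have "ip (G x) x = 0" using G_nonneg[of x] by simp
    then have "(ip (G x) (G x))^2 \<le> 0" using form.cauchy_schwarz[of x "G x"] by simp
    then show False using G_inj[of x] that by simp
  qed
  define S where "S = {ip (G y) y | y. y \<in> X \<and> ip y y \<le> 1}"
  have bdd: "bdd_above S"
  proof (rule bdd_aboveI)
    fix s assume "s \<in> S"
    then obtain y where y: "s = ip (G y) y" "ip y y \<le> 1" by (auto simp: S_def)
    have "s^2 \<le> ip (G y) (G y) * ip y y" using cauchy_schwarz[of "G y" y] y by simp
    also have "\<dots> \<le> \<bar>B\<bar> * 1"
    proof (intro mult_mono y(2))
      have "ip (G y) (G y) \<le> B * ip y y" by (rule G_bounded)
      also have "\<dots> \<le> \<bar>B\<bar> * 1" using ip_nonneg[of y] y by (intro mult_mono) auto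
      finally show "ip (G y) (G y) \<le> \<bar>B\<bar>" by simp
    qed (auto simp: ip_nonneg)
    finally show "s \<le> sqrt \<bar>B\<bar>" by (intro real_le_rsqrt) simp
  qed
  have norm1: "ip ((1 / sqrt (ip y y)) *\<^sub>R y) ((1 / sqrt (ip y y)) *\<^sub>R y) = 1" if "ip y y > 0" for y
    using that by (simp add: ip_simps)
  define m where "m = Sup S"
  have form_le: "ip (G y) y \<le> m * ip y y" if y: "y \<in> X" for y
  proof (cases "ip y y = 0")
    case True
    then show ?thesis using ip_eq_0_of_null[of y "G y"] by simp
  next
    case False
    then have p: "ip y y > 0" using ip_nonneg[of y] by simp
    let ?z = "(1 / sqrt (ip y y)) *\<^sub>R y"
    have "ip (G ?z) ?z \<in> S" unfolding S_def using norm1[OF p] sX[OF y] by auto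
    then have "ip (G ?z) ?z \<le> m" unfolding m_def by (intro cSup_upper bdd)
    moreover have "ip (G ?z) ?z = ip (G y) y / ip y y" using p by (simp add: G_scale ip_simps)
    ultimately show ?thesis using p by (simp add: divide_le_eq)
  qed
  have m: "m > 0" using Gpos[OF x0(1)] form_le[OF x0(2)] x0(1) by (metis less_le_trans zero_less_mult_pos2)
  \<comment> \<open>Cauchy-Schwarz for the form of G, applied to y and G y in X, upgrades the bound
    m on the quadratic form to the bound m on the norm of G.\<close>
  have G_le: "ip (G y) (G y) \<le> m^2 * ip y y" if y: "y \<in> X" for y
  proof (cases "ip (G y) (G y) = 0")
    case True
    then show ?thesis using ip_nonneg[of y] by simp
  next
    case False
    then have p: "ip (G y) (G y) > 0" using ip_nonneg[of "G y"] by simp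
    have "(ip (G y) (G y))^2 \<le> ip (G y) y * ip (G (G y)) (G y)" by (rule form.cauchy_schwarz)
    also have "\<dots> \<le> (m * ip y y) * (m * ip (G y) (G y))"
      using m ip_nonneg[of y] by (intro mult_mono form_le y GX G_nonneg) auto
    finally show ?thesis using p by (simp add: power2_eq_square algebra_simps)
  qed
  have "\<exists>y. y \<in> X \<and> ip y y \<le> 1 \<and> ip (G y) y > m - 1 / real (Suc i)" for i
  proof -
    have "0 \<in> X" by (simp add: X_def)
    then have "S \<noteq> {}" unfolding S_def by force
    then have "\<exists>s\<in>S. m - 1 / real (Suc i) < s" unfolding m_def by (intro less_cSupD) auto
    then show ?thesis by (auto simp: S_def)
  qed
  then obtain x where x: "\<And>i. x i \<in> X" "\<And>i. ip (x i) (x i) \<le> 1" "\<And>i. ip (G (x i)) (x i) > m - 1 / real (Suc i)"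
    by metis
  obtain y k where k: "strict_mono (k :: nat \<Rightarrow> nat)"
    and lim: "(\<lambda>i. ip (G (x (k i)) - y) (G (x (k i)) - y)) \<longlonglongrightarrow> 0"
    using G_compact[of x] x(2) by blast
  have lim2: "(\<lambda>i. ip (G (x i) - m *\<^sub>R x i) (G (x i) - m *\<^sub>R x i)) \<longlonglongrightarrow> 0"
  proof (rule tendsto_sandwich)
    show "\<forall>\<^sub>F i in sequentially. 0 \<le> ip (G (x i) - m *\<^sub>R x i) (G (x i) - m *\<^sub>R x i)"
      by (simp add: ip_nonneg)
    show "\<forall>\<^sub>F i in sequentially. ip (G (x i) - m *\<^sub>R x i) (G (x i) - m *\<^sub>R x i) \<le> 2 * m * (1 / real (Suc i))"
    proof (intro always_eventually allI)
      fix i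
      have "ip (G (x i) - m *\<^sub>R x i) (G (x i) - m *\<^sub>R x i)
        = ip (G (x i)) (G (x i)) - 2 * m * ip (G (x i)) (x i) + m^2 * ip (x i) (x i)"
        using ip_commute[of "x i" "G (x i)"] by (simp add: ip_simps power2_eq_square algebra_simps)
      also have "\<dots> \<le> m^2 * 1 - 2 * m * (m - 1 / real (Suc i)) + m^2 * 1"
      proof (intro add_mono diff_mono mult_left_mono)
        show "ip (G (x i)) (G (x i)) \<le> m^2 * 1"
          using G_le[OF x(1)[of i]] mult_left_mono[OF x(2)[of i], of "m^2"] by simp
      qed (use x m in \<open>auto intro: less_imp_le\<close>)
      finally show "ip (G (x i) - m *\<^sub>R x i) (G (x i) - m *\<^sub>R x i) \<le> 2 * m * (1 / real (Suc i))"
        by (simp add: power2_eq_square algebra_simps)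
    qed
    show "(\<lambda>i. 2 * m * (1 / real (Suc i))) \<longlonglongrightarrow> 0"
      using tendsto_mult_right_zero[OF LIMSEQ_inverse_real_of_nat, of "2 * m"] by (simp add: inverse_eq_divide)
  qed simp
  have lim2k: "(\<lambda>i. ip (G (x (k i)) - m *\<^sub>R x (k i)) (G (x (k i)) - m *\<^sub>R x (k i))) \<longlonglongrightarrow> 0"
    using LIMSEQ_subseq_LIMSEQ[OF lim2 k] by (simp add: o_def)
  have swap: "ip (a - b) (a - b) = ip (b - a) (b - a)" for a b by (simp add: ip_simps)
  \<comment> \<open>For x in the subsequence, G y - m y = G (y - m x) + m (G x - y). The second part
    is small by the choice of y, the first because y - m x is small and G is bounded.\<close>
  have Gy: "ip (G y - m *\<^sub>R y) (G y - m *\<^sub>R y) \<le> 0"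
  proof (rule LIMSEQ_le_const)
    let ?h = "\<lambda>i. 2 * (\<bar>B\<bar> * (2 * ip (G (x (k i)) - y) (G (x (k i)) - y) + 2 * ip (G (x (k i)) - m *\<^sub>R x (k i)) (G (x (k i)) - m *\<^sub>R x (k i))))
       + 2 * (m^2 * ip (G (x (k i)) - y) (G (x (k i)) - y))"
    have "?h \<longlonglongrightarrow> 2 * (\<bar>B\<bar> * (2 * 0 + 2 * 0)) + 2 * (m^2 * 0)"
      by (intro tendsto_intros lim lim2k)
    then show "?h \<longlonglongrightarrow> 0" by simp
    have "ip (G y - m *\<^sub>R y) (G y - m *\<^sub>R y) \<le> ?h i" for i
    proof -
      let ?x = "x (k i)"
      have "G y - m *\<^sub>R y = G (y - m *\<^sub>R ?x) + m *\<^sub>R (G ?x - y)" by (simp add: G_diff G_scale scaleR_diff_right)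
      then have "ip (G y - m *\<^sub>R y) (G y - m *\<^sub>R y) \<le> 2 * ip (G (y - m *\<^sub>R ?x)) (G (y - m *\<^sub>R ?x)) + 2 * ip (m *\<^sub>R (G ?x - y)) (m *\<^sub>R (G ?x - y))"
        using ip_sum_square_le by metis
      moreover have "ip (G (y - m *\<^sub>R ?x)) (G (y - m *\<^sub>R ?x)) \<le> \<bar>B\<bar> * ip (y - m *\<^sub>R ?x) (y - m *\<^sub>R ?x)"
        by (rule order_trans[OF G_bounded]) (auto intro!: mult_right_mono ip_nonneg)
      moreover have "ip (y - m *\<^sub>R ?x) (y - m *\<^sub>R ?x) \<le> 2 * ip (G ?x - y) (G ?x - y) + 2 * ip (G ?x - m *\<^sub>R ?x) (G ?x - m *\<^sub>R ?x)"
        using ip_sum_square_le[of "y - G ?x" "G ?x - m *\<^sub>R ?x"] swap[of y "G ?x"] by simp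
      then have "\<bar>B\<bar> * ip (y - m *\<^sub>R ?x) (y - m *\<^sub>R ?x) \<le> \<bar>B\<bar> * (2 * ip (G ?x - y) (G ?x - y) + 2 * ip (G ?x - m *\<^sub>R ?x) (G ?x - m *\<^sub>R ?x))"
        by (intro mult_left_mono) auto
      moreover have "ip (m *\<^sub>R (G ?x - y)) (m *\<^sub>R (G ?x - y)) = m^2 * ip (G ?x - y) (G ?x - y)"
        by (simp only: ip_scale_left ip_scale_right power2_eq_square mult.assoc)
      ultimately show ?thesis by linarith
    qed
    then show "\<exists>N. \<forall>i\<ge>N. ip (G y - m *\<^sub>R y) (G y - m *\<^sub>R y) \<le> ?h i" by blast
  qed
  have y_orth: "ip y (e j) = 0" if j: "j < n" for j
  proof -
    have "(ip y (e j))^2 \<le> 0"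
    proof (rule LIMSEQ_le_const)
      let ?h = "\<lambda>i. ip (G (x (k i)) - y) (G (x (k i)) - y) * ip (e j) (e j)"
      show "?h \<longlonglongrightarrow> 0" using lim by (rule tendsto_mult_left_zero)
      have "(ip y (e j))^2 \<le> ?h i" for i
      proof -
        have "ip (G (x (k i))) (e j) = 0" using GX[OF x(1)] j by (simp add: X_def)
        then have "(ip (G (x (k i)) - y) (e j))^2 = (ip y (e j))^2" by (simp add: ip_simps)
        then show ?thesis using cauchy_schwarz[of "G (x (k i)) - y" "e j"] by simp
      qed
      then show "\<exists>N. \<forall>i\<ge>N. (ip y (e j))^2 \<le> ?h i" by blast
    qed
    then show ?thesis by simp
  qed
  \<comment> \<open>If y were null, G x_i would tend to 0 along the subsequence, whereas
    \<open>ip (G x) x\<close> tends to m > 0 with the x_i in the unit ball.\<close>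
  have y_pos: "ip y y > 0"
  proof (rule ccontr)
    assume "\<not> ip y y > 0"
    then have y0: "ip y y = 0" using ip_nonneg[of y] by simp
    have "m^2 \<le> 0"
    proof (rule LIMSEQ_le)
      show "(\<lambda>i. (m - 1 / real (Suc (k i)))^2) \<longlonglongrightarrow> m^2"
      proof -
        have "(\<lambda>i. 1 / real (Suc (k i))) \<longlonglongrightarrow> 0"
          using LIMSEQ_subseq_LIMSEQ[OF LIMSEQ_inverse_real_of_nat k] by (simp add: o_def inverse_eq_divide)
        then have "(\<lambda>i. (m - 1 / real (Suc (k i)))^2) \<longlonglongrightarrow> (m - 0)^2" by (intro tendsto_intros)
        then show ?thesis by simp
      qed
      show "(\<lambda>i. 2 * ip (G (x (k i)) - y) (G (x (k i)) - y)) \<longlonglongrightarrow> 0"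
        using tendsto_mult_right_zero[OF lim] by simp
      obtain N where N: "1 / real (Suc N) < m" using m nat_approx_posE by metis
      have "(m - 1 / real (Suc (k i)))^2 \<le> 2 * ip (G (x (k i)) - y) (G (x (k i)) - y)" if "i \<ge> N" for i
      proof -
        have "k i \<ge> N" using seq_suble[OF k, of i] that by simp
        then have "1 / real (Suc (k i)) \<le> 1 / real (Suc N)" by (intro divide_left_mono) auto
        then have "(m - 1 / real (Suc (k i)))^2 \<le> (ip (G (x (k i))) (x (k i)))^2"
          using N x(3)[of "k i"] by (intro power_mono) auto
        also have "\<dots> \<le> ip (G (x (k i))) (G (x (k i))) * ip (x (k i)) (x (k i))" by (rule cauchy_schwarz)
        also have "\<dots> \<le> ip (G (x (k i))) (G (x (k i))) * 1" by (intro mult_left_mono x ip_nonneg)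
        also have "\<dots> \<le> 2 * ip (G (x (k i)) - y) (G (x (k i)) - y) + 2 * ip y y"
          using ip_sum_square_le[of "G (x (k i)) - y" y] by simp
        finally show ?thesis using y0 by simp
      qed
      then show "\<exists>N. \<forall>i\<ge>N. (m - 1 / real (Suc (k i)))^2 \<le> 2 * ip (G (x (k i)) - y) (G (x (k i)) - y)" by blast
    qed
    then show False using m by simp
  qed
  let ?z = "(1 / sqrt (ip y y)) *\<^sub>R y"
  have "G ?z - m *\<^sub>R ?z = (1 / sqrt (ip y y)) *\<^sub>R (G y - m *\<^sub>R y)"
    by (simp add: G_scale scaleR_diff_right)
  moreover have "ip (G y - m *\<^sub>R y) (G y - m *\<^sub>R y) = 0" using Gy ip_nonneg[of "G y - m *\<^sub>R y"] by linarith
  ultimately have "ip (G ?z - m *\<^sub>R ?z) (G ?z - m *\<^sub>R ?z) = 0"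
    by (simp only: ip_scale_left ip_scale_right)
  moreover have "\<forall>j<n. ip ?z (e j) = 0" using y_orth by (simp add: ip_simps)
  ultimately show ?thesis using m norm1[OF y_pos] G_le unfolding X_def by blast
qed

text \<open>The chosen vector depends on all earlier ones, hence the choice along the well-order of
  the naturals. That \<mu> tends to 0 is not claimed here; it comes later from the trace
  bound.\<close>

theorem spectral_sequence:
  obtains e :: "nat \<Rightarrow> 'a" and \<mu> :: "nat \<Rightarrow> real"
  where "\<And>n. \<mu> n > 0" "\<And>i j. ip (e i) (e j) = (if i = j then 1 else 0)"
    "\<And>n. ip (G (e n) - \<mu> n *\<^sub>R e n) (G (e n) - \<mu> n *\<^sub>R e n) = 0"
    "\<And>n y. (\<And>j. j < n \<Longrightarrow> ip y (e j) = 0) \<Longrightarrow> ip (G y) (G y) \<le> (\<mu> n)^2 * ip y y"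
proof -
  let ?P = "\<lambda>(f :: nat \<Rightarrow> 'a \<times> real) n r. snd r > 0 \<and> ip (fst r) (fst r) = 1 \<and> (\<forall>j<n. ip (fst r) (fst (f j)) = 0)
     \<and> ip (G (fst r) - snd r *\<^sub>R fst r) (G (fst r) - snd r *\<^sub>R fst r) = 0
     \<and> (\<forall>y. (\<forall>j<n. ip y (fst (f j)) = 0) \<longrightarrow> ip (G y) (G y) \<le> (snd r)^2 * ip y y)"
  have "\<exists>f. \<forall>n. ?P f n (f n)"
  proof (rule dependent_wellorder_choice)
    fix r :: "'a \<times> real" and f g :: "nat \<Rightarrow> 'a \<times> real" and n
    assume "\<And>y. y < n \<Longrightarrow> f y = g y"
    then show "?P f n r = ?P g n r" by auto
  next
    fix n and f :: "nat \<Rightarrow> 'a \<times> real"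
    assume P: "\<And>y. y < n \<Longrightarrow> ?P f y (f y)"
    have on: "ip (fst (f i)) (fst (f j)) = (if i = j then 1 else 0)" if "i < n" "j < n" for i j
      using P[OF that(1)] P[OF that(2)] ip_commute by (metis linorder_neqE_nat)
    have "\<And>j. j < n \<Longrightarrow> ip (G (fst (f j)) - snd (f j) *\<^sub>R fst (f j)) (G (fst (f j)) - snd (f j) *\<^sub>R fst (f j)) = 0" using P by blast
    from eigenvector_step[OF on this] show "\<exists>r. ?P f n r" by (simp only: fst_conv snd_conv split_paired_Ex)
  qed
  then obtain f where f: "\<And>n. ?P f n (f n)" by blast
  show thesis
  proof (rule that[of "\<lambda>n. snd (f n)" "\<lambda>n. fst (f n)"])
    fix i j
    have "ip (fst (f i)) (fst (f j)) = 0" if "i \<noteq> j"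
      using that f[of i] f[of j] ip_commute by (metis linorder_neqE_nat)
    then show "ip (fst (f i)) (fst (f j)) = (if i = j then 1 else 0)" using f[of i] by auto
  qed (use f in blast)+
qed

end

section \<open>Sturm--Liouville eigenbases\<close>

lemma real_integral_by_parts:
  fixes f g f1 g1 :: "real \<Rightarrow> real"
  assumes "l \<le> r"
    and "\<And>x. x \<in> {l..r} \<Longrightarrow> (f has_real_derivative f1 x) (at x within {l..r})"
    and "\<And>x. x \<in> {l..r} \<Longrightarrow> (g has_real_derivative g1 x) (at x within {l..r})"
    and "continuous_on {l..r} f1" "continuous_on {l..r} g1"
  shows "integral {l..r} (\<lambda>x. f1 x * g x) = f r * g r - f l * g l - integral {l..r} (\<lambda>x. f x * g1 x)"
proof -
  have c: "continuous_on {l..r} f" "continuous_on {l..r} g" using DERIV_continuous_on[OF assms(2)] DERIV_continuous_on[OF assms(3)] by auto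
  have "((\<lambda>x. f1 x * g x + f x * g1 x) has_integral (f r * g r - f l * g l)) {l..r}"
    using assms(1) by (intro fundamental_theorem_of_calculus[of l r "\<lambda>x. f x * g x"])
      (auto simp: has_real_derivative_iff_has_vector_derivative[symmetric] intro!: derivative_eq_intros assms(2,3))
  then have "integral {l..r} (\<lambda>x. f1 x * g x + f x * g1 x) = f r * g r - f l * g l" by (rule integral_unique)
  moreover have "integral {l..r} (\<lambda>x. f1 x * g x + f x * g1 x) = integral {l..r} (\<lambda>x. f1 x * g x) + integral {l..r} (\<lambda>x. f x * g1 x)"
    by (intro Henstock_Kurzweil_Integration.integral_add integrable_continuous_real continuous_intros c assms)
  ultimately show ?thesis by simp
qed

text \<open>Continuous functions on [l,r] are placed in a real vector space by extending them
  constantly to bounded continuous functions on the line.\<close>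

definition cext :: "real \<Rightarrow> real \<Rightarrow> (real \<Rightarrow> real) \<Rightarrow> real \<Rightarrow>\<^sub>C real" where
  "cext l r f = Bcontfun (ext_cont f l r)"

definition ipb :: "real \<Rightarrow> real \<Rightarrow> (real \<Rightarrow>\<^sub>C real) \<Rightarrow> (real \<Rightarrow>\<^sub>C real) \<Rightarrow> real" where
  "ipb l r f g = integral {l..r} (\<lambda>x. apply_bcontfun f x * apply_bcontfun g x)"

lemma clamp_real_in: "l \<le> r \<Longrightarrow> clamp l r (x::real) \<in> {l..r}"
  using clamp_in_interval[of l r x] by auto

lemma cext_apply:
  assumes "l \<le> r" "continuous_on {l..r} f"
  shows "apply_bcontfun (cext l r f) x = f (clamp l r x)"
proof -
  have "bounded (f ` {l..r})" using assms by (intro compact_imp_bounded compact_continuous_image) auto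
  then have "bounded (range (ext_cont f l r))"
    by (rule bounded_subset) (use clamp_real_in[OF assms(1)] in \<open>auto simp: ext_cont_def\<close>)
  moreover have "continuous_on UNIV (ext_cont f l r)" using assms by (intro continuous_on_ext_cont) auto
  ultimately have "ext_cont f l r \<in> bcontfun" by (simp add: bcontfun_def)
  then show ?thesis by (simp add: cext_def Bcontfun_inverse ext_cont_def)
qed

lemma cext_apply_in:
  assumes "l \<le> r" "continuous_on {l..r} f" "x \<in> {l..r}"
  shows "apply_bcontfun (cext l r f) x = f x"
  using cext_apply[OF assms(1,2), of x] assms(3) by (simp add: clamp_cancel_cbox)

lemma continuous_on_bcontfun [continuous_intros]: "continuous_on S (apply_bcontfun f)"
  using apply_bcontfun[of f] continuous_on_subset by (auto simp: bcontfun_def)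

lemma ipb_cext:
  assumes "l \<le> r" "continuous_on {l..r} f" "continuous_on {l..r} g"
  shows "ipb l r (cext l r f) (cext l r g) = integral {l..r} (\<lambda>x. f x * g x)"
  unfolding ipb_def by (intro Henstock_Kurzweil_Integration.integral_cong) (simp add: cext_apply_in assms)

interpretation ipb: semi_inner_product "ipb l r" for l r
proof
  fix x y z :: "real \<Rightarrow>\<^sub>C real" and c :: real
  show "ipb l r (x + y) z = ipb l r x z + ipb l r y z"
    unfolding ipb_def plus_bcontfun.rep_eq distrib_right
    by (intro Henstock_Kurzweil_Integration.integral_add integrable_continuous_real continuous_intros)
  show "ipb l r (c *\<^sub>R x) z = c * ipb l r x z"
    unfolding ipb_def scaleR_bcontfun.rep_eq by (simp add: mult.assoc)
  show "ipb l r x y = ipb l r y x" unfolding ipb_def by (simp add: mult.commute)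
  show "ipb l r x x \<ge> 0"
    unfolding ipb_def by (intro Henstock_Kurzweil_Integration.integral_nonneg integrable_continuous_real continuous_intros) auto
qed

lemma integral_cauchy_schwarz:
  fixes f g :: "real \<Rightarrow> real"
  assumes "l \<le> r" "continuous_on {l..r} f" "continuous_on {l..r} g"
  shows "(integral {l..r} (\<lambda>x. f x * g x))^2 \<le> integral {l..r} (\<lambda>x. (f x)^2) * integral {l..r} (\<lambda>x. (g x)^2)"
  using ipb.cauchy_schwarz[of l r "cext l r f" "cext l r g"] assms by (simp add: ipb_cext power2_eq_square)

lemma ipb_null_imp_zero:
  assumes "l < r" "ipb l r f f = 0" "x \<in> {l..r}"
  shows "apply_bcontfun f x = 0"
proof -
  have "\<forall>x\<in>{l..r}. apply_bcontfun f x * apply_bcontfun f x = 0"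
    using assms(1,2) unfolding ipb_def by (subst (asm) integral_eq_0_iff) (auto intro!: continuous_intros)
  then show ?thesis using assms(3) by simp
qed

text \<open>The fundamental theorem and Cauchy-Schwarz. It is the source both of the Poincare
  inequality and of the Hoelder bound behind compactness.\<close>

lemma difference_square_le:
  assumes xy: "l \<le> x" "x \<le> y" "y \<le> r"
    and d: "\<And>x. x \<in> {l..r} \<Longrightarrow> (w has_real_derivative w1 x) (at x within {l..r})"
    and c: "continuous_on {l..r} w1"
  shows "(w y - w x)^2 \<le> (y - x) * integral {l..r} (\<lambda>x. (w1 x)^2)"
proof -
  have sub: "{x..y} \<subseteq> {l..r}" using xy by auto
  have c': "continuous_on {x..y} w1" by (rule continuous_on_subset[OF c sub])
  have "(w1 has_integral (w y - w x)) {x..y}"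
    using xy sub by (intro fundamental_theorem_of_calculus)
      (auto simp: has_real_derivative_iff_has_vector_derivative[symmetric] intro!: has_field_derivative_subset[OF d])
  then have "w y - w x = integral {x..y} (\<lambda>x. 1 * w1 x)" by (simp add: integral_unique)
  then have "(w y - w x)^2 \<le> integral {x..y} (\<lambda>x. 1^2) * integral {x..y} (\<lambda>x. (w1 x)^2)"
    using integral_cauchy_schwarz[OF xy(2) continuous_on_const c', of 1] by simp
  also have "\<dots> = (y - x) * integral {x..y} (\<lambda>x. (w1 x)^2)" using xy by simp
  also have "\<dots> \<le> (y - x) * integral {l..r} (\<lambda>x. (w1 x)^2)"
    using xy by (intro mult_left_mono integral_subset_le sub integrable_continuous_real continuous_intros c c') auto
  finally show ?thesis .
qed

lemma integral_square_le:
  fixes f :: "real \<Rightarrow> real"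
  assumes "l \<le> r" "continuous_on {l..r} f" "\<And>x. x \<in> {l..r} \<Longrightarrow> (f x)^2 \<le> C"
  shows "integral {l..r} (\<lambda>x. (f x)^2) \<le> (r - l) * C"
proof -
  have "integral {l..r} (\<lambda>x. (f x)^2) \<le> integral {l..r} (\<lambda>x. C)"
    using assms by (intro integral_le integrable_continuous_real continuous_intros) auto
  then show ?thesis using assms by simp
qed

lemma dirichlet_energy:
  assumes lr: "l \<le> r" and q: "continuous_on {l..r} q" and w: "C2_on l r w w1 w2" "w l = 0" "w r = 0"
  shows "integral {l..r} (\<lambda>x. (w1 x)^2 + q x * (w x)^2) = integral {l..r} (\<lambda>x. (q x * w x - w2 x) * w x)"
proof -
  note W = C2_onD[OF w(1)]
  have "integral {l..r} (\<lambda>x. w2 x * w x) = - integral {l..r} (\<lambda>x. w1 x * w1 x)"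
    using real_integral_by_parts[OF lr W(2) W(1) W(5) W(4)] w by simp
  moreover have "integral {l..r} (\<lambda>x. (q x * w x - w2 x) * w x) = integral {l..r} (\<lambda>x. q x * (w x)^2) - integral {l..r} (\<lambda>x. w2 x * w x)"
    unfolding left_diff_distrib power2_eq_square mult.assoc[symmetric]
    by (intro Henstock_Kurzweil_Integration.integral_diff integrable_continuous_real continuous_intros q W)
  moreover have "integral {l..r} (\<lambda>x. (w1 x)^2 + q x * (w x)^2) = integral {l..r} (\<lambda>x. (w1 x)^2) + integral {l..r} (\<lambda>x. q x * (w x)^2)"
    by (intro Henstock_Kurzweil_Integration.integral_add integrable_continuous_real continuous_intros q W)
  ultimately show ?thesis by (simp add: power2_eq_square)
qed

section \<open>The Dirichlet problem and its Green operator\<close>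

locale sturm_liouville =
  fixes l r :: real and q :: "real \<Rightarrow> real"
  assumes lr: "l < r" and q_cont: "continuous_on {l..r} q" and q_nonneg: "\<And>x. x \<in> {l..r} \<Longrightarrow> q x \<ge> 0"
begin

lemma derivative_energy_le:
  assumes w: "C2_on l r w w1 w2" "w l = 0" "w r = 0"
  shows "integral {l..r} (\<lambda>x. (w1 x)^2) \<le> integral {l..r} (\<lambda>x. (q x * w x - w2 x) * w x)"
proof -
  note W = C2_onD[OF w(1)]
  have "integral {l..r} (\<lambda>x. (w1 x)^2) \<le> integral {l..r} (\<lambda>x. (w1 x)^2 + q x * (w x)^2)"
    by (intro integral_le integrable_continuous_real continuous_intros q_cont W) (auto simp: q_nonneg)
  then show ?thesis using dirichlet_energy[OF _ q_cont w] lr by simp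
qed

lemma sup_square_le:
  assumes w: "C2_on l r w w1 w2" "w l = 0" "w r = 0" and x: "x \<in> {l..r}"
  shows "(w x)^2 \<le> (r - l) * integral {l..r} (\<lambda>x. (w1 x)^2)"
proof -
  note W = C2_onD[OF w(1)]
  have nn: "0 \<le> integral {l..r} (\<lambda>x. (w1 x)^2)"
    by (intro Henstock_Kurzweil_Integration.integral_nonneg integrable_continuous_real continuous_intros W) auto
  have "(w x - w l)^2 \<le> (x - l) * integral {l..r} (\<lambda>x. (w1 x)^2)"
    using x by (intro difference_square_le[OF _ _ _ W(1) W(4)]) auto
  also have "\<dots> \<le> (r - l) * integral {l..r} (\<lambda>x. (w1 x)^2)" using x nn by (intro mult_right_mono) auto
  finally show ?thesis using w by simp
qed

text \<open>With a, b, c the integrals of w^2, w'^2, f^2, the energy inequality and Cauchy-Schwarz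
  give b^2 \<le> c a, and the Poincare inequality a \<le> L^2 b closes the estimate. As q \<ge> 0,
  the constants depend on the length of the interval only.\<close>

lemma bvp_bounds:
  assumes w: "C2_on l r w w1 (\<lambda>x. q x * w x - f x)" "w l = 0" "w r = 0" and f: "continuous_on {l..r} f"
  shows "integral {l..r} (\<lambda>x. (w x)^2) \<le> (r - l) ^ 4 * integral {l..r} (\<lambda>x. (f x)^2)"
    and "integral {l..r} (\<lambda>x. (w1 x)^2) \<le> (r - l)^2 * integral {l..r} (\<lambda>x. (f x)^2)"
proof -
  note W = C2_onD[OF w(1)]
  define a where "a = integral {l..r} (\<lambda>x. (w x)^2)"
  define b where "b = integral {l..r} (\<lambda>x. (w1 x)^2)"
  define c where "c = integral {l..r} (\<lambda>x. (f x)^2)"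
  define L where "L = r - l"
  have L: "L > 0" using lr by (simp add: L_def)
  have nn: "0 \<le> a" "0 \<le> b" "0 \<le> c" unfolding a_def b_def c_def
    by (intro Henstock_Kurzweil_Integration.integral_nonneg integrable_continuous_real continuous_intros W f; simp)+
  have "b \<le> integral {l..r} (\<lambda>x. f x * w x)" using derivative_energy_le[OF w] by (simp add: b_def)
  then have "b^2 \<le> (integral {l..r} (\<lambda>x. f x * w x))^2" using nn by (intro power_mono) auto
  also have "\<dots> \<le> c * a" unfolding a_def c_def using lr by (intro integral_cauchy_schwarz f W) simp
  finally have b2: "b^2 \<le> c * a" .
  have "a \<le> L * (L * b)" unfolding a_def L_def b_def
    using lr sup_square_le[OF w] by (intro integral_square_le W) auto
  then have ab: "a \<le> L^2 * b" by (simp add: power2_eq_square)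
  have "b * b \<le> (L^2 * c) * b" using b2 mult_left_mono[OF ab nn(3)] by (simp add: power2_eq_square algebra_simps)
  then have bc: "b \<le> L^2 * c" using nn L by (cases "b = 0") (auto simp: mult_le_cancel_right)
  then show "integral {l..r} (\<lambda>x. (w1 x)^2) \<le> (r - l)^2 * integral {l..r} (\<lambda>x. (f x)^2)"
    by (simp add: b_def c_def L_def)
  have "a \<le> L^2 * (L^2 * c)" using ab mult_left_mono[OF bc, of "L^2"] by simp
  also have "\<dots> = L ^ 4 * c" by (simp add: power_numeral_reduce)
  finally show "integral {l..r} (\<lambda>x. (w x)^2) \<le> (r - l) ^ 4 * integral {l..r} (\<lambda>x. (f x)^2)"
    by (simp add: a_def c_def L_def)
qed

lemma homogeneous_bvp_zero:
  assumes w: "C2_on l r w w1 (\<lambda>x. q x * w x)" "w l = 0" "w r = 0" and x: "x \<in> {l..r}"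
  shows "w x = 0"
proof -
  have w': "C2_on l r w w1 (\<lambda>x. q x * w x - 0)" using w(1) by simp
  have "integral {l..r} (\<lambda>x. (w1 x)^2) \<le> 0" using bvp_bounds(2)[OF w' w(2,3)] by simp
  then have "(r - l) * integral {l..r} (\<lambda>x. (w1 x)^2) \<le> 0" using lr by (simp add: mult_le_0_iff)
  then have "(w x)^2 \<le> 0" using sup_square_le[OF w x] by linarith
  then show ?thesis by simp
qed

lemma C2_on_lincomb:
  assumes "C2_on l r v v1 v2" "C2_on l r w w1 w2"
  shows "C2_on l r (\<lambda>x. a * v x + b * w x) (\<lambda>x. a * v1 x + b * w1 x) (\<lambda>x. a * v2 x + b * w2 x)"
  using assms unfolding C2_on_def by (auto intro!: derivative_eq_intros continuous_intros)

lemma bounded_by_square: obtains K where "K \<ge> 0" "\<And>x. x \<in> {l..r} \<Longrightarrow> \<bar>q x\<bar> \<le> K^2"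
proof -
  have "bounded (q ` {l..r})" using q_cont by (intro compact_imp_bounded compact_continuous_image) auto
  then obtain A where A: "\<And>x. x \<in> {l..r} \<Longrightarrow> \<bar>q x\<bar> \<le> A" unfolding bounded_iff by (metis imageI real_norm_def)
  then have "0 \<le> A" using A[of l] lr by force
  then show thesis using A by (intro that[of "sqrt A"]) auto
qed

text \<open>Shooting from l: a solution with zero initial data is corrected by a multiple of a
  homogeneous solution \<theta> that vanishes at l with slope 1. If \<theta> vanished at r too, it
  would be zero by uniqueness, against its slope.\<close>

lemma bvp_exists:
  assumes f: "continuous_on {l..r} f"
  shows "\<exists>w w1. C2_on l r w w1 (\<lambda>x. q x * w x - f x) \<and> w l = 0 \<and> w r = 0"
proof -
  obtain K where K: "K \<ge> 0" "\<And>x. x \<in> {l..r} \<Longrightarrow> \<bar>q x\<bar> \<le> K^2" using bounded_by_square by blast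
  have solve: "\<exists>w w1. C2_on l r w w1 (\<lambda>x. q x * w x + g x) \<and> w l = 0 \<and> w1 l = 0" if g: "continuous_on {l..r} g" for g
  proof -
    have "bounded (g ` {l..r})" using g by (intro compact_imp_bounded compact_continuous_image) auto
    then obtain A where A: "\<And>x. x \<in> {l..r} \<Longrightarrow> \<bar>g x\<bar> \<le> A" unfolding bounded_iff by (metis imageI real_norm_def)
    then have A0: "0 \<le> A" using A[of l] lr by force
    have "\<bar>g x\<bar> \<le> A * exp (K * (x - l)) * ((x - l) ^ 0 / fact 0)" if "x \<in> {l..r}" for x
    proof -
      have "A * 1 \<le> A * exp (K * (x - l))" using A0 that K by (intro mult_left_mono) auto
      then show ?thesis using A[OF that] by simp
    qed
    from volterra_exists[OF less_imp_le[OF lr] q_cont g K this A0] show ?thesis by metis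
  qed
  obtain w w1 where w: "C2_on l r w w1 (\<lambda>x. q x * w x + - f x)" "w l = 0" "w1 l = 0"
    using solve[of "\<lambda>x. - f x"] f continuous_on_minus by blast
  obtain u u1 where u: "C2_on l r u u1 (\<lambda>x. q x * u x + q x * (x - l))" "u l = 0" "u1 l = 0"
    using solve[OF continuous_on_mult[OF q_cont continuous_on_diff[OF continuous_on_id continuous_on_const]]] by blast
  \<comment> \<open>The Volterra equation is solved with zero initial data, so x - l is split off
    from \<theta> and q (x - l) becomes the source for u.\<close>
  define \<theta> where "\<theta> = (\<lambda>x. u x + (x - l))"
  have t: "C2_on l r \<theta> (\<lambda>x. u1 x + 1) (\<lambda>x. q x * \<theta> x)"
    using u(1) unfolding C2_on_def \<theta>_def by (auto intro!: derivative_eq_intros simp: algebra_simps)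
  have "\<theta> r \<noteq> 0"
  proof
    assume r0: "\<theta> r = 0"
    have z: "\<theta> x = 0" if "x \<in> {l..r}" for x
      using homogeneous_bvp_zero[OF t _ r0 that] u by (simp add: \<theta>_def)
    have "(\<theta> has_real_derivative 0) (at l within {l..r})"
      by (rule has_field_derivative_transform_within[of "\<lambda>x. 0" _ _ _ 1]) (use z lr in auto)
    moreover have "(\<theta> has_real_derivative u1 l + 1) (at l within {l..r})" using C2_onD(1)[OF t, of l] lr by simp
    ultimately have "u1 l + 1 = 0"
      using lr vector_derivative_unique_within_closed_interval[of l r l \<theta>]
      by (simp add: has_real_derivative_iff_has_vector_derivative)
    then show False using u by simp
  qed
  then have "C2_on l r (\<lambda>x. 1 * w x + (- w r / \<theta> r) * \<theta> x) (\<lambda>x. 1 * w1 x + (- w r / \<theta> r) * (u1 x + 1))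
      (\<lambda>x. q x * (1 * w x + (- w r / \<theta> r) * \<theta> x) - f x)"
    by (intro C2_on_cong[OF C2_on_lincomb[OF w(1) t]]) (simp add: algebra_simps)
  moreover have "1 * w l + (- w r / \<theta> r) * \<theta> l = 0" using w u by (simp add: \<theta>_def)
  moreover have "1 * w r + (- w r / \<theta> r) * \<theta> r = 0" using \<open>\<theta> r \<noteq> 0\<close> by simp
  ultimately show ?thesis by blast
qed

text \<open>The choice determines the values on [l,r] only; outside they are arbitrary, which is why
  \<open>Gop\<close> extends again by clamping.\<close>

definition green :: "(real \<Rightarrow> real) \<Rightarrow> real \<Rightarrow> real" where
  "green f = (SOME w. \<exists>w1. C2_on l r w w1 (\<lambda>x. q x * w x - f x) \<and> w l = 0 \<and> w r = 0)"

lemma green_solves: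
  assumes "continuous_on {l..r} f"
  obtains w1 where "C2_on l r (green f) w1 (\<lambda>x. q x * green f x - f x)" "green f l = 0" "green f r = 0"
  using someI_ex[OF bvp_exists[OF assms], folded green_def] by blast

lemma green_unique:
  assumes f: "continuous_on {l..r} f" and w: "C2_on l r w w1 (\<lambda>x. q x * w x - f x)" "w l = 0" "w r = 0"
    and x: "x \<in> {l..r}"
  shows "green f x = w x"
proof -
  obtain g1 where g: "C2_on l r (green f) g1 (\<lambda>x. q x * green f x - f x)" "green f l = 0" "green f r = 0"
    by (rule green_solves[OF f])
  have "C2_on l r (\<lambda>x. 1 * green f x + (-1) * w x) (\<lambda>x. 1 * g1 x + (-1) * w1 x) (\<lambda>x. q x * (1 * green f x + (-1) * w x))"
    by (rule C2_on_cong[OF C2_on_lincomb[OF g(1) w(1)]]) (simp add: algebra_simps)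
  from homogeneous_bvp_zero[OF this _ _ x] show ?thesis using g w by simp
qed

lemma green_continuous:
  assumes "continuous_on {l..r} f" shows "continuous_on {l..r} (green f)"
  using green_solves[OF assms] C2_onD(3) by metis

lemma green_bounds:
  assumes f: "continuous_on {l..r} f"
  shows "integral {l..r} (\<lambda>x. (green f x)^2) \<le> (r - l) ^ 4 * integral {l..r} (\<lambda>x. (f x)^2)"
    and "x \<in> {l..r} \<Longrightarrow> (green f x)^2 \<le> (r - l) ^ 3 * integral {l..r} (\<lambda>x. (f x)^2)"
    and "x \<in> {l..r} \<Longrightarrow> y \<in> {l..r} \<Longrightarrow> (green f x - green f y)^2 \<le> \<bar>x - y\<bar> * ((r - l)^2 * integral {l..r} (\<lambda>x. (f x)^2))"
proof -
  obtain g1 where g: "C2_on l r (green f) g1 (\<lambda>x. q x * green f x - f x)" "green f l = 0" "green f r = 0"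
    by (rule green_solves[OF f])
  note b = bvp_bounds[OF g f]
  show "integral {l..r} (\<lambda>x. (green f x)^2) \<le> (r - l) ^ 4 * integral {l..r} (\<lambda>x. (f x)^2)" by (rule b)
  show "(green f x)^2 \<le> (r - l) ^ 3 * integral {l..r} (\<lambda>x. (f x)^2)" if "x \<in> {l..r}"
  proof -
    have "(green f x)^2 \<le> (r - l) * ((r - l)^2 * integral {l..r} (\<lambda>x. (f x)^2))"
      using sup_square_le[OF g that] mult_left_mono[OF b(2), of "r - l"] lr by linarith
    then show ?thesis by (simp add: power_numeral_reduce mult.assoc)
  qed
  have le: "(green f y - green f x)^2 \<le> \<bar>y - x\<bar> * ((r - l)^2 * integral {l..r} (\<lambda>x. (f x)^2))"
    if "x \<in> {l..r}" "y \<in> {l..r}" "x \<le> y" for x y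
  proof -
    have "(green f y - green f x)^2 \<le> (y - x) * integral {l..r} (\<lambda>x. (g1 x)^2)"
      using that by (intro difference_square_le[OF _ _ _ C2_onD(1,4)[OF g(1)]]) auto
    also have "\<dots> \<le> (y - x) * ((r - l)^2 * integral {l..r} (\<lambda>x. (f x)^2))" using that b(2) by (intro mult_left_mono) auto
    finally show ?thesis using that by simp
  qed
  show "(green f x - green f y)^2 \<le> \<bar>x - y\<bar> * ((r - l)^2 * integral {l..r} (\<lambda>x. (f x)^2))" if "x \<in> {l..r}" "y \<in> {l..r}"
    using le[OF that] le[OF that(2) that(1)] by (cases "x \<le> y") (auto simp: power2_commute abs_minus_commute)
qed

definition Gop :: "(real \<Rightarrow>\<^sub>C real) \<Rightarrow> (real \<Rightarrow>\<^sub>C real)" where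
  "Gop f = cext l r (green (apply_bcontfun f))"

lemma Gop_apply: "x \<in> {l..r} \<Longrightarrow> apply_bcontfun (Gop f) x = green (apply_bcontfun f) x"
  unfolding Gop_def using lr by (intro cext_apply_in green_continuous continuous_intros) auto

lemma Gop_eqI:
  assumes "\<And>x. x \<in> {l..r} \<Longrightarrow> green (apply_bcontfun f) x = h x" "\<And>x. apply_bcontfun g x = h (clamp l r x)"
  shows "Gop f = g"
  using lr assms clamp_real_in[of l r]
  by (intro bcontfun_eqI) (simp add: Gop_def cext_apply green_continuous continuous_on_bcontfun)

lemma Gop_clamp: "apply_bcontfun (Gop f) x = green (apply_bcontfun f) (clamp l r x)"
  using lr by (simp add: Gop_def cext_apply green_continuous continuous_on_bcontfun)

lemma ipb_Gop: "ipb l r (Gop f) g = integral {l..r} (\<lambda>x. green (apply_bcontfun f) x * apply_bcontfun g x)"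
  unfolding ipb_def by (intro Henstock_Kurzweil_Integration.integral_cong) (simp add: Gop_apply)

text \<open>Symmetry and positivity are integrations by parts, and injectivity reads f off the
  equation, whose solution vanishes with its derivatives. Compactness is Arzela-Ascoli: the energy
  bound makes the images of the unit ball uniformly bounded and uniformly Hoelder continuous with
  exponent 1/2.\<close>

lemma Gop_positive_operator: "compact_positive_operator (ipb l r) Gop ((r - l) ^ 4)"
proof
  fix x y :: "real \<Rightarrow>\<^sub>C real" and c :: real
  note cb = continuous_on_bcontfun
  obtain a1 where a: "C2_on l r (green (apply_bcontfun x)) a1 (\<lambda>t. q t * green (apply_bcontfun x) t - apply_bcontfun x t)"
    "green (apply_bcontfun x) l = 0" "green (apply_bcontfun x) r = 0" by (rule green_solves[OF cb])
  obtain b1 where b: "C2_on l r (green (apply_bcontfun y)) b1 (\<lambda>t. q t * green (apply_bcontfun y) t - apply_bcontfun y t)"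
    "green (apply_bcontfun y) l = 0" "green (apply_bcontfun y) r = 0" by (rule green_solves[OF cb])
  show "Gop (x + y) = Gop x + Gop y"
  proof (rule Gop_eqI)
    fix t assume t: "t \<in> {l..r}"
    show "green (apply_bcontfun (x + y)) t = 1 * green (apply_bcontfun x) t + 1 * green (apply_bcontfun y) t"
      by (rule green_unique[OF cb C2_on_cong[OF C2_on_lincomb[OF a(1) b(1)]] _ _ t]) (use a b in \<open>simp_all add: algebra_simps plus_bcontfun.rep_eq\<close>)
  qed (simp add: plus_bcontfun.rep_eq Gop_clamp)
  show "Gop (c *\<^sub>R x) = c *\<^sub>R Gop x"
  proof (rule Gop_eqI)
    fix t assume t: "t \<in> {l..r}"
    show "green (apply_bcontfun (c *\<^sub>R x)) t = c * green (apply_bcontfun x) t + 0 * green (apply_bcontfun y) t"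
      by (rule green_unique[OF cb C2_on_cong[OF C2_on_lincomb[OF a(1) b(1)]] _ _ t]) (use a b in \<open>simp_all add: algebra_simps scaleR_bcontfun.rep_eq\<close>)
  qed (simp add: scaleR_bcontfun.rep_eq Gop_clamp)
  show "ipb l r (Gop x) y = ipb l r x (Gop y)"
  proof -
    let ?X = "apply_bcontfun x" and ?Y = "apply_bcontfun y"
    note A = C2_onD[OF a(1)] and B = C2_onD[OF b(1)]
    have "integral {l..r} (\<lambda>t. (q t * green ?X t - ?X t) * green ?Y t) = - integral {l..r} (\<lambda>t. a1 t * b1 t)"
      using real_integral_by_parts[OF less_imp_le[OF lr] A(2) B(1) A(5) B(4)] b by simp
    moreover have "integral {l..r} (\<lambda>t. (q t * green ?Y t - ?Y t) * green ?X t) = - integral {l..r} (\<lambda>t. b1 t * a1 t)"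
      using real_integral_by_parts[OF less_imp_le[OF lr] B(2) A(1) B(5) A(4)] a by simp
    moreover have "integral {l..r} (\<lambda>t. (q t * green ?X t - ?X t) * green ?Y t) =
        integral {l..r} (\<lambda>t. q t * green ?X t * green ?Y t) - integral {l..r} (\<lambda>t. ?X t * green ?Y t)"
      unfolding left_diff_distrib
      by (intro Henstock_Kurzweil_Integration.integral_diff integrable_continuous_real continuous_intros q_cont A B)
    moreover have "integral {l..r} (\<lambda>t. (q t * green ?Y t - ?Y t) * green ?X t) =
        integral {l..r} (\<lambda>t. q t * green ?Y t * green ?X t) - integral {l..r} (\<lambda>t. ?Y t * green ?X t)"
      unfolding left_diff_distrib
      by (intro Henstock_Kurzweil_Integration.integral_diff integrable_continuous_real continuous_intros q_cont A B)
    moreover have "integral {l..r} (\<lambda>t. q t * green ?Y t * green ?X t) = integral {l..r} (\<lambda>t. q t * green ?X t * green ?Y t)"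
      by (simp add: mult_ac)
    ultimately show ?thesis
      by (simp add: ipb_Gop ipb.ip_commute[of _ _ x "Gop y"] mult.commute[of "b1 _"] mult.commute[of "green ?X _"] mult.commute[of "green ?Y _" "?X _"])
  qed
  show "0 \<le> ipb l r (Gop x) x"
  proof -
    have "0 \<le> integral {l..r} (\<lambda>x. (a1 x)^2)"
      by (intro Henstock_Kurzweil_Integration.integral_nonneg integrable_continuous_real continuous_intros C2_onD[OF a(1)]) auto
    also have "\<dots> \<le> integral {l..r} (\<lambda>t. apply_bcontfun x t * green (apply_bcontfun x) t)"
      using derivative_energy_le[OF a] by simp
    finally show ?thesis by (simp add: ipb_Gop mult.commute)
  qed
  show "ipb l r (Gop x) (Gop x) \<le> (r - l) ^ 4 * ipb l r x x"
  proof -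
    have "ipb l r (Gop x) (Gop x) = integral {l..r} (\<lambda>t. (green (apply_bcontfun x) t)^2)"
      unfolding ipb_def by (intro Henstock_Kurzweil_Integration.integral_cong) (simp add: Gop_apply power2_eq_square)
    then show ?thesis using green_bounds(1)[OF cb, of x] by (simp add: ipb_def power2_eq_square)
  qed
  show "ipb l r x x = 0" if "ipb l r (Gop x) (Gop x) = 0"
  proof -
    have z: "green (apply_bcontfun x) t = 0" if t: "t \<in> {l..r}" for t
      using ipb_null_imp_zero[OF lr \<open>ipb l r (Gop x) (Gop x) = 0\<close> t] Gop_apply[OF t] by simp
    have ud: "D = 0" if "\<And>t. t \<in> {l..r} \<Longrightarrow> f t = 0" "t \<in> {l..r}" "(f has_real_derivative D) (at t within {l..r})" for f D t
    proof -
      have "(f has_real_derivative 0) (at t within {l..r})"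
        by (rule has_field_derivative_transform_within[of "\<lambda>x. 0" _ _ _ 1]) (use that in auto)
      then show ?thesis using that lr vector_derivative_unique_within_closed_interval[of l r t f]
        by (simp add: has_real_derivative_iff_has_vector_derivative)
    qed
    have a0: "a1 t = 0" if "t \<in> {l..r}" for t by (rule ud[OF z that C2_onD(1)[OF a(1) that]])
    have "apply_bcontfun x t = 0" if "t \<in> {l..r}" for t
      using ud[OF a0 that C2_onD(2)[OF a(1) that]] z[OF that] by simp
    then show ?thesis unfolding ipb_def by (intro integral_unique has_integral_is_0) auto
  qed
next
  fix X :: "nat \<Rightarrow> real \<Rightarrow>\<^sub>C real"
  assume X: "\<And>n. ipb l r (X n) (X n) \<le> 1"
  define F where "F n = green (apply_bcontfun (X n))" for n
  have X': "integral {l..r} (\<lambda>x. (apply_bcontfun (X n) x)^2) \<le> 1" for n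
    using X[of n] by (simp add: ipb_def power2_eq_square)
  have bd: "norm (F n x) \<le> sqrt ((r - l) ^ 3)" if "x \<in> {l..r}" for n x
  proof -
    have "(F n x)^2 \<le> (r - l) ^ 3 * 1"
      unfolding F_def
      by (rule order_trans[OF green_bounds(2)[OF continuous_on_bcontfun that] mult_left_mono[OF X']]) (use lr in simp)
    then show ?thesis by (simp add: real_le_rsqrt)
  qed
  have eq: "\<exists>d. 0 < d \<and> (\<forall>n y. y \<in> {l..r} \<and> norm (x - y) < d \<longrightarrow> norm (F n x - F n y) < e)" if x: "x \<in> {l..r}" and e: "0 < e" for x e
  proof (intro exI conjI allI impI)
    show "0 < e^2 / (r - l)^2" using e lr by simp
    fix n y assume y: "y \<in> {l..r} \<and> norm (x - y) < e^2 / (r - l)^2"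
    have "(F n x - F n y)^2 \<le> \<bar>x - y\<bar> * ((r - l)^2 * integral {l..r} (\<lambda>x. (apply_bcontfun (X n) x)^2))"
      unfolding F_def using x y by (intro green_bounds(3) continuous_intros) auto
    also have "\<dots> \<le> \<bar>x - y\<bar> * ((r - l)^2 * 1)" using X' by (intro mult_left_mono) auto
    also have "\<dots> < e^2" using y lr by (simp add: pos_less_divide_eq)
    finally show "norm (F n x - F n y) < e" using e by (simp add: abs_square_less_1 power2_less_imp_less[of "\<bar>F n x - F n y\<bar>" e])
  qed
  obtain g k where g: "continuous_on {l..r} g" "strict_mono (k :: nat \<Rightarrow> nat)"
    "\<And>e. 0 < e \<Longrightarrow> \<exists>N. \<forall>n x. n \<ge> N \<and> x \<in> {l..r} \<longrightarrow> norm (F (k n) x - g x) < e"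
    using Arzela_Ascoli[OF compact_Icc bd eq] by metis
  have "(\<lambda>n. ipb l r (Gop (X (k n)) - cext l r g) (Gop (X (k n)) - cext l r g)) \<longlonglongrightarrow> 0"
  proof (rule LIMSEQ_I)
    fix e :: real assume e: "e > 0"
    define d where "d = sqrt (e / (2 * (r - l)))"
    have d: "d > 0" "d^2 * (r - l) = e / 2" using e lr by (simp_all add: d_def field_simps)
    obtain N where N: "\<And>n x. n \<ge> N \<Longrightarrow> x \<in> {l..r} \<Longrightarrow> norm (F (k n) x - g x) < d" using g(3)[OF d(1)] by blast
    show "\<exists>N. \<forall>n\<ge>N. norm (ipb l r (Gop (X (k n)) - cext l r g) (Gop (X (k n)) - cext l r g) - 0) < e"
    proof (intro exI allI impI)
      fix n assume n: "n \<ge> N"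
      have "ipb l r (Gop (X (k n)) - cext l r g) (Gop (X (k n)) - cext l r g) = integral {l..r} (\<lambda>x. (F (k n) x - g x)^2)"
        unfolding ipb_def using lr by (intro Henstock_Kurzweil_Integration.integral_cong)
          (simp add: minus_bcontfun.rep_eq Gop_apply F_def power2_eq_square cext_apply_in g)
      also have "\<dots> \<le> (r - l) * d^2"
      proof (intro integral_square_le continuous_intros g)
        show "continuous_on {l..r} (F (k n))" unfolding F_def by (intro green_continuous continuous_intros)
        show "(F (k n) x - g x)^2 \<le> d^2" if "x \<in> {l..r}" for x
          using N[OF n that] d by (intro abs_le_square_iff[THEN iffD1]) auto
      qed (use lr in auto)
      also have "\<dots> < e" using d e by (simp add: mult.commute)
      finally show "norm (ipb l r (Gop (X (k n)) - cext l r g) (Gop (X (k n)) - cext l r g) - 0) < e"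
        using ipb.ip_nonneg[of l r] by (simp add: abs_of_nonneg)
    qed
  qed
  with g(2) show "\<exists>y k. strict_mono k \<and> (\<lambda>n. ipb l r (Gop (X (k n)) - y) (Gop (X (k n)) - y)) \<longlonglongrightarrow> 0" by blast
next
  fix n :: nat and e :: "nat \<Rightarrow> real \<Rightarrow>\<^sub>C real"
  assume on: "\<And>i j. i < n \<Longrightarrow> j < n \<Longrightarrow> ipb l r (e i) (e j) = (if i = j then 1 else 0)"
  \<comment> \<open>Otherwise every \<open>y\<close> would equal its projection, so \<open>y r\<close> would be controlled by the \<open>L^2\<close> norm of \<open>y\<close>;
    high powers contradict this.\<close>
  show "\<exists>x. 0 < ipb l r x x \<and> (\<forall>j<n. ipb l r x (e j) = 0)"
  proof (rule ccontr)
    assume no: "\<nexists>x. 0 < ipb l r x x \<and> (\<forall>j<n. ipb l r x (e j) = 0)"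
    define C where "C = (\<Sum>j<n. \<bar>apply_bcontfun (e j) r\<bar>)"
    have C: "C \<ge> 0" by (simp add: C_def sum_nonneg)
    have key: "(apply_bcontfun y r)^2 \<le> C^2 * ipb l r y y" for y
    proof -
      let ?s = "\<Sum>j<n. ipb l r y (e j) *\<^sub>R e j"
      have "ipb l r (y - ?s) (e i) = 0" if "i < n" for i
      proof -
        have "(\<Sum>j<n. ipb l r y (e j) * ipb l r (e j) (e i)) = (\<Sum>j<n. if j = i then ipb l r y (e i) else 0)"
          using on that by (intro sum.cong) auto
        then show ?thesis using that by (simp add: ipb.ip_simps ipb.ip_sum_left)
      qed
      then have "ipb l r (y - ?s) (y - ?s) = 0" using no ipb.ip_nonneg[of l r "y - ?s"] by force
      then have "apply_bcontfun (y - ?s) r = 0" using lr by (intro ipb_null_imp_zero) auto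
      moreover have "apply_bcontfun (sum f A) r = (\<Sum>j\<in>A. apply_bcontfun (f j) r)" for f :: "nat \<Rightarrow> real \<Rightarrow>\<^sub>C real" and A
        by (induction A rule: infinite_finite_induct) (auto simp: plus_bcontfun.rep_eq zero_bcontfun.rep_eq)
      ultimately have "apply_bcontfun y r = (\<Sum>j<n. ipb l r y (e j) * apply_bcontfun (e j) r)"
        by (simp add: minus_bcontfun.rep_eq scaleR_bcontfun.rep_eq)
      also have "\<bar>\<dots>\<bar> \<le> (\<Sum>j<n. sqrt (ipb l r y y) * \<bar>apply_bcontfun (e j) r\<bar>)"
      proof (rule order_trans[OF sum_abs sum_mono])
        fix j assume "j \<in> {..<n}"
        then have "(ipb l r y (e j))^2 \<le> ipb l r y y" using ipb.cauchy_schwarz[of l r y "e j"] on by simp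
        then have "\<bar>ipb l r y (e j)\<bar> \<le> sqrt (ipb l r y y)" by (simp add: real_le_rsqrt)
        then show "\<bar>ipb l r y (e j) * apply_bcontfun (e j) r\<bar> \<le> sqrt (ipb l r y y) * \<bar>apply_bcontfun (e j) r\<bar>"
          unfolding abs_mult by (intro mult_right_mono) auto
      qed
      finally have "\<bar>apply_bcontfun y r\<bar> \<le> sqrt (ipb l r y y) * C" by (simp add: C_def sum_distrib_left)
      then have "\<bar>apply_bcontfun y r\<bar>^2 \<le> (sqrt (ipb l r y y) * C)^2" by (intro power_mono) auto
      then show ?thesis using ipb.ip_nonneg[of l r y] by (simp add: power_mult_distrib mult.commute)
    qed
    have "1 \<le> C^2 * ((r - l) / real (Suc (2 * i)))" for i
    proof -
      let ?f = "\<lambda>x. ((x - l) / (r - l)) ^ i"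
      have cf: "continuous_on {l..r} ?f" using lr by (intro continuous_intros) auto
      have "((\<lambda>x. ((x - l) / (r - l)) ^ (2 * i)) has_integral
         (r - l) / real (Suc (2 * i)) * ((r - l) / (r - l)) ^ Suc (2 * i) - (r - l) / real (Suc (2 * i)) * ((l - l) / (r - l)) ^ Suc (2 * i)) {l..r}"
      proof (rule fundamental_theorem_of_calculus)
        fix x
        have "((\<lambda>x. (r - l) / real (Suc (2 * i)) * ((x - l) / (r - l)) ^ Suc (2 * i)) has_real_derivative
           (r - l) / real (Suc (2 * i)) * (real (Suc (2 * i)) * ((x - l) / (r - l)) ^ (2 * i) * (1 / (r - l)))) (at x within {l..r})"
          using lr by (auto intro!: derivative_eq_intros simp del: power_Suc of_nat_Suc)
        also have "(r - l) / real (Suc (2 * i)) * (real (Suc (2 * i)) * ((x - l) / (r - l)) ^ (2 * i) * (1 / (r - l))) = ((x - l) / (r - l)) ^ (2 * i)"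
          using lr by (simp add: field_simps del: of_nat_Suc)
        finally show "((\<lambda>x. (r - l) / real (Suc (2 * i)) * ((x - l) / (r - l)) ^ Suc (2 * i)) has_vector_derivative ((x - l) / (r - l)) ^ (2 * i)) (at x within {l..r})"
          by (simp only: has_real_derivative_iff_has_vector_derivative)
      qed (use lr in simp)
      then have int: "integral {l..r} (\<lambda>x. ?f x * ?f x) = (r - l) / real (Suc (2 * i))"
        using lr by (simp add: integral_unique mult_2 power_add del: of_nat_Suc)
      have "(apply_bcontfun (cext l r ?f) r)^2 \<le> C^2 * ipb l r (cext l r ?f) (cext l r ?f)" by (rule key)
      then show ?thesis using lr int by (simp add: cext_apply_in[OF _ cf] ipb_cext[OF _ cf cf] del: of_nat_Suc)
    qed
    then have "1 + 2 * real i \<le> C^2 * (r - l)" for i by (simp add: field_simps)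
    moreover obtain i :: nat where "C^2 * (r - l) < real i" using reals_Archimedean2 by blast
    ultimately show False by (metis add_strict_increasing linorder_not_less mult_2 of_nat_0_le_iff add_increasing zero_less_one less_le_trans order_less_le)
  qed
qed

end

section \<open>Density of polynomials that vanish at both endpoints\<close>

lemma square_add_le: "(A + B)^2 \<le> 2 * A^2 + 2 * B^2" for A B :: real
  using zero_le_power2[of "A - B"] unfolding power2_sum power2_diff by linarith

lemma real_polynomial_C2_on:
  assumes "real_polynomial_function p"
  obtains p1 p2 where "C2_on l r p p1 p2"
proof -
  obtain p1 where p1: "real_polynomial_function p1" "\<And>x. (p has_real_derivative p1 x) (at x)"
    using has_real_derivative_polynomial_function[OF assms] by blast
  obtain p2 where p2: "real_polynomial_function p2" "\<And>x. (p1 has_real_derivative p2 x) (at x)"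
    using has_real_derivative_polynomial_function[OF p1(1)] by blast
  have "continuous_on {l..r} p2" using continuous_on_polymonial_function real_polynomial_function_eq p2(1) by blast
  then show thesis using p1 p2 by (intro that[of p1 p2]) (auto simp: C2_on_def intro: has_field_derivative_at_within)
qed

text \<open>A Weierstrass polynomial is multiplied by 1 - z^(2j), where z maps [l,r] affinely onto
  [-1,1]. The factor vanishes at both ends, and the error z^(2j) has square integral (r - l)/(4j +
  1), which is small for large j.\<close>

lemma real_polynomial_dirichlet_approx:
  fixes f :: "real \<Rightarrow> real"
  assumes lr: "l < r" and f: "continuous_on {l..r} f" and e: "e > 0"
  obtains w where "real_polynomial_function w" "w l = 0" "w r = 0" "integral {l..r} (\<lambda>x. (f x - w x)^2) < e"
proof -
  define d where "d = sqrt (e / (4 * (r - l)))"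
  have d: "d > 0" "2 * (d^2 * (r - l)) = e / 2" using e lr by (simp_all add: d_def field_simps)
  obtain p where p: "polynomial_function p" "\<And>x. x \<in> {l..r} \<Longrightarrow> norm (f x - p x) < d"
    using Stone_Weierstrass_polynomial_function[OF compact_Icc f d(1)] by blast
  have rp: "real_polynomial_function p" using p(1) by (simp add: real_polynomial_function_eq)
  have cp: "continuous_on {l..r} p" using p(1) by (rule continuous_on_polymonial_function)
  then have "bounded (p ` {l..r})" by (intro compact_imp_bounded compact_continuous_image) auto
  then obtain M where M: "\<And>x. x \<in> {l..r} \<Longrightarrow> \<bar>p x\<bar> \<le> M" unfolding bounded_iff by (metis imageI real_norm_def)
  have M0: "M \<ge> 0" using M[of l] lr by force
  define z where "z x = (2 * x - l - r) / (r - l)" for x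
  have z1: "z l = - 1" "z r = 1" using lr by (auto simp: z_def field_simps)
  have cz: "continuous_on S z" for S unfolding z_def using lr by (intro continuous_intros) auto
  have rz: "real_polynomial_function z"
  proof -
    have "real_polynomial_function (\<lambda>x. 2 / (r - l) * x + (- (l + r) / (r - l)))"
      by (intro real_polynomial_function.intros) (auto intro: bounded_linear_ident)
    moreover have "(\<lambda>x. 2 / (r - l) * x + (- (l + r) / (r - l))) = z"
      by (rule ext) (simp add: z_def diff_divide_distrib add_divide_distrib)
    ultimately show ?thesis by simp
  qed
  have intz: "integral {l..r} (\<lambda>x. (z x) ^ (2 * (2 * j))) = (r - l) / real (Suc (4 * j))" for j
  proof -
    have "((\<lambda>x. (z x) ^ (4 * j)) has_integral
       (r - l) / (2 * real (Suc (4 * j))) * (z r) ^ Suc (4 * j) - (r - l) / (2 * real (Suc (4 * j))) * (z l) ^ Suc (4 * j)) {l..r}"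
    proof (rule fundamental_theorem_of_calculus)
      fix x
      have dz: "(z has_real_derivative 2 / (r - l)) (at x within {l..r})"
        unfolding z_def by (intro DERIV_cdivide) (auto intro!: derivative_eq_intros)
      have "((\<lambda>x. (r - l) / (2 * real (Suc (4 * j))) * (z x) ^ Suc (4 * j)) has_real_derivative
         (r - l) / (2 * real (Suc (4 * j))) * (real (Suc (4 * j)) * (2 / (r - l) * (z x) ^ (4 * j)))) (at x within {l..r})"
        by (rule DERIV_cong[OF DERIV_cmult[OF DERIV_power[OF dz, of "Suc (4 * j)"]]]) (simp del: of_nat_Suc)
      also have "(r - l) / (2 * real (Suc (4 * j))) * (real (Suc (4 * j)) * (2 / (r - l) * (z x) ^ (4 * j))) = (z x) ^ (4 * j)"
        using lr by (simp add: field_simps del: of_nat_Suc)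
      finally show "((\<lambda>x. (r - l) / (2 * real (Suc (4 * j))) * (z x) ^ Suc (4 * j)) has_vector_derivative (z x) ^ (4 * j)) (at x within {l..r})"
        by (simp only: has_real_derivative_iff_has_vector_derivative)
    qed (use lr in simp)
    then have "integral {l..r} (\<lambda>x. (z x) ^ (4 * j)) = (r - l) / (2 * real (Suc (4 * j))) * (1 + 1)"
      by (simp add: integral_unique z1 field_simps del: of_nat_Suc)
    also have "\<dots> = (r - l) / real (Suc (4 * j))"
    proof -
      have "(r - l) / (2 * N) * (1 + 1) = (r - l) / N" if "N \<noteq> 0" for N :: real using that by (simp add: field_simps)
      then show ?thesis by (simp del: of_nat_Suc)
    qed
    finally show ?thesis by simp
  qed
  obtain j :: nat where j: "4 * M^2 * (r - l) / e < real j" using reals_Archimedean2 by blast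
  let ?w = "\<lambda>x. p x * (1 - (z x) ^ (2 * j))"
  show thesis
  proof
    show "real_polynomial_function ?w"
      by (intro real_polynomial_function.intros(4) rp real_polynomial_function_diff real_polynomial_function_power rz real_polynomial_function.intros(2))
    show "?w l = 0" "?w r = 0" by (simp_all add: z1)
    have "integral {l..r} (\<lambda>x. (f x - ?w x)^2) \<le> integral {l..r} (\<lambda>x. 2 * d^2 + 2 * M^2 * (z x) ^ (2 * (2 * j)))"
    proof (intro integral_le integrable_continuous_real continuous_intros f cp cz)
      fix x assume x: "x \<in> {l..r}"
      have "f x - ?w x = (f x - p x) + p x * (z x) ^ (2 * j)" by (simp add: algebra_simps)
      moreover have "((f x - p x) + p x * (z x) ^ (2 * j))^2 \<le> 2 * (f x - p x)^2 + 2 * (p x * (z x) ^ (2 * j))^2"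
        by (rule square_add_le)
      moreover have "(f x - p x)^2 \<le> d^2" using p(2)[OF x] d by (intro abs_le_square_iff[THEN iffD1]) auto
      moreover have "(p x * (z x) ^ (2 * j))^2 \<le> M^2 * (z x) ^ (2 * (2 * j))"
      proof -
        have "(p x)^2 \<le> M^2" using M[OF x] M0 by (intro abs_le_square_iff[THEN iffD1]) auto
        then have "(p x)^2 * ((z x) ^ (2 * j))^2 \<le> M^2 * ((z x) ^ (2 * j))^2" by (intro mult_right_mono) auto
        then show ?thesis by (simp add: power_mult_distrib power_mult[symmetric] mult.commute)
      qed
      ultimately show "(f x - ?w x)^2 \<le> 2 * d^2 + 2 * M^2 * (z x) ^ (2 * (2 * j))" by (simp only:)
    qed
    also have "\<dots> = 2 * d^2 * (r - l) + 2 * M^2 * ((r - l) / real (Suc (4 * j)))"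
    proof -
      have "integral {l..r} (\<lambda>x. 2 * d^2 + 2 * M^2 * (z x) ^ (2 * (2 * j)))
        = integral {l..r} (\<lambda>x. 2 * d^2) + integral {l..r} (\<lambda>x. 2 * M^2 * (z x) ^ (2 * (2 * j)))"
        by (intro Henstock_Kurzweil_Integration.integral_add integrable_continuous_real continuous_intros cz)
      also have "integral {l..r} (\<lambda>x. 2 * M^2 * (z x) ^ (2 * (2 * j))) = 2 * M^2 * ((r - l) / real (Suc (4 * j)))"
        by (simp only: Henstock_Kurzweil_Integration.integral_mult_right intz)
      finally show ?thesis using lr by (simp add: mult_ac)
    qed
    also have "\<dots> < e / 2 + e / 2"
    proof (rule add_le_less_mono)
      have "4 * M^2 * (r - l) < e * real j" using j e by (simp add: field_simps)
      also have "\<dots> \<le> e * real (Suc (4 * j))" using e by (intro mult_left_mono) auto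
      finally show "2 * M^2 * ((r - l) / real (Suc (4 * j))) < e / 2" by (simp add: field_simps)
    qed (use d in simp)
    finally show "integral {l..r} (\<lambda>x. (f x - ?w x)^2) < e" by simp
  qed
qed

section \<open>Trace bound and completeness of the eigenfunctions\<close>

context sturm_liouville
begin

lemma eigenfunction_sup_le:
  assumes v: "C2_on l r v v1 (\<lambda>x. (q x - lam) * v x)" "v l = 0" "v r = 0"
    and n: "integral {l..r} (\<lambda>x. v x * v x) = 1" and x: "x \<in> {l..r}"
  shows "(v x)^2 \<le> (r - l) * lam"
proof -
  have "integral {l..r} (\<lambda>x. (v1 x)^2) \<le> integral {l..r} (\<lambda>x. (q x * v x - (q x - lam) * v x) * v x)"
    by (rule derivative_energy_le[OF v])
  also have "(\<lambda>x. (q x * v x - (q x - lam) * v x) * v x) = (\<lambda>x. lam * (v x * v x))" by (simp add: algebra_simps)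
  finally have "integral {l..r} (\<lambda>x. (v1 x)^2) \<le> lam" using n by simp
  then have "(r - l) * integral {l..r} (\<lambda>x. (v1 x)^2) \<le> (r - l) * lam" using lr by (intro mult_left_mono) auto
  then show ?thesis using sup_square_le[OF v x] by linarith
qed

text \<open>For fixed x the function f with coefficients v_k(x)/lam_k is the truncated Green
  function with pole x: both f(x) and its energy equal S, the partial sum of v_k(x)^2/lam_k. The sup
  bound for Dirichlet functions then reads S^2 \<le> (r - l) S, and integrating S \<le> r - l over x
  gives the claim.\<close>

lemma trace_le:
  fixes n :: nat
  assumes v: "\<And>k. C2_on l r (v k) (v1 k) (\<lambda>x. (q x - lam k) * v k x)" "\<And>k. v k l = 0" "\<And>k. v k r = 0"
    and lam: "\<And>k. lam k > 0"
    and on: "\<And>i j. integral {l..r} (\<lambda>x. v i x * v j x) = (if i = j then 1 else 0)"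
  shows "(\<Sum>k<n. 1 / lam k) \<le> (r - l)^2"
proof -
  have cv: "continuous_on {l..r} (v k)" for k using C2_onD(3)[OF v(1)] .
  have pw: "(\<Sum>k<n. (v k x)^2 / lam k) \<le> r - l" if x: "x \<in> {l..r}" for x
  proof -
    define a where "a k = v k x / lam k" for k
    define S where "S = (\<Sum>k<n. (v k x)^2 / lam k)"
    define f where "f t = (\<Sum>k<n. a k * v k t)" for t
    define f1 where "f1 t = (\<Sum>k<n. a k * v1 k t)" for t
    define f2 where "f2 t = (\<Sum>k<n. a k * ((q t - lam k) * v k t))" for t
    have f: "C2_on l r f f1 f2"
      unfolding C2_on_def f_def f1_def f2_def
      by (intro conjI ballI DERIV_sum DERIV_cmult C2_onD(1,2)[OF v(1)] continuous_intros q_cont cv) auto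
    have f0: "f l = 0" "f r = 0" using v by (auto simp: f_def)
    have Sa: "S = (\<Sum>k<n. a k * a k * lam k)" unfolding S_def a_def
      using lam by (intro sum.cong) (auto simp: power2_eq_square field_simps less_imp_neq[OF lam, symmetric])
    have fx: "f x = S" unfolding f_def S_def a_def by (simp add: power2_eq_square)
    have "integral {l..r} (\<lambda>t. (q t * f t - f2 t) * f t) = integral {l..r} (\<lambda>t. \<Sum>i<n. \<Sum>j<n. (a i * lam i * a j) * (v i t * v j t))"
    proof (intro Henstock_Kurzweil_Integration.integral_cong)
      fix t
      have "q t * f t - f2 t = (\<Sum>i<n. a i * lam i * v i t)"
        unfolding f_def f2_def sum_distrib_left sum_subtractf[symmetric] by (intro sum.cong) (auto simp: algebra_simps)
      then have "(q t * f t - f2 t) * f t = (\<Sum>i<n. \<Sum>j<n. (a i * lam i * v i t) * (a j * v j t))"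
        by (simp only: f_def sum_product)
      then show "(q t * f t - f2 t) * f t = (\<Sum>i<n. \<Sum>j<n. (a i * lam i * a j) * (v i t * v j t))"
        by (simp only: mult_ac)
    qed
    also have "\<dots> = (\<Sum>i<n. \<Sum>j<n. (a i * lam i * a j) * integral {l..r} (\<lambda>t. v i t * v j t))"
      by (subst Henstock_Kurzweil_Integration.integral_sum, auto intro!: integrable_sum integrable_continuous_real continuous_intros cv sum.cong)
         (subst Henstock_Kurzweil_Integration.integral_sum, auto intro!: integrable_continuous_real continuous_intros cv)
    also have "\<dots> = S" by (simp add: on Sa if_distrib cong: if_cong) (simp add: mult_ac)
    finally have "integral {l..r} (\<lambda>t. (q t * f t - f2 t) * f t) = S" .
    then have "integral {l..r} (\<lambda>t. (f1 t)^2) \<le> S" using derivative_energy_le[OF f f0] by simp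
    then have "S^2 \<le> (r - l) * S"
      using sup_square_le[OF f f0 x] mult_left_mono[of "integral {l..r} (\<lambda>t. (f1 t)^2)" S "r - l"] lr unfolding fx by linarith
    moreover have "S \<ge> 0" unfolding S_def using less_imp_le[OF lam] by (intro sum_nonneg) auto
    ultimately have "S \<le> r - l" using lr by (cases "S = 0") (auto simp: power2_eq_square mult_le_cancel_right)
    then show ?thesis by (simp add: S_def)
  qed
  have "(\<Sum>k<n. 1 / lam k) = (\<Sum>k<n. integral {l..r} (\<lambda>x. (v k x)^2 / lam k))"
    using on by (simp add: power2_eq_square)
  also have "\<dots> = integral {l..r} (\<lambda>x. \<Sum>k<n. (v k x)^2 / lam k)"
    using less_imp_neq[OF lam, symmetric] by (intro Henstock_Kurzweil_Integration.integral_sum[symmetric] integrable_continuous_real continuous_intros cv) auto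
  also have "\<dots> \<le> integral {l..r} (\<lambda>x. r - l)"
    using pw less_imp_neq[OF lam, symmetric] by (intro integral_le integrable_continuous_real continuous_intros cv) auto
  also have "\<dots> = (r - l)^2" using lr by (simp add: power2_eq_square)
  finally show ?thesis .
qed

text \<open>A Dirichlet polynomial w is the image under \<open>Gop\<close> of h = q w - w''.
  Removing from h its first n components leaves a vector on which G has norm at most \<mu>_n, so the
  expansion error of w is at most \<mu>_n times the norm of h, and \<mu>_n tends to 0 by the trace
  bound. The last clause is the case n = 0 of the same estimate; it makes upper bounds on
  \<open>lam 0\<close> a matter of test functions.\<close>

theorem eigenbasis:
  obtains v v1 :: "nat \<Rightarrow> real \<Rightarrow> real" and lam :: "nat \<Rightarrow> real"
  where "\<And>k. C2_on l r (v k) (v1 k) (\<lambda>x. (q x - lam k) * v k x)" "\<And>k. v k l = 0" "\<And>k. v k r = 0"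
    "\<And>k. lam k > 0" "\<And>i j. integral {l..r} (\<lambda>x. v i x * v j x) = (if i = j then 1 else 0)"
    "\<And>n. (\<Sum>k<n. 1 / lam k) \<le> (r - l)^2"
    "\<And>k x. x \<in> {l..r} \<Longrightarrow> (v k x)^2 \<le> (r - l) * lam k"
    "\<And>f e. continuous_on {l..r} f \<Longrightarrow> e > 0 \<Longrightarrow> \<exists>n a. integral {l..r} (\<lambda>x. (f x - (\<Sum>k<n. a k * v k x))^2) < e"
    "\<And>w w1 w2. C2_on l r w w1 w2 \<Longrightarrow> w l = 0 \<Longrightarrow> w r = 0 \<Longrightarrow>
       (lam 0)^2 * integral {l..r} (\<lambda>x. (w x)^2) \<le> integral {l..r} (\<lambda>x. (q x * w x - w2 x)^2)"
proof -
  interpret G: compact_positive_operator "ipb l r" Gop "(r - l) ^ 4" by (rule Gop_positive_operator)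
  obtain e :: "nat \<Rightarrow> real \<Rightarrow>\<^sub>C real" and \<mu> where \<mu>: "\<And>n. \<mu> n > 0" and on: "\<And>i j. ipb l r (e i) (e j) = (if i = j then 1 else 0)"
    and eig: "\<And>n. ipb l r (Gop (e n) - \<mu> n *\<^sub>R e n) (Gop (e n) - \<mu> n *\<^sub>R e n) = 0"
    and decay: "\<And>n y. (\<And>j. j < n \<Longrightarrow> ipb l r y (e j) = 0) \<Longrightarrow> ipb l r (Gop y) (Gop y) \<le> (\<mu> n)^2 * ipb l r y y"
    using G.spectral_sequence by metis
  define v where "v k = apply_bcontfun (e k)" for k :: nat
  define lam where "lam k = 1 / \<mu> k" for k :: nat
  have lam: "lam k > 0" for k using \<mu> by (simp add: lam_def)
  have cv: "continuous_on {l..r} (v k)" for k unfolding v_def by (intro continuous_intros)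
  have Gv: "green (v k) x = \<mu> k * v k x" if "x \<in> {l..r}" for k x
    using ipb_null_imp_zero[OF lr eig that, of k] Gop_apply[OF that, of "e k"]
    by (simp add: minus_bcontfun.rep_eq scaleR_bcontfun.rep_eq v_def)
  have "\<exists>v1. C2_on l r (v k) v1 (\<lambda>x. (q x - lam k) * v k x) \<and> v k l = 0 \<and> v k r = 0" for k
  proof -
    obtain w1 where w: "C2_on l r (green (v k)) w1 (\<lambda>x. q x * green (v k) x - v k x)" "green (v k) l = 0" "green (v k) r = 0"
      by (rule green_solves[OF cv])
    have m: "\<mu> k \<noteq> 0" using \<mu>[of k] by simp
    have veq: "v k x = lam k * green (v k) x" if "x \<in> {l..r}" for x using Gv[OF that, of k] m by (simp add: lam_def)
    have "C2_on l r (v k) (\<lambda>x. lam k * w1 x) (\<lambda>x. lam k * (q x * green (v k) x - v k x))"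
      unfolding C2_on_def
    proof (intro conjI ballI)
      fix x assume x: "x \<in> {l..r}"
      show "(v k has_real_derivative lam k * w1 x) (at x within {l..r})"
        by (rule has_field_derivative_transform_within[OF DERIV_cmult[OF C2_onD(1)[OF w(1) x]] zero_less_one x]) (simp add: veq)
      show "((\<lambda>x. lam k * w1 x) has_real_derivative lam k * (q x * green (v k) x - v k x)) (at x within {l..r})"
        by (rule DERIV_cmult[OF C2_onD(2)[OF w(1) x]])
    qed (intro continuous_intros C2_onD(5)[OF w(1)])
    then have "C2_on l r (v k) (\<lambda>x. lam k * w1 x) (\<lambda>x. (q x - lam k) * v k x)"
      by (rule C2_on_cong) (simp add: right_diff_distrib left_diff_distrib veq)
    then show ?thesis using w veq[of l] veq[of r] lr by auto
  qed
  then obtain v1 where v: "\<And>k. C2_on l r (v k) (v1 k) (\<lambda>x. (q x - lam k) * v k x)" "\<And>k. v k l = 0" "\<And>k. v k r = 0"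
    by metis
  have on': "integral {l..r} (\<lambda>x. v i x * v j x) = (if i = j then 1 else 0)" for i j
    using on[of i j] by (simp add: ipb_def v_def)
  have tr: "(\<Sum>k<n. 1 / lam k) \<le> (r - l)^2" for n by (rule trace_le[OF v lam on'])
  have Gw: "apply_bcontfun (Gop (cext l r (\<lambda>x. q x * w x - w2 x))) x = w x"
    if w: "C2_on l r w w1 w2" "w l = 0" "w r = 0" and x: "x \<in> {l..r}" for w w1 w2 x
  proof -
    have c: "continuous_on {l..r} (\<lambda>x. q x * w x - w2 x)" using C2_onD[OF w(1)] by (intro continuous_intros q_cont)
    have "C2_on l r w w1 (\<lambda>x. q x * w x - apply_bcontfun (cext l r (\<lambda>x. q x * w x - w2 x)) x)"
      by (rule C2_on_cong[OF w(1)]) (use lr in \<open>simp add: cext_apply_in[OF _ c]\<close>)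
    from green_unique[OF continuous_on_bcontfun this w(2,3) x] Gop_apply[OF x] show ?thesis by simp
  qed
  have first: "(lam 0)^2 * integral {l..r} (\<lambda>x. (w x)^2) \<le> integral {l..r} (\<lambda>x. (q x * w x - w2 x)^2)"
    if w: "C2_on l r w w1 w2" "w l = 0" "w r = 0" for w w1 w2
  proof -
    let ?h = "cext l r (\<lambda>x. q x * w x - w2 x)"
    have c: "continuous_on {l..r} (\<lambda>x. q x * w x - w2 x)" using C2_onD[OF w(1)] by (intro continuous_intros q_cont)
    have "ipb l r (Gop ?h) (Gop ?h) \<le> (\<mu> 0)^2 * ipb l r ?h ?h" by (rule decay) simp
    moreover have "ipb l r ?h ?h = integral {l..r} (\<lambda>x. (q x * w x - w2 x)^2)"
      using lr by (simp add: ipb_cext[OF _ c c] power2_eq_square)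
    moreover have "ipb l r (Gop ?h) (Gop ?h) = integral {l..r} (\<lambda>x. (w x)^2)"
      unfolding ipb_def by (intro Henstock_Kurzweil_Integration.integral_cong) (simp add: Gw[OF w] power2_eq_square)
    ultimately show ?thesis using \<mu>[of 0] by (simp add: lam_def power_divide divide_le_eq mult.commute)
  qed
  have dense: "\<exists>n a. integral {l..r} (\<lambda>x. (f x - (\<Sum>k<n. a k * v k x))^2) < \<epsilon>" if f: "continuous_on {l..r} f" and \<epsilon>: "\<epsilon> > 0" for f \<epsilon>
  proof -
    obtain w where w: "real_polynomial_function w" "w l = 0" "w r = 0" "integral {l..r} (\<lambda>x. (f x - w x)^2) < \<epsilon> / 4"
      using real_polynomial_dirichlet_approx[OF lr f, of "\<epsilon> / 4"] \<epsilon> by auto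
    obtain w1 w2 where w2: "C2_on l r w w1 w2" using real_polynomial_C2_on[OF w(1)] by blast
    have cw: "continuous_on {l..r} w" using C2_onD(3)[OF w2] .
    define h where "h = cext l r (\<lambda>x. q x * w x - w2 x)"
    have "summable (\<lambda>k. 1 / lam k)"
      by (rule summableI_nonneg_bounded[of _ "(r - l)^2"]) (use lam tr in \<open>auto intro: less_imp_le\<close>)
    then have "\<mu> \<longlonglongrightarrow> 0" using summable_LIMSEQ_zero by (force simp: lam_def)
    then have "(\<lambda>n. (\<mu> n)^2 * ipb l r h h) \<longlonglongrightarrow> 0^2 * ipb l r h h" by (intro tendsto_intros)
    then have "\<forall>\<^sub>F n in sequentially. (\<mu> n)^2 * ipb l r h h < \<epsilon> / 4" using \<epsilon> by (intro order_tendstoD(2)[of _ "0^2 * ipb l r h h"]) auto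
    then obtain n where n: "(\<mu> n)^2 * ipb l r h h < \<epsilon> / 4" by (auto simp: eventually_sequentially)
    define a where "a k = ipb l r h (e k)" for k
    define s where "s = (\<Sum>k<n. a k *\<^sub>R e k)"
    have se: "ipb l r s (e i) = a i" if "i < n" for i
    proof -
      have "ipb l r s (e i) = (\<Sum>j<n. if j = i then a i else 0)"
        unfolding s_def ipb.ip_sum_left ipb.ip_scale_left using on that by (intro sum.cong) auto
      then show ?thesis using that by simp
    qed
    have ss: "ipb l r s s = ipb l r h s"
    proof -
      have "ipb l r s s = (\<Sum>k<n. a k * a k)"
        using se by (subst (2) s_def) (auto simp: ipb.ip_sum_right ipb.ip_scale_right intro!: sum.cong)
      moreover have "ipb l r h s = (\<Sum>k<n. a k * a k)"
        by (subst s_def) (auto simp: ipb.ip_sum_right ipb.ip_scale_right a_def)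
      ultimately show ?thesis by simp
    qed
    have "ipb l r (Gop (h - s)) (Gop (h - s)) \<le> (\<mu> n)^2 * ipb l r (h - s) (h - s)"
      by (rule decay) (simp add: ipb.ip_simps se a_def)
    also have "ipb l r (h - s) (h - s) \<le> ipb l r h h"
      using ss ipb.ip_nonneg[of l r s] ipb.ip_commute[of l r s h] by (simp add: ipb.ip_simps)
    finally have "ipb l r (Gop (h - s)) (Gop (h - s)) < \<epsilon> / 4" using n by (simp add: mult_left_mono)
    moreover have Gs: "apply_bcontfun (Gop (h - s)) x = w x - (\<Sum>k<n. a k * \<mu> k * v k x)" if x: "x \<in> {l..r}" for x
    proof -
      have sum_G: "Gop (sum F A) = (\<Sum>k\<in>A. Gop (F k))" for F :: "nat \<Rightarrow> real \<Rightarrow>\<^sub>C real" and A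
        using G.G_add G.G_scale[of 0] by (induction A rule: infinite_finite_induct) auto
      have sum_ap: "apply_bcontfun (sum F A) x = (\<Sum>j\<in>A. apply_bcontfun (F j) x)" for F :: "nat \<Rightarrow> real \<Rightarrow>\<^sub>C real" and A
        by (induction A rule: infinite_finite_induct) (auto simp: plus_bcontfun.rep_eq zero_bcontfun.rep_eq)
      have "apply_bcontfun (Gop s) x = (\<Sum>k<n. a k * \<mu> k * v k x)"
        unfolding s_def sum_G sum_ap using Gv[OF x] Gop_apply[OF x]
        by (simp add: G.G_scale scaleR_bcontfun.rep_eq v_def mult_ac)
      then show ?thesis using Gw[OF w2 w(2,3) x] by (simp add: G.G_diff minus_bcontfun.rep_eq h_def)
    qed
    then have "ipb l r (Gop (h - s)) (Gop (h - s)) = integral {l..r} (\<lambda>x. (w x - (\<Sum>k<n. a k * \<mu> k * v k x))^2)"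
      unfolding ipb_def by (intro Henstock_Kurzweil_Integration.integral_cong) (simp add: power2_eq_square)
    ultimately have i2: "integral {l..r} (\<lambda>x. (w x - (\<Sum>k<n. a k * \<mu> k * v k x))^2) < \<epsilon> / 4" by simp
    have "integral {l..r} (\<lambda>x. (f x - (\<Sum>k<n. a k * \<mu> k * v k x))^2)
       \<le> integral {l..r} (\<lambda>x. 2 * (f x - w x)^2 + 2 * (w x - (\<Sum>k<n. a k * \<mu> k * v k x))^2)"
    proof (intro integral_le integrable_continuous_real continuous_intros f cw cv)
      fix x
      have "(A + B)^2 \<le> 2 * A^2 + 2 * B^2" for A B :: real using zero_le_power2[of "A - B"] unfolding power2_sum power2_diff by linarith
      from this[of "f x - w x" "w x - (\<Sum>k<n. a k * \<mu> k * v k x)"]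
      show "(f x - (\<Sum>k<n. a k * \<mu> k * v k x))^2 \<le> 2 * (f x - w x)^2 + 2 * (w x - (\<Sum>k<n. a k * \<mu> k * v k x))^2" by simp
    qed
    also have "\<dots> = 2 * integral {l..r} (\<lambda>x. (f x - w x)^2) + 2 * integral {l..r} (\<lambda>x. (w x - (\<Sum>k<n. a k * \<mu> k * v k x))^2)"
      by (subst Henstock_Kurzweil_Integration.integral_add) (auto intro!: integrable_continuous_real continuous_intros f cw cv)
    also have "\<dots> < \<epsilon>" using w(4) i2 by simp
    finally show ?thesis by (intro exI[of _ n] exI[of _ "\<lambda>k. a k * \<mu> k"])
  qed
  show thesis
    by (rule that[OF v lam on' tr eigenfunction_sup_le[OF v] dense first]) (auto simp: on')
qed

end

section \<open>The Hilbert space\<close>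

abbreviation "LO \<equiv> lebesgue_on Omega"
abbreviation "box2 \<equiv> cbox (-1, 0) (1, 1) :: (real \<times> real) set"

lemma Omega_box: "Omega = box (-1, 0) (1, 1)"
  by (auto simp: Omega_def box_def Basis_prod_def)

lemma Omega_sets [simp]: "Omega \<in> sets lebesgue" "Omega \<in> sets borel"
  by (simp_all add: Omega_box)

lemma Omega_subset_box2: "Omega \<subseteq> box2"
  unfolding Omega_box by (rule box_subset_cbox)

lemma box2_iff: "p \<in> box2 \<longleftrightarrow> fst p \<in> {-1..1} \<and> snd p \<in> {0..1}"
  by (cases p) (auto simp: cbox_Pair_eq)

lemma emeasure_Omega_finite: "emeasure lebesgue Omega < \<infinity>"
  unfolding Omega_box by (simp add: emeasure_lborel_box_eq)

lemma finite_measure_LO: "finite_measure LO"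
  by (rule finite_measureI) (use emeasure_Omega_finite in \<open>simp add: emeasure_restrict_space\<close>)

lemma continuous_integrable_Omega:
  fixes f :: "real \<times> real \<Rightarrow> real"
  assumes "continuous_on box2 f"
  shows "integrable LO f"
proof -
  have "f absolutely_integrable_on box2" by (rule absolutely_integrable_continuous[OF assms])
  then have "f absolutely_integrable_on Omega"
    by (rule set_integrable_subset) (use Omega_subset_box2 in auto)
  then show ?thesis by (rule absolutely_integrable_imp_integrable) simp
qed

lemma integral_Omega_eq:
  fixes f :: "real \<times> real \<Rightarrow> real"
  assumes "continuous_on box2 f"
  shows "integral\<^sup>L LO f = integral {-1..1} (\<lambda>x. integral {0..1} (\<lambda>y. f (x, y)))"
    and "integral\<^sup>L LO f = integral {0..1} (\<lambda>y. integral {-1..1} (\<lambda>x. f (x, y)))"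
proof -
  have 1: "integral\<^sup>L LO f = integral box2 f"
    using lebesgue_integral_eq_integral[OF continuous_integrable_Omega[OF assms]]
    by (simp add: Omega_box integral_open_interval)
  show 2: "integral\<^sup>L LO f = integral {-1..1} (\<lambda>x. integral {0..1} (\<lambda>y. f (x, y)))"
    using integral_prod_continuous[OF assms] 1 by simp
  have "continuous_on box2 (\<lambda>(x, y). f (x, y))" using assms by simp
  from integral_swap_continuous[OF this] show "integral\<^sup>L LO f = integral {0..1} (\<lambda>y. integral {-1..1} (\<lambda>x. f (x, y)))"
    using 2 by simp
qed

lemma continuous_on_tensor:
  fixes f g :: "real \<Rightarrow> real"
  assumes "continuous_on {-1..1} f" "continuous_on {0..1} g"
  shows "continuous_on box2 (\<lambda>p. f (fst p) * g (snd p))"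
  by (intro continuous_on_mult continuous_on_compose2[OF assms(1)] continuous_on_compose2[OF assms(2)] continuous_intros)
     (auto simp: box2_iff)

lemma integral_Omega_tensor:
  fixes f g :: "real \<Rightarrow> real"
  assumes "continuous_on {-1..1} f" "continuous_on {0..1} g"
  shows "integral\<^sup>L LO (\<lambda>p. f (fst p) * g (snd p)) = integral {-1..1} f * integral {0..1} g"
  by (simp add: integral_Omega_eq(1)[OF continuous_on_tensor[OF assms]])

lemma continuous_L2:
  assumes "continuous_on box2 f" shows "L2 f"
  unfolding L2_def
proof
  show "f \<in> borel_measurable LO" using continuous_integrable_Omega[OF assms] by (rule borel_measurable_integrable)
  show "integrable LO (\<lambda>p. (f p)^2)" by (intro continuous_integrable_Omega continuous_intros assms)
qed

lemma L2_measurable [measurable_dest]: "L2 f \<Longrightarrow> f \<in> borel_measurable LO"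
  by (simp add: L2_def)

lemma L2_mult_integrable:
  assumes "L2 f" "L2 g" shows "integrable LO (\<lambda>p. f p * g p)"
proof (rule Bochner_Integration.integrable_bound)
  show "integrable LO (\<lambda>p. (f p)^2 + (g p)^2)" using assms by (auto simp: L2_def)
  show "(\<lambda>p. f p * g p) \<in> borel_measurable LO" using assms by (auto simp: L2_def)
  have "\<bar>f p * g p\<bar> \<le> (f p)^2 + (g p)^2" for p
  proof -
    have "2 * (\<bar>f p\<bar> * \<bar>g p\<bar>) \<le> (f p)^2 + (g p)^2" using sum_squares_bound[of "\<bar>f p\<bar>" "\<bar>g p\<bar>"] by simp
    moreover have "0 \<le> \<bar>f p\<bar> * \<bar>g p\<bar>" by simp
    ultimately show ?thesis unfolding abs_mult by linarith
  qed
  then show "AE p in LO. norm (f p * g p) \<le> norm ((f p)^2 + (g p)^2)" by simp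
qed

lemma L2_lincomb:
  assumes "L2 f" "L2 g" shows "L2 (\<lambda>p. c * f p + d * g p)"
  unfolding L2_def
proof
  show "(\<lambda>p. c * f p + d * g p) \<in> borel_measurable LO" using assms by (auto simp: L2_def)
  have "integrable LO (\<lambda>p. c^2 * (f p)^2 + 2 * c * d * (f p * g p) + d^2 * (g p)^2)"
    using assms L2_mult_integrable[OF assms] by (auto simp: L2_def)
  then show "integrable LO (\<lambda>p. (c * f p + d * g p)^2)"
    by (simp add: power2_sum power_mult_distrib mult_ac add_ac)
qed

lemma L2_diff: "L2 f \<Longrightarrow> L2 g \<Longrightarrow> L2 (\<lambda>p. f p - g p)"
  using L2_lincomb[of f g 1 "-1"] by simp

lemma L2_add: "L2 f \<Longrightarrow> L2 g \<Longrightarrow> L2 (\<lambda>p. f p + g p)"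
  using L2_lincomb[of f g 1 1] by simp

lemma L2_scale: "L2 f \<Longrightarrow> L2 (\<lambda>p. c * f p)"
  using L2_lincomb[of f f c 0] by simp

lemma L2_zero: "L2 (\<lambda>p. 0)"
  by (simp add: L2_def)

lemma L2_sum: "(\<And>i. i \<in> A \<Longrightarrow> L2 (f i)) \<Longrightarrow> L2 (\<lambda>p. \<Sum>i\<in>A. f i p)"
  by (induction A rule: infinite_finite_induct) (auto intro: L2_zero L2_add)

lemma ip_commute: "ip f g = ip g f"
  by (simp add: ip_def mult.commute)

lemma ip_lincomb:
  assumes "L2 f" "L2 g" "L2 h"
  shows "ip (\<lambda>p. c * f p + d * g p) h = c * ip f h + d * ip g h"
proof -
  have "ip (\<lambda>p. c * f p + d * g p) h = integral\<^sup>L LO (\<lambda>p. c * (f p * h p) + d * (g p * h p))"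
    unfolding ip_def by (simp add: algebra_simps)
  then show ?thesis using L2_mult_integrable[OF assms(1,3)] L2_mult_integrable[OF assms(2,3)] by (simp add: ip_def)
qed

lemma ip_diff: "L2 f \<Longrightarrow> L2 g \<Longrightarrow> L2 h \<Longrightarrow> ip (\<lambda>p. f p - g p) h = ip f h - ip g h"
  using ip_lincomb[of f g h 1 "-1"] by simp

lemma ip_add: "L2 f \<Longrightarrow> L2 g \<Longrightarrow> L2 h \<Longrightarrow> ip (\<lambda>p. f p + g p) h = ip f h + ip g h"
  using ip_lincomb[of f g h 1 1] by simp

lemma ip_scale: "ip (\<lambda>p. c * f p) h = c * ip f h"
  by (simp add: ip_def mult.assoc)

lemma ip_sum: "(\<And>i. i \<in> A \<Longrightarrow> L2 (f i)) \<Longrightarrow> L2 h \<Longrightarrow> ip (\<lambda>p. \<Sum>i\<in>A. f i p) h = (\<Sum>i\<in>A. ip (f i) h)"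
  by (induction A rule: infinite_finite_induct) (auto simp: ip_add L2_sum, auto simp: ip_def)

lemma ip_nonneg: "ip f f \<ge> 0"
  by (simp add: ip_def)

lemma dist2_ip: "dist2 f g = ip (\<lambda>p. f p - g p) (\<lambda>p. f p - g p)"
  by (simp add: dist2_def ip_def power2_eq_square)

lemma dist2_nonneg: "dist2 f g \<ge> 0"
  by (simp add: dist2_ip ip_nonneg)

lemma dist2_commute: "dist2 f g = dist2 g f"
  by (simp add: dist2_def power2_commute)

lemma ip_cauchy_schwarz:
  assumes "L2 f" "L2 g" shows "(ip f g)^2 \<le> ip f f * ip g g"
proof (rule nonneg_quadratic_discriminant)
  fix t
  have L: "L2 (\<lambda>p. 1 * f p + t * g p)" using assms by (rule L2_lincomb)
  have "0 \<le> ip (\<lambda>p. 1 * f p + t * g p) (\<lambda>p. 1 * f p + t * g p)" by (rule ip_nonneg)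
  also have "\<dots> = ip f f + 2 * t * ip f g + t^2 * ip g g"
    using assms L ip_commute[of g f]
    by (simp only: ip_lincomb ip_commute[of f "\<lambda>p. 1 * f p + t * g p"] ip_commute[of g "\<lambda>p. 1 * f p + t * g p"])
       (simp add: algebra_simps power2_eq_square)
  finally show "0 \<le> ip f f + 2 * t * ip f g + t^2 * ip g g" .
qed (rule ip_nonneg)

lemma abs_ip_le: "L2 f \<Longrightarrow> L2 g \<Longrightarrow> \<bar>ip f g\<bar> \<le> sqrt (ip f f) * sqrt (ip g g)"
  using ip_cauchy_schwarz[of f g] by (simp add: real_le_rsqrt real_sqrt_mult[symmetric])

lemma tendsto_ip_of_dist2:
  assumes "\<And>n. L2 (f n)" "L2 g" "L2 h" "((\<lambda>n. dist2 (f n) g) \<longlongrightarrow> 0) F"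
  shows "((\<lambda>n. ip (f n) h) \<longlongrightarrow> ip g h) F"
proof (rule LIM_zero_cancel, rule Lim_null_comparison)
  show "\<forall>\<^sub>F n in F. norm (ip (f n) h - ip g h) \<le> sqrt (dist2 (f n) g) * sqrt (ip h h)"
    using assms abs_ip_le[OF L2_diff[OF assms(1,2)] assms(3)] by (intro always_eventually allI) (simp add: ip_diff dist2_ip)
  have "((\<lambda>n. sqrt (dist2 (f n) g) * sqrt (ip h h)) \<longlongrightarrow> sqrt 0 * sqrt (ip h h)) F"
    by (intro tendsto_intros assms)
  then show "((\<lambda>n. sqrt (dist2 (f n) g) * sqrt (ip h h)) \<longlongrightarrow> 0) F" by simp
qed

lemma ip_self_eq_0_imp_AE:
  assumes "L2 f" "ip f f = 0" shows "AE p in LO. f p = 0"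
proof -
  have "AE p in LO. f p * f p = 0"
    using assms(2) L2_mult_integrable[OF assms(1,1)] unfolding ip_def
    by (subst (asm) integral_nonneg_eq_0_iff_AE) auto
  then show ?thesis by eventually_elim simp
qed

section \<open>Approximation by test functions\<close>

text \<open>Carrying the derivative as a witness lets closure under sums, products and affine
  substitutions go by induction on k, without formulas for iterated derivatives.\<close>

primrec Ck :: "nat \<Rightarrow> (real \<Rightarrow> real) \<Rightarrow> bool" where
  "Ck 0 f = True"
| "Ck (Suc k) f = (\<exists>f'. (\<forall>x. (f has_real_derivative f' x) (at x)) \<and> Ck k f')"

definition smooth1 :: "(real \<Rightarrow> real) \<Rightarrow> bool" where
  "smooth1 f \<longleftrightarrow> (\<forall>k. Ck k f)"

lemma Ck_Suc_imp: "Ck (Suc k) f \<Longrightarrow> Ck k f"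
proof (induction k arbitrary: f)
  case (Suc k)
  then show ?case by (metis Ck.simps(2))
qed simp

lemma Ck_add: "Ck k f \<Longrightarrow> Ck k g \<Longrightarrow> Ck k (\<lambda>x. f x + g x)"
proof (induction k arbitrary: f g)
  case (Suc k)
  then obtain f' g' where "\<And>x. (f has_real_derivative f' x) (at x)" "Ck k f'"
    "\<And>x. (g has_real_derivative g' x) (at x)" "Ck k g'" by auto
  then show ?case using Suc.IH[of f' g'] by (auto intro!: exI[of _ "\<lambda>x. f' x + g' x"] derivative_eq_intros)
qed simp

lemma Ck_mult: "Ck k f \<Longrightarrow> Ck k g \<Longrightarrow> Ck k (\<lambda>x. f x * g x)"
proof (induction k arbitrary: f g)
  case (Suc k)
  then obtain f' g' where d: "\<And>x. (f has_real_derivative f' x) (at x)" "Ck k f'"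
    "\<And>x. (g has_real_derivative g' x) (at x)" "Ck k g'" by auto
  have "Ck k (\<lambda>x. f' x * g x + f x * g' x)"
    using Ck_Suc_imp[OF Suc.prems(1)] Ck_Suc_imp[OF Suc.prems(2)] d by (intro Ck_add Suc.IH)
  moreover have "((\<lambda>x. f x * g x) has_real_derivative f' x * g x + f x * g' x) (at x)" for x
    by (auto intro!: derivative_eq_intros d)
  ultimately show ?case unfolding Ck.simps by (intro exI[of _ "\<lambda>x. f' x * g x + f x * g' x"]) simp
qed simp

lemma Ck_const: "Ck k (\<lambda>x. c)"
proof (induction k arbitrary: c)
  case (Suc k)
  have "((\<lambda>x. c) has_real_derivative 0) (at x)" for x :: real by simp
  then show ?case using Suc[of 0] unfolding Ck.simps by (intro exI[of _ "\<lambda>x. 0"]) simp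
qed simp

lemma Ck_affine: "Ck k f \<Longrightarrow> Ck k (\<lambda>x. f (a * x + b))"
proof (induction k arbitrary: f)
  case (Suc k)
  then obtain f' where d: "\<And>x. (f has_real_derivative f' x) (at x)" "Ck k f'" by auto
  have "Ck k (\<lambda>x. f' (a * x + b) * a)" by (intro Ck_mult Ck_const Suc.IH d)
  moreover have "((\<lambda>x. f (a * x + b)) has_real_derivative f' (a * x + b) * a) (at x)" for x
    by (rule DERIV_chain2[OF d(1)]) (auto intro!: derivative_eq_intros)
  ultimately show ?case unfolding Ck.simps by (intro exI[of _ "\<lambda>x. f' (a * x + b) * a"]) simp
qed simp

lemma smooth1_add: "smooth1 f \<Longrightarrow> smooth1 g \<Longrightarrow> smooth1 (\<lambda>x. f x + g x)"
  by (simp add: smooth1_def Ck_add)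

lemma smooth1_mult: "smooth1 f \<Longrightarrow> smooth1 g \<Longrightarrow> smooth1 (\<lambda>x. f x * g x)"
  by (simp add: smooth1_def Ck_mult)

lemma smooth1_const: "smooth1 (\<lambda>x. c)"
  by (simp add: smooth1_def Ck_const)

lemma smooth1_affine: "smooth1 f \<Longrightarrow> smooth1 (\<lambda>x. f (a * x + b))"
  by (simp add: smooth1_def Ck_affine)

lemma smooth1_id: "smooth1 (\<lambda>x. x)"
  unfolding smooth1_def
proof
  fix k
  have "((\<lambda>x. x) has_real_derivative 1) (at x)" for x :: real by simp
  then show "Ck k (\<lambda>x. x)" using Ck_const[of _ 1] by (cases k) (auto intro!: exI[of _ "\<lambda>x. 1"])
qed

lemma smooth1_power: "smooth1 (\<lambda>x. x ^ n)"
  by (induction n) (auto intro: smooth1_const smooth1_mult smooth1_id)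

lemma smooth1_sum: "(\<And>i. i \<in> A \<Longrightarrow> smooth1 (f i)) \<Longrightarrow> smooth1 (\<lambda>x. \<Sum>i\<in>A. f i x)"
  by (induction A rule: infinite_finite_induct) (auto intro: smooth1_const smooth1_add)

lemma smooth1_of_derivs:
  assumes "\<And>j t. (D j has_real_derivative D (Suc j) t) (at t)"
  shows "smooth1 (D (j :: nat))"
proof -
  have "Ck k (D j)" for k
  proof (induction k arbitrary: j)
    case (Suc k)
    then show ?case using assms[of j] by auto
  qed simp
  then show ?thesis by (simp add: smooth1_def)
qed

lemma smooth1_deriv:
  assumes "smooth1 f"
  obtains f' where "\<And>x. (f has_real_derivative f' x) (at x)" "smooth1 f'"
proof -
  obtain f' where f': "\<And>x. (f has_real_derivative f' x) (at x)" using assms[unfolded smooth1_def, rule_format, of 1] by auto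
  have "Ck k f'" for k
  proof -
    obtain g where "\<And>x. (f has_real_derivative g x) (at x)" "Ck k g"
      using assms[unfolded smooth1_def, rule_format, of "Suc k"] by auto
    moreover have "g = f'" using calculation(1) f' DERIV_unique by blast
    ultimately show ?thesis by simp
  qed
  then show thesis using f' that by (auto simp: smooth1_def)
qed

lemma smooth1_continuous: "smooth1 f \<Longrightarrow> continuous_on S f"
  by (metis smooth1_deriv DERIV_continuous_on has_field_derivative_at_within)

section \<open>Approximation of Dirichlet functions in H^1\<close>

lemma integral_boundary_layer:
  fixes f :: "real \<Rightarrow> real"
  assumes f: "continuous_on {l..r} f" and e: "0 < e" "2 * e < r - l"
    and K: "\<And>x. x \<in> {l..r} \<Longrightarrow> (f x)^2 \<le> K" and z: "\<And>x. x \<in> {l + e..r - e} \<Longrightarrow> f x = 0"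
  shows "integral {l..r} (\<lambda>x. (f x)^2) \<le> 2 * e * K"
proof -
  let ?g = "\<lambda>x. (f x)^2"
  have i: "?g integrable_on {x..y}" if "{x..y} \<subseteq> {l..r}" for x y
    by (intro integrable_continuous_real continuous_intros continuous_on_subset[OF f that])
  have "integral {l..r} ?g = integral {l..l+e} ?g + integral {l+e..r} ?g"
    using e by (intro Henstock_Kurzweil_Integration.integral_combine[symmetric] i) auto
  also have "integral {l+e..r} ?g = integral {l+e..r-e} ?g + integral {r-e..r} ?g"
    using e by (intro Henstock_Kurzweil_Integration.integral_combine[symmetric] i) auto
  also have "integral {l+e..r-e} ?g = 0" using z by (intro integral_unique has_integral_is_0) auto
  also have "integral {l..l+e} ?g \<le> (l + e - l) * K"
    using e K by (intro integral_square_le continuous_on_subset[OF f]) auto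
  also have "integral {r-e..r} ?g \<le> (r - (r - e)) * K"
    using e K by (intro integral_square_le continuous_on_subset[OF f]) auto
  finally show ?thesis by (simp add: mult_ac)
qed

text \<open>Approximate v' by a polynomial g and integrate. As v' has integral 0, the increment of
  the primitive Q over [l,r] is only the integral of g - v', so subtracting a line of slope c with
  |c| \<le> e/2 restores both boundary values.\<close>

lemma smooth_dirichlet_C1_approx:
  assumes lr: "l < r" and v: "\<And>x. x \<in> {l..r} \<Longrightarrow> (v has_real_derivative v1 x) (at x within {l..r})"
    and v1: "continuous_on {l..r} v1" and v0: "v l = 0" "v r = 0" and e: "e > 0"
  obtains P P1 where "smooth1 P" "smooth1 P1" "\<And>x. (P has_real_derivative P1 x) (at x)" "P l = 0" "P r = 0"
    "\<And>x. x \<in> {l..r} \<Longrightarrow> \<bar>v1 x - P1 x\<bar> \<le> e"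
proof -
  have e2: "e / 2 > 0" using e by simp
  obtain g where g: "polynomial_function g" "\<And>x. x \<in> {l..r} \<Longrightarrow> norm (v1 x - g x) < e / 2"
    using Stone_Weierstrass_polynomial_function[OF compact_Icc v1 e2] by blast
  then have "real_polynomial_function g" by (simp add: real_polynomial_function_eq)
  then obtain a n where an: "g = (\<lambda>x. \<Sum>i\<le>n. a i * x ^ i)" using real_polynomial_function_iff_sum[of g] by blast
  define Q where "Q x = (\<Sum>i\<le>n. (a i / real (Suc i)) * x ^ Suc i)" for x
  have Qd: "(Q has_real_derivative g x) (at x)" for x
  proof -
    have "(Q has_real_derivative (\<Sum>i\<le>n. (a i / real (Suc i)) * (real (Suc i) * x ^ i))) (at x)"
      unfolding Q_def by (intro DERIV_sum DERIV_cmult) (use DERIV_pow[of "Suc _"] in simp)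
    then show ?thesis by (simp add: an del: of_nat_Suc)
  qed
  define c where "c = (Q r - Q l) / (r - l)"
  have "((\<lambda>x. g x - v1 x) has_integral (Q r - v r) - (Q l - v l)) {l..r}"
    using lr by (intro fundamental_theorem_of_calculus)
      (auto simp: has_real_derivative_iff_has_vector_derivative[symmetric] intro!: DERIV_diff has_field_derivative_at_within[OF Qd] v)
  then have "norm ((Q r - v r) - (Q l - v l)) \<le> e / 2 * measure lborel {l..r}"
    by (intro has_integral_bound_real[of "e / 2" "{}"]) (use g(2) e in \<open>auto simp: abs_minus_commute intro: less_imp_le\<close>)
  then have c: "\<bar>c\<bar> \<le> e / 2" using lr v0 by (simp add: c_def divide_le_eq)
  show thesis
  proof
    show "smooth1 (\<lambda>x. Q x + (- c) * x + (c * l - Q l))" unfolding Q_def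
      by (intro smooth1_add smooth1_sum smooth1_mult smooth1_const smooth1_power smooth1_id)
    show "smooth1 (\<lambda>x. g x + (- c))" unfolding an
      by (intro smooth1_add smooth1_sum smooth1_mult smooth1_const smooth1_power)
    show "((\<lambda>x. Q x + (- c) * x + (c * l - Q l)) has_real_derivative g x + (- c)) (at x)" for x
      by (auto intro!: derivative_eq_intros Qd)
    show "Q l + (- c) * l + (c * l - Q l) = 0" by simp
    have "c * (r - l) = Q r - Q l" using lr by (simp add: c_def)
    then show "Q r + (- c) * r + (c * l - Q l) = 0" by (simp add: algebra_simps)
    show "\<bar>v1 x - (g x + - c)\<bar> \<le> e" if "x \<in> {l..r}" for x using g(2)[OF that] c unfolding real_norm_def by linarith
  qed
qed

definition H1_close where
  "H1_close l r v v1 e \<phi> \<phi>1 \<delta> \<longleftrightarrow> smooth1 \<phi> \<and> (\<forall>x. (\<phi> has_real_derivative \<phi>1 x) (at x)) \<and> smooth1 \<phi>1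
     \<and> \<delta> > 0 \<and> (\<forall>x. x \<notin> {l + \<delta>..r - \<delta>} \<longrightarrow> \<phi> x = 0)
     \<and> integral {l..r} (\<lambda>x. (v x - \<phi> x)^2) < e \<and> integral {l..r} (\<lambda>x. (v1 x - \<phi>1 x)^2) < e"

text \<open>A smooth P vanishing at both ends is cut off in a layer of width of order \<delta>. The
  cutoff has slope of order 1/\<delta>, but P is of order \<delta> there by the boundary condition,
  so the derivative of the product stays bounded, and its error lives on a set of measure of order
  \<delta>. The error of the function itself follows by Poincare.\<close>

lemma H1_dirichlet_approx:
  assumes lr: "l < r" and v: "\<And>x. x \<in> {l..r} \<Longrightarrow> (v has_real_derivative v1 x) (at x within {l..r})"
    and v1: "continuous_on {l..r} v1" and v0: "v l = 0" "v r = 0" and e: "e > 0"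
  shows "\<exists>\<phi> \<phi>1 \<delta>. H1_close l r v v1 e \<phi> \<phi>1 \<delta>"
proof -
  define L where "L = r - l"
  have L: "L > 0" using lr by (simp add: L_def)
  \<comment> \<open>The Poincare inequality for v - \<phi> loses a factor L^2, hence the second
    member of the minimum.\<close>
  define e1 where "e1 = min e (e / L^2)"
  have e1: "e1 > 0" "e1 \<le> e" "L^2 * e1 \<le> e" using e L by (auto simp: e1_def min_def field_simps)
  define \<eta> where "\<eta> = sqrt (e1 / (8 * L))"
  have \<eta>: "\<eta> > 0" "L * \<eta>^2 = e1 / 8" using e1 L by (simp_all add: \<eta>_def)
  obtain P P1 where P: "smooth1 P" "smooth1 P1" "\<And>x. (P has_real_derivative P1 x) (at x)" "P l = 0" "P r = 0"
    "\<And>x. x \<in> {l..r} \<Longrightarrow> \<bar>v1 x - P1 x\<bar> \<le> \<eta>"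
    using smooth_dirichlet_C1_approx[OF lr v v1 v0 \<eta>(1)] by blast
  have cP1: "continuous_on S P1" for S by (rule smooth1_continuous[OF P(2)])
  have cP: "continuous_on S P" for S by (rule smooth1_continuous[OF P(1)])
  have "bounded (P1 ` {l..r})" using cP1 by (intro compact_imp_bounded compact_continuous_image) auto
  then obtain M where M: "\<And>x. x \<in> {l..r} \<Longrightarrow> \<bar>P1 x\<bar> \<le> M" unfolding bounded_iff by (metis imageI real_norm_def)
  have M0: "M \<ge> 0" using M[of l] lr by force
  have lip: "\<bar>P x - P y\<bar> \<le> M * \<bar>x - y\<bar>" if "x \<in> {l..r}" "y \<in> {l..r}" for x y
    using field_differentiable_bound[of "{l..r}" P P1 M x y] P(3) M that by (auto intro: has_field_derivative_at_within)
  obtain D C R where D: "\<And>j t. (D j has_real_derivative D (Suc j) t) (at t)"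
    "\<And>t. t \<le> 1 \<Longrightarrow> D 0 t = 1" "\<And>t. t \<ge> 2 \<Longrightarrow> D 0 t = (0::real)" "\<And>j t. t \<le> 1 \<or> 2 \<le> t \<Longrightarrow> D (Suc j) t = 0"
    "C > 0" "R > 0" "\<And>j t. \<bar>D j t\<bar> \<le> C * R ^ j * (fact j * sqrt (fact j))" "\<And>t. 0 \<le> D 0 t" "\<And>t. D 0 t \<le> 1"
    using gevrey_step_exists[of 1 2] by (metis one_less_numeral_iff semiring_norm(76))
  define s where "s t = 1 + (-1) * D 0 t" for t
  have s01: "0 \<le> s t" "s t \<le> 1" for t using D(8,9)[of t] by (auto simp: s_def)
  have sd: "(s has_real_derivative - D 1 t) (at t)" for t
    unfolding s_def using D(1)[of 0 t] by (auto intro!: derivative_eq_intros)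
  have ss: "smooth1 s" unfolding s_def by (intro smooth1_add smooth1_mult smooth1_const smooth1_of_derivs[of D, OF D(1)])
  have D1: "\<bar>D 1 t\<bar> \<le> C * R" for t using D(7)[of 1 t] by simp
  \<comment> \<open>Bounds |P1 - \<phi>1| in the layer: M from P1 (1 - \<xi>), and 2 M \<delta>
    times 2 C R / \<delta> from P \<xi>1.\<close>
  define K where "K = M * (1 + 4 * (C * R))"
  have K0: "K \<ge> 0" using M0 D by (simp add: K_def)
  define \<delta> where "\<delta> = min (L / 5) (e1 / (32 * (K^2 + 1)))"
  have K1: "K^2 + 1 > 0" by (simp add: add_nonneg_pos)
  have \<delta>: "\<delta> > 0" "4 * \<delta> < L" using L e1 K1 by (auto simp: \<delta>_def min_def)
  have "\<delta> * K^2 \<le> e1 / (32 * (K^2 + 1)) * (K^2 + 1)"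
    using e1 K1 by (intro mult_mono) (auto simp: \<delta>_def)
  also have "\<dots> = e1 / 32" using K1 by (simp add: field_simps)
  finally have \<delta>K: "\<delta> * K^2 \<le> e1 / 32" .
  define \<xi> where "\<xi> x = s ((1 / \<delta>) * x + (- l / \<delta>)) * s ((- 1 / \<delta>) * x + r / \<delta>)" for x
  define \<xi>1 where "\<xi>1 x = (- D 1 ((1 / \<delta>) * x + (- l / \<delta>)) * (1 / \<delta>)) * s ((- 1 / \<delta>) * x + r / \<delta>)
     + s ((1 / \<delta>) * x + (- l / \<delta>)) * (- D 1 ((- 1 / \<delta>) * x + r / \<delta>) * (- 1 / \<delta>))" for x
  have \<xi>s: "smooth1 \<xi>" unfolding \<xi>_def by (intro smooth1_mult smooth1_affine ss)
  have \<xi>d: "(\<xi> has_real_derivative \<xi>1 x) (at x)" for x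
  proof -
    have 1: "((\<lambda>x. s ((1 / \<delta>) * x + (- l / \<delta>))) has_real_derivative - D 1 ((1 / \<delta>) * x + (- l / \<delta>)) * (1 / \<delta>)) (at x)"
      by (rule DERIV_chain2[OF sd]) (use \<delta> in \<open>auto intro!: derivative_eq_intros\<close>)
    have 2: "((\<lambda>x. s ((- 1 / \<delta>) * x + r / \<delta>)) has_real_derivative - D 1 ((- 1 / \<delta>) * x + r / \<delta>) * (- 1 / \<delta>)) (at x)"
      by (rule DERIV_chain2[OF sd]) (use \<delta> in \<open>auto intro!: derivative_eq_intros\<close>)
    show ?thesis unfolding \<xi>_def \<xi>1_def
      by (rule DERIV_cong[OF DERIV_mult[OF 1 2]]) (simp only: mult.commute add.commute)
  qed
  have arg: "(1 / \<delta>) * x + (- l / \<delta>) = (x - l) / \<delta>" "(- 1 / \<delta>) * x + r / \<delta> = (r - x) / \<delta>" for x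
    by (simp_all add: diff_divide_distrib)
  have \<xi>01: "0 \<le> \<xi> x" "\<xi> x \<le> 1" for x
    unfolding \<xi>_def using s01 by (auto intro: mult_nonneg_nonneg mult_le_one)
  have \<xi>out: "\<xi> x = 0" if "x \<notin> {l + \<delta>..r - \<delta>}" for x
  proof -
    have "(x - l) / \<delta> \<le> 1 \<or> (r - x) / \<delta> \<le> 1" using that \<delta> by (auto simp: divide_le_eq)
    then show ?thesis unfolding \<xi>_def arg using D(2) by (auto simp: s_def)
  qed
  have \<xi>in: "\<xi> x = 1" "\<xi>1 x = 0" if "x \<in> {l + 2 * \<delta>..r - 2 * \<delta>}" for x
  proof -
    have "(x - l) / \<delta> \<ge> 2" "(r - x) / \<delta> \<ge> 2" using that \<delta> by (auto simp: le_divide_eq)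
    then show "\<xi> x = 1" "\<xi>1 x = 0" unfolding \<xi>_def \<xi>1_def arg using D(3) D(4)[of _ 0] by (auto simp: s_def)
  qed
  have \<xi>1b: "\<bar>\<xi>1 x\<bar> \<le> 2 * (C * R) / \<delta>" for x
  proof -
    have "\<bar>\<xi>1 x\<bar> \<le> (C * R * (1 / \<delta>)) * 1 + 1 * (C * R * (1 / \<delta>))"
      unfolding \<xi>1_def
    proof (rule order_trans[OF abs_triangle_ineq add_mono])
      show "\<bar>- D 1 (1 / \<delta> * x + - l / \<delta>) * (1 / \<delta>) * s (- 1 / \<delta> * x + r / \<delta>)\<bar> \<le> C * R * (1 / \<delta>) * 1"
        unfolding abs_mult using D1 s01 \<delta> D by (intro mult_mono) (auto intro: mult_nonneg_nonneg)
      show "\<bar>s (1 / \<delta> * x + - l / \<delta>) * (- D 1 (- 1 / \<delta> * x + r / \<delta>) * (- 1 / \<delta>))\<bar> \<le> 1 * (C * R * (1 / \<delta>))"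
        unfolding abs_mult using D1 s01 \<delta> D by (intro mult_mono) (auto intro: mult_nonneg_nonneg)
    qed
    then show ?thesis by simp
  qed
  define \<phi> where "\<phi> x = P x * \<xi> x" for x
  define \<phi>1 where "\<phi>1 x = P1 x * \<xi> x + P x * \<xi>1 x" for x
  have \<phi>s: "smooth1 \<phi>" unfolding \<phi>_def by (intro smooth1_mult P \<xi>s)
  have \<phi>d: "(\<phi> has_real_derivative \<phi>1 x) (at x)" for x
    unfolding \<phi>_def \<phi>1_def by (rule DERIV_cong[OF DERIV_mult[OF P(3) \<xi>d]]) simp
  obtain \<phi>1' where \<phi>1': "\<And>x. (\<phi> has_real_derivative \<phi>1' x) (at x)" "smooth1 \<phi>1'" using smooth1_deriv[OF \<phi>s] by blast
  have "\<phi>1' = \<phi>1" using \<phi>d \<phi>1'(1) DERIV_unique by blast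
  then have \<phi>1s: "smooth1 \<phi>1" using \<phi>1' by simp
  have c\<phi>1: "continuous_on S \<phi>1" for S by (rule smooth1_continuous[OF \<phi>1s])
  have layer: "integral {l..r} (\<lambda>x. (P1 x - \<phi>1 x)^2) \<le> 2 * (2 * \<delta>) * K^2"
  proof (rule integral_boundary_layer)
    show "continuous_on {l..r} (\<lambda>x. P1 x - \<phi>1 x)" by (intro continuous_intros cP1 c\<phi>1)
    show "0 < 2 * \<delta>" "2 * (2 * \<delta>) < r - l" using \<delta> by (auto simp: L_def)
    show z: "P1 x - \<phi>1 x = 0" if "x \<in> {l + 2 * \<delta>..r - 2 * \<delta>}" for x
      using \<xi>in[OF that] by (simp add: \<phi>1_def)
    show "(P1 x - \<phi>1 x)^2 \<le> K^2" if x: "x \<in> {l..r}" for x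
    proof (cases "x \<in> {l + 2 * \<delta>..r - 2 * \<delta>}")
      case True
      then show ?thesis using z by simp
    next
      case False
      have "\<bar>P x\<bar> \<le> M * (2 * \<delta>)"
      proof (cases "x < l + 2 * \<delta>")
        case True
        have "\<bar>P x\<bar> \<le> M * (x - l)" using lip[OF x, of l] x P(4) by simp
        also have "\<dots> \<le> M * (2 * \<delta>)" using True M0 by (intro mult_left_mono) auto
        finally show ?thesis .
      next
        case False': False
        have "\<bar>P x\<bar> \<le> M * (r - x)" using lip[OF x, of r] x P(5) by simp
        also have "\<dots> \<le> M * (2 * \<delta>)" using False False' M0 by (intro mult_left_mono) auto
        finally show ?thesis .
      qed
      then have "\<bar>P x\<bar> * \<bar>\<xi>1 x\<bar> \<le> (M * (2 * \<delta>)) * (2 * (C * R) / \<delta>)"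
        using \<xi>1b[of x] M0 \<delta> by (intro mult_mono) auto
      also have "\<dots> = M * (4 * (C * R))" using \<delta> by simp
      finally have 1: "\<bar>P x\<bar> * \<bar>\<xi>1 x\<bar> \<le> M * (4 * (C * R))" .
      have 2: "\<bar>P1 x\<bar> * \<bar>1 - \<xi> x\<bar> \<le> M * 1" using \<xi>01[of x] M[OF x] M0 by (intro mult_mono) auto
      have "P1 x - \<phi>1 x = P1 x * (1 - \<xi> x) - P x * \<xi>1 x" by (simp add: \<phi>1_def algebra_simps)
      then have "\<bar>P1 x - \<phi>1 x\<bar> \<le> \<bar>P1 x\<bar> * \<bar>1 - \<xi> x\<bar> + \<bar>P x\<bar> * \<bar>\<xi>1 x\<bar>"
        by (metis abs_mult abs_triangle_ineq4)
      then have "\<bar>P1 x - \<phi>1 x\<bar> \<le> K" using 1 2 by (simp add: K_def algebra_simps)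
      then show ?thesis using K0 by (intro abs_le_square_iff[THEN iffD1]) auto
    qed
  qed
  have near: "integral {l..r} (\<lambda>x. (v1 x - P1 x)^2) \<le> (r - l) * \<eta>^2"
    using lr P(6) \<eta> by (intro integral_square_le continuous_intros v1 cP1 abs_le_square_iff[THEN iffD1]) auto
  have "integral {l..r} (\<lambda>x. (v1 x - \<phi>1 x)^2) \<le> integral {l..r} (\<lambda>x. 2 * (v1 x - P1 x)^2 + 2 * (P1 x - \<phi>1 x)^2)"
    using square_add_le[of "v1 x - P1 x" "P1 x - \<phi>1 x" for x] by (intro integral_le integrable_continuous_real continuous_intros v1 cP1 c\<phi>1) simp
  also have "\<dots> = 2 * integral {l..r} (\<lambda>x. (v1 x - P1 x)^2) + 2 * integral {l..r} (\<lambda>x. (P1 x - \<phi>1 x)^2)"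
    by (subst Henstock_Kurzweil_Integration.integral_add) (auto intro!: integrable_continuous_real continuous_intros v1 cP1 c\<phi>1)
  also have "\<dots> < e1" using near layer \<delta>K \<eta>(2) e1 by (simp add: L_def)
  finally have fin1: "integral {l..r} (\<lambda>x. (v1 x - \<phi>1 x)^2) < e1" .
  have cv: "continuous_on {l..r} v" using DERIV_continuous_on[OF v] .
  have "integral {l..r} (\<lambda>x. (v x - \<phi> x)^2) \<le> (r - l) * ((r - l) * integral {l..r} (\<lambda>x. (v1 x - \<phi>1 x)^2))"
  proof (intro integral_square_le continuous_intros cv smooth1_continuous \<phi>s)
    fix x assume x: "x \<in> {l..r}"
    have "((v x - \<phi> x) - (v l - \<phi> l))^2 \<le> (x - l) * integral {l..r} (\<lambda>x. (v1 x - \<phi>1 x)^2)"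
      using x by (intro difference_square_le[of l l x r "\<lambda>x. v x - \<phi> x"] continuous_intros v1 c\<phi>1 DERIV_diff v has_field_derivative_at_within[OF \<phi>d]) auto
    also have "\<dots> \<le> (r - l) * integral {l..r} (\<lambda>x. (v1 x - \<phi>1 x)^2)"
      using x by (intro mult_right_mono Henstock_Kurzweil_Integration.integral_nonneg integrable_continuous_real continuous_intros v1 c\<phi>1) auto
    finally show "(v x - \<phi> x)^2 \<le> (r - l) * integral {l..r} (\<lambda>x. (v1 x - \<phi>1 x)^2)" using v0 P(4) by (simp add: \<phi>_def)
  qed (use lr in auto)
  also have "\<dots> = L^2 * integral {l..r} (\<lambda>x. (v1 x - \<phi>1 x)^2)" by (simp add: L_def power2_eq_square)
  also have "\<dots> < L^2 * e1" using fin1 L by (intro mult_strict_left_mono) auto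
  finally have fin0: "integral {l..r} (\<lambda>x. (v x - \<phi> x)^2) < e" using e1 by simp
  have "H1_close l r v v1 e \<phi> \<phi>1 \<delta>"
    unfolding H1_close_def using \<phi>s \<phi>d \<phi>1s \<delta>(1) \<xi>out fin0 fin1 e1 by (auto simp: \<phi>_def)
  then show ?thesis by blast
qed

section \<open>Smooth functions of two variables\<close>

lemma pd_append: "pd (w @ [b]) f = pd w (pd [b] f)"
  by (induction w) auto

lemma smooth2_dx: assumes "smooth2 f" shows "smooth2 (dx f)"
proof -
  have eq: "pd w (dx f) = pd (w @ [True]) f" for w by (simp add: pd_append)
  show ?thesis using assms unfolding smooth2_def eq by blast
qed

lemma smooth2_dy: assumes "smooth2 f" shows "smooth2 (dy f)"
proof -
  have eq: "pd w (dy f) = pd (w @ [False]) f" for w by (simp add: pd_append)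
  show ?thesis using assms unfolding smooth2_def eq by blast
qed

lemma smooth2_continuous: assumes "smooth2 f" shows "continuous_on S f"
  using assms[unfolded smooth2_def, rule_format, of "[]"] continuous_on_subset by auto

lemma smooth2_dx_deriv:
  assumes "smooth2 f" shows "((\<lambda>s. f (s, y)) has_real_derivative dx f (x, y)) (at x)"
proof -
  have "(\<lambda>s. f (s, y)) differentiable (at x)" using assms[unfolded smooth2_def, rule_format, of "[]"] by (metis fst_conv snd_conv pd.simps(1))
  then show ?thesis unfolding dx_def fst_conv snd_conv using DERIV_deriv_iff_real_differentiable by blast
qed

lemma smooth2_dy_deriv:
  assumes "smooth2 f" shows "((\<lambda>s. f (x, s)) has_real_derivative dy f (x, y)) (at y)"
proof -
  have "(\<lambda>s. f (x, s)) differentiable (at y)" using assms[unfolded smooth2_def, rule_format, of "[]"] by (metis fst_conv snd_conv pd.simps(1))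
  then show ?thesis unfolding dy_def fst_conv snd_conv using DERIV_deriv_iff_real_differentiable by blast
qed

lemma smooth2_diff:
  assumes "smooth2 f" "smooth2 g" shows "smooth2 (\<lambda>p. f p - g p)"
proof -
  have "pd w (\<lambda>p. f p - g p) = (\<lambda>p. pd w f p - pd w g p)" for w
  proof (induction w)
    case (Cons b w)
    have "(\<lambda>s. pd w h (s, snd p)) differentiable (at (fst p))" "(\<lambda>s. pd w h (fst p, s)) differentiable (at (snd p))"
      if "smooth2 h" for h p using that unfolding smooth2_def by blast+
    from this[OF assms(1)] this[OF assms(2)] show ?case using Cons
      by (auto simp: dx_def dy_def fun_eq_iff intro!: deriv_diff simp: field_differentiable_def real_differentiable_def)
  qed simp
  then show ?thesis using assms unfolding smooth2_def
    by (auto intro!: continuous_intros differentiable_diff)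
qed

lemma dx_tensor:
  assumes "\<And>x. (F has_real_derivative F' x) (at x)"
  shows "dx (\<lambda>p. F (fst p) * G (snd p)) = (\<lambda>p. F' (fst p) * G (snd p))"
  unfolding dx_def by (rule ext, rule DERIV_imp_deriv) (auto intro!: derivative_eq_intros assms)

lemma dy_tensor:
  assumes "\<And>x. (G has_real_derivative G' x) (at x)"
  shows "dy (\<lambda>p. F (fst p) * G (snd p)) = (\<lambda>p. F (fst p) * G' (snd p))"
  unfolding dy_def by (rule ext, rule DERIV_imp_deriv) (auto intro!: derivative_eq_intros assms)

text \<open>Products of a smooth function of x and one of y are closed under both partial
  derivatives, so every iterated derivative is again such a product.\<close>

lemma smooth2_tensor:
  assumes "smooth1 f" "smooth1 g" shows "smooth2 (\<lambda>p. f (fst p) * g (snd p))"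
proof -
  have rep: "\<exists>F G. smooth1 F \<and> smooth1 G \<and> pd w (\<lambda>p. f (fst p) * g (snd p)) = (\<lambda>p. F (fst p) * G (snd p))" for w
  proof (induction w)
    case Nil
    then show ?case using assms by auto
  next
    case (Cons b w)
    then obtain F G where FG: "smooth1 F" "smooth1 G" "pd w (\<lambda>p. f (fst p) * g (snd p)) = (\<lambda>p. F (fst p) * G (snd p))" by blast
    obtain F' where F': "\<And>x. (F has_real_derivative F' x) (at x)" "smooth1 F'" using smooth1_deriv[OF FG(1)] by blast
    obtain G' where G': "\<And>x. (G has_real_derivative G' x) (at x)" "smooth1 G'" using smooth1_deriv[OF FG(2)] by blast
    show ?case
    proof (cases b)
      case True
      then show ?thesis using dx_tensor[OF F'(1), of G] FG F' by auto
    next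
      case False
      then show ?thesis using dy_tensor[OF G'(1), of F] FG G' by auto
    qed
  qed
  show ?thesis
    unfolding smooth2_def
  proof (intro allI conjI)
    fix w p
    obtain F G where FG: "smooth1 F" "smooth1 G" "pd w (\<lambda>p. f (fst p) * g (snd p)) = (\<lambda>p. F (fst p) * G (snd p))" using rep by blast
    obtain F' where F': "\<And>x. (F has_real_derivative F' x) (at x)" using smooth1_deriv[OF FG(1)] by blast
    obtain G' where G': "\<And>x. (G has_real_derivative G' x) (at x)" using smooth1_deriv[OF FG(2)] by blast
    show "continuous_on UNIV (pd w (\<lambda>p. f (fst p) * g (snd p)))" unfolding FG(3)
      by (intro continuous_on_mult continuous_on_compose2[OF smooth1_continuous[OF FG(1)]] continuous_on_compose2[OF smooth1_continuous[OF FG(2)]] continuous_intros) auto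
    show "(\<lambda>s. pd w (\<lambda>p. f (fst p) * g (snd p)) (s, snd p)) differentiable at (fst p)"
      unfolding FG(3) fst_conv snd_conv real_differentiable_def by (rule exI, rule DERIV_cmult_right[OF F'])
    show "(\<lambda>s. pd w (\<lambda>p. f (fst p) * g (snd p)) (fst p, s)) differentiable at (snd p)"
      unfolding FG(3) fst_conv snd_conv real_differentiable_def by (rule exI, rule DERIV_cmult[OF G'])
  qed
qed

lemma Cc_inf_tensor:
  assumes "smooth1 f" "smooth1 g" "\<delta> > 0" "\<And>x. x \<notin> {-1 + \<delta>..1 - \<delta>} \<Longrightarrow> f x = 0"
    "\<delta>' > 0" "\<And>x. x \<notin> {0 + \<delta>'..1 - \<delta>'} \<Longrightarrow> g x = 0"
  shows "(\<lambda>p. f (fst p) * g (snd p)) \<in> Cc_inf"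
proof -
  let ?S = "{p. f (fst p) * g (snd p) \<noteq> 0}"
  have "?S \<subseteq> cbox (-1 + \<delta>, \<delta>') (1 - \<delta>, 1 - \<delta>')" 
  proof
    fix p assume "p \<in> ?S"
    then have "f (fst p) \<noteq> 0" "g (snd p) \<noteq> 0" by auto
    then have "fst p \<in> {-1 + \<delta>..1 - \<delta>}" "snd p \<in> {0 + \<delta>'..1 - \<delta>'}" using assms(4,6) by blast+
    then show "p \<in> cbox (-1 + \<delta>, \<delta>') (1 - \<delta>, 1 - \<delta>')" by (cases p) (auto simp: cbox_Pair_eq)
  qed
  then have cl: "closure ?S \<subseteq> cbox (-1 + \<delta>, \<delta>') (1 - \<delta>, 1 - \<delta>')" by (rule closure_minimal) (rule closed_cbox)
  then have "closure ?S \<subseteq> Omega" using assms(3,5) by (auto simp: Omega_def cbox_Pair_eq)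
  moreover have "compact (closure ?S)"
    unfolding compact_eq_bounded_closed using bounded_subset[OF bounded_cbox cl] by simp
  ultimately show ?thesis using smooth2_tensor[OF assms(1,2)] by (simp add: Cc_inf_def)
qed

lemma Cc_infD:
  assumes "f \<in> Cc_inf" shows "smooth2 f" "p \<notin> Omega \<Longrightarrow> f p = 0"
  using assms closure_subset[of "{p. f p \<noteq> 0}"] by (auto simp: Cc_inf_def)

lemma Cc_inf_L2: "f \<in> Cc_inf \<Longrightarrow> L2 f"
  by (intro continuous_L2 smooth2_continuous Cc_infD)

section \<open>The energy form on test functions\<close>

lemma weight_continuous: "\<gamma> > 0 \<Longrightarrow> continuous_on S (weight \<gamma>)"
  unfolding weight_def by (intro continuous_on_powr' continuous_intros) auto

lemma weight_nonneg: "weight \<gamma> p \<ge> 0"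
  by (simp add: weight_def)

lemma weight_le_1: assumes "\<gamma> > 0" "p \<in> box2" shows "weight \<gamma> p \<le> 1"
  unfolding weight_def using assms by (intro powr_le1) (auto simp: box2_iff)

definition Aop :: "real \<Rightarrow> (real \<times> real \<Rightarrow> real) \<Rightarrow> real \<times> real \<Rightarrow> real" where
  "Aop \<gamma> f p = dx (dx f) p + weight \<gamma> p * dy (dy f) p"

lemma Aop_continuous: "\<gamma> > 0 \<Longrightarrow> smooth2 f \<Longrightarrow> continuous_on S (Aop \<gamma> f)"
  unfolding Aop_def by (intro continuous_intros weight_continuous smooth2_continuous smooth2_dx smooth2_dy)

lemma Bform_integrable:
  assumes "\<gamma> > 0" "smooth2 f" "smooth2 g"
  shows "integrable LO (\<lambda>p. dx f p * dx g p + weight \<gamma> p * dy f p * dy g p)"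
  by (intro continuous_integrable_Omega continuous_intros weight_continuous smooth2_continuous smooth2_dx smooth2_dy assms)

lemma Bform_commute: "Bform \<gamma> f g = Bform \<gamma> g f"
  unfolding Bform_def by (simp add: mult_ac)

lemma Bform_diff_right:
  assumes "\<gamma> > 0" "smooth2 f" "smooth2 g" "smooth2 h"
  shows "Bform \<gamma> f (\<lambda>p. g p - h p) = Bform \<gamma> f g - Bform \<gamma> f h"
proof -
  have "dx (\<lambda>p. g p - h p) p = dx g p - dx h p" "dy (\<lambda>p. g p - h p) p = dy g p - dy h p" for p
    unfolding dx_def dy_def
    using smooth2_dx_deriv[OF assms(3), of "snd p" "fst p"] smooth2_dx_deriv[OF assms(4), of "snd p" "fst p"]
      smooth2_dy_deriv[OF assms(3), of "fst p" "snd p"] smooth2_dy_deriv[OF assms(4), of "fst p" "snd p"]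
    by (auto intro!: DERIV_imp_deriv derivative_eq_intros simp: dx_def dy_def)
  then have "Bform \<gamma> f (\<lambda>p. g p - h p) = integral\<^sup>L LO (\<lambda>p. (dx f p * dx g p + weight \<gamma> p * dy f p * dy g p) - (dx f p * dx h p + weight \<gamma> p * dy f p * dy h p))"
    unfolding Bform_def by (simp only:) (simp add: algebra_simps)
  then show ?thesis unfolding Bform_def
    using Bform_integrable[OF assms(1,2,3)] Bform_integrable[OF assms(1,2,4)] by simp
qed

lemma Bform_nonneg: "Bform \<gamma> f f \<ge> 0"
  unfolding Bform_def by (intro Bochner_Integration.integral_nonneg) (auto simp: weight_nonneg mult.assoc)

lemma Bform_cauchy_schwarz:
  assumes "\<gamma> > 0" "smooth2 f" "smooth2 g"
  shows "(Bform \<gamma> f g)^2 \<le> Bform \<gamma> f f * Bform \<gamma> g g"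
proof (rule nonneg_quadratic_discriminant)
  fix t
  let ?F = "\<lambda>p. dx f p * dx f p + weight \<gamma> p * dy f p * dy f p"
  let ?M = "\<lambda>p. dx f p * dx g p + weight \<gamma> p * dy f p * dy g p"
  let ?G = "\<lambda>p. dx g p * dx g p + weight \<gamma> p * dy g p * dy g p"
  have "Bform \<gamma> f f + 2 * t * Bform \<gamma> f g + t^2 * Bform \<gamma> g g = integral\<^sup>L LO (\<lambda>p. ?F p + 2 * t * ?M p + t^2 * ?G p)"
    unfolding Bform_def using assms Bform_integrable by simp
  also have "(\<lambda>p. ?F p + 2 * t * ?M p + t^2 * ?G p) = (\<lambda>p. (dx f p + t * dx g p)^2 + weight \<gamma> p * (dy f p + t * dy g p)^2)"
    by (rule ext) (simp add: power2_eq_square algebra_simps)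
  also have "integral\<^sup>L LO \<dots> \<ge> 0" by (intro Bochner_Integration.integral_nonneg) (auto simp: weight_nonneg)
  finally show "0 \<le> Bform \<gamma> f f + 2 * t * Bform \<gamma> f g + t^2 * Bform \<gamma> g g" .
qed (rule Bform_nonneg)

lemma boundary_not_Omega: "(1, y) \<notin> Omega" "(-1, y) \<notin> Omega" "(x, 1) \<notin> Omega" "(x, 0) \<notin> Omega"
  by (auto simp: Omega_def)

lemma cont_Pair_right: "continuous_on UNIV f \<Longrightarrow> continuous_on S (\<lambda>y. f (x, y))"
  by (rule continuous_on_compose2[of UNIV f]) (auto intro!: continuous_intros)

lemma cont_Pair_left: "continuous_on UNIV f \<Longrightarrow> continuous_on S (\<lambda>x. f (x, y))"
  by (rule continuous_on_compose2[of UNIV f]) (auto intro!: continuous_intros)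

lemma integral_dx_by_parts:
  assumes "continuous_on UNIV c" "smooth2 f" "smooth2 g" "\<And>p. p \<notin> Omega \<Longrightarrow> f p = 0 \<or> g p = 0"
  shows "integral\<^sup>L LO (\<lambda>p. c (snd p) * (dx f p * g p)) = - integral\<^sup>L LO (\<lambda>p. c (snd p) * (f p * dx g p))"
proof -
  note c' = continuous_on_compose2[OF assms(1) continuous_on_snd[OF continuous_on_id]]
  have "integral {-1..1} (\<lambda>x. dx f (x, y) * g (x, y)) = - integral {-1..1} (\<lambda>x. f (x, y) * dx g (x, y))" for y
    using assms(4)[of "(1, y)"] assms(4)[of "(-1, y)"] boundary_not_Omega
    by (subst real_integral_by_parts[of "-1" 1 "\<lambda>x. f (x, y)" "\<lambda>x. dx f (x, y)" "\<lambda>x. g (x, y)" "\<lambda>x. dx g (x, y)"])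
       (auto intro!: has_field_derivative_at_within smooth2_dx_deriv assms cont_Pair_left smooth2_continuous smooth2_dx)
  then show ?thesis
    using c' by (subst (1 2) integral_Omega_eq(2)) (auto intro!: continuous_on_mult smooth2_continuous[OF assms(2)] smooth2_continuous[OF assms(3)]
      smooth2_continuous[OF smooth2_dx[OF assms(2)]] smooth2_continuous[OF smooth2_dx[OF assms(3)]])
qed

lemma integral_dy_by_parts:
  assumes "continuous_on UNIV c" "smooth2 f" "smooth2 g" "\<And>p. p \<notin> Omega \<Longrightarrow> f p = 0 \<or> g p = 0"
  shows "integral\<^sup>L LO (\<lambda>p. c (fst p) * (dy f p * g p)) = - integral\<^sup>L LO (\<lambda>p. c (fst p) * (f p * dy g p))"
proof -
  note c' = continuous_on_compose2[OF assms(1) continuous_on_fst[OF continuous_on_id]]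
  have "integral {0..1} (\<lambda>y. dy f (x, y) * g (x, y)) = - integral {0..1} (\<lambda>y. f (x, y) * dy g (x, y))" for x
    using assms(4)[of "(x, 1)"] assms(4)[of "(x, 0)"] boundary_not_Omega
    by (subst real_integral_by_parts[of 0 1 "\<lambda>y. f (x, y)" "\<lambda>y. dy f (x, y)" "\<lambda>y. g (x, y)" "\<lambda>y. dy g (x, y)"])
       (auto intro!: has_field_derivative_at_within smooth2_dy_deriv assms cont_Pair_right smooth2_continuous smooth2_dy)
  then show ?thesis
    using c' by (subst (1 2) integral_Omega_eq(1)) (auto intro!: continuous_on_mult smooth2_continuous[OF assms(2)] smooth2_continuous[OF assms(3)]
      smooth2_continuous[OF smooth2_dy[OF assms(2)]] smooth2_continuous[OF smooth2_dy[OF assms(3)]])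
qed

lemma weight_1d_continuous: "\<gamma> > 0 \<Longrightarrow> continuous_on S (\<lambda>x. \<bar>x\<bar> powr (2 * \<gamma>))" for \<gamma> :: real
  by (intro continuous_on_powr' continuous_intros) auto

lemma Bform_by_parts:
  assumes \<gamma>: "\<gamma> > 0" and f: "f \<in> Cc_inf" and g: "g \<in> Cc_inf"
  shows "Bform \<gamma> f g = - ip f (Aop \<gamma> g)"
proof -
  note F = Cc_infD[OF f] and G = Cc_infD[OF g]
  have "Bform \<gamma> f g = integral\<^sup>L LO (\<lambda>p. dx f p * dx g p) + integral\<^sup>L LO (\<lambda>p. weight \<gamma> p * (dy f p * dy g p))"
    unfolding Bform_def mult.assoc
    by (intro Bochner_Integration.integral_add continuous_integrable_Omega continuous_intros weight_continuous \<gamma> smooth2_continuous smooth2_dx smooth2_dy F G)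
  also have "integral\<^sup>L LO (\<lambda>p. dx f p * dx g p) = - integral\<^sup>L LO (\<lambda>p. f p * dx (dx g) p)"
    using integral_dx_by_parts[of "\<lambda>_. 1" f "dx g"] F smooth2_dx[OF G(1)] by simp
  also have "integral\<^sup>L LO (\<lambda>p. weight \<gamma> p * (dy f p * dy g p)) = - integral\<^sup>L LO (\<lambda>p. weight \<gamma> p * (f p * dy (dy g) p))"
    unfolding weight_def
    by (rule integral_dy_by_parts[of "\<lambda>x. \<bar>x\<bar> powr (2 * \<gamma>)" f "dy g"]) (use F smooth2_dy[OF G(1)] weight_1d_continuous[OF \<gamma>] in auto)
  also have "- integral\<^sup>L LO (\<lambda>p. f p * dx (dx g) p) + - integral\<^sup>L LO (\<lambda>p. weight \<gamma> p * (f p * dy (dy g) p)) = - ip f (Aop \<gamma> g)"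
  proof -
    have "ip f (Aop \<gamma> g) = integral\<^sup>L LO (\<lambda>p. f p * dx (dx g) p + weight \<gamma> p * (f p * dy (dy g) p))"
      unfolding ip_def Aop_def by (simp add: algebra_simps)
    also have "\<dots> = integral\<^sup>L LO (\<lambda>p. f p * dx (dx g) p) + integral\<^sup>L LO (\<lambda>p. weight \<gamma> p * (f p * dy (dy g) p))"
      by (intro Bochner_Integration.integral_add continuous_integrable_Omega continuous_intros weight_continuous \<gamma> smooth2_continuous smooth2_dx smooth2_dy F G)
    finally show ?thesis by simp
  qed
  finally show ?thesis .
qed

section \<open>Products of one-variable functions in the domain of the operator\<close>

definition tensor :: "(real \<Rightarrow> real) \<Rightarrow> (real \<Rightarrow> real) \<Rightarrow> real \<times> real \<Rightarrow> real" where
  "tensor f g p = f (fst p) * g (snd p)"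

lemma double_by_parts:
  fixes w \<psi> :: "real \<Rightarrow> real"
  assumes lr: "l \<le> r" and w: "C2_on l r w w1 w2" "w l = 0" "w r = 0" and p: "C2_on l r \<psi> \<psi>1 \<psi>2" "\<psi> l = 0" "\<psi> r = 0"
  shows "integral {l..r} (\<lambda>x. w x * \<psi>2 x) = integral {l..r} (\<lambda>x. w2 x * \<psi> x)"
proof -
  note W = C2_onD[OF w(1)] and P = C2_onD[OF p(1)]
  have "integral {l..r} (\<lambda>x. \<psi>2 x * w x) = - integral {l..r} (\<lambda>x. \<psi>1 x * w1 x)"
    using real_integral_by_parts[OF lr P(2) W(1) P(5) W(4)] w by simp
  moreover have "integral {l..r} (\<lambda>x. w2 x * \<psi> x) = - integral {l..r} (\<lambda>x. w1 x * \<psi>1 x)"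
    using real_integral_by_parts[OF lr W(2) P(1) W(5) P(4)] p by simp
  ultimately show ?thesis by (simp add: mult.commute)
qed

text \<open>Both pairs of derivatives are moved from the test function to the factors w and s. The
  weight depends on x only and is constant in the integration over y.\<close>

lemma tensor_Aop_by_parts:
  assumes \<gamma>: "\<gamma> > 0" and w: "C2_on (-1) 1 w w1 w2" "w (-1) = 0" "w 1 = 0"
    and s: "C2_on 0 1 s s1 s2" "s 0 = 0" "s 1 = 0" and g: "g \<in> Cc_inf"
  shows "ip (tensor w s) (Aop \<gamma> g) = ip (\<lambda>p. w2 (fst p) * s (snd p) + weight \<gamma> p * w (fst p) * s2 (snd p)) g"
proof -
  note W = C2_onD[OF w(1)] and S = C2_onD[OF s(1)] and G = Cc_infD[OF g]
  let ?a = "\<lambda>x. \<bar>x\<bar> powr (2 * \<gamma>)"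
  note ca = weight_1d_continuous[OF \<gamma>]
  have cT: "continuous_on box2 (\<lambda>p. f (fst p) * h (snd p) * G p)" if "continuous_on {-1..1} f" "continuous_on {0..1} h" "continuous_on UNIV G" for f h and G :: "real \<times> real \<Rightarrow> real"
    by (intro continuous_on_mult[OF continuous_on_tensor[OF that(1,2)] continuous_on_subset[OF that(3)]]) auto
  note cg = smooth2_continuous[OF G(1)] smooth2_continuous[OF smooth2_dx[OF smooth2_dx[OF G(1)]]] smooth2_continuous[OF smooth2_dy[OF smooth2_dy[OF G(1)]]]
  have caw: "continuous_on {-1..1} (\<lambda>x. ?a x * w x)" by (intro continuous_intros ca W)
  have gx: "C2_on (-1) 1 (\<lambda>x. g (x, y)) (\<lambda>x. dx g (x, y)) (\<lambda>x. dx (dx g) (x, y))" for y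
    unfolding C2_on_def by (auto intro!: has_field_derivative_at_within smooth2_dx_deriv smooth2_dx G cont_Pair_left smooth2_continuous)
  have gy: "C2_on 0 1 (\<lambda>y. g (x, y)) (\<lambda>y. dy g (x, y)) (\<lambda>y. dy (dy g) (x, y))" for x
    unfolding C2_on_def by (auto intro!: has_field_derivative_at_within smooth2_dy_deriv smooth2_dy G cont_Pair_right smooth2_continuous)
  have x_part: "integral\<^sup>L LO (\<lambda>p. w (fst p) * s (snd p) * dx (dx g) p) = integral\<^sup>L LO (\<lambda>p. w2 (fst p) * s (snd p) * g p)"
  proof -
    have "integral {-1..1} (\<lambda>x. w x * s y * dx (dx g) (x, y)) = integral {-1..1} (\<lambda>x. w2 x * s y * g (x, y))" for y
    proof -
      have "integral {-1..1} (\<lambda>x. w x * s y * dx (dx g) (x, y)) = s y * integral {-1..1} (\<lambda>x. w x * dx (dx g) (x, y))"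
        by (subst Henstock_Kurzweil_Integration.integral_mult_right[symmetric]) (simp add: mult_ac)
      also have "integral {-1..1} (\<lambda>x. w x * dx (dx g) (x, y)) = integral {-1..1} (\<lambda>x. w2 x * g (x, y))"
        by (rule double_by_parts[OF _ w gx]) (auto intro!: G(2) boundary_not_Omega)
      also have "s y * \<dots> = integral {-1..1} (\<lambda>x. w2 x * s y * g (x, y))"
        by (subst Henstock_Kurzweil_Integration.integral_mult_right[symmetric]) (simp add: mult_ac)
      finally show ?thesis .
    qed
    then show ?thesis by (simp add: integral_Omega_eq(2)[OF cT[OF W(3) S(3) cg(2)]] integral_Omega_eq(2)[OF cT[OF W(5) S(3) cg(1)]])
  qed
  have y_part: "integral\<^sup>L LO (\<lambda>p. (?a (fst p) * w (fst p)) * s (snd p) * dy (dy g) p) = integral\<^sup>L LO (\<lambda>p. (?a (fst p) * w (fst p)) * s2 (snd p) * g p)"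
  proof -
    have "integral {0..1} (\<lambda>y. (?a x * w x) * s y * dy (dy g) (x, y)) = integral {0..1} (\<lambda>y. (?a x * w x) * s2 y * g (x, y))" for x
    proof -
      have "integral {0..1} (\<lambda>y. (?a x * w x) * s y * dy (dy g) (x, y)) = (?a x * w x) * integral {0..1} (\<lambda>y. s y * dy (dy g) (x, y))"
        by (subst Henstock_Kurzweil_Integration.integral_mult_right[symmetric]) (simp add: mult_ac)
      also have "integral {0..1} (\<lambda>y. s y * dy (dy g) (x, y)) = integral {0..1} (\<lambda>y. s2 y * g (x, y))"
        by (rule double_by_parts[OF _ s gy]) (auto intro!: G(2) boundary_not_Omega)
      also have "(?a x * w x) * \<dots> = integral {0..1} (\<lambda>y. (?a x * w x) * s2 y * g (x, y))"
        by (subst Henstock_Kurzweil_Integration.integral_mult_right[symmetric]) (simp add: mult_ac)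
      finally show ?thesis .
    qed
    then show ?thesis by (simp add: integral_Omega_eq(1)[OF cT[OF caw S(3) cg(3)]] integral_Omega_eq(1)[OF cT[OF caw S(5) cg(1)]])
  qed
  have "ip (tensor w s) (Aop \<gamma> g) = integral\<^sup>L LO (\<lambda>p. w (fst p) * s (snd p) * dx (dx g) p + (?a (fst p) * w (fst p)) * s (snd p) * dy (dy g) p)"
    unfolding ip_def Aop_def tensor_def weight_def by (simp add: algebra_simps)
  also have "\<dots> = integral\<^sup>L LO (\<lambda>p. w2 (fst p) * s (snd p) * g p) + integral\<^sup>L LO (\<lambda>p. (?a (fst p) * w (fst p)) * s2 (snd p) * g p)"
    by (subst Bochner_Integration.integral_add)
       (auto intro!: continuous_integrable_Omega cT W S cg caw simp: x_part y_part)
  also have "\<dots> = integral\<^sup>L LO (\<lambda>p. w2 (fst p) * s (snd p) * g p + (?a (fst p) * w (fst p)) * s2 (snd p) * g p)"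
    by (intro Bochner_Integration.integral_add[symmetric] continuous_integrable_Omega cT W S cg caw)
  also have "\<dots> = ip (\<lambda>p. w2 (fst p) * s (snd p) + weight \<gamma> p * w (fst p) * s2 (snd p)) g"
    unfolding ip_def weight_def by (simp add: algebra_simps)
  finally show ?thesis .
qed

text \<open>f' g' - f g = f' (g' - g) + (f' - f) g. To keep f' out of the constant, its square
  integral is bounded by twice that of f plus 2; this is where e \<le> 1 enters.\<close>

lemma tensor_diff_bound:
  fixes f f' g g' :: "real \<Rightarrow> real"
  assumes c: "continuous_on {-1..1} f" "continuous_on {-1..1} f'" "continuous_on {0..1} g" "continuous_on {0..1} g'"
    and a: "integral {-1..1} (\<lambda>x. (f x - f' x)^2) < e" and b: "integral {0..1} (\<lambda>x. (g x - g' x)^2) < e" and e: "e \<le> 1"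
  shows "integral\<^sup>L LO (\<lambda>p. (f' (fst p) * g' (snd p) - f (fst p) * g (snd p))^2)
     \<le> e * (4 * integral {-1..1} (\<lambda>x. (f x)^2) + 4 + 2 * integral {0..1} (\<lambda>x. (g x)^2))"
proof -
  let ?A = "integral {-1..1} (\<lambda>x. (f x - f' x)^2)" and ?B = "integral {0..1} (\<lambda>x. (g x - g' x)^2)"
  let ?F = "integral {-1..1} (\<lambda>x. (f x)^2)" and ?G = "integral {0..1} (\<lambda>x. (g x)^2)" and ?F' = "integral {-1..1} (\<lambda>x. (f' x)^2)"
  have nn: "0 \<le> ?A" "0 \<le> ?B" "0 \<le> ?F" "0 \<le> ?G" "0 \<le> ?F'"
    by (intro Henstock_Kurzweil_Integration.integral_nonneg integrable_continuous_real continuous_intros c; simp)+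
  have "?F' \<le> integral {-1..1} (\<lambda>x. 2 * (f x)^2 + 2 * (f x - f' x)^2)"
    using square_add_le[of "f x" "f' x - f x" for x]
    by (intro integral_le integrable_continuous_real continuous_intros c) (simp add: power2_commute)
  also have "\<dots> = 2 * ?F + 2 * ?A"
    by (subst Henstock_Kurzweil_Integration.integral_add) (auto intro!: integrable_continuous_real continuous_intros c)
  finally have F': "?F' \<le> 2 * ?F + 2" using a e by linarith
  have "integral\<^sup>L LO (\<lambda>p. (f' (fst p) * g' (snd p) - f (fst p) * g (snd p))^2)
     \<le> integral\<^sup>L LO (\<lambda>p. 2 * ((f' (fst p))^2 * (g (snd p) - g' (snd p))^2) + 2 * ((f (fst p) - f' (fst p))^2 * (g (snd p))^2))"
  proof (intro integral_mono)
    show "integrable LO (\<lambda>p. (f' (fst p) * g' (snd p) - f (fst p) * g (snd p))^2)"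
      by (intro continuous_integrable_Omega continuous_on_power continuous_on_diff continuous_on_tensor c)
    show "integrable LO (\<lambda>p. 2 * ((f' (fst p))^2 * (g (snd p) - g' (snd p))^2) + 2 * ((f (fst p) - f' (fst p))^2 * (g (snd p))^2))"
      by (intro continuous_integrable_Omega continuous_on_add continuous_on_mult_left
          continuous_on_tensor[of "\<lambda>x. (f' x)^2" "\<lambda>y. (g y - g' y)^2"] continuous_on_tensor[of "\<lambda>x. (f x - f' x)^2" "\<lambda>y. (g y)^2"] continuous_on_power continuous_on_diff c)
    fix p
    show "(f' (fst p) * g' (snd p) - f (fst p) * g (snd p))^2 \<le> 2 * ((f' (fst p))^2 * (g (snd p) - g' (snd p))^2) + 2 * ((f (fst p) - f' (fst p))^2 * (g (snd p))^2)"
      using square_add_le[of "f' (fst p) * (g' (snd p) - g (snd p))" "(f' (fst p) - f (fst p)) * g (snd p)"]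
      unfolding power_mult_distrib by (simp add: algebra_simps power2_commute[of "g' _"] power2_commute[of "f' _"])
  qed
  also have "\<dots> = 2 * (?F' * ?B) + 2 * (?A * ?G)"
  proof -
    have "integrable LO (\<lambda>p. (f' (fst p))^2 * (g (snd p) - g' (snd p))^2)" "integrable LO (\<lambda>p. (f (fst p) - f' (fst p))^2 * (g (snd p))^2)"
      by (intro continuous_integrable_Omega
          continuous_on_tensor[of "\<lambda>x. (f' x)^2" "\<lambda>y. (g y - g' y)^2"] continuous_on_tensor[of "\<lambda>x. (f x - f' x)^2" "\<lambda>y. (g y)^2"] continuous_on_power continuous_on_diff c)+
    moreover have "integral\<^sup>L LO (\<lambda>p. (f' (fst p))^2 * (g (snd p) - g' (snd p))^2) = ?F' * ?B"
      by (rule integral_Omega_tensor[of "\<lambda>x. (f' x)^2" "\<lambda>y. (g y - g' y)^2"]) (intro continuous_on_power continuous_on_diff c)+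
    moreover have "integral\<^sup>L LO (\<lambda>p. (f (fst p) - f' (fst p))^2 * (g (snd p))^2) = ?A * ?G"
      by (rule integral_Omega_tensor[of "\<lambda>x. (f x - f' x)^2" "\<lambda>y. (g y)^2"]) (intro continuous_on_power continuous_on_diff c)+
    ultimately show ?thesis by simp
  qed
  also have "\<dots> \<le> 2 * ((2 * ?F + 2) * e) + 2 * (e * ?G)"
    using F' a b nn by (intro add_mono mult_left_mono mult_mono) auto
  finally show ?thesis by (simp add: algebra_simps)
qed

text \<open>Membership in V asks for approximants in \<open>Cc_inf\<close>; they are products of
  one-dimensional ones. Since the weight is at most 1, the Cauchy property in V follows from L2
  convergence of both partial derivatives.\<close>

lemma tensor_V_approx:
  assumes \<gamma>: "\<gamma> > 0" and w: "C2_on (-1) 1 w w1 w2" "w (-1) = 0" "w 1 = 0"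
    and s: "C2_on 0 1 s s1 s2" "s 0 = 0" "s 1 = 0"
  shows "\<exists>\<phi>. V_approx \<gamma> \<phi> (tensor w s)"
proof -
  note W = C2_onD[OF w(1)] and S = C2_onD[OF s(1)]
  have pos: "inverse (real (Suc n)) > 0" for n by simp
  have "\<exists>\<phi> \<phi>1 \<delta>. H1_close (-1) 1 w w1 (inverse (real (Suc n))) \<phi> \<phi>1 \<delta>" for n
    by (rule H1_dirichlet_approx[OF _ W(1) W(4) w(2,3) pos]) simp
  then obtain \<phi> \<phi>1 \<delta> where "\<And>n. H1_close (-1) 1 w w1 (inverse (real (Suc n))) (\<phi> n) (\<phi>1 n) (\<delta> n)" by metis
  then have \<phi>: "\<And>n. smooth1 (\<phi> n)" "\<And>n x. (\<phi> n has_real_derivative \<phi>1 n x) (at x)" "\<And>n. smooth1 (\<phi>1 n)"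
    "\<And>n. \<delta> n > 0" "\<And>n x. x \<notin> {-1 + \<delta> n..1 - \<delta> n} \<Longrightarrow> \<phi> n x = 0"
    "\<And>n. integral {-1..1} (\<lambda>x. (w x - \<phi> n x)^2) < inverse (real (Suc n))" "\<And>n. integral {-1..1} (\<lambda>x. (w1 x - \<phi>1 n x)^2) < inverse (real (Suc n))"
    unfolding H1_close_def by blast+
  have "\<exists>\<sigma> \<sigma>1 \<delta>. H1_close 0 1 s s1 (inverse (real (Suc n))) \<sigma> \<sigma>1 \<delta>" for n
    by (rule H1_dirichlet_approx[OF _ S(1) S(4) s(2,3) pos]) simp
  then obtain \<sigma> \<sigma>1 \<delta>' where "\<And>n. H1_close 0 1 s s1 (inverse (real (Suc n))) (\<sigma> n) (\<sigma>1 n) (\<delta>' n)" by metis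
  then have \<sigma>: "\<And>n. smooth1 (\<sigma> n)" "\<And>n x. (\<sigma> n has_real_derivative \<sigma>1 n x) (at x)" "\<And>n. smooth1 (\<sigma>1 n)"
    "\<And>n. \<delta>' n > 0" "\<And>n x. x \<notin> {0 + \<delta>' n..1 - \<delta>' n} \<Longrightarrow> \<sigma> n x = 0"
    "\<And>n. integral {0..1} (\<lambda>x. (s x - \<sigma> n x)^2) < inverse (real (Suc n))" "\<And>n. integral {0..1} (\<lambda>x. (s1 x - \<sigma>1 n x)^2) < inverse (real (Suc n))"
    unfolding H1_close_def by blast+
  define \<Phi> where "\<Phi> n = (\<lambda>p. \<phi> n (fst p) * \<sigma> n (snd p))" for n
  note cc = smooth1_continuous[OF \<phi>(1)] smooth1_continuous[OF \<phi>(3)] smooth1_continuous[OF \<sigma>(1)] smooth1_continuous[OF \<sigma>(3)]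
  have e1: "inverse (real (Suc n)) \<le> 1" for n by (simp add: field_simps)
  define C where "C = 4 * integral {-1..1} (\<lambda>x. (w x)^2) + 4 + 2 * integral {0..1} (\<lambda>x. (s x)^2)"
  define C1 where "C1 = 4 * integral {-1..1} (\<lambda>x. (w1 x)^2) + 4 + 2 * integral {0..1} (\<lambda>x. (s x)^2)"
  define C2 where "C2 = 4 * integral {-1..1} (\<lambda>x. (w x)^2) + 4 + 2 * integral {0..1} (\<lambda>x. (s1 x)^2)"
  have C12: "C1 \<ge> 0" "C2 \<ge> 0" unfolding C1_def C2_def
    by (intro add_nonneg_nonneg mult_nonneg_nonneg Henstock_Kurzweil_Integration.integral_nonneg integrable_continuous_real continuous_intros W S; simp)+
  define X where "X n p = \<phi>1 n (fst p) * \<sigma> n (snd p) - w1 (fst p) * s (snd p)" for n p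
  define Y where "Y n p = \<phi> n (fst p) * \<sigma>1 n (snd p) - w (fst p) * s1 (snd p)" for n p
  have X: "integral\<^sup>L LO (\<lambda>p. (X n p)^2) \<le> inverse (real (Suc n)) * C1" for n
    unfolding X_def C1_def by (intro tensor_diff_bound W S cc \<phi> \<sigma> e1)
  have Y: "integral\<^sup>L LO (\<lambda>p. (Y n p)^2) \<le> inverse (real (Suc n)) * C2" for n
    unfolding Y_def C2_def by (intro tensor_diff_bound W S cc \<phi> \<sigma> e1)
  have cX: "continuous_on box2 (X n)" for n unfolding X_def by (intro continuous_on_diff continuous_on_tensor cc W S)
  have cY: "continuous_on box2 (Y n)" for n unfolding Y_def by (intro continuous_on_diff continuous_on_tensor cc W S)
  have "V_approx \<gamma> \<Phi> (tensor w s)"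
    unfolding V_approx_def
  proof (intro conjI allI impI)
    show "L2 (tensor w s)" unfolding tensor_def by (intro continuous_L2 continuous_on_tensor W S)
    show "\<Phi> n \<in> Cc_inf" for n unfolding \<Phi>_def by (intro Cc_inf_tensor[OF \<phi>(1) \<sigma>(1) \<phi>(4,5) \<sigma>(4,5)])
    show "(\<lambda>n. dist2 (\<Phi> n) (tensor w s)) \<longlonglongrightarrow> 0"
    proof (rule tendsto_sandwich)
      show "\<forall>\<^sub>F n in sequentially. 0 \<le> dist2 (\<Phi> n) (tensor w s)" by (simp add: dist2_nonneg)
      show "\<forall>\<^sub>F n in sequentially. dist2 (\<Phi> n) (tensor w s) \<le> inverse (real (Suc n)) * C"
        unfolding dist2_def \<Phi>_def tensor_def C_def
        by (intro always_eventually allI tensor_diff_bound W S cc \<phi> \<sigma> e1)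
      show "(\<lambda>n. inverse (real (Suc n)) * C) \<longlonglongrightarrow> 0" by (intro tendsto_mult_left_zero LIMSEQ_inverse_real_of_nat)
    qed simp
    fix e :: real assume e: "e > 0"
    have Bd: "Bform \<gamma> (\<lambda>p. \<Phi> m p - \<Phi> n p) (\<lambda>p. \<Phi> m p - \<Phi> n p) \<le> 2 * (inverse (real (Suc m)) + inverse (real (Suc n))) * (C1 + C2)" for m n
    proof -
      have ddx: "dx (\<lambda>p. \<Phi> m p - \<Phi> n p) p = X m p - X n p" for p
        unfolding dx_def \<Phi>_def X_def by (rule DERIV_imp_deriv) (auto intro!: derivative_eq_intros \<phi>(2))
      have ddy: "dy (\<lambda>p. \<Phi> m p - \<Phi> n p) p = Y m p - Y n p" for p
        unfolding dy_def \<Phi>_def Y_def by (rule DERIV_imp_deriv) (auto intro!: derivative_eq_intros \<sigma>(2))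
      have "Bform \<gamma> (\<lambda>p. \<Phi> m p - \<Phi> n p) (\<lambda>p. \<Phi> m p - \<Phi> n p) = integral\<^sup>L LO (\<lambda>p. (X m p - X n p)^2 + weight \<gamma> p * (Y m p - Y n p)^2)"
        unfolding Bform_def ddx ddy by (simp add: power2_eq_square mult.assoc)
      also have "\<dots> \<le> integral\<^sup>L LO (\<lambda>p. 2 * (X m p)^2 + 2 * (X n p)^2 + (2 * (Y m p)^2 + 2 * (Y n p)^2))"
      proof (intro integral_mono continuous_integrable_Omega continuous_intros cX cY weight_continuous \<gamma>)
        fix p assume "p \<in> space LO"
        then have p: "p \<in> box2" using Omega_subset_box2 by auto
        have "weight \<gamma> p * (Y m p - Y n p)^2 \<le> 1 * (Y m p - Y n p)^2" using weight_le_1[OF \<gamma> p] by (intro mult_right_mono) auto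
        then show "(X m p - X n p)^2 + weight \<gamma> p * (Y m p - Y n p)^2 \<le> 2 * (X m p)^2 + 2 * (X n p)^2 + (2 * (Y m p)^2 + 2 * (Y n p)^2)"
          using square_add_le[of "X m p" "- X n p"] square_add_le[of "Y m p" "- Y n p"] by simp
      qed
      also have "\<dots> = 2 * integral\<^sup>L LO (\<lambda>p. (X m p)^2) + 2 * integral\<^sup>L LO (\<lambda>p. (X n p)^2) + (2 * integral\<^sup>L LO (\<lambda>p. (Y m p)^2) + 2 * integral\<^sup>L LO (\<lambda>p. (Y n p)^2))"
        using continuous_integrable_Omega[OF continuous_on_power[OF cX]] continuous_integrable_Omega[OF continuous_on_power[OF cY]] by simp
      also have "\<dots> \<le> 2 * (inverse (real (Suc m)) * C1) + 2 * (inverse (real (Suc n)) * C1) + (2 * (inverse (real (Suc m)) * C2) + 2 * (inverse (real (Suc n)) * C2))"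
        by (intro add_mono mult_left_mono X Y) auto
      finally show ?thesis by (simp add: algebra_simps)
    qed
    define c where "c = 4 * (C1 + C2) + 1"
    have c: "c > 0" using C12 by (simp add: c_def)
    obtain N where N: "inverse (real (Suc N)) < e / c" using reals_Archimedean[of "e / c"] e c by auto
    show "\<exists>N. \<forall>m\<ge>N. \<forall>n\<ge>N. Bform \<gamma> (\<lambda>p. \<Phi> m p - \<Phi> n p) (\<lambda>p. \<Phi> m p - \<Phi> n p) < e"
    proof (intro exI allI impI)
      fix m n assume mn: "m \<ge> N" "n \<ge> N"
      have im: "inverse (real (Suc m)) \<le> inverse (real (Suc N))" "inverse (real (Suc n)) \<le> inverse (real (Suc N))" using mn by (auto intro!: le_imp_inverse_le)
      have "Bform \<gamma> (\<lambda>p. \<Phi> m p - \<Phi> n p) (\<lambda>p. \<Phi> m p - \<Phi> n p) \<le> 2 * (inverse (real (Suc N)) + inverse (real (Suc N))) * (C1 + C2)"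
        using im C12 by (intro order_trans[OF Bd] mult_right_mono mult_left_mono add_mono) auto
      also have "\<dots> = inverse (real (Suc N)) * (4 * (C1 + C2))" by simp
      also have "\<dots> \<le> inverse (real (Suc N)) * c" by (intro mult_left_mono) (auto simp: c_def)
      also have "\<dots> < e" using N c by (simp add: pos_less_divide_eq)
      finally show "Bform \<gamma> (\<lambda>p. \<Phi> m p - \<Phi> n p) (\<lambda>p. \<Phi> m p - \<Phi> n p) < e" .
    qed
  qed
  then show ?thesis by blast
qed

lemma V_approx_Bform_bounded:
  assumes \<gamma>: "\<gamma> > 0" and V: "V_approx \<gamma> \<phi> h"
  obtains M N where "M \<ge> 0" "\<And>n. n \<ge> N \<Longrightarrow> Bform \<gamma> (\<phi> n) (\<phi> n) \<le> M"
proof -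
  have sm: "smooth2 (\<phi> n)" for n using V Cc_infD by (auto simp: V_approx_def)
  obtain N where N: "\<And>m n. m \<ge> N \<Longrightarrow> n \<ge> N \<Longrightarrow> Bform \<gamma> (\<lambda>p. \<phi> m p - \<phi> n p) (\<lambda>p. \<phi> m p - \<phi> n p) < 1"
    using V unfolding V_approx_def by (metis zero_less_one)
  have "Bform \<gamma> (\<phi> n) (\<phi> n) \<le> 2 + 2 * Bform \<gamma> (\<phi> N) (\<phi> N)" if "n \<ge> N" for n
  proof -
    let ?a = "Bform \<gamma> (\<phi> n) (\<phi> n)" and ?b = "Bform \<gamma> (\<phi> N) (\<phi> N)" and ?c = "Bform \<gamma> (\<phi> n) (\<phi> N)"
    let ?d = "\<lambda>p. \<phi> n p - \<phi> N p"
    have "Bform \<gamma> ?d ?d = Bform \<gamma> ?d (\<phi> n) - Bform \<gamma> ?d (\<phi> N)"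
      by (rule Bform_diff_right[OF \<gamma> smooth2_diff[OF sm sm] sm sm])
    moreover have "Bform \<gamma> ?d (\<phi> n) = ?a - ?c"
      using Bform_diff_right[OF \<gamma> sm sm sm, of n n N] by (simp add: Bform_commute[of \<gamma> ?d])
    moreover have "Bform \<gamma> ?d (\<phi> N) = ?c - ?b"
      using Bform_diff_right[OF \<gamma> sm sm sm, of N n N] by (simp add: Bform_commute[of \<gamma> ?d] Bform_commute[of \<gamma> "\<phi> N" "\<phi> n"])
    ultimately have "Bform \<gamma> ?d ?d = ?a - 2 * ?c + ?b" by simp
    then have 1: "?a - 2 * ?c + ?b < 1" using N[OF that order_refl] by simp
    have "\<bar>?c\<bar> \<le> sqrt ?a * sqrt ?b"
      using Bform_cauchy_schwarz[OF \<gamma> sm sm, of n N] by (simp add: real_le_rsqrt real_sqrt_mult[symmetric])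
    moreover have "0 \<le> (sqrt ?a - 2 * sqrt ?b)^2" by simp
    then have "4 * (sqrt ?a * sqrt ?b) \<le> ?a + 4 * ?b"
      using Bform_nonneg[of \<gamma> "\<phi> n"] Bform_nonneg[of \<gamma> "\<phi> N"] by (simp add: power2_diff power_mult_distrib)
    ultimately have "4 * ?c \<le> ?a + 4 * ?b" by linarith
    with 1 show ?thesis by linarith
  qed
  then show thesis using Bform_nonneg[of \<gamma> "\<phi> N"] by (intro that[of "2 + 2 * Bform \<gamma> (\<phi> N) (\<phi> N)" N]) auto
qed

text \<open>The definition tests a diagonal limit along arbitrary approximating sequences. With the
  index of \<psi> frozen at m, integration by parts and L2 convergence give the limit in n; the
  Cauchy property of \<psi> and the bounded energies of \<phi> make the replacement of \<psi> n by
  \<psi> m uniformly harmless.\<close>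

theorem is_A_tensor:
  assumes \<gamma>: "\<gamma> > 0" and w: "C2_on (-1) 1 w w1 w2" "w (-1) = 0" "w 1 = 0"
    and s: "C2_on 0 1 s s1 s2" "s 0 = 0" "s 1 = 0"
  shows "is_A \<gamma> (tensor w s) (\<lambda>p. w2 (fst p) * s (snd p) + weight \<gamma> p * w (fst p) * s2 (snd p))"
    (is "is_A \<gamma> ?h ?g")
  unfolding is_A_def
proof (intro conjI allI impI)
  note W = C2_onD[OF w(1)] and S = C2_onD[OF s(1)]
  show "?h \<in> V \<gamma>" using tensor_V_approx[OF assms] by (simp add: V_def)
  have "continuous_on box2 (\<lambda>p. w2 (fst p) * s (snd p) + weight \<gamma> p * (w (fst p) * s2 (snd p)))"
    by (intro continuous_on_add continuous_on_mult continuous_on_tensor[OF W(5) S(3)] continuous_on_tensor[OF W(3) S(5)] weight_continuous \<gamma>)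
  then show Lg: "L2 ?g" by (intro continuous_L2) (simp add: mult.assoc)
  fix k \<phi> \<psi>
  assume V\<phi>: "V_approx \<gamma> \<phi> ?h" and V\<psi>: "V_approx \<gamma> \<psi> k"
  have \<phi>C: "\<phi> n \<in> Cc_inf" and \<psi>C: "\<psi> n \<in> Cc_inf" for n using V\<phi> V\<psi> by (auto simp: V_approx_def)
  have \<phi>s: "smooth2 (\<phi> n)" and \<psi>s: "smooth2 (\<psi> n)" for n using Cc_infD \<phi>C \<psi>C by auto
  have Lh: "L2 ?h" and Lk: "L2 k" using V\<phi> V\<psi> by (auto simp: V_approx_def)
  obtain M N where M: "M \<ge> 0" "\<And>n. n \<ge> N \<Longrightarrow> Bform \<gamma> (\<phi> n) (\<phi> n) \<le> M" using V_approx_Bform_bounded[OF \<gamma> V\<phi>] by blast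
  have lim1: "(\<lambda>n. Bform \<gamma> (\<phi> n) (\<psi> m)) \<longlonglongrightarrow> - ip ?g (\<psi> m)" for m
  proof -
    have "(\<lambda>n. ip (\<phi> n) (Aop \<gamma> (\<psi> m))) \<longlonglongrightarrow> ip ?h (Aop \<gamma> (\<psi> m))"
    proof (rule tendsto_ip_of_dist2[OF Cc_inf_L2[OF \<phi>C] Lh])
      show "L2 (Aop \<gamma> (\<psi> m))" by (intro continuous_L2 Aop_continuous \<gamma> \<psi>s)
      show "(\<lambda>n. dist2 (\<phi> n) ?h) \<longlonglongrightarrow> 0" using V\<phi> by (auto simp: V_approx_def)
    qed
    then have "(\<lambda>n. - ip (\<phi> n) (Aop \<gamma> (\<psi> m))) \<longlonglongrightarrow> - ip ?h (Aop \<gamma> (\<psi> m))" by (rule tendsto_minus)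
    then show ?thesis using tensor_Aop_by_parts[OF \<gamma> w s \<psi>C] Bform_by_parts[OF \<gamma> \<phi>C \<psi>C] by simp
  qed
  have lim2: "(\<lambda>m. ip (\<psi> m) ?g) \<longlonglongrightarrow> ip k ?g"
    by (rule tendsto_ip_of_dist2[OF Cc_inf_L2[OF \<psi>C] Lk Lg]) (use V\<psi> in \<open>auto simp: V_approx_def\<close>)
  show "(\<lambda>n. Bform \<gamma> (\<phi> n) (\<psi> n)) \<longlonglongrightarrow> - ip ?g k"
  proof (rule LIMSEQ_I)
    fix e :: real assume e: "e > 0"
    \<comment> \<open>Chosen so that Cauchy-Schwarz for the form gives sqrt(M d) \<le> e/3; M + 1
      avoids a division by zero.\<close>
    define d where "d = (e / 3)^2 / (M + 1)"
    have d: "d > 0" using e M by (simp add: d_def)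
    obtain N1 where N1: "\<And>m n. m \<ge> N1 \<Longrightarrow> n \<ge> N1 \<Longrightarrow> Bform \<gamma> (\<lambda>p. \<psi> m p - \<psi> n p) (\<lambda>p. \<psi> m p - \<psi> n p) < d"
      using V\<psi> d unfolding V_approx_def by metis
    obtain N2 where N2: "\<And>m. m \<ge> N2 \<Longrightarrow> \<bar>ip (\<psi> m) ?g - ip k ?g\<bar> < e / 3"
      using LIMSEQ_D[OF lim2, of "e / 3"] e by auto
    define m where "m = max N1 N2"
    obtain N3 where N3: "\<And>n. n \<ge> N3 \<Longrightarrow> \<bar>Bform \<gamma> (\<phi> n) (\<psi> m) - (- ip ?g (\<psi> m))\<bar> < e / 3"
      using LIMSEQ_D[OF lim1, of "e / 3" m] e by auto
    show "\<exists>no. \<forall>n\<ge>no. norm (Bform \<gamma> (\<phi> n) (\<psi> n) - - ip ?g k) < e"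
    proof (intro exI allI impI)
      fix n assume n: "n \<ge> max N (max N1 N3)"
      have "(Bform \<gamma> (\<phi> n) (\<psi> n) - Bform \<gamma> (\<phi> n) (\<psi> m))^2 = (Bform \<gamma> (\<phi> n) (\<lambda>p. \<psi> n p - \<psi> m p))^2"
        using Bform_diff_right[OF \<gamma> \<phi>s \<psi>s \<psi>s] by simp
      also have "\<dots> \<le> Bform \<gamma> (\<phi> n) (\<phi> n) * Bform \<gamma> (\<lambda>p. \<psi> n p - \<psi> m p) (\<lambda>p. \<psi> n p - \<psi> m p)"
        by (rule Bform_cauchy_schwarz[OF \<gamma> \<phi>s smooth2_diff[OF \<psi>s \<psi>s]])
      also have "\<dots> \<le> M * d" using M n N1[of n m] by (intro mult_mono) (auto simp: m_def Bform_nonneg intro: less_imp_le)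
      also have "\<dots> \<le> (M + 1) * d" using d by simp
      also have "\<dots> = (e / 3)^2" using M by (simp add: d_def)
      finally have "\<bar>Bform \<gamma> (\<phi> n) (\<psi> n) - Bform \<gamma> (\<phi> n) (\<psi> m)\<bar> \<le> e / 3"
        using e by (intro power2_le_imp_le[of "\<bar>Bform \<gamma> (\<phi> n) (\<psi> n) - Bform \<gamma> (\<phi> n) (\<psi> m)\<bar>"]) auto
      moreover have "\<bar>Bform \<gamma> (\<phi> n) (\<psi> m) + ip ?g (\<psi> m)\<bar> < e / 3" using N3[of n] n by simp
      moreover have "\<bar>ip ?g (\<psi> m) - ip ?g k\<bar> < e / 3" using N2[of m] by (simp add: m_def ip_commute[of ?g])
      ultimately show "norm (Bform \<gamma> (\<phi> n) (\<psi> n) - - ip ?g k) < e" unfolding real_norm_def by linarith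
    qed
  qed
qed

lemma is_A_symmetric:
  assumes "is_A \<gamma> h g" "is_A \<gamma> h' g'"
  shows "ip g h' = ip g' h"
proof -
  obtain \<phi> \<psi> where "V_approx \<gamma> \<phi> h" "V_approx \<gamma> \<psi> h'" using assms by (auto simp: is_A_def V_def)
  then have "(\<lambda>n. Bform \<gamma> (\<phi> n) (\<psi> n)) \<longlonglongrightarrow> - ip g h'" "(\<lambda>n. Bform \<gamma> (\<psi> n) (\<phi> n)) \<longlonglongrightarrow> - ip g' h"
    using assms by (auto simp: is_A_def)
  then have "- ip g h' = - ip g' h" unfolding Bform_commute[of \<gamma> "\<psi> _"] by (rule LIMSEQ_unique)
  then show ?thesis by simp
qed

lemma is_A_L2: "is_A \<gamma> h g \<Longrightarrow> L2 h" "is_A \<gamma> h g \<Longrightarrow> L2 g"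
  by (auto simp: is_A_def V_def V_approx_def)

section \<open>Eigenfunctions of the Grushin operator\<close>

text \<open>The constants are powers of interval lengths: 1^2 and 2^2 in \<open>nu_trace\<close> and
  \<open>lam_trace\<close>, 1 and 2 in the sup bounds. Only the index 0 is singled out, by
  \<open>lam_first\<close>; the eigenvalues carry no other order.\<close>

locale grushin_modes =
  fixes \<gamma> :: real and s s1 :: "nat \<Rightarrow> real \<Rightarrow> real" and \<nu> :: "nat \<Rightarrow> real"
    and v v1 :: "nat \<Rightarrow> nat \<Rightarrow> real \<Rightarrow> real" and lam :: "nat \<Rightarrow> nat \<Rightarrow> real"
  assumes gamma: "\<gamma> > 0"
    and s_C2: "\<And>m. C2_on 0 1 (s m) (s1 m) (\<lambda>y. - \<nu> m * s m y)" and s_0: "\<And>m. s m 0 = 0" and s_1: "\<And>m. s m 1 = 0"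
    and nu_pos: "\<And>m. \<nu> m > 0" and s_orth: "\<And>i j. integral {0..1} (\<lambda>y. s i y * s j y) = (if i = j then 1 else 0)"
    and nu_trace: "\<And>n. (\<Sum>m<n. 1 / \<nu> m) \<le> 1" and s_sup: "\<And>m y. y \<in> {0..1} \<Longrightarrow> (s m y)^2 \<le> \<nu> m"
    and s_dense: "\<And>f e. continuous_on {0..1} f \<Longrightarrow> e > 0 \<Longrightarrow> \<exists>n a. integral {0..1} (\<lambda>x. (f x - (\<Sum>k<n. a k * s k x))^2) < e"
    and v_C2: "\<And>m k. C2_on (-1) 1 (v m k) (v1 m k) (\<lambda>x. (\<nu> m * \<bar>x\<bar> powr (2 * \<gamma>) - lam m k) * v m k x)"
    and v_l: "\<And>m k. v m k (-1) = 0" and v_r: "\<And>m k. v m k 1 = 0"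
    and lam_pos: "\<And>m k. lam m k > 0"
    and v_orth: "\<And>m i j. integral {-1..1} (\<lambda>x. v m i x * v m j x) = (if i = j then 1 else 0)"
    and lam_trace: "\<And>m n. (\<Sum>k<n. 1 / lam m k) \<le> 4" and v_sup: "\<And>m k x. x \<in> {-1..1} \<Longrightarrow> (v m k x)^2 \<le> 2 * lam m k"
    and v_dense: "\<And>m f e. continuous_on {-1..1} f \<Longrightarrow> e > 0 \<Longrightarrow> \<exists>n a. integral {-1..1} (\<lambda>x. (f x - (\<Sum>k<n. a k * v m k x))^2) < e"
    and lam_first: "\<And>m w w1 w2. C2_on (-1) 1 w w1 w2 \<Longrightarrow> w (-1) = 0 \<Longrightarrow> w 1 = 0 \<Longrightarrow>
       (lam m 0)^2 * integral {-1..1} (\<lambda>x. (w x)^2) \<le> integral {-1..1} (\<lambda>x. (\<nu> m * \<bar>x\<bar> powr (2 * \<gamma>) * w x - w2 x)^2)"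

text \<open>One predicate for the conclusion of \<open>eigenbasis\<close>, so that a basis can be
  chosen for all the potentials \<nu>_m |x|^(2\<gamma>) at once.\<close>

definition SL_basis where
  "SL_basis l r q v v1 lam \<longleftrightarrow> (\<forall>k. C2_on l r (v k) (v1 k) (\<lambda>x. (q x - lam k) * v k x)) \<and> (\<forall>k. v k l = 0) \<and> (\<forall>k. v k r = 0) \<and>
    (\<forall>k. lam k > 0) \<and> (\<forall>i j. integral {l..r} (\<lambda>x. v i x * v j x) = (if i = j then 1 else 0)) \<and>
    (\<forall>n. (\<Sum>k<n. 1 / lam k) \<le> (r - l)^2) \<and>
    (\<forall>k. \<forall>x\<in>{l..r}. (v k x)^2 \<le> (r - l) * lam k) \<and>
    (\<forall>f e. continuous_on {l..r} f \<longrightarrow> e > 0 \<longrightarrow> (\<exists>n a. integral {l..r} (\<lambda>x. (f x - (\<Sum>k<n. a k * v k x))^2) < e)) \<and>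
    (\<forall>w w1 w2. C2_on l r w w1 w2 \<longrightarrow> w l = 0 \<longrightarrow> w r = 0 \<longrightarrow>
       (lam 0)^2 * integral {l..r} (\<lambda>x. (w x)^2) \<le> integral {l..r} (\<lambda>x. (q x * w x - w2 x)^2))"

lemma SL_basis_exists:
  assumes "sturm_liouville l r q"
  shows "\<exists>(v :: nat \<Rightarrow> real \<Rightarrow> real) v1 lam. SL_basis l r q v v1 lam"
proof -
  interpret sturm_liouville l r q by fact
  obtain v v1 :: "nat \<Rightarrow> real \<Rightarrow> real" and lam :: "nat \<Rightarrow> real"
  where B: "\<And>k. C2_on l r (v k) (v1 k) (\<lambda>x. (q x - lam k) * v k x)" "\<And>k. v k l = 0" "\<And>k. v k r = 0"
    "\<And>k. lam k > 0" "\<And>i j. integral {l..r} (\<lambda>x. v i x * v j x) = (if i = j then 1 else 0)"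
    "\<And>n. (\<Sum>k<n. 1 / lam k) \<le> (r - l)^2"
    "\<And>k x. x \<in> {l..r} \<Longrightarrow> (v k x)^2 \<le> (r - l) * lam k"
    "\<And>f e. continuous_on {l..r} f \<Longrightarrow> e > 0 \<Longrightarrow> \<exists>n a. integral {l..r} (\<lambda>x. (f x - (\<Sum>k<n. a k * v k x))^2) < e"
    "\<And>w w1 w2. C2_on l r w w1 w2 \<Longrightarrow> w l = 0 \<Longrightarrow> w r = 0 \<Longrightarrow>
       (lam 0)^2 * integral {l..r} (\<lambda>x. (w x)^2) \<le> integral {l..r} (\<lambda>x. (q x * w x - w2 x)^2)"
    by (rule eigenbasis) (assumption | blast)+
  have "SL_basis l r q v v1 lam" unfolding SL_basis_def using B by blast
  then show ?thesis by blast
qed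

lemma grushin_modes_exists:
  assumes "\<gamma> > 0"
  obtains s s1 \<nu> v v1 lam where "grushin_modes \<gamma> s s1 \<nu> v v1 lam"
proof -
  have "sturm_liouville 0 1 (\<lambda>_. 0)" by unfold_locales auto
  then obtain s s1 \<nu> where S: "SL_basis 0 1 (\<lambda>_. 0) (s :: nat \<Rightarrow> real \<Rightarrow> real) s1 \<nu>" using SL_basis_exists by blast
  have nu: "\<nu> m > 0" for m using S by (auto simp: SL_basis_def)
  have "sturm_liouville (-1) 1 (\<lambda>x. \<nu> m * \<bar>x\<bar> powr (2 * \<gamma>))" for m
    using nu[of m] assms by unfold_locales (auto intro!: continuous_intros weight_1d_continuous)
  then have "\<exists>(v :: nat \<Rightarrow> real \<Rightarrow> real) v1 lam. SL_basis (-1) 1 (\<lambda>x. \<nu> m * \<bar>x\<bar> powr (2 * \<gamma>)) v v1 lam" for m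
    using SL_basis_exists by blast
  then obtain v v1 lam where V: "\<And>m. SL_basis (-1) 1 (\<lambda>x. \<nu> m * \<bar>x\<bar> powr (2 * \<gamma>)) (v m :: nat \<Rightarrow> real \<Rightarrow> real) (v1 m) (lam m)"
    by metis
  have "grushin_modes \<gamma> s s1 \<nu> v v1 lam"
    by unfold_locales (use assms S V in \<open>simp_all add: SL_basis_def\<close>)
  then show thesis by (rule that)
qed

section \<open>Density of continuous functions and of sums of products in L2\<close>

lemma dist2_triangle:
  assumes "L2 f" "L2 g" "L2 h"
  shows "dist2 f h \<le> 2 * dist2 f g + 2 * dist2 g h"
proof -
  have i: "integrable LO (\<lambda>p. (a p - b p)^2)" if "L2 a" "L2 b" for a b using L2_diff[OF that] by (simp add: L2_def)
  have "dist2 f h \<le> integral\<^sup>L LO (\<lambda>p. 2 * (f p - g p)^2 + 2 * (g p - h p)^2)"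
    unfolding dist2_def using i[OF assms(1,3)] i[OF assms(1,2)] i[OF assms(2,3)] square_add_le[of "f p - g p" "g p - h p" for p]
    by (intro integral_mono) auto
  also have "\<dots> = 2 * dist2 f g + 2 * dist2 g h"
    unfolding dist2_def using i[OF assms(1,2)] i[OF assms(2,3)] by simp
  finally show ?thesis .
qed

lemma dist2_le_of_uniform:
  assumes "L2 f" "L2 g" "\<And>p. p \<in> Omega \<Longrightarrow> \<bar>f p - g p\<bar> \<le> e"
  shows "dist2 f g \<le> 2 * e^2"
proof -
  have "dist2 f g \<le> integral\<^sup>L LO (\<lambda>p. e^2)"
    unfolding dist2_def
  proof (intro integral_mono)
    show "integrable LO (\<lambda>p. (f p - g p)^2)" using L2_diff[OF assms(1,2)] by (simp add: L2_def)
    show "integrable LO (\<lambda>p. e^2)" by (intro continuous_integrable_Omega continuous_intros)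
    show "(f p - g p)^2 \<le> e^2" if "p \<in> space LO" for p using assms(3)[of p] that by (intro abs_le_square_iff[THEN iffD1]) auto
  qed
  also have "\<dots> = 2 * e^2" by (subst integral_Omega_eq(1)) auto
  finally show ?thesis .
qed

text \<open>Truncate f to a bounded function, take the almost everywhere convergent continuous
  functions that measurability provides, and truncate these as well. Dominated convergence on a
  space of finite measure applies to both truncations.\<close>

lemma L2_approx_continuous:
  assumes f: "L2 f" and e: "e > 0"
  shows "\<exists>g. continuous_on UNIV g \<and> dist2 f g < e"
proof -
  interpret finite_measure LO by (rule finite_measure_LO)
  have fm: "f \<in> borel_measurable LO" using f by (rule L2_measurable)
  define cl where "cl M x = max (- M) (min M x)" for M x :: real
  have clb: "\<bar>cl M x\<bar> \<le> M" if "M \<ge> 0" for M x using that by (auto simp: cl_def)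
  have cl_cont: "continuous_on UNIV (cl M)" for M unfolding cl_def by (intro continuous_intros)
  have "(\<lambda>n. integral\<^sup>L LO (\<lambda>p. (f p - cl (real n) (f p))^2)) \<longlonglongrightarrow> integral\<^sup>L LO (\<lambda>p. 0)"
  proof (rule integral_dominated_convergence[where w = "\<lambda>p. (f p)^2"])
    show "integrable LO (\<lambda>p. (f p)^2)" using f by (simp add: L2_def)
    show "(\<lambda>p. (f p - cl (real n) (f p))^2) \<in> borel_measurable LO" for n unfolding cl_def using fm by measurable
    show "AE p in LO. (\<lambda>n. (f p - cl (real n) (f p))^2) \<longlonglongrightarrow> 0"
    proof (rule AE_I2)
      fix p
      obtain N :: nat where N: "\<bar>f p\<bar> \<le> real N" using real_arch_simple by blast
      have "\<forall>\<^sub>F n in sequentially. (f p - cl (real n) (f p))^2 = 0"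
        unfolding eventually_sequentially using N by (intro exI[of _ N]) (auto simp: cl_def)
      then show "(\<lambda>n. (f p - cl (real n) (f p))^2) \<longlonglongrightarrow> 0" by (rule tendsto_eventually)
    qed
    show "AE p in LO. norm ((f p - cl (real n) (f p))^2) \<le> (f p)^2" for n
    proof (rule AE_I2)
      fix p
      have "\<bar>f p - cl (real n) (f p)\<bar> \<le> \<bar>f p\<bar>" by (auto simp: cl_def)
      then show "norm ((f p - cl (real n) (f p))^2) \<le> (f p)^2" using abs_le_square_iff by auto
    qed
  qed simp
  then have "\<forall>\<^sub>F n in sequentially. integral\<^sup>L LO (\<lambda>p. (f p - cl (real n) (f p))^2) < e / 4"
    using e by (intro order_tendstoD(2)[of _ 0]) auto
  then obtain n where n: "integral\<^sup>L LO (\<lambda>p. (f p - cl (real n) (f p))^2) < e / 4" by (auto simp: eventually_sequentially)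
  define M where "M = real n"
  have M: "M \<ge> 0" by (simp add: M_def)
  define h where "h p = cl M (f p)" for p
  have hm: "h \<in> borel_measurable LO" unfolding h_def cl_def using fm by measurable
  have hL: "L2 h" unfolding L2_def
  proof
    show "integrable LO (\<lambda>p. (h p)^2)"
    proof (rule integrable_const_bound[of _ "M^2"])
      show "AE p in LO. norm ((h p)^2) \<le> M^2" using clb[OF M] M by (intro AE_I2) (auto simp: h_def intro!: abs_le_square_iff[THEN iffD1])
    qed (use hm in measurable)
  qed (rule hm)
  have "h measurable_on Omega" using hm by (simp add: measurable_on_iff_borel_measurable)
  then obtain N g where N: "negligible N" "\<And>k. continuous_on UNIV (g k)" "\<And>x. x \<notin> N \<Longrightarrow> (\<lambda>k. g k x) \<longlonglongrightarrow> (if x \<in> Omega then h x else 0)"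
    unfolding measurable_on_def by blast
  have "AE p in lebesgue. p \<notin> N" using N(1) by (intro AE_not_in) (simp add: negligible_iff_null_sets)
  then have Nz: "AE p in LO. p \<notin> N" by (subst AE_restrict_space_iff) auto
  have gc: "continuous_on UNIV (\<lambda>p. cl M (g k p))" for k by (rule continuous_on_compose2[OF cl_cont N(2)]) auto
  have gL: "L2 (\<lambda>p. cl M (g k p))" for k by (intro continuous_L2 continuous_on_subset[OF gc]) auto
  have "(\<lambda>k. integral\<^sup>L LO (\<lambda>p. (h p - cl M (g k p))^2)) \<longlonglongrightarrow> integral\<^sup>L LO (\<lambda>p. 0)"
  proof (rule integral_dominated_convergence[where w = "\<lambda>p. (2 * M)^2"])
    show "(\<lambda>p. (h p - cl M (g k p))^2) \<in> borel_measurable LO" for k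
      using hm L2_measurable[OF gL] by measurable
    show "AE p in LO. (\<lambda>k. (h p - cl M (g k p))^2) \<longlonglongrightarrow> 0"
      using Nz
    proof (rule AE_mp, intro AE_I2 impI)
      fix p assume p: "p \<in> space LO" "p \<notin> N"
      then have "(\<lambda>k. g k p) \<longlonglongrightarrow> h p" using N(3)[of p] by simp
      then have "(\<lambda>k. cl M (g k p)) \<longlonglongrightarrow> cl M (h p)" unfolding cl_def by (intro tendsto_intros)
      also have "cl M (h p) = h p" using M by (auto simp: h_def cl_def)
      finally have "(\<lambda>k. (h p - cl M (g k p))^2) \<longlonglongrightarrow> (h p - h p)^2" by (intro tendsto_intros)
      then show "(\<lambda>k. (h p - cl M (g k p))^2) \<longlonglongrightarrow> 0" by simp
    qed
    show "AE p in LO. norm ((h p - cl M (g k p))^2) \<le> (2 * M)^2" for k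
    proof (rule AE_I2)
      fix p
      have "\<bar>h p - cl M (g k p)\<bar> \<le> 2 * M" using clb[OF M, of "f p"] clb[OF M, of "g k p"] unfolding h_def by linarith
      then have "(h p - cl M (g k p))^2 \<le> (2 * M)^2" using M by (intro abs_le_square_iff[THEN iffD1]) auto
      then show "norm ((h p - cl M (g k p))^2) \<le> (2 * M)^2" by simp
    qed
  qed auto
  then have "\<forall>\<^sub>F k in sequentially. integral\<^sup>L LO (\<lambda>p. (h p - cl M (g k p))^2) < e / 4"
    using e by (intro order_tendstoD(2)[of _ 0]) auto
  then obtain k where k: "integral\<^sup>L LO (\<lambda>p. (h p - cl M (g k p))^2) < e / 4" by (auto simp: eventually_sequentially)
  have "dist2 f (\<lambda>p. cl M (g k p)) \<le> 2 * dist2 f h + 2 * dist2 h (\<lambda>p. cl M (g k p))"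
    by (intro dist2_triangle f hL gL)
  also have "\<dots> < e" using n k by (simp add: dist2_def h_def M_def)
  finally show ?thesis using gc by blast
qed

text \<open>These sums form an algebra containing the constants and the coordinate functions, hence
  all polynomials in two variables.\<close>

inductive tensor_sum :: "(real \<times> real \<Rightarrow> real) \<Rightarrow> bool" where
  base: "continuous_on UNIV F \<Longrightarrow> continuous_on UNIV G \<Longrightarrow> tensor_sum (\<lambda>p. F (fst p) * G (snd p))"
| add: "tensor_sum f \<Longrightarrow> tensor_sum g \<Longrightarrow> tensor_sum (\<lambda>p. f p + g p)"

lemma tensor_sum_mult_base:
  assumes "tensor_sum f" "continuous_on UNIV F" "continuous_on UNIV G"
  shows "tensor_sum (\<lambda>p. f p * (F (fst p) * G (snd p)))"
  using assms(1)
proof induction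
  case (base F' G')
  have "tensor_sum (\<lambda>p. (F' (fst p) * F (fst p)) * (G' (snd p) * G (snd p)))"
    by (rule tensor_sum.base[of "\<lambda>x. F' x * F x" "\<lambda>y. G' y * G y"]) (intro continuous_intros base assms)+
  then show ?case by (simp add: mult_ac)
next
  case (add f g)
  then show ?case using tensor_sum.add by (simp add: distrib_right)
qed

lemma tensor_sum_mult: "tensor_sum g \<Longrightarrow> tensor_sum f \<Longrightarrow> tensor_sum (\<lambda>p. f p * g p)"
proof (induction rule: tensor_sum.induct)
  case (base F G)
  then show ?case by (intro tensor_sum_mult_base)
next
  case (add g h)
  then show ?case using tensor_sum.add by (simp add: distrib_left)
qed

lemma polynomial_tensor_sum:
  fixes f :: "real \<times> real \<Rightarrow> real"
  assumes "real_polynomial_function f" shows "tensor_sum f"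
  using assms
proof induction
  case (linear f)
  interpret bounded_linear f by fact
  have "tensor_sum (\<lambda>p. (fst p * f (1, 0)) * 1 + 1 * (snd p * f (0, 1)))"
    by (intro tensor_sum.add tensor_sum.base[of "\<lambda>x. x * f (1, 0)" "\<lambda>_. 1"] tensor_sum.base[of "\<lambda>_. 1" "\<lambda>y. y * f (0, 1)"] continuous_intros)
  moreover have "f = (\<lambda>p. (fst p * f (1, 0)) * 1 + 1 * (snd p * f (0, 1)))"
  proof
    fix p
    have "f p = f (fst p *\<^sub>R (1, 0) + snd p *\<^sub>R (0, 1))" by (cases p) simp
    then show "f p = (fst p * f (1, 0)) * 1 + 1 * (snd p * f (0, 1))" by (simp only: add scaleR) simp
  qed
  ultimately show ?case by (rule ssubst[rotated])
next
  case (const c)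
  have "tensor_sum (\<lambda>p. c * 1)" by (rule tensor_sum.base[of "\<lambda>_. c" "\<lambda>_. 1"]) (intro continuous_intros)+
  then show ?case by simp
next
  case (add f g)
  then show ?case by (intro tensor_sum.add)
next
  case (mult f g)
  then show ?case by (intro tensor_sum_mult)
qed

section \<open>Completeness of the product eigenfunctions\<close>

context grushin_modes
begin

definition ef :: "nat \<Rightarrow> nat \<Rightarrow> real \<times> real \<Rightarrow> real" where
  "ef m k = tensor (v m k) (s m)"

lemma s_cont: "continuous_on {0..1} (s m)" and v_cont: "continuous_on {-1..1} (v m k)"
  using C2_onD(3)[OF s_C2] C2_onD(3)[OF v_C2] .

lemma ef_continuous: "continuous_on box2 (ef m k)"
  unfolding ef_def tensor_def by (intro continuous_on_tensor s_cont v_cont)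

lemma ef_L2: "L2 (ef m k)"
  by (rule continuous_L2[OF ef_continuous])

lemma is_A_ef: "is_A \<gamma> (ef m k) (\<lambda>p. - lam m k * ef m k p)"
proof -
  have "is_A \<gamma> (tensor (v m k) (s m)) (\<lambda>p. (\<nu> m * \<bar>fst p\<bar> powr (2 * \<gamma>) - lam m k) * v m k (fst p) * s m (snd p) + weight \<gamma> p * v m k (fst p) * (- \<nu> m * s m (snd p)))"
    by (rule is_A_tensor[OF gamma v_C2 v_l v_r s_C2 s_0 s_1])
  moreover have "(\<lambda>p. (\<nu> m * \<bar>fst p\<bar> powr (2 * \<gamma>) - lam m k) * v m k (fst p) * s m (snd p) + weight \<gamma> p * v m k (fst p) * (- \<nu> m * s m (snd p))) = (\<lambda>p. - lam m k * ef m k p)"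
    by (rule ext) (simp add: ef_def tensor_def weight_def algebra_simps)
  ultimately show ?thesis by (simp add: ef_def)
qed

lemma ip_tensor:
  assumes "continuous_on {-1..1} f" "continuous_on {-1..1} f'" "continuous_on {0..1} g" "continuous_on {0..1} g'"
  shows "ip (tensor f g) (tensor f' g') = integral {-1..1} (\<lambda>x. f x * f' x) * integral {0..1} (\<lambda>y. g y * g' y)"
  using integral_Omega_tensor[of "\<lambda>x. f x * f' x" "\<lambda>y. g y * g' y"] assms
  by (simp add: ip_def tensor_def mult_ac continuous_on_mult)

lemma ef_orth: "ip (ef m k) (ef m' k') = (if m = m' \<and> k = k' then 1 else 0)"
  unfolding ef_def by (simp add: ip_tensor s_cont v_cont s_orth v_orth)

definition es :: "nat \<Rightarrow> real \<times> real \<Rightarrow> real" where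
  "es j = ef (fst (prod_decode j)) (snd (prod_decode j))"

definition ls :: "nat \<Rightarrow> real" where
  "ls j = lam (fst (prod_decode j)) (snd (prod_decode j))"

lemma es_L2: "L2 (es j)" by (simp add: es_def ef_L2)

lemma es_orth: "ip (es i) (es j) = (if i = j then 1 else 0)"
proof -
  have "i = j" if "fst (prod_decode i) = fst (prod_decode j)" "snd (prod_decode i) = snd (prod_decode j)"
    using that by (metis prod_eqI prod_decode_inverse)
  then show ?thesis by (auto simp: es_def ef_orth)
qed

lemma is_A_es: "is_A \<gamma> (es j) (\<lambda>p. - ls j * es j p)"
  using is_A_ef by (simp add: es_def ls_def)

text \<open>The closed linear span of the eigenfunctions, the pairs (m,k) being enumerated by
  \<open>prod_decode\<close>.\<close>

definition app :: "(real \<times> real \<Rightarrow> real) \<Rightarrow> bool" where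
  "app f \<longleftrightarrow> L2 f \<and> (\<forall>e>0. \<exists>n a. dist2 f (\<lambda>p. \<Sum>j<n. a j * es j p) < e)"

lemma comb_L2: "L2 (\<lambda>p. \<Sum>j<n. a j * es j p)"
  by (intro L2_sum L2_scale es_L2)

lemma app_closed:
  assumes "L2 f" "\<And>e. e > 0 \<Longrightarrow> \<exists>g. app g \<and> dist2 f g < e"
  shows "app f"
  unfolding app_def
proof (intro conjI allI impI assms(1))
  fix e :: real assume e: "e > 0"
  then obtain g where g: "app g" "dist2 f g < e / 4" using assms(2)[of "e / 4"] by auto
  then obtain n a where na: "dist2 g (\<lambda>p. \<Sum>j<n. a j * es j p) < e / 4" using e unfolding app_def by (elim conjE allE[of _ "e / 4"]) auto
  have "dist2 f (\<lambda>p. \<Sum>j<n. a j * es j p) \<le> 2 * dist2 f g + 2 * dist2 g (\<lambda>p. \<Sum>j<n. a j * es j p)"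
    using g by (intro dist2_triangle assms comb_L2) (auto simp: app_def)
  also have "\<dots> < e" using g na by simp
  finally show "\<exists>n a. dist2 f (\<lambda>p. \<Sum>j<n. a j * es j p) < e" by blast
qed

lemma dist2_add_le:
  assumes "L2 f" "L2 g" "L2 f'" "L2 g'"
  shows "dist2 (\<lambda>p. f p + g p) (\<lambda>p. f' p + g' p) \<le> 2 * dist2 f f' + 2 * dist2 g g'"
proof -
  have "dist2 (\<lambda>p. f p + g p) (\<lambda>p. f' p + g' p) = dist2 (\<lambda>p. f p - f' p) (\<lambda>p. g' p - g p)"
    unfolding dist2_def by (intro arg_cong[of _ _ "integral\<^sup>L LO"] ext) (simp add: algebra_simps)
  also have "\<dots> \<le> 2 * dist2 (\<lambda>p. f p - f' p) (\<lambda>p. 0) + 2 * dist2 (\<lambda>p. 0) (\<lambda>p. g' p - g p)"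
    by (intro dist2_triangle L2_diff L2_zero assms)
  also have "\<dots> = 2 * dist2 f f' + 2 * dist2 g g'" by (simp add: dist2_def power2_commute[of "g' _"])
  finally show ?thesis .
qed

lemma app_add: assumes "app f" "app g" shows "app (\<lambda>p. f p + g p)"
  unfolding app_def
proof (intro conjI allI impI)
  show "L2 (\<lambda>p. f p + g p)" using assms by (auto simp: app_def intro: L2_add)
  fix e :: real assume e: "e > 0"
  obtain n a where na: "dist2 f (\<lambda>p. \<Sum>j<n. a j * es j p) < e / 4" using assms(1) e unfolding app_def by (elim conjE allE[of _ "e / 4"]) auto
  obtain m b where mb: "dist2 g (\<lambda>p. \<Sum>j<m. b j * es j p) < e / 4" using assms(2) e unfolding app_def by (elim conjE allE[of _ "e / 4"]) auto
  define c where "c j = (if j < n then a j else 0) + (if j < m then b j else 0)" for j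
  have "(\<Sum>j<max n m. c j * es j p) = (\<Sum>j<n. a j * es j p) + (\<Sum>j<m. b j * es j p)" for p
  proof -
    have "(\<Sum>j<max n m. c j * es j p) = (\<Sum>j<max n m. (if j < n then a j * es j p else 0)) + (\<Sum>j<max n m. (if j < m then b j * es j p else 0))"
      unfolding sum.distrib[symmetric] by (intro sum.cong) (auto simp: c_def algebra_simps)
    also have "(\<Sum>j<max n m. (if j < n then a j * es j p else 0)) = (\<Sum>j<n. a j * es j p)"
      by (subst sum.inter_filter[symmetric]) (auto intro!: sum.cong)
    also have "(\<Sum>j<max n m. (if j < m then b j * es j p else 0)) = (\<Sum>j<m. b j * es j p)"
      by (subst sum.inter_filter[symmetric]) (auto intro!: sum.cong)
    finally show ?thesis .
  qed
  moreover have "dist2 (\<lambda>p. f p + g p) (\<lambda>p. (\<Sum>j<n. a j * es j p) + (\<Sum>j<m. b j * es j p)) \<le> 2 * dist2 f (\<lambda>p. \<Sum>j<n. a j * es j p) + 2 * dist2 g (\<lambda>p. \<Sum>j<m. b j * es j p)"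
    using assms by (intro dist2_add_le comb_L2) (auto simp: app_def)
  ultimately have "dist2 (\<lambda>p. f p + g p) (\<lambda>p. \<Sum>j<max n m. c j * es j p) < e" using na mb by simp
  then show "\<exists>n a. dist2 (\<lambda>p. f p + g p) (\<lambda>p. \<Sum>j<n. a j * es j p) < e" by blast
qed

lemma app_zero: "app (\<lambda>p. 0)"
  unfolding app_def by (intro conjI L2_zero allI impI exI[of _ 0] exI[of _ "\<lambda>_. 0"]) (simp add: dist2_def)

lemma app_sum: "(\<And>i. i \<in> A \<Longrightarrow> app (f i)) \<Longrightarrow> app (\<lambda>p. \<Sum>i\<in>A. f i p)"
  by (induction A rule: infinite_finite_induct) (auto intro: app_zero app_add)

lemma app_ef: "app (\<lambda>p. c * ef m k p)"
  unfolding app_def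
proof (intro conjI allI impI)
  show "L2 (\<lambda>p. c * ef m k p)" by (intro L2_scale ef_L2)
  fix e :: real assume e: "e > 0"
  let ?j = "prod_encode (m, k)"
  have "(\<Sum>j<Suc ?j. (if j = ?j then c else 0) * es j p) = c * ef m k p" for p
  proof -
    have "(\<Sum>j<Suc ?j. (if j = ?j then c else 0) * es j p) = (\<Sum>j<Suc ?j. if j = ?j then c * es ?j p else 0)"
      by (intro sum.cong) auto
    then show ?thesis by (simp add: es_def)
  qed
  then have "dist2 (\<lambda>p. c * ef m k p) (\<lambda>p. \<Sum>j<Suc ?j. (if j = ?j then c else 0) * es j p) = 0" by (simp only: dist2_def) simp
  then show "\<exists>n a. dist2 (\<lambda>p. c * ef m k p) (\<lambda>p. \<Sum>j<n. a j * es j p) < e" using e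
    by (intro exI[of _ "Suc ?j"] exI[of _ "\<lambda>j. if j = ?j then c else 0"]) simp
qed

lemma dist2_tensor_left:
  assumes "continuous_on {-1..1} f" "continuous_on {-1..1} f'" "continuous_on {0..1} g"
  shows "dist2 (tensor f g) (tensor f' g) = integral {-1..1} (\<lambda>x. (f x - f' x)^2) * integral {0..1} (\<lambda>y. (g y)^2)"
proof -
  have "dist2 (tensor f g) (tensor f' g) = integral\<^sup>L LO (\<lambda>p. (f (fst p) - f' (fst p))^2 * (g (snd p))^2)"
    unfolding dist2_def tensor_def by (simp add: left_diff_distrib[symmetric] power_mult_distrib)
  also have "\<dots> = integral {-1..1} (\<lambda>x. (f x - f' x)^2) * integral {0..1} (\<lambda>y. (g y)^2)"
    by (rule integral_Omega_tensor[of "\<lambda>x. (f x - f' x)^2" "\<lambda>y. (g y)^2"]) (intro continuous_intros assms)+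
  finally show ?thesis .
qed

lemma dist2_tensor_right:
  assumes "continuous_on {-1..1} f" "continuous_on {0..1} g" "continuous_on {0..1} g'"
  shows "dist2 (tensor f g) (tensor f g') = integral {-1..1} (\<lambda>x. (f x)^2) * integral {0..1} (\<lambda>y. (g y - g' y)^2)"
proof -
  have "dist2 (tensor f g) (tensor f g') = integral\<^sup>L LO (\<lambda>p. (f (fst p))^2 * (g (snd p) - g' (snd p))^2)"
    unfolding dist2_def tensor_def by (simp add: right_diff_distrib[symmetric] power_mult_distrib)
  also have "\<dots> = integral {-1..1} (\<lambda>x. (f x)^2) * integral {0..1} (\<lambda>y. (g y - g' y)^2)"
    by (rule integral_Omega_tensor[of "\<lambda>x. (f x)^2" "\<lambda>y. (g y - g' y)^2"]) (intro continuous_intros assms)+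
  finally show ?thesis .
qed

lemma app_tensor_s:
  assumes f: "continuous_on {-1..1} f" shows "app (tensor f (s m))"
proof (rule app_closed)
  show "L2 (tensor f (s m))" unfolding tensor_def by (intro continuous_L2 continuous_on_tensor f s_cont)
  fix e :: real assume e: "e > 0"
  obtain n a where na: "integral {-1..1} (\<lambda>x. (f x - (\<Sum>k<n. a k * v m k x))^2) < e" using v_dense[OF f e] by blast
  have "app (\<lambda>p. \<Sum>k<n. a k * ef m k p)" by (intro app_sum app_ef)
  moreover have "(\<lambda>p. \<Sum>k<n. a k * ef m k p) = tensor (\<lambda>x. \<Sum>k<n. a k * v m k x) (s m)"
    by (rule ext) (simp add: ef_def tensor_def sum_distrib_right mult.assoc)
  moreover have "dist2 (tensor f (s m)) (tensor (\<lambda>x. \<Sum>k<n. a k * v m k x) (s m)) < e"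
    using na s_orth[of m m] by (subst dist2_tensor_left) (auto intro!: f s_cont continuous_intros v_cont simp: power2_eq_square)
  ultimately show "\<exists>g. app g \<and> dist2 (tensor f (s m)) g < e" by auto
qed

lemma app_tensor:
  assumes f: "continuous_on {-1..1} f" and g: "continuous_on {0..1} g" shows "app (tensor f g)"
proof (rule app_closed)
  show "L2 (tensor f g)" unfolding tensor_def by (intro continuous_L2 continuous_on_tensor f g)
  fix e :: real assume e: "e > 0"
  let ?F = "integral {-1..1} (\<lambda>x. (f x)^2)"
  have F: "?F \<ge> 0" by (intro Henstock_Kurzweil_Integration.integral_nonneg integrable_continuous_real continuous_intros f) auto
  have "e / (?F + 1) > 0" using e F by simp
  then obtain n b where nb: "integral {0..1} (\<lambda>x. (g x - (\<Sum>k<n. b k * s k x))^2) < e / (?F + 1)" using s_dense[OF g] by blast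
  let ?g = "\<lambda>x. \<Sum>k<n. b k * s k x"
  have cg: "continuous_on {0..1} ?g" by (intro continuous_intros s_cont)
  have "app (\<lambda>p. \<Sum>k<n. tensor (\<lambda>x. b k * f x) (s k) p)" by (intro app_sum app_tensor_s continuous_intros f)
  moreover have "(\<lambda>p. \<Sum>k<n. tensor (\<lambda>x. b k * f x) (s k) p) = tensor f ?g"
    by (rule ext) (simp add: tensor_def sum_distrib_left mult_ac)
  moreover have "dist2 (tensor f g) (tensor f ?g) < e"
  proof -
    have "dist2 (tensor f g) (tensor f ?g) = ?F * integral {0..1} (\<lambda>x. (g x - ?g x)^2)" by (rule dist2_tensor_right[OF f g cg])
    also have "\<dots> \<le> ?F * (e / (?F + 1))" using nb F by (intro mult_left_mono) auto
    also have "\<dots> < (?F + 1) * (e / (?F + 1))" using e F by (intro mult_strict_right_mono) auto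
    also have "\<dots> = e" using F by simp
    finally show ?thesis .
  qed
  ultimately show "\<exists>h. app h \<and> dist2 (tensor f g) h < e" by auto
qed

lemma app_tensor_sum: "tensor_sum f \<Longrightarrow> app f"
proof (induction rule: tensor_sum.induct)
  case (base F G)
  then show ?case using app_tensor[of F G] continuous_on_subset[of UNIV] by (auto simp: tensor_def[abs_def])
qed (rule app_add)

text \<open>L2 functions are reduced to continuous ones, these to polynomials by Stone-Weierstrass,
  and these to products. Each product is expanded first in the s_m and then, for every m separately,
  in x, because the basis in x depends on m.\<close>

theorem es_dense: assumes "L2 f" shows "app f"
proof (rule app_closed[OF assms])
  fix e :: real assume e: "e > 0"
  then obtain g where g: "continuous_on UNIV g" "dist2 f g < e / 4" using L2_approx_continuous[OF assms, of "e / 4"] by auto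
  define d where "d = sqrt (e / 16)"
  have d: "d > 0" "d^2 = e / 16" using e by (auto simp: d_def)
  have cg: "continuous_on box2 g" by (rule continuous_on_subset[OF g(1)]) simp
  obtain h where h: "polynomial_function h" "\<And>x. x \<in> box2 \<Longrightarrow> norm (g x - h x) < d"
    using Stone_Weierstrass_polynomial_function[OF compact_cbox cg d(1)] by blast
  have ts: "tensor_sum h" using h(1) by (intro polynomial_tensor_sum) (simp add: real_polynomial_function_eq)
  have Lh: "L2 h" using app_tensor_sum[OF ts] by (simp add: app_def)
  have Lg: "L2 g" by (rule continuous_L2[OF cg])
  have "dist2 g h \<le> 2 * d^2"
    using h(2) Omega_subset_box2 by (intro dist2_le_of_uniform Lg Lh) (auto intro: less_imp_le)
  then have "dist2 f h < e" using dist2_triangle[OF assms Lg Lh] g(2) d e by simp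
  then show "\<exists>g. app g \<and> dist2 f g < e" using app_tensor_sum[OF ts] by blast
qed

text \<open>f is then orthogonal to all its approximants, so its norm is at most its distance to
  them. This is what makes weak solutions unique.\<close>

lemma orth_imp_null:
  assumes f: "L2 f" and z: "\<And>j. ip f (es j) = 0" shows "AE p in LO. f p = 0"
proof -
  have "ip f f \<le> e" if e: "e > 0" for e
  proof -
    obtain n a where na: "dist2 f (\<lambda>p. \<Sum>j<n. a j * es j p) < e" using es_dense[OF f] e by (auto simp: app_def)
    let ?g = "\<lambda>p. \<Sum>j<n. a j * es j p"
    have "ip ?g f = 0" using z by (subst ip_sum) (auto simp: ip_scale ip_commute[of "es _" f] intro: L2_scale es_L2 f)
    then have "ip f f = ip (\<lambda>p. f p - ?g p) f" using ip_diff[OF f comb_L2 f] by simp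
    then have "(ip f f)^2 \<le> dist2 f ?g * ip f f"
      using ip_cauchy_schwarz[OF L2_diff[OF f comb_L2] f] by (simp add: dist2_ip)
    then have "ip f f \<le> dist2 f ?g" using ip_nonneg[of f] dist2_nonneg[of f ?g]
      by (cases "ip f f = 0") (auto simp: power2_eq_square mult_le_cancel_right)
    then show ?thesis using na by simp
  qed
  then have "ip f f = 0" using ip_nonneg[of f] field_le_epsilon[of "ip f f" 0] by fastforce
  then show ?thesis by (rule ip_self_eq_0_imp_AE[OF f])
qed

lemma dist2_comb:
  assumes f: "L2 f"
  shows "dist2 f (\<lambda>p. \<Sum>j<n. a j * es j p) = ip f f - (\<Sum>j<n. (ip f (es j))^2) + (\<Sum>j<n. (a j - ip f (es j))^2)"
proof -
  let ?g = "\<lambda>p. \<Sum>j<n. a j * es j p"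
  have gh: "ip ?g h = (\<Sum>j<n. a j * ip (es j) h)" if "L2 h" for h
    using that by (subst ip_sum) (auto simp: ip_scale intro: L2_scale es_L2)
  have ge: "ip ?g (es i) = a i" if "i < n" for i
  proof -
    have "(\<Sum>j<n. a j * ip (es j) (es i)) = (\<Sum>j<n. if j = i then a i else 0)" by (intro sum.cong) (auto simp: es_orth)
    then show ?thesis using that by (simp add: gh es_L2)
  qed
  have gg: "ip ?g ?g = (\<Sum>j<n. (a j)^2)"
    using gh[OF comb_L2] ge by (simp add: ip_commute[of "es _" ?g] power2_eq_square)
  have gf: "ip ?g f = (\<Sum>j<n. a j * ip f (es j))" using gh[OF f] by (simp add: ip_commute)
  have "dist2 f ?g = ip (\<lambda>p. f p - ?g p) f - ip (\<lambda>p. f p - ?g p) ?g"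
    unfolding dist2_ip by (subst ip_commute, subst ip_diff[OF f comb_L2 L2_diff[OF f comb_L2]]) (simp only: ip_commute)
  also have "\<dots> = ip f f - 2 * ip ?g f + ip ?g ?g"
    by (simp only: ip_diff[OF f comb_L2 f] ip_diff[OF f comb_L2 comb_L2] ip_commute[of f ?g])
  also have "\<dots> = ip f f - (\<Sum>j<n. (ip f (es j))^2) + (\<Sum>j<n. (a j - ip f (es j))^2)"
    unfolding gg gf by (simp add: power2_diff sum.distrib sum_subtractf sum_distrib_left[symmetric] mult.assoc)
  finally show ?thesis .
qed

lemma bessel: assumes "L2 f" shows "(\<Sum>j<n. (ip f (es j))^2) \<le> ip f f"
  using dist2_comb[OF assms, of "\<lambda>j. ip f (es j)" n] dist2_nonneg[of f "\<lambda>p. \<Sum>j<n. ip f (es j) * es j p"] by simp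

lemma parseval:
  assumes f: "L2 f"
  shows "(\<lambda>n. dist2 f (\<lambda>p. \<Sum>j<n. ip f (es j) * es j p)) \<longlonglongrightarrow> 0"
proof (rule LIMSEQ_I)
  fix e :: real assume e: "e > 0"
  then obtain N a where Na: "dist2 f (\<lambda>p. \<Sum>j<N. a j * es j p) < e" using es_dense[OF f] by (auto simp: app_def)
  show "\<exists>no. \<forall>n\<ge>no. norm (dist2 f (\<lambda>p. \<Sum>j<n. ip f (es j) * es j p) - 0) < e"
  proof (intro exI allI impI)
    fix n assume n: "n \<ge> N"
    have "(\<Sum>j<N. (ip f (es j))^2) \<le> (\<Sum>j<n. (ip f (es j))^2)" using n by (intro sum_mono2) auto
    moreover have "0 \<le> (\<Sum>j<N. (a j - ip f (es j))^2)" by (intro sum_nonneg) auto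
    ultimately have "dist2 f (\<lambda>p. \<Sum>j<n. ip f (es j) * es j p) < e"
      using Na by (simp add: dist2_comb[OF f])
    then show "norm (dist2 f (\<lambda>p. \<Sum>j<n. ip f (es j) * es j p) - 0) < e" using dist2_nonneg by simp
  qed
qed

end

section \<open>Control of a single mode by flatness\<close>

lemma has_real_derivative_suminf:
  fixes f f' :: "nat \<Rightarrow> real \<Rightarrow> real"
  assumes S: "convex S" and d: "\<And>n x. x \<in> S \<Longrightarrow> (f n has_real_derivative f' n x) (at x within S)"
    and b: "\<And>n x. x \<in> S \<Longrightarrow> \<bar>f n x\<bar> \<le> N n" "summable N"
    and b': "\<And>n x. x \<in> S \<Longrightarrow> \<bar>f' n x\<bar> \<le> M n" "summable M" and x: "x \<in> S"
  shows "((\<lambda>x. \<Sum>n. f n x) has_real_derivative (\<Sum>n. f' n x)) (at x within S)"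
proof -
  have u: "uniform_limit S (\<lambda>n x. \<Sum>i<n. f' i x) (\<lambda>x. \<Sum>n. f' n x) sequentially"
    by (rule Weierstrass_m_test[OF _ b'(2)]) (simp add: b'(1))
  have sm: "summable (\<lambda>n. f n x)" by (rule summable_comparison_test'[OF b(2), of 0]) (simp add: b(1)[OF x])
  obtain g where g: "\<And>x. x \<in> S \<Longrightarrow> (\<lambda>n. f n x) sums g x" "\<And>x. x \<in> S \<Longrightarrow> (g has_real_derivative (\<Sum>n. f' n x)) (at x within S)"
    using has_field_derivative_series[OF S d u x sm] by blast
  show ?thesis
    by (rule has_field_derivative_transform_within[OF g(2)[OF x] zero_less_one x]) (use g(1) in \<open>auto simp: sums_iff\<close>)
qed

lemma continuous_on_suminf:
  fixes f :: "nat \<Rightarrow> 'a::topological_space \<Rightarrow> real"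
  assumes "\<And>n. continuous_on S (f n)" "\<And>n x. x \<in> S \<Longrightarrow> \<bar>f n x\<bar> \<le> N n" "summable N"
  shows "continuous_on S (\<lambda>x. \<Sum>n. f n x)"
proof (rule uniform_limit_theorem)
  show "uniform_limit S (\<lambda>n x. \<Sum>i<n. f i x) (\<lambda>x. \<Sum>n. f n x) sequentially"
    by (rule Weierstrass_m_test[OF _ assms(3)]) (simp add: assms(2))
  show "\<forall>\<^sub>F n in sequentially. continuous_on S (\<lambda>x. \<Sum>i<n. f i x)"
    using assms(1) by (intro always_eventually allI continuous_intros)
qed simp

lemma abs_suminf_le:
  fixes f :: "nat \<Rightarrow> real"
  assumes "\<And>n. \<bar>f n\<bar> \<le> N n" "summable N"
  shows "\<bar>\<Sum>n. f n\<bar> \<le> (\<Sum>n. N n)"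
proof -
  have s: "summable (\<lambda>n. \<bar>f n\<bar>)" by (rule summable_comparison_test'[OF assms(2), of 0]) (simp add: assms(1))
  have "\<bar>\<Sum>n. f n\<bar> \<le> (\<Sum>n. \<bar>f n\<bar>)" by (rule summable_rabs[OF s])
  also have "\<dots> \<le> (\<Sum>n. N n)" by (rule suminf_le[OF assms(1) s assms(2)])
  finally show ?thesis .
qed

lemma C2_on_reflect:
  assumes "C2_on (-1) 1 w w1 w2"
  shows "C2_on (-1) 1 (\<lambda>x. w (- x)) (\<lambda>x. - w1 (- x)) (\<lambda>x. w2 (- x))"
proof -
  have refl: "((\<lambda>x. f (- x)) has_real_derivative - f' (- x)) (at x within {-1..1})"
    if "\<And>x. x \<in> {-1..1} \<Longrightarrow> (f has_real_derivative f' x) (at x within {-1..1})" "x \<in> {-1..1}" for f f' and x :: real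
  proof -
    have "(f has_real_derivative f' (- x)) (at (- x) within uminus ` {-1..1})" using that(1)[of "- x"] that(2) by simp
    moreover have "(uminus has_real_derivative - 1) (at x within {-1..1})" by (auto intro!: derivative_eq_intros)
    ultimately show ?thesis using DERIV_image_chain[of f "f' (- x)" uminus x "{-1..1}" "- 1"] by (simp add: o_def)
  qed
  have c: "continuous_on {-1..1} (\<lambda>x. w2 (- x))"
    by (rule continuous_on_compose2[OF C2_onD(5)[OF assms]]) (auto intro!: continuous_intros)
  show ?thesis unfolding C2_on_def
  proof (intro conjI ballI c)
    fix x :: real assume x: "x \<in> {-1..1}"
    show "((\<lambda>x. w (- x)) has_real_derivative - w1 (- x)) (at x within {-1..1})" using refl[OF C2_onD(1)[OF assms] x] by simp
    show "((\<lambda>x. - w1 (- x)) has_real_derivative w2 (- x)) (at x within {-1..1})"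
      using DERIV_minus[OF refl[OF C2_onD(2)[OF assms] x]] by simp
  qed
qed

text \<open>Solutions of g_t = g_xx - p g with p = q - lam: the decay exp(-lam t) has been factored
  out, so that the eigenfunction v is stationary until T1. No boundary condition is part of the
  predicate; it will hold at one end only, the free end leaving room to reach zero.\<close>

definition heat_ext where
  "heat_ext p T1 T2 v v1 B g gx gt \<longleftrightarrow>
    (\<forall>t. C2_on (-1) 1 (g t) (gx t) (\<lambda>x. p x * g t x + gt t x)) \<and>
    (\<forall>t. \<forall>x\<in>{-1..1}. ((\<lambda>t. g t x) has_real_derivative gt t x) (at t)) \<and>
    continuous_on (UNIV \<times> {-1..1}) (\<lambda>z. g (fst z) (snd z)) \<and> continuous_on (UNIV \<times> {-1..1}) (\<lambda>z. gx (fst z) (snd z)) \<and>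
    continuous_on (UNIV \<times> {-1..1}) (\<lambda>z. gt (fst z) (snd z)) \<and>
    (\<forall>t. \<forall>x\<in>{-1..1}. \<bar>g t x\<bar> \<le> B \<and> \<bar>gx t x\<bar> \<le> B \<and> \<bar>gt t x\<bar> \<le> B) \<and>
    (\<forall>t\<le>T1. \<forall>x\<in>{-1..1}. g t x = v x \<and> gx t x = v1 x \<and> gt t x = 0) \<and>
    (\<forall>t\<ge>T2. \<forall>x\<in>{-1..1}. g t x = 0 \<and> gx t x = 0 \<and> gt t x = (0 :: real))"

text \<open>Each member solves the inhomogeneous equation with the previous one as source and zero
  initial data at -1. The bound is the Volterra majorant with x + 1 \<le> 2, so 4^j appears, while
  exp(2 K) occurs once for all j.\<close>

lemma volterra_tower:
  assumes p: "continuous_on {-1..1} p" and K: "K \<ge> 0" "\<And>x. x \<in> {-1..1} \<Longrightarrow> \<bar>p x\<bar> \<le> K^2"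
    and v: "C2_on (-1) 1 v v1 (\<lambda>x. p x * v x)" "v (-1) = 0" "v 1 = 0" and M: "M \<ge> 0" "\<And>x. x \<in> {-1..1} \<Longrightarrow> \<bar>v x\<bar> \<le> M"
  obtains \<Theta> \<Theta>1 :: "nat \<Rightarrow> real \<Rightarrow> real" where "\<Theta> 0 = v" "\<Theta>1 0 = v1"
    "\<And>j. C2_on (-1) 1 (\<Theta> (Suc j)) (\<Theta>1 (Suc j)) (\<lambda>x. p x * \<Theta> (Suc j) x + \<Theta> j x)"
    "\<And>j. \<Theta> j (-1) = 0"
    "\<And>j x. x \<in> {-1..1} \<Longrightarrow> \<bar>\<Theta> j x\<bar> \<le> M * exp (2 * K) * (4 ^ j / fact (2 * j))"
    "\<And>x. x \<in> {-1..1} \<Longrightarrow> \<bar>\<Theta>1 0 x\<bar> \<le> 2 * K^2 * (M * exp (2 * K))"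
    "\<And>j x. x \<in> {-1..1} \<Longrightarrow> \<bar>\<Theta>1 (Suc j) x\<bar> \<le> M * exp (2 * K) * (2 * K^2 * (4 ^ Suc j / fact (2 * Suc j)) + 2 * (4 ^ j / fact (2 * j)))"
proof -
  define ok where "ok j f \<longleftrightarrow> continuous_on {-1..1} f \<and> (\<forall>x\<in>{-1..1}. \<bar>f x\<bar> \<le> M * exp (K * (x - (-1))) * ((x - (-1)) ^ (2 * j) / fact (2 * j)))" for j :: nat and f :: "real \<Rightarrow> real"
  define rel where "rel f w w1 \<longleftrightarrow> C2_on (-1) 1 w w1 (\<lambda>x. p x * w x + f x) \<and> w (-1) = 0 \<and> w1 (-1) = (0 :: real)" for f w w1
  have step: "\<exists>w'. ok (Suc j) (fst w') \<and> rel (fst w) (fst w') (snd w')" if "ok j (fst w)" for j and w :: "(real \<Rightarrow> real) \<times> (real \<Rightarrow> real)"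
  proof -
    have c: "continuous_on {-1..1} (fst w)" and b: "\<And>x. x \<in> {-1..1} \<Longrightarrow> \<bar>fst w x\<bar> \<le> M * exp (K * (x - (-1))) * ((x - (-1)) ^ (2 * j) / fact (2 * j))"
      using that by (auto simp: ok_def)
    obtain u u1 where u: "C2_on (-1) 1 u u1 (\<lambda>x. p x * u x + fst w x)" "u (-1) = 0" "u1 (-1) = 0"
      "\<And>x. x \<in> {-1..1} \<Longrightarrow> \<bar>u x\<bar> \<le> M * exp (K * (x - (-1))) * ((x - (-1)) ^ Suc (Suc (2 * j)) / fact (Suc (Suc (2 * j))))"
      by (rule volterra_exists[OF _ p c K b M(1)]) auto
    have "ok (Suc j) u" unfolding ok_def using C2_onD(3)[OF u(1)] u(4) by simp
    then show ?thesis using u by (intro exI[of _ "(u, u1)"]) (simp add: rel_def)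
  qed
  have ok0: "ok 0 v" unfolding ok_def
  proof (intro conjI ballI C2_onD(3)[OF v(1)])
    fix x :: real assume x: "x \<in> {-1..1}"
    have "M * 1 \<le> M * exp (K * (x - (-1)))" using M K x by (intro mult_left_mono) auto
    then show "\<bar>v x\<bar> \<le> M * exp (K * (x - (-1))) * ((x - (-1)) ^ (2 * 0) / fact (2 * 0))" using M(2)[OF x] by simp
  qed
  have "\<exists>f. \<forall>n. ok n (fst (f n)) \<and> (n = 0 \<longrightarrow> f n = (v, v1)) \<and> rel (fst (f n)) (fst (f (Suc n))) (snd (f (Suc n)))"
  proof (rule dependent_nat_choice[where P = "\<lambda>n z. ok n (fst z) \<and> (n = 0 \<longrightarrow> z = (v, v1))" and Q = "\<lambda>n z z'. rel (fst z) (fst z') (snd z')", THEN ex_forward])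
    show "\<exists>x. ok 0 (fst x) \<and> (0 = 0 \<longrightarrow> x = (v, v1))" using ok0 by auto
    show "\<exists>y. (ok (Suc n) (fst y) \<and> (Suc n = 0 \<longrightarrow> y = (v, v1))) \<and> rel (fst x) (fst y) (snd y)" if "ok n (fst x) \<and> (n = 0 \<longrightarrow> x = (v, v1))" for x n
      using step[of n x] that by auto
  qed auto
  then obtain f where f: "\<And>n. ok n (fst (f n))" "f 0 = (v, v1)" "\<And>n. rel (fst (f n)) (fst (f (Suc n))) (snd (f (Suc n)))"
    by blast
  define \<Theta> where "\<Theta> n = fst (f n)" for n
  define \<Theta>1 where "\<Theta>1 n = snd (f n)" for n
  have b: "\<bar>\<Theta> j x\<bar> \<le> M * exp (2 * K) * (4 ^ j / fact (2 * j))" if x: "x \<in> {-1..1}" for j x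
  proof -
    have "\<bar>\<Theta> j x\<bar> \<le> M * exp (K * (x - (-1))) * ((x - (-1)) ^ (2 * j) / fact (2 * j))" using f(1)[of j] x by (auto simp: ok_def \<Theta>_def)
    also have "\<dots> \<le> M * exp (2 * K) * (2 ^ (2 * j) / fact (2 * j))"
    proof (intro mult_mono divide_right_mono power_mono)
      show "exp (K * (x - (-1))) \<le> exp (2 * K)" using K x mult_left_mono[of "x - (-1)" 2 K] by (simp add: mult.commute)
    qed (use x M in auto)
    finally show ?thesis by (simp add: power_mult)
  qed
  have C2: "C2_on (-1) 1 (\<Theta> (Suc j)) (\<Theta>1 (Suc j)) (\<lambda>x. p x * \<Theta> (Suc j) x + \<Theta> j x)" for j
    using f(3)[of j] by (simp add: rel_def \<Theta>_def \<Theta>1_def)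
  show thesis
  proof
    show "\<Theta> 0 = v" "\<Theta>1 0 = v1" using f(2) by (auto simp: \<Theta>_def \<Theta>1_def)
    show "C2_on (-1) 1 (\<Theta> (Suc j)) (\<Theta>1 (Suc j)) (\<lambda>x. p x * \<Theta> (Suc j) x + \<Theta> j x)" for j by (rule C2)
    show "\<Theta> j (-1) = 0" for j using f(2) v f(3)[of "j - 1"] by (cases j) (auto simp: \<Theta>_def rel_def)
    show "\<bar>\<Theta> j x\<bar> \<le> M * exp (2 * K) * (4 ^ j / fact (2 * j))" if "x \<in> {-1..1}" for j x by (rule b[OF that])
    show "\<bar>\<Theta>1 0 x\<bar> \<le> 2 * K^2 * (M * exp (2 * K))" if x: "x \<in> {-1..1}" for x
    proof -
      have int: "(v has_real_derivative v1 z) (at z)" if "-1 < z" "z < 1" for z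
      proof -
        have "at z within {-1..1} = at z" using that by (intro at_within_interior) auto
        then show ?thesis using C2_onD(1)[OF v(1), of z] that by simp
      qed
      \<comment> \<open>v1 has no zero prescribed at -1, unlike the later members; Rolle's theorem
        supplies an interior zero from which to integrate v'' instead.\<close>
      obtain z where z: "-1 < z" "z < 1" "(v has_real_derivative 0) (at z)"
        using Rolle[of "-1" 1 v] v(2,3) C2_onD(3)[OF v(1)] int real_differentiable_def by (metis one_neq_neg_one less_minus_one_simps(1) order.strict_trans zero_less_one)
      have v1z: "v1 z = 0" using DERIV_unique[OF int z(3)] z by simp
      have pv: "\<bar>p y * v y\<bar> \<le> K^2 * M" if "y \<in> {-1..1}" for y
        unfolding abs_mult using K(2)[OF that] M(2)[OF that] by (intro mult_mono) auto
      have "\<bar>v1 x - v1 z\<bar> \<le> (K^2 * M) * \<bar>x - z\<bar>"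
        using field_differentiable_bound[OF _ C2_onD(2)[OF v(1)], of "K^2 * M" x z] pv x z by auto
      also have "\<dots> \<le> (K^2 * M) * 2" using x z M by (intro mult_left_mono) auto
      also have "\<dots> \<le> 2 * K^2 * (M * exp (2 * K))"
      proof -
        have "M * 1 \<le> M * exp (2 * K)" using M K by (intro mult_left_mono) auto
        then have "K^2 * M \<le> K^2 * (M * exp (2 * K))" by (intro mult_left_mono) auto
        then show ?thesis by linarith
      qed
      finally show ?thesis using v1z f(2) by (simp add: \<Theta>1_def)
    qed
    show "\<bar>\<Theta>1 (Suc j) x\<bar> \<le> M * exp (2 * K) * (2 * K^2 * (4 ^ Suc j / fact (2 * Suc j)) + 2 * (4 ^ j / fact (2 * j)))" if x: "x \<in> {-1..1}" for j x
    proof -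
      define E where "E = M * exp (2 * K)"
      define A where "A = (4 ^ Suc j / fact (2 * Suc j) :: real)"
      define B where "B = (4 ^ j / fact (2 * j) :: real)"
      define c where "c = K^2 * (E * A) + E * B"
      have nn: "E \<ge> 0" "A \<ge> 0" "B \<ge> 0" using M unfolding E_def A_def B_def by (intro mult_nonneg_nonneg divide_nonneg_nonneg; simp)+
      then have c0: "c \<ge> 0" unfolding c_def by simp
      have "\<bar>p y * \<Theta> (Suc j) y + \<Theta> j y\<bar> \<le> c" if y: "y \<in> {-1..1}" for y
      proof -
        have "\<bar>p y * \<Theta> (Suc j) y\<bar> \<le> K^2 * (E * A)"
          unfolding abs_mult using K(2)[OF y] b[OF y, of "Suc j", folded E_def A_def] by (intro mult_mono) auto
        then show ?thesis using b[OF y, of j, folded E_def B_def] unfolding c_def by linarith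
      qed
      then have "norm (\<Theta>1 (Suc j) x - \<Theta>1 (Suc j) (-1)) \<le> c * norm (x - (-1))"
        using x by (intro field_differentiable_bound[OF _ C2_onD(2)[OF C2[of j]], of c x "-1"]) auto
      also have "\<dots> \<le> c * 2" using x c0 by (intro mult_left_mono) auto
      also have "\<dots> = E * (2 * K^2 * A + 2 * B)" unfolding c_def by (simp add: algebra_simps)
      finally have "\<bar>\<Theta>1 (Suc j) x\<bar> \<le> E * (2 * K^2 * A + 2 * B)"
        using f(3)[of j] unfolding rel_def \<Theta>1_def real_norm_def by simp
      then show ?thesis by (simp only: E_def A_def B_def)
    qed
  qed
qed

text \<open>The flatness series, the sum of D j (t) \<Theta> j (x). Its second x-derivative is p g
  plus the series with the index of \<Theta> lowered by one, which is the time derivative of g.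
  Outside (T1,T2) only \<open>D 0\<close> can survive, leaving v or 0. The majorant \<beta> has to
  serve both \<open>D j\<close> and \<open>D (Suc j)\<close>, for g and for its time
  derivative.\<close>

lemma heat_ext_left:
  fixes D :: "nat \<Rightarrow> real \<Rightarrow> real"
  assumes D: "\<And>j t. (D j has_real_derivative D (Suc j) t) (at t)" "\<And>t. t \<le> T1 \<Longrightarrow> D 0 t = 1" "\<And>t. t \<ge> T2 \<Longrightarrow> D 0 t = 0"
      "\<And>j t. t \<le> T1 \<or> T2 \<le> t \<Longrightarrow> D (Suc j) t = 0"
    and \<beta>: "summable \<beta>" "\<And>j t. \<bar>D j t\<bar> * (4 ^ j / fact (2 * j)) \<le> \<beta> j" "\<And>j t. \<bar>D (Suc j) t\<bar> * (4 ^ j / fact (2 * j)) \<le> \<beta> j"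
    and p: "continuous_on {-1..1} p" and K: "K \<ge> 0" "\<And>x. x \<in> {-1..1} \<Longrightarrow> \<bar>p x\<bar> \<le> K^2"
    and v: "C2_on (-1) 1 v v1 (\<lambda>x. p x * v x)" "v (-1) = 0" "v 1 = 0" and M: "M \<ge> 0" "\<And>x. x \<in> {-1..1} \<Longrightarrow> \<bar>v x\<bar> \<le> M"
  shows "\<exists>g gx gt. heat_ext p T1 T2 v v1 (M * exp (2 * K) * ((2 * K^2 + 2) * suminf \<beta>)) g gx gt \<and> (\<forall>t. g t (-1) = 0)"
proof -
  obtain \<Theta> \<Theta>1 where T: "\<Theta> 0 = v" "\<Theta>1 0 = v1"
    "\<And>j. C2_on (-1) 1 (\<Theta> (Suc j)) (\<Theta>1 (Suc j)) (\<lambda>x. p x * \<Theta> (Suc j) x + \<Theta> j x)"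
    "\<And>j. \<Theta> j (-1) = 0"
    "\<And>j x. x \<in> {-1..1} \<Longrightarrow> \<bar>\<Theta> j x\<bar> \<le> M * exp (2 * K) * (4 ^ j / fact (2 * j))"
    "\<And>x. x \<in> {-1..1} \<Longrightarrow> \<bar>\<Theta>1 0 x\<bar> \<le> 2 * K^2 * (M * exp (2 * K))"
    "\<And>j x. x \<in> {-1..1} \<Longrightarrow> \<bar>\<Theta>1 (Suc j) x\<bar> \<le> M * exp (2 * K) * (2 * K^2 * (4 ^ Suc j / fact (2 * Suc j)) + 2 * (4 ^ j / fact (2 * j)))"
    using volterra_tower[OF p K v M] by blast
  define E where "E = M * exp (2 * K)"
  have E: "E \<ge> 0" using M by (simp add: E_def)
  have \<beta>0: "\<beta> j \<ge> 0" for j by (rule order_trans[OF _ \<beta>(2)[of j 0]]) simp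
  have S0: "suminf \<beta> \<ge> 0" using \<beta>(1) \<beta>0 by (rule suminf_nonneg)
  define \<theta>2 where "\<theta>2 j x = p x * \<Theta> j x + (case j of 0 \<Rightarrow> 0 | Suc i \<Rightarrow> \<Theta> i x)" for j x
  have dT: "(\<Theta> j has_real_derivative \<Theta>1 j x) (at x within {-1..1})" "(\<Theta>1 j has_real_derivative \<theta>2 j x) (at x within {-1..1})" if "x \<in> {-1..1}" for j x
  proof -
    have "(\<Theta> j has_real_derivative \<Theta>1 j x) (at x within {-1..1}) \<and> (\<Theta>1 j has_real_derivative \<theta>2 j x) (at x within {-1..1})"
    proof (cases j)
      case 0
      then show ?thesis using C2_onD(1,2)[OF v(1) that] T(1,2) by (simp add: \<theta>2_def)
    next
      case (Suc i)
      then show ?thesis using C2_onD(1,2)[OF T(3) that] by (simp add: \<theta>2_def)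
    qed
    then show "(\<Theta> j has_real_derivative \<Theta>1 j x) (at x within {-1..1})" "(\<Theta>1 j has_real_derivative \<theta>2 j x) (at x within {-1..1})" by auto
  qed
  have cT: "continuous_on {-1..1} (\<Theta> j)" "continuous_on {-1..1} (\<Theta>1 j)" for j
    using DERIV_continuous_on[OF dT(1)] DERIV_continuous_on[OF dT(2)] by auto
  have cD: "continuous_on S (D j)" for S j by (rule DERIV_continuous_on[OF has_field_derivative_at_within[OF D(1)]])
  \<comment> \<open>The bound on \<open>\<Theta>1 (Suc j)\<close> has a term of index j, so its
    majorant is \<beta> shifted by one place; the sum is unchanged.\<close>
  define sh where "sh j = (case j of 0 \<Rightarrow> 0 | Suc i \<Rightarrow> \<beta> i)" for j
  have sh: "summable sh" "suminf sh = suminf \<beta>"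
  proof -
    have "(\<lambda>n. sh (Suc n)) sums suminf \<beta>" using \<beta>(1) by (simp add: sh_def summable_sums)
    then have "sh sums suminf \<beta>" by (subst (asm) sums_Suc_iff) (simp add: sh_def)
    then show "summable sh" "suminf sh = suminf \<beta>" by (auto simp: sums_iff)
  qed
  define bx where "bx j = E * (2 * K^2 * \<beta> j + 2 * sh j)" for j
  have bx: "summable bx" "suminf bx = E * ((2 * K^2 + 2) * suminf \<beta>)"
  proof -
    have "(\<lambda>j. E * (2 * K^2 * \<beta> j + 2 * sh j)) sums (E * (2 * K^2 * suminf \<beta> + 2 * suminf sh))"
      by (intro sums_mult sums_add summable_sums \<beta> sh)
    then show "summable bx" "suminf bx = E * ((2 * K^2 + 2) * suminf \<beta>)"
      unfolding bx_def by (auto simp: sums_iff sh algebra_simps)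
  qed
  have b0: "\<bar>D j t * \<Theta> j x\<bar> \<le> E * \<beta> j" if x: "x \<in> {-1..1}" for j t x
  proof -
    have "\<bar>D j t * \<Theta> j x\<bar> \<le> \<bar>D j t\<bar> * (E * (4 ^ j / fact (2 * j)))"
      unfolding abs_mult E_def using T(5)[OF x] by (intro mult_left_mono) auto
    also have "\<dots> = E * (\<bar>D j t\<bar> * (4 ^ j / fact (2 * j)))" by (simp only: mult_ac)
    also have "\<dots> \<le> E * \<beta> j" by (intro mult_left_mono \<beta> E)
    finally show ?thesis .
  qed
  have bt: "\<bar>D (Suc j) t * \<Theta> j x\<bar> \<le> E * \<beta> j" if x: "x \<in> {-1..1}" for j t x
  proof -
    have "\<bar>D (Suc j) t * \<Theta> j x\<bar> \<le> \<bar>D (Suc j) t\<bar> * (E * (4 ^ j / fact (2 * j)))"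
      unfolding abs_mult E_def using T(5)[OF x] by (intro mult_left_mono) auto
    also have "\<dots> = E * (\<bar>D (Suc j) t\<bar> * (4 ^ j / fact (2 * j)))" by (simp only: mult_ac)
    also have "\<dots> \<le> E * \<beta> j" by (intro mult_left_mono \<beta> E)
    finally show ?thesis .
  qed
  have b1: "\<bar>D j t * \<Theta>1 j x\<bar> \<le> bx j" if x: "x \<in> {-1..1}" for j t x
  proof (cases j)
    case 0
    have "\<bar>D j t * \<Theta>1 j x\<bar> \<le> \<bar>D 0 t\<bar> * (2 * K^2 * E)" unfolding abs_mult E_def 0 using T(6)[OF x] by (intro mult_left_mono) auto
    also have "\<dots> \<le> \<beta> 0 * (2 * K^2 * E)" using \<beta>(2)[of 0 t] E by (intro mult_right_mono) auto
    finally show ?thesis by (simp add: bx_def sh_def 0 algebra_simps)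
  next
    case (Suc i)
    have "\<bar>D j t * \<Theta>1 j x\<bar> \<le> \<bar>D j t\<bar> * (E * (2 * K^2 * (4 ^ j / fact (2 * j)) + 2 * (4 ^ i / fact (2 * i))))"
      unfolding abs_mult E_def Suc using T(7)[OF x, of i] by (intro mult_left_mono) auto
    also have "\<dots> = E * (2 * K^2 * (\<bar>D j t\<bar> * (4 ^ j / fact (2 * j))) + 2 * (\<bar>D (Suc i) t\<bar> * (4 ^ i / fact (2 * i))))"
    proof -
      have "d * (E * (2 * k * a + 2 * b)) = E * (2 * k * (d * a) + 2 * (d * b))" for k E a b d :: real by (simp add: algebra_simps)
      then show ?thesis unfolding Suc by blast
    qed
    also have "\<dots> \<le> E * (2 * K^2 * \<beta> j + 2 * \<beta> i)" by (intro mult_left_mono add_mono \<beta> E) auto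
    finally show ?thesis by (simp add: bx_def sh_def Suc)
  qed
  have b2: "\<bar>D j t * \<theta>2 j x\<bar> \<le> bx j" if x: "x \<in> {-1..1}" for j t x
  proof -
    have 1: "\<bar>D j t * (p x * \<Theta> j x)\<bar> \<le> K^2 * (E * \<beta> j)"
    proof -
      have "\<bar>D j t * (p x * \<Theta> j x)\<bar> = \<bar>p x\<bar> * \<bar>D j t * \<Theta> j x\<bar>" by (simp add: abs_mult)
      also have "\<dots> \<le> K^2 * (E * \<beta> j)" using K x b0[OF x] by (intro mult_mono) auto
      finally show ?thesis .
    qed
    have 2: "\<bar>D j t * (case j of 0 \<Rightarrow> 0 | Suc i \<Rightarrow> \<Theta> i x)\<bar> \<le> E * sh j" using bt[OF x] by (cases j) (auto simp: sh_def)
    have nn: "0 \<le> K^2 * (E * \<beta> j)" "0 \<le> E * sh j" using E \<beta>0 by (auto simp: sh_def split: nat.split)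
    have "\<bar>D j t * \<theta>2 j x\<bar> \<le> K^2 * (E * \<beta> j) + E * sh j" unfolding \<theta>2_def distrib_left using 1 2 by linarith
    also have "\<dots> \<le> 2 * (K^2 * (E * \<beta> j)) + 2 * (E * sh j)" using nn by linarith
    finally show ?thesis by (simp add: bx_def algebra_simps)
  qed
  have sE: "summable (\<lambda>j. E * \<beta> j)" by (intro summable_mult \<beta>)
  define g where "g t x = (\<Sum>j. D j t * \<Theta> j x)" for t x
  define gx where "gx t x = (\<Sum>j. D j t * \<Theta>1 j x)" for t x
  define gt where "gt t x = (\<Sum>j. D (Suc j) t * \<Theta> j x)" for t x
  have g2: "(\<Sum>j. D j t * \<theta>2 j x) = p x * g t x + gt t x" if x: "x \<in> {-1..1}" for t x
  proof -
    have s1: "(\<lambda>j. D j t * \<Theta> j x) sums g t x" unfolding g_def using b0[OF x] by (intro summable_sums summable_comparison_test'[OF sE, of 0]) simp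
    have "(\<lambda>j. D (Suc j) t * \<Theta> j x) sums gt t x" unfolding gt_def using bt[OF x] by (intro summable_sums summable_comparison_test'[OF sE, of 0]) simp
    then have s2: "(\<lambda>j. D j t * (case j of 0 \<Rightarrow> 0 | Suc i \<Rightarrow> \<Theta> i x)) sums gt t x"
      using sums_Suc_iff[of "\<lambda>j. D j t * (case j of 0 \<Rightarrow> 0 | Suc i \<Rightarrow> \<Theta> i x)" "gt t x"] by simp
    have "(\<lambda>j. p x * (D j t * \<Theta> j x) + D j t * (case j of 0 \<Rightarrow> 0 | Suc i \<Rightarrow> \<Theta> i x)) sums (p x * g t x + gt t x)"
      by (intro sums_add sums_mult s1 s2)
    then show ?thesis unfolding \<theta>2_def by (simp add: sums_iff algebra_simps)
  qed
  have c2: "continuous_on (UNIV \<times> {-1..1}) (\<lambda>z. D i (fst z) * f (snd z))" if "continuous_on {-1..1} f" for i f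
    by (intro continuous_on_mult continuous_on_compose2[OF cD] continuous_on_compose2[OF that] continuous_intros) auto
  have cg: "continuous_on (UNIV \<times> {-1..1}) (\<lambda>z. g (fst z) (snd z))" unfolding g_def
    by (rule continuous_on_suminf[where N = "\<lambda>j. E * \<beta> j"]) (use sE in \<open>auto intro!: c2 cT b0 simp del: summable_cmult_iff\<close>)
  have cgt: "continuous_on (UNIV \<times> {-1..1}) (\<lambda>z. gt (fst z) (snd z))" unfolding gt_def
    by (rule continuous_on_suminf[where N = "\<lambda>j. E * \<beta> j"]) (use sE in \<open>auto intro!: c2 cT bt simp del: summable_cmult_iff\<close>)
  have cgx: "continuous_on (UNIV \<times> {-1..1}) (\<lambda>z. gx (fst z) (snd z))" unfolding gx_def
    by (rule continuous_on_suminf[where N = bx]) (auto intro!: c2 cT bx b1)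
  have sec: "continuous_on {-1..1} (h t)" if "continuous_on (UNIV \<times> {-1..1}) (\<lambda>z. h (fst z) (snd z))" for h :: "real \<Rightarrow> real \<Rightarrow> real" and t
  proof -
    have "continuous_on {-1..1} (\<lambda>x. h (fst (t, x)) (snd (t, x)))"
      by (rule continuous_on_compose2[OF that]) (auto intro!: continuous_intros)
    then show ?thesis by simp
  qed
  let ?B = "E * ((2 * K^2 + 2) * suminf \<beta>)"
  have EB: "E * suminf \<beta> \<le> ?B"
  proof -
    have "1 * suminf \<beta> \<le> (2 * K^2 + 2) * suminf \<beta>" using S0 by (intro mult_right_mono) auto
    then show ?thesis using E by (intro mult_left_mono) auto
  qed
  have const: "(\<Sum>j. f j) = f 0" if "\<And>j. f (Suc j) = (0::real)" for f
  proof -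
    have "f n = 0" if "n \<notin> {0}" for n using that \<open>\<And>j. f (Suc j) = 0\<close> by (cases n) auto
    then show ?thesis using suminf_finite[of "{0}" f] by simp
  qed
  have "heat_ext p T1 T2 v v1 ?B g gx gt"
    unfolding heat_ext_def
  proof (intro conjI allI impI ballI cg cgx cgt)
    fix t
    show "C2_on (-1) 1 (g t) (gx t) (\<lambda>x. p x * g t x + gt t x)"
      unfolding C2_on_def
    proof (intro conjI ballI)
      show "continuous_on {-1..1} (\<lambda>x. p x * g t x + gt t x)" by (intro continuous_intros p sec cg cgt)
      fix x :: real assume x: "x \<in> {-1..1}"
      show "(g t has_real_derivative gx t x) (at x within {-1..1})"
        unfolding g_def gx_def
        by (rule has_real_derivative_suminf[where N = "\<lambda>j. E * \<beta> j" and M = bx]) (use x sE bx b0 b1 dT in \<open>auto intro!: DERIV_cmult\<close>)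
      have "((\<lambda>x. \<Sum>j. D j t * \<Theta>1 j x) has_real_derivative (\<Sum>j. D j t * \<theta>2 j x)) (at x within {-1..1})"
        by (rule has_real_derivative_suminf[where N = bx and M = bx]) (use x bx b2 b1 dT in \<open>auto intro!: DERIV_cmult\<close>)
      then show "(gx t has_real_derivative p x * g t x + gt t x) (at x within {-1..1})"
        unfolding g2[OF x] by (simp add: gx_def[abs_def])
    qed
    fix x :: real assume x: "x \<in> {-1..1}"
    show "((\<lambda>t. g t x) has_real_derivative gt t x) (at t)"
      unfolding g_def gt_def
      by (rule has_real_derivative_suminf[where N = "\<lambda>j. E * \<beta> j" and M = "\<lambda>j. E * \<beta> j" and S = UNIV])
         (use sE b0[OF x] bt[OF x] D(1) in \<open>auto intro!: DERIV_cmult_right\<close>)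
    show "\<bar>g t x\<bar> \<le> ?B" using abs_suminf_le[OF b0[OF x, of _ t] sE] EB suminf_mult[OF \<beta>(1), of E] by (simp add: g_def)
    show "\<bar>gt t x\<bar> \<le> ?B" using abs_suminf_le[OF bt[OF x, of _ t] sE] EB suminf_mult[OF \<beta>(1), of E] by (simp add: gt_def)
    show "\<bar>gx t x\<bar> \<le> ?B" using abs_suminf_le[OF b1[OF x, of _ t] bx(1)] by (simp add: gx_def bx(2))
  next
    fix t x :: real assume t: "t \<le> T1" and x: "x \<in> {-1..1}"
    have z: "D (Suc j) t = 0" for j using D(4) t by auto
    show "g t x = v x" unfolding g_def using const[of "\<lambda>j. D j t * \<Theta> j x"] z D(2)[OF t] T(1) by simp
    show "gx t x = v1 x" unfolding gx_def using const[of "\<lambda>j. D j t * \<Theta>1 j x"] z D(2)[OF t] T(2) by simp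
    show "gt t x = 0" unfolding gt_def using z by simp
  next
    fix t x :: real assume t: "t \<ge> T2" and x: "x \<in> {-1..1}"
    have z: "D j t = 0" for j using D(3)[OF t] D(4)[of t] t by (cases j) auto
    show "g t x = 0" "gx t x = 0" "gt t x = 0" unfolding g_def gx_def gt_def using z by simp_all
  qed
  moreover have "g t (-1) = 0" for t unfolding g_def using T(4) by simp
  ultimately show ?thesis unfolding E_def by blast
qed

lemma heat_extD:
  assumes "heat_ext p T1 T2 v v1 B g gx gt"
  shows "\<And>t. C2_on (-1) 1 (g t) (gx t) (\<lambda>x. p x * g t x + gt t x)"
    "\<And>t x. x \<in> {-1..1} \<Longrightarrow> ((\<lambda>t. g t x) has_real_derivative gt t x) (at t)"
    "continuous_on (UNIV \<times> {-1..1}) (\<lambda>z. g (fst z) (snd z))" "continuous_on (UNIV \<times> {-1..1}) (\<lambda>z. gx (fst z) (snd z))"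
    "continuous_on (UNIV \<times> {-1..1}) (\<lambda>z. gt (fst z) (snd z))"
    "\<And>t x. x \<in> {-1..1} \<Longrightarrow> \<bar>g t x\<bar> \<le> B" "\<And>t x. x \<in> {-1..1} \<Longrightarrow> \<bar>gx t x\<bar> \<le> B" "\<And>t x. x \<in> {-1..1} \<Longrightarrow> \<bar>gt t x\<bar> \<le> B"
    "\<And>t x. t \<le> T1 \<Longrightarrow> x \<in> {-1..1} \<Longrightarrow> g t x = v x" "\<And>t x. t \<le> T1 \<Longrightarrow> x \<in> {-1..1} \<Longrightarrow> gx t x = v1 x"
    "\<And>t x. t \<le> T1 \<Longrightarrow> x \<in> {-1..1} \<Longrightarrow> gt t x = 0"
    "\<And>t x. t \<ge> T2 \<Longrightarrow> x \<in> {-1..1} \<Longrightarrow> g t x = 0" "\<And>t x. t \<ge> T2 \<Longrightarrow> x \<in> {-1..1} \<Longrightarrow> gx t x = 0"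
  using assms unfolding heat_ext_def by blast+

text \<open>Reflection x to -x: the potential is even, so the equation is the same and the boundary
  condition moves to the other end.\<close>

lemma heat_ext_right:
  fixes D :: "nat \<Rightarrow> real \<Rightarrow> real"
  assumes D: "\<And>j t. (D j has_real_derivative D (Suc j) t) (at t)" "\<And>t. t \<le> T1 \<Longrightarrow> D 0 t = 1" "\<And>t. t \<ge> T2 \<Longrightarrow> D 0 t = 0"
      "\<And>j t. t \<le> T1 \<or> T2 \<le> t \<Longrightarrow> D (Suc j) t = 0"
    and \<beta>: "summable \<beta>" "\<And>j t. \<bar>D j t\<bar> * (4 ^ j / fact (2 * j)) \<le> \<beta> j" "\<And>j t. \<bar>D (Suc j) t\<bar> * (4 ^ j / fact (2 * j)) \<le> \<beta> j"
    and p: "continuous_on {-1..1} p" and K: "K \<ge> 0" "\<And>x. x \<in> {-1..1} \<Longrightarrow> \<bar>p x\<bar> \<le> K^2"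
    and v: "C2_on (-1) 1 v v1 (\<lambda>x. p x * v x)" "v (-1) = 0" "v 1 = 0" and M: "M \<ge> 0" "\<And>x. x \<in> {-1..1} \<Longrightarrow> \<bar>v x\<bar> \<le> M"
    and even: "\<And>x. p (- x) = p x"
  shows "\<exists>g gx gt. heat_ext p T1 T2 v v1 (M * exp (2 * K) * ((2 * K^2 + 2) * suminf \<beta>)) g gx gt \<and> (\<forall>t. g t 1 = 0)"
proof -
  have v': "C2_on (-1) 1 (\<lambda>x. v (- x)) (\<lambda>x. - v1 (- x)) (\<lambda>x. p x * v (- x))"
    using C2_on_reflect[OF v(1)] by (simp add: even)
  let ?B = "M * exp (2 * K) * ((2 * K^2 + 2) * suminf \<beta>)"
  have "\<exists>g gx gt. heat_ext p T1 T2 (\<lambda>x. v (- x)) (\<lambda>x. - v1 (- x)) ?B g gx gt \<and> (\<forall>t. g t (-1) = 0)"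
    by (rule heat_ext_left[OF D \<beta> p K v' _ _ M(1)]) (use v M in auto)
  then obtain g gx gt where g: "heat_ext p T1 T2 (\<lambda>x. v (- x)) (\<lambda>x. - v1 (- x)) ?B g gx gt" "\<And>t. g t (-1) = 0" by blast
  note G = heat_extD[OF g(1)]
  have cr: "continuous_on (UNIV \<times> {-1..1}) (\<lambda>z. h (fst z) (- snd z))"
    if "continuous_on (UNIV \<times> {-1..1}) (\<lambda>z. h (fst z) (snd z))" for h :: "real \<Rightarrow> real \<Rightarrow> real"
  proof -
    have "continuous_on (UNIV \<times> {-1..1}) (\<lambda>z. h (fst (fst z, - snd z)) (snd (fst z, - snd z)))"
      by (rule continuous_on_compose2[OF that]) (auto intro!: continuous_intros)
    then show ?thesis by simp
  qed
  have m: "- x \<in> {-1..1}" if "x \<in> {-1..1}" for x :: real using that by auto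
  have "heat_ext p T1 T2 v v1 ?B (\<lambda>t x. g t (- x)) (\<lambda>t x. - gx t (- x)) (\<lambda>t x. gt t (- x))"
    unfolding heat_ext_def
  proof (intro conjI allI impI ballI)
    show "C2_on (-1) 1 (\<lambda>x. g t (- x)) (\<lambda>x. - gx t (- x)) (\<lambda>x. p x * g t (- x) + gt t (- x))" for t
      using C2_on_reflect[OF G(1), of t] by (simp add: even)
    show "continuous_on (UNIV \<times> {-1..1}) (\<lambda>z. g (fst z) (- snd z))" by (rule cr[OF G(3)])
    show "continuous_on (UNIV \<times> {-1..1}) (\<lambda>z. - gx (fst z) (- snd z))" by (rule continuous_on_minus[OF cr[OF G(4)]])
    show "continuous_on (UNIV \<times> {-1..1}) (\<lambda>z. gt (fst z) (- snd z))" by (rule cr[OF G(5)])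
    fix t x :: real assume x: "x \<in> {-1..1}"
    show "((\<lambda>t. g t (- x)) has_real_derivative gt t (- x)) (at t)" by (rule G(2)[OF m[OF x]])
    show "\<bar>g t (- x)\<bar> \<le> ?B" by (rule G(6)[OF m[OF x]])
    show "\<bar>- gx t (- x)\<bar> \<le> ?B" using G(7)[OF m[OF x], of t] by simp
    show "\<bar>gt t (- x)\<bar> \<le> ?B" by (rule G(8)[OF m[OF x]])
    show "g t (- x) = v x" if "t \<le> T1" using G(9)[OF that m[OF x]] by simp
    show "- gx t (- x) = v1 x" if "t \<le> T1" using G(10)[OF that m[OF x]] by simp
    show "gt t (- x) = 0" if "t \<le> T1" using G(11)[OF that m[OF x]] by simp
    show "g t (- x) = 0" if "t \<ge> T2" using G(12)[OF that m[OF x]] by simp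
    show "- gx t (- x) = 0" if "t \<ge> T2" using G(13)[OF that m[OF x]] by simp
    show "gt t (- x) = 0" if "t \<ge> T2" using g(1) that m[OF x] unfolding heat_ext_def by blast
  qed
  then show ?thesis using g(2) by (intro exI[of _ "\<lambda>t x. g t (- x)"] exI[of _ "\<lambda>t x. - gx t (- x)"] exI[of _ "\<lambda>t x. gt t (- x)"]) simp
qed

text \<open>Trajectory F and control U of one mode, for all real times. B is the cost of control
  before dissipation is counted, and exp(-lam T1) is the gain from waiting until T1.\<close>

definition mode_sol where
  "mode_sol a b q lam T1 T2 v B F Ft U \<longleftrightarrow>
    (\<forall>t. \<exists>Fx Fxx. C2_on (-1) 1 (F t) Fx Fxx \<and> (\<forall>x\<in>{-1..1}. Ft t x = Fxx x - q x * F t x + U t x)) \<and>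
    (\<forall>t. F t (-1) = 0 \<and> F t 1 = 0) \<and>
    (\<forall>t. \<forall>x\<in>{-1..1}. ((\<lambda>t. F t x) has_real_derivative Ft t x) (at t)) \<and>
    continuous_on (UNIV \<times> {-1..1}) (\<lambda>z. F (fst z) (snd z)) \<and> continuous_on (UNIV \<times> {-1..1}) (\<lambda>z. Ft (fst z) (snd z)) \<and>
    continuous_on (UNIV \<times> {-1..1}) (\<lambda>z. U (fst z) (snd z)) \<and>
    (\<forall>t\<le>T1. \<forall>x\<in>{-1..1}. F t x = exp (- lam * t) * v x) \<and>
    (\<forall>t\<ge>T2. \<forall>x\<in>{-1..1}. F t x = 0) \<and>
    (\<forall>t x. x \<notin> {a<..<b} \<longrightarrow> U t x = 0) \<and>
    (\<forall>t\<ge>T1. \<forall>x\<in>{-1..1}. \<bar>F t x\<bar> \<le> B * exp (- lam * T1)) \<and>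
    (\<forall>t. \<forall>x\<in>{-1..1}. \<bar>U t x\<bar> \<le> B * exp (- lam * (T1 :: real)))"

text \<open>L vanishes at -1 and R at 1, so w = X L + (1 - X) R, with X = 1 up to a and X = 0 from b
  on, satisfies both boundary conditions. The commutator h contains only derivatives of X, hence
  lives in (a,b), and U = -exp(-lam t) h cancels it. Until T1 both L and R equal v, so no control
  acts. In 2 + 6c, 2 accounts for F and 6c for h.\<close>

lemma mode_sol_exists:
  fixes D X :: "nat \<Rightarrow> real \<Rightarrow> real"
  assumes D: "\<And>j t. (D j has_real_derivative D (Suc j) t) (at t)" "\<And>t. t \<le> T1 \<Longrightarrow> D 0 t = 1" "\<And>t. t \<ge> T2 \<Longrightarrow> D 0 t = 0"
      "\<And>j t. t \<le> T1 \<or> T2 \<le> t \<Longrightarrow> D (Suc j) t = 0"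
    and \<beta>: "summable \<beta>" "\<And>j t. \<bar>D j t\<bar> * (4 ^ j / fact (2 * j)) \<le> \<beta> j" "\<And>j t. \<bar>D (Suc j) t\<bar> * (4 ^ j / fact (2 * j)) \<le> \<beta> j"
    and X: "\<And>j t. (X j has_real_derivative X (Suc j) t) (at t)" "\<And>t. t \<le> a \<Longrightarrow> X 0 t = 1" "\<And>t. t \<ge> b \<Longrightarrow> X 0 t = 0"
      "\<And>j t. t \<le> a \<or> b \<le> t \<Longrightarrow> X (Suc j) t = 0" "\<And>t. 0 \<le> X 0 t" "\<And>t. X 0 t \<le> 1"
    and c: "\<And>t. \<bar>X 1 t\<bar> \<le> c" "\<And>t. \<bar>X 2 t\<bar> \<le> c" and ab: "-1 < a" "a < b" "b < 1"
    and q: "continuous_on {-1..1} q" "\<And>x. q (- x) = q x" and lam: "lam \<ge> 0"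
    and K: "K \<ge> 0" "\<And>x. x \<in> {-1..1} \<Longrightarrow> \<bar>q x - lam\<bar> \<le> K^2"
    and v: "C2_on (-1) 1 v v1 (\<lambda>x. (q x - lam) * v x)" "v (-1) = 0" "v 1 = 0" and M: "M \<ge> 0" "\<And>x. x \<in> {-1..1} \<Longrightarrow> \<bar>v x\<bar> \<le> M"
  shows "\<exists>F Ft U. mode_sol a b q lam T1 T2 v ((2 + 6 * c) * (M * exp (2 * K) * ((2 * K^2 + 2) * suminf \<beta>))) F Ft U"
proof -
  define p where "p x = q x - lam" for x
  define B where "B = M * exp (2 * K) * ((2 * K^2 + 2) * suminf \<beta>)"
  have pc: "continuous_on {-1..1} p" unfolding p_def by (intro continuous_intros q)
  have pe: "p (- x) = p x" for x by (simp add: p_def q)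
  note K' = K(2)[folded p_def] and v' = v(1)[folded p_def]
  obtain L Lx Lt where L: "heat_ext p T1 T2 v v1 B L Lx Lt" "\<And>t. L t (-1) = 0"
    using heat_ext_left[OF D \<beta> pc K(1) K' v' v(2,3) M] unfolding B_def by blast
  obtain R Rx Rt where R: "heat_ext p T1 T2 v v1 B R Rx Rt" "\<And>t. R t 1 = 0"
    using heat_ext_right[OF D \<beta> pc K(1) K' v' v(2,3) M pe] unfolding B_def by blast
  note L' = heat_extD[OF L(1)] and R' = heat_extD[OF R(1)]
  have B0: "B \<ge> 0" using order_trans[OF abs_ge_zero L'(6)[of 0 0]] by simp
  have c0: "c \<ge> 0" using c(1)[of 0] by linarith
  define w where "w t x = X 0 x * L t x + (1 - X 0 x) * R t x" for t x
  define w1 where "w1 t x = X 1 x * (L t x - R t x) + X 0 x * Lx t x + (1 - X 0 x) * Rx t x" for t x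
  define wt where "wt t x = X 0 x * Lt t x + (1 - X 0 x) * Rt t x" for t x
  define h where "h t x = X 2 x * (L t x - R t x) + 2 * X 1 x * (Lx t x - Rx t x)" for t x
  define F where "F t x = exp (- lam * t) * w t x" for t x
  define Ft where "Ft t x = exp (- lam * t) * (wt t x - lam * w t x)" for t x
  define U where "U t x = - exp (- lam * t) * h t x" for t x
  have Xc: "continuous_on S (X j)" for S j by (rule DERIV_continuous_on[OF has_field_derivative_at_within[OF X(1)]])
  have X2: "continuous_on (UNIV \<times> {-1..1}) (\<lambda>z. X j (snd z))" for j
    by (rule continuous_on_compose2[OF Xc]) (auto intro!: continuous_intros)
  have Xout: "X 1 x = 0" "X 2 x = 0" if "x \<notin> {a<..<b}" for x
  proof -
    have "x \<le> a \<or> b \<le> x" using that by auto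
    then have "X (Suc 0) x = 0" "X (Suc (Suc 0)) x = 0" by (rule X(4))+
    then show "X 1 x = 0" "X 2 x = 0" by (simp_all add: numeral_2_eq_2)
  qed
  have dX: "(X 0 has_real_derivative X 1 x) (at x within S)" "(X 1 has_real_derivative X 2 x) (at x within S)" for x S
    using X(1)[of 0 x] X(1)[of 1 x] by (auto simp: numeral_2_eq_2 intro: has_field_derivative_at_within)
  have wC2: "C2_on (-1) 1 (w t) (w1 t) (\<lambda>x. h t x + p x * w t x + wt t x)" for t
    unfolding C2_on_def
  proof (intro conjI ballI)
    fix x :: real assume x: "x \<in> {-1..1}"
    note dL = C2_onD(1,2)[OF L'(1)[of t] x] and dR = C2_onD(1,2)[OF R'(1)[of t] x]
    show "(w t has_real_derivative w1 t x) (at x within {-1..1})"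
      unfolding w_def w1_def by (auto intro!: derivative_eq_intros dX dL dR simp: algebra_simps)
    show "(w1 t has_real_derivative h t x + p x * w t x + wt t x) (at x within {-1..1})"
      unfolding w_def w1_def h_def wt_def by (auto intro!: derivative_eq_intros dX dX(2)[unfolded One_nat_def] dL dR simp: algebra_simps)
  next
    have cl: "continuous_on {-1..1} (L t)" "continuous_on {-1..1} (Lx t)" "continuous_on {-1..1} (R t)" "continuous_on {-1..1} (Rx t)"
      using C2_onD(3,4)[OF L'(1)[of t]] C2_onD(3,4)[OF R'(1)[of t]] by auto
    have sec: "continuous_on {-1..1} (k t)" if "continuous_on (UNIV \<times> {-1..1}) (\<lambda>z. k (fst z) (snd z))" for k :: "real \<Rightarrow> real \<Rightarrow> real"
    proof -
      have "continuous_on {-1..1} (\<lambda>x. k (fst (t, x)) (snd (t, x)))"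
        by (rule continuous_on_compose2[OF that]) (auto intro!: continuous_intros)
      then show ?thesis by simp
    qed
    show "continuous_on {-1..1} (\<lambda>x. h t x + p x * w t x + wt t x)"
      unfolding h_def w_def wt_def by (intro continuous_intros pc cl Xc sec[OF L'(5)] sec[OF R'(5)])
  qed
  have bnd: "\<bar>s * y + (1 - s) * z\<bar> \<le> 2 * B" if "0 \<le> s" "s \<le> 1" "\<bar>y\<bar> \<le> B" "\<bar>z\<bar> \<le> B" for s y z
  proof -
    have "\<bar>s * y\<bar> \<le> 1 * B" "\<bar>(1 - s) * z\<bar> \<le> 1 * B" unfolding abs_mult using that by (intro mult_mono; simp)+
    then show ?thesis by linarith
  qed
  have "mode_sol a b q lam T1 T2 v ((2 + 6 * c) * B) F Ft U"
    unfolding mode_sol_def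
  proof (intro conjI allI impI ballI)
    show "\<exists>Fx Fxx. C2_on (-1) 1 (F t) Fx Fxx \<and> (\<forall>x\<in>{-1..1}. Ft t x = Fxx x - q x * F t x + U t x)" for t
    proof (intro exI conjI ballI)
      show "C2_on (-1) 1 (F t) (\<lambda>x. exp (- lam * t) * w1 t x) (\<lambda>x. exp (- lam * t) * (h t x + p x * w t x + wt t x))"
        using wC2[of t] unfolding C2_on_def F_def by (auto intro!: DERIV_cmult continuous_intros)
      show "Ft t x = exp (- lam * t) * (h t x + p x * w t x + wt t x) - q x * F t x + U t x" for x
        by (simp add: Ft_def F_def U_def p_def algebra_simps)
    qed
    show "F t (-1) = 0" for t using L(2) X(2)[of "-1"] ab by (simp add: F_def w_def)
    show "F t 1 = 0" for t using R(2) X(3)[of 1] ab by (simp add: F_def w_def)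
    show "continuous_on (UNIV \<times> {-1..1}) (\<lambda>z. F (fst z) (snd z))" unfolding F_def w_def
      by (intro continuous_intros X2 L' R')
    show "continuous_on (UNIV \<times> {-1..1}) (\<lambda>z. Ft (fst z) (snd z))" unfolding Ft_def w_def wt_def
      by (intro continuous_intros X2 L' R')
    show "continuous_on (UNIV \<times> {-1..1}) (\<lambda>z. U (fst z) (snd z))" unfolding U_def h_def
      by (intro continuous_intros X2 L' R')
    show "U t x = 0" if "x \<notin> {a<..<b}" for t x using Xout[OF that] by (simp add: U_def h_def)
    fix t x :: real assume x: "x \<in> {-1..1}"
    have "((\<lambda>t. exp (- lam * t) * (X 0 x * L t x + (1 - X 0 x) * R t x)) has_real_derivative Ft t x) (at t)"
      unfolding Ft_def w_def wt_def by (auto intro!: derivative_eq_intros L'(2)[OF x] R'(2)[OF x] simp: algebra_simps)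
    then show "((\<lambda>t. F t x) has_real_derivative Ft t x) (at t)" by (simp add: F_def w_def)
    show "F t x = exp (- lam * t) * v x" if "t \<le> T1"
      using L'(9)[OF that x] R'(9)[OF that x] by (simp add: F_def w_def algebra_simps)
    show "F t x = 0" if "t \<ge> T2" using L'(12)[OF that x] R'(12)[OF that x] by (simp add: F_def w_def)
    have et: "exp (- lam * t) \<le> exp (- lam * T1)" if "T1 \<le> t" for t using that lam by (simp add: mult_left_mono)
    show "\<bar>F t x\<bar> \<le> (2 + 6 * c) * B * exp (- lam * T1)" if "T1 \<le> t"
    proof -
      have "\<bar>F t x\<bar> \<le> exp (- lam * T1) * (2 * B)" unfolding F_def abs_mult w_def
        using et[OF that] B0 by (intro mult_mono bnd X L'(6)[OF x] R'(6)[OF x]) auto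
      also have "\<dots> \<le> exp (- lam * T1) * ((2 + 6 * c) * B)" using B0 c0 by (intro mult_left_mono mult_right_mono) auto
      finally show ?thesis by (simp only: mult.commute)
    qed
    show "\<bar>U t x\<bar> \<le> (2 + 6 * c) * B * exp (- lam * T1)"
    proof (cases "t \<le> T1")
      case True
      then have "U t x = 0" using L'(9,10)[OF True x] R'(9,10)[OF True x] by (simp add: U_def h_def)
      then show ?thesis using B0 c0 by simp
    next
      case False
      have "\<bar>X 2 x * (L t x - R t x)\<bar> \<le> c * (2 * B)"
        unfolding abs_mult using c(2)[of x] c0 L'(6)[OF x, of t] R'(6)[OF x, of t] by (intro mult_mono) auto
      moreover have "\<bar>2 * X 1 x * (Lx t x - Rx t x)\<bar> \<le> (2 * c) * (2 * B)"
        unfolding abs_mult using c(1)[of x] c0 L'(7)[OF x, of t] R'(7)[OF x, of t] by (intro mult_mono) auto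
      ultimately have "\<bar>h t x\<bar> \<le> 6 * c * B" unfolding h_def by linarith
      then have "\<bar>U t x\<bar> \<le> exp (- lam * T1) * (6 * c * B)"
        unfolding U_def abs_mult using et[of t] False by (intro mult_mono) auto
      also have "\<dots> \<le> exp (- lam * T1) * ((2 + 6 * c) * B)" using B0 by (intro mult_left_mono mult_right_mono) auto
      finally show ?thesis by (simp only: mult.commute)
    qed
  qed
  then show ?thesis unfolding B_def by blast
qed

section \<open>Weak solutions\<close>

lemma linear_volterra_zero:
  fixes d :: "real \<Rightarrow> real"
  assumes c: "continuous_on {0..T} d" and e: "\<And>t. t \<in> {0..T} \<Longrightarrow> d t = integral {0..t} (\<lambda>s. - \<mu> * d s)" and t: "t \<in> {0..T}"
  shows "d t = 0"
proof -
  have dd: "(d has_real_derivative - \<mu> * d t) (at t within {0..T})" if t: "t \<in> {0..T}" for t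
  proof -
    have "((\<lambda>t. integral {0..t} (\<lambda>s. - \<mu> * d s)) has_real_derivative - \<mu> * d t) (at t within {0..T})"
      by (rule integral_has_real_derivative[OF _ t]) (intro continuous_intros c)
    then show ?thesis by (rule has_field_derivative_transform_within[OF _ zero_less_one t]) (simp add: e)
  qed
  have "((\<lambda>t. exp (\<mu> * t) * d t) has_real_derivative 0) (at t within {0..T})" if t: "t \<in> {0..T}" for t
    by (auto intro!: derivative_eq_intros dd[OF t])
  then obtain k where k: "\<And>t. t \<in> {0..T} \<Longrightarrow> exp (\<mu> * t) * d t = k"
    using has_field_derivative_zero_constant[of "{0..T}" "\<lambda>t. exp (\<mu> * t) * d t"] by auto
  have "d 0 = 0" using e[of 0] t by simp
  then have "k = 0" using k[of 0] t by simp
  then show ?thesis using k[OF t] by simp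
qed

lemma continuous_ip_of_dist2:
  assumes L: "\<And>t. t \<in> S \<Longrightarrow> L2 (f t)" and h: "L2 h"
    and c: "\<And>t. t \<in> S \<Longrightarrow> ((\<lambda>s. dist2 (f s) (f t)) \<longlongrightarrow> 0) (at t within S)"
  shows "continuous_on S (\<lambda>t. ip (f t) h)"
  unfolding continuous_on_def
proof
  fix t assume t: "t \<in> S"
  show "((\<lambda>t. ip (f t) h) \<longlongrightarrow> ip (f t) h) (at t within S)"
  proof (rule LIM_zero_cancel, rule Lim_null_comparison)
    have "\<forall>\<^sub>F s in at t within S. s \<in> S" by (simp add: eventually_at_filter)
    then show "\<forall>\<^sub>F s in at t within S. norm (ip (f s) h - ip (f t) h) \<le> sqrt (dist2 (f s) (f t)) * sqrt (ip h h)"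
    proof eventually_elim
      case (elim s)
      then show ?case using abs_ip_le[OF L2_diff[OF L[OF elim] L[OF t]] h] ip_diff[OF L[OF elim] L[OF t] h] by (simp add: dist2_ip)
    qed
    have "((\<lambda>s. sqrt (dist2 (f s) (f t)) * sqrt (ip h h)) \<longlongrightarrow> sqrt 0 * sqrt (ip h h)) (at t within S)"
      by (intro tendsto_intros c t)
    then show "((\<lambda>s. sqrt (dist2 (f s) (f t)) * sqrt (ip h h)) \<longlongrightarrow> 0) (at t within S)" by simp
  qed
qed

lemma weak_solD:
  assumes "weak_sol \<gamma> a b T f0 u f"
  shows "\<And>t. t \<in> {0..T} \<Longrightarrow> L2 (f t)" "\<And>t. t \<in> {0..T} \<Longrightarrow> ((\<lambda>s. dist2 (f s) (f t)) \<longlongrightarrow> 0) (at t within {0..T})"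
    "AE p in LO. f 0 p = f0 p"
    "\<And>h g t. is_A \<gamma> h g \<Longrightarrow> t \<in> {0..T} \<Longrightarrow> set_integrable lborel {0..t} (\<lambda>s. ip (f s) g + ip (\<lambda>p. indicator (omega a b) p * u s p) h)"
    "\<And>h g t. is_A \<gamma> h g \<Longrightarrow> t \<in> {0..T} \<Longrightarrow> ip (f t) h = ip f0 h + (LINT s:{0..t}|lborel. ip (f s) g + ip (\<lambda>p. indicator (omega a b) p * u s p) h)"
  using assms unfolding weak_sol_def by blast+

text \<open>The control terms cancel in the difference of two solutions, leaving a scalar linear
  Volterra equation for the coefficient along the eigenfunction h.\<close>

lemma weak_sol_coefficient_unique:
  assumes f: "weak_sol \<gamma> a b T f0 u f" and f': "weak_sol \<gamma> a b T f0 u f'"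
    and h: "is_A \<gamma> h (\<lambda>p. - \<mu> * h p)" and t: "t \<in> {0..T}"
  shows "ip (f t) h = ip (f' t) h"
proof -
  note F = weak_solD[OF f] and F' = weak_solD[OF f']
  have Lh: "L2 h" using is_A_L2[OF h] by simp
  define d where "d t = ip (f t) h - ip (f' t) h" for t
  have cont: "continuous_on {0..T} d" unfolding d_def
    by (intro continuous_on_diff continuous_ip_of_dist2[OF F(1) Lh F(2)] continuous_ip_of_dist2[OF F'(1) Lh F'(2)])
  have sc: "ip k (\<lambda>p. - \<mu> * h p) = - \<mu> * ip k h" for k
    using ip_scale[of "- \<mu>" h k] by (simp add: ip_commute)
  have "d t = integral {0..t} (\<lambda>s. - \<mu> * d s)" if t: "t \<in> {0..T}" for t
  proof -
    let ?w = "\<lambda>s. ip (\<lambda>p. indicator (omega a b) p * u s p) h"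
    have "d t = (LINT s:{0..t}|lborel. - \<mu> * ip (f s) h + ?w s) - (LINT s:{0..t}|lborel. - \<mu> * ip (f' s) h + ?w s)"
      using F(5)[OF h t] F'(5)[OF h t] unfolding sc d_def by simp
    also have "\<dots> = (LINT s:{0..t}|lborel. (- \<mu> * ip (f s) h + ?w s) - (- \<mu> * ip (f' s) h + ?w s))"
      using F(4)[OF h t] F'(4)[OF h t] unfolding sc by (rule set_integral_diff(2)[symmetric])
    also have "\<dots> = (LINT s:{0..t}|lborel. - \<mu> * d s)"
      by (simp add: d_def algebra_simps)
    also have "\<dots> = integral {0..t} (\<lambda>s. - \<mu> * d s)"
      by (intro set_borel_integral_eq_integral(2) borel_integrable_atLeastAtMost' continuous_intros continuous_on_subset[OF cont]) (use t in auto)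
    finally show ?thesis .
  qed
  then have "d t = 0" by (intro linear_volterra_zero[OF cont _ t]) auto
  then show ?thesis by (simp add: d_def)
qed

lemma (in grushin_modes) weak_sol_unique:
  assumes "weak_sol \<gamma> a b T f0 u f" "weak_sol \<gamma> a b T f0 u f'" "t \<in> {0..T}"
  shows "AE p in LO. f t p = f' t p"
proof -
  have L: "L2 (f t)" "L2 (f' t)" using weak_solD(1) assms by blast+
  have "AE p in LO. f t p - f' t p = 0"
  proof (rule orth_imp_null[OF L2_diff[OF L]])
    fix j
    have "ip (f t) (es j) = ip (f' t) (es j)" by (rule weak_sol_coefficient_unique[OF assms(1,2) is_A_es assms(3)])
    then show "ip (\<lambda>p. f t p - f' t p) (es j) = 0" by (simp add: ip_diff L es_L2)
  qed
  then show ?thesis by eventually_elim simp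
qed

section \<open>Time regularity of L2 pairings\<close>

lemma uniform_time_continuity:
  fixes H :: "real \<Rightarrow> real \<times> real \<Rightarrow> real"
  assumes c: "continuous_on ({r..T} \<times> box2) (\<lambda>z. H (fst z) (snd z))" and e: "e > 0"
  shows "\<exists>d>0. \<forall>t\<in>{r..T}. \<forall>t'\<in>{r..T}. \<bar>t - t'\<bar> < d \<longrightarrow> (\<forall>p\<in>box2. \<bar>H t p - H t' p\<bar> < e)"
proof -
  have "uniformly_continuous_on ({r..T} \<times> box2) (\<lambda>z. H (fst z) (snd z))"
    by (intro compact_uniformly_continuous c compact_Times compact_Icc compact_cbox)
  then obtain d where d: "d > 0" "\<And>z z'. z \<in> {r..T} \<times> box2 \<Longrightarrow> z' \<in> {r..T} \<times> box2 \<Longrightarrow> dist z' z < d \<Longrightarrow> dist (H (fst z') (snd z')) (H (fst z) (snd z)) < e"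
    using e unfolding uniformly_continuous_on_def by metis
  show ?thesis
  proof (rule exI[of _ d], rule conjI[OF d(1)], intro ballI impI)
    fix t t' p assume t: "t \<in> {r..T}" "t' \<in> {r..T}" "\<bar>t - t'\<bar> < d" and p: "p \<in> box2"
    have "dist (t, p) (t', p) < d" using t(3) by (simp add: dist_Pair_Pair dist_real_def)
    then show "\<bar>H t p - H t' p\<bar> < e" using d(2)[of "(t', p)" "(t, p)"] t p by (simp add: dist_real_def)
  qed
qed

lemma time_section_continuous:
  fixes H :: "real \<Rightarrow> real \<times> real \<Rightarrow> real"
  assumes "continuous_on (S \<times> box2) (\<lambda>z. H (fst z) (snd z))" "t \<in> S"
  shows "continuous_on box2 (H t)"
proof -
  have "continuous_on box2 (\<lambda>p. H (fst (t, p)) (snd (t, p)))"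
    by (rule continuous_on_compose2[OF assms(1)]) (use assms(2) in \<open>auto intro!: continuous_intros\<close>)
  then show ?thesis by simp
qed

lemma dist2_time_continuous:
  fixes H :: "real \<Rightarrow> real \<times> real \<Rightarrow> real"
  assumes c: "continuous_on ({r..T} \<times> box2) (\<lambda>z. H (fst z) (snd z))" and t: "t \<in> {r..T}"
  shows "((\<lambda>s. dist2 (H s) (H t)) \<longlongrightarrow> 0) (at t within {r..T})"
proof (rule tendstoI)
  fix e :: real assume e: "e > 0"
  define \<eta> where "\<eta> = sqrt (e / 4)"
  have \<eta>: "\<eta> > 0" "\<eta>^2 = e / 4" using e by (auto simp: \<eta>_def)
  obtain d where d: "d > 0" "\<And>t t' p. t \<in> {r..T} \<Longrightarrow> t' \<in> {r..T} \<Longrightarrow> \<bar>t - t'\<bar> < d \<Longrightarrow> p \<in> box2 \<Longrightarrow> \<bar>H t p - H t' p\<bar> < \<eta>"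
    using uniform_time_continuity[OF c \<eta>(1)] by blast
  show "\<forall>\<^sub>F s in at t within {r..T}. dist (dist2 (H s) (H t)) 0 < e"
    unfolding eventually_at
  proof (rule exI[of _ d], rule conjI[OF d(1)], intro ballI impI)
    fix s assume s: "s \<in> {r..T}" "s \<noteq> t \<and> dist s t < d"
    have "dist2 (H s) (H t) \<le> 2 * \<eta>^2"
    proof (rule dist2_le_of_uniform)
      show "L2 (H s)" "L2 (H t)" using time_section_continuous[OF c] s t by (auto intro: continuous_L2)
      show "\<bar>H s p - H t p\<bar> \<le> \<eta>" if "p \<in> Omega" for p
        using d(2)[of s t p] s t that Omega_subset_box2 by (force simp: dist_real_def)
    qed
    then show "dist (dist2 (H s) (H t)) 0 < e" using \<eta> e dist2_nonneg[of "H s" "H t"] by (simp add: dist_real_def)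
  qed
qed

lemma ip_uniform_le:
  assumes "L2 f" "L2 h" "\<And>p. p \<in> Omega \<Longrightarrow> \<bar>f p\<bar> \<le> e" "e \<ge> 0"
  shows "\<bar>ip f h\<bar> \<le> e * (2 * sqrt (ip h h))"
proof -
  have "ip f f \<le> 2 * e^2" using dist2_le_of_uniform[OF assms(1) L2_zero, of e] assms(3) by (simp add: dist2_ip)
  also have "\<dots> \<le> (2 * e)^2" by (simp add: power_mult_distrib)
  finally have "sqrt (ip f f) \<le> 2 * e" using assms(4) by (intro real_le_lsqrt) (auto simp: ip_nonneg)
  then have "sqrt (ip f f) * sqrt (ip h h) \<le> (2 * e) * sqrt (ip h h)" by (intro mult_right_mono) (auto simp: ip_nonneg)
  then show ?thesis using abs_ip_le[OF assms(1,2)] by simp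
qed

text \<open>The remainder of the first order expansion in time is estimated uniformly in p by the
  mean value inequality and the uniform continuity of Ht. A uniform bound passes to the pairing with
  h because the domain has finite measure.\<close>

lemma ip_time_derivative:
  fixes H Ht :: "real \<Rightarrow> real \<times> real \<Rightarrow> real"
  assumes c: "continuous_on ({r..T} \<times> box2) (\<lambda>z. H (fst z) (snd z))"
    and ct: "continuous_on ({r..T} \<times> box2) (\<lambda>z. Ht (fst z) (snd z))"
    and d: "\<And>t p. t \<in> {r..T} \<Longrightarrow> p \<in> box2 \<Longrightarrow> ((\<lambda>t. H t p) has_real_derivative Ht t p) (at t within {r..T})"
    and h: "L2 h" and t: "t \<in> {r..T}"
  shows "((\<lambda>t. ip (H t) h) has_real_derivative ip (Ht t) h) (at t within {r..T})"
proof -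
  have L: "L2 (H s)" "L2 (Ht s)" if "s \<in> {r..T}" for s
    using time_section_continuous[OF c that] time_section_continuous[OF ct that] by (auto intro: continuous_L2)
  have "((\<lambda>s. (ip (H s) h - ip (H t) h) / (s - t)) \<longlongrightarrow> ip (Ht t) h) (at t within {r..T})"
  proof (rule tendstoI)
    fix e :: real assume e: "e > 0"
    define \<eta> where "\<eta> = e / (2 * sqrt (ip h h) + 1)"
    have hn: "2 * sqrt (ip h h) + 1 > 0" using ip_nonneg[of h] by (intro add_nonneg_pos) auto
    have \<eta>: "\<eta> > 0" using divide_pos_pos[OF e hn] by (simp add: \<eta>_def)
    obtain \<delta> where \<delta>: "\<delta> > 0" "\<And>t t' p. t \<in> {r..T} \<Longrightarrow> t' \<in> {r..T} \<Longrightarrow> \<bar>t - t'\<bar> < \<delta> \<Longrightarrow> p \<in> box2 \<Longrightarrow> \<bar>Ht t p - Ht t' p\<bar> < \<eta>"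
      using uniform_time_continuity[OF ct \<eta>] by blast
    show "\<forall>\<^sub>F s in at t within {r..T}. dist ((ip (H s) h - ip (H t) h) / (s - t)) (ip (Ht t) h) < e"
      unfolding eventually_at
    proof (rule exI[of _ \<delta>], rule conjI[OF \<delta>(1)], intro ballI impI)
      fix s assume s: "s \<in> {r..T}" "s \<noteq> t \<and> dist s t < \<delta>"
      define G where "G p = (H s p - H t p) - (s - t) * Ht t p" for p
      have LG: "L2 G" unfolding G_def by (intro L2_diff L2_scale L s t)
      have "\<bar>G p\<bar> \<le> \<eta> * \<bar>s - t\<bar>" if p: "p \<in> Omega" for p
      proof -
        have p2: "p \<in> box2" using p Omega_subset_box2 by auto
        let ?S = "{r..T} \<inter> {t - \<bar>s - t\<bar>..t + \<bar>s - t\<bar>}"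
        have "norm ((H s p - s * Ht t p) - (H t p - t * Ht t p)) \<le> \<eta> * norm (s - t)"
        proof (rule field_differentiable_bound[of ?S "\<lambda>\<tau>. H \<tau> p - \<tau> * Ht t p" "\<lambda>\<tau>. Ht \<tau> p - Ht t p"])
          show "convex ?S" by (intro convex_Int convex_real_interval)
          fix z assume z: "z \<in> ?S"
          have "((\<lambda>t. H t p) has_real_derivative Ht z p) (at z within ?S)"
            using z by (intro has_field_derivative_subset[OF d[OF _ p2]]) auto
          then show "((\<lambda>\<tau>. H \<tau> p - \<tau> * Ht t p) has_real_derivative Ht z p - Ht t p) (at z within ?S)"
            by (auto intro!: derivative_eq_intros)
          have "\<bar>z - t\<bar> < \<delta>" using z s by (auto simp: dist_real_def)
          then show "norm (Ht z p - Ht t p) \<le> \<eta>" using \<delta>(2)[of z t p] z t p2 by auto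
        qed (use s t in \<open>auto simp: abs_if\<close>)
        then show ?thesis by (simp add: G_def algebra_simps)
      qed
      then have "\<bar>ip G h\<bar> \<le> (\<eta> * \<bar>s - t\<bar>) * (2 * sqrt (ip h h))" using \<eta> by (intro ip_uniform_le LG h) auto
      moreover have "ip G h = (ip (H s) h - ip (H t) h) - (s - t) * ip (Ht t) h"
        unfolding G_def using s t h by (simp add: ip_diff ip_scale L L2_diff L2_scale)
      ultimately have "\<bar>(ip (H s) h - ip (H t) h) - (s - t) * ip (Ht t) h\<bar> \<le> (\<eta> * (2 * sqrt (ip h h))) * \<bar>s - t\<bar>" by (simp add: mult_ac)
      then have "\<bar>(ip (H s) h - ip (H t) h) / (s - t) - ip (Ht t) h\<bar> \<le> \<eta> * (2 * sqrt (ip h h))"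
      proof -
        have st: "\<bar>s - t\<bar> > 0" using s by simp
        have "(ip (H s) h - ip (H t) h) / (s - t) - ip (Ht t) h = ((ip (H s) h - ip (H t) h) - (s - t) * ip (Ht t) h) / (s - t)"
          using st by (simp add: field_simps)
        then show ?thesis using \<open>_ \<le> (\<eta> * (2 * sqrt (ip h h))) * \<bar>s - t\<bar>\<close> st by (simp add: pos_divide_le_eq)
      qed
      also have "\<dots> < \<eta> * (2 * sqrt (ip h h) + 1)" using \<eta> by (intro mult_strict_left_mono) auto
      also have "\<dots> = e" unfolding \<eta>_def using less_imp_neq[OF hn] by (intro nonzero_eq_divide_eq[THEN iffD1]) auto
      finally show "dist ((ip (H s) h - ip (H t) h) / (s - t)) (ip (Ht t) h) < e" by (simp add: dist_real_def)
    qed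
  qed
  then show ?thesis by (simp add: has_field_derivative_iff)
qed

section \<open>Synthesis of the control\<close>

lemma ip_cong: "(\<And>p. p \<in> Omega \<Longrightarrow> f p = f' p) \<Longrightarrow> ip f h = ip f' h"
  unfolding ip_def by (intro Bochner_Integration.integral_cong) auto

lemma mode_solD:
  assumes "mode_sol a b q lam T1 T2 v B F Ft U"
  shows "\<And>t. \<exists>Fx Fxx. C2_on (-1) 1 (F t) Fx Fxx \<and> (\<forall>x\<in>{-1..1}. Ft t x = Fxx x - q x * F t x + U t x)"
    "\<And>t. F t (-1) = 0" "\<And>t. F t 1 = 0"
    "\<And>t x. x \<in> {-1..1} \<Longrightarrow> ((\<lambda>t. F t x) has_real_derivative Ft t x) (at t)"
    "continuous_on (UNIV \<times> {-1..1}) (\<lambda>z. F (fst z) (snd z))" "continuous_on (UNIV \<times> {-1..1}) (\<lambda>z. Ft (fst z) (snd z))"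
    "continuous_on (UNIV \<times> {-1..1}) (\<lambda>z. U (fst z) (snd z))"
    "\<And>t x. t \<le> T1 \<Longrightarrow> x \<in> {-1..1} \<Longrightarrow> F t x = exp (- lam * t) * v x"
    "\<And>t x. t \<ge> T2 \<Longrightarrow> x \<in> {-1..1} \<Longrightarrow> F t x = 0"
    "\<And>t x. x \<notin> {a<..<b} \<Longrightarrow> U t x = 0"
    "\<And>t x. t \<ge> T1 \<Longrightarrow> x \<in> {-1..1} \<Longrightarrow> \<bar>F t x\<bar> \<le> B * exp (- lam * T1)"
    "\<And>t x. x \<in> {-1..1} \<Longrightarrow> \<bar>U t x\<bar> \<le> B * exp (- lam * T1)"
  using assms unfolding mode_sol_def by blast+

lemma tensor_time_continuous:
  fixes F :: "real \<Rightarrow> real \<Rightarrow> real"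
  assumes "continuous_on (UNIV \<times> {-1..1}) (\<lambda>z. F (fst z) (snd z))" "continuous_on {0..1} s"
  shows "continuous_on (S \<times> box2) (\<lambda>z. tensor (F (fst z)) s (snd z))"
proof -
  have "continuous_on (S \<times> box2) (\<lambda>z. F (fst (fst z, fst (snd z))) (snd (fst z, fst (snd z))))"
    by (rule continuous_on_compose2[OF assms(1)]) (auto intro!: continuous_intros simp: box2_iff)
  moreover have "continuous_on (S \<times> box2) (\<lambda>z. s (snd (snd z)))"
    by (rule continuous_on_compose2[OF assms(2)]) (auto intro!: continuous_intros simp: box2_iff)
  ultimately show ?thesis unfolding tensor_def by (auto intro!: continuous_on_mult)
qed

lemma continuous_ip_time:
  fixes H :: "real \<Rightarrow> real \<times> real \<Rightarrow> real"
  assumes "continuous_on ({r..T} \<times> box2) (\<lambda>z. H (fst z) (snd z))" "L2 h"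
  shows "continuous_on {r..T} (\<lambda>t. ip (H t) h)"
  by (rule continuous_ip_of_dist2[OF _ assms(2) dist2_time_continuous[OF assms(1)]])
     (auto intro!: continuous_L2 time_section_continuous[OF assms(1)])

lemma continuous_time_box_integrable:
  fixes f :: "real \<times> real \<times> real \<Rightarrow> real"
  assumes "continuous_on (UNIV \<times> box2) f"
  shows "integrable (lebesgue_on ({0<..<T} \<times> Omega)) f"
proof -
  have eq: "cbox (0, (-1, 0)) (T, (1, 1)) = {0..T} \<times> box2" by (auto simp: cbox_Pair_eq)
  have "f absolutely_integrable_on (cbox (0, (-1, 0)) (T, (1, 1)))"
    by (rule absolutely_integrable_continuous) (rule continuous_on_subset[OF assms], auto simp: eq)
  moreover have st: "{0<..<T} \<times> Omega \<in> sets lebesgue"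
  proof -
    have "open ({0<..<T} \<times> Omega)" unfolding Omega_box by (intro open_Times open_greaterThanLessThan open_box)
    then have "{0<..<T} \<times> Omega \<in> sets lborel" unfolding sets_lborel by (rule borel_open)
    then show ?thesis by (rule sets_completionI_sets)
  qed
  ultimately have "f absolutely_integrable_on ({0<..<T} \<times> Omega)"
    by (rule set_integrable_subset) (use Omega_subset_box2 in \<open>auto simp: eq\<close>)
  then show ?thesis using st by (rule absolutely_integrable_imp_integrable)
qed

context grushin_modes
begin

lemma ip_comb_self:
  assumes "finite A" shows "ip (\<lambda>p. \<Sum>j\<in>A. a j * es j p) (\<lambda>p. \<Sum>j\<in>A. a j * es j p) = (\<Sum>j\<in>A. (a j)^2)"
proof -
  have L: "L2 (\<lambda>p. \<Sum>j\<in>A. a j * es j p)" by (intro L2_sum L2_scale es_L2)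
  have 1: "ip (\<lambda>p. \<Sum>j\<in>A. a j * es j p) (es i) = a i" if "i \<in> A" for i
  proof -
    have "ip (\<lambda>p. \<Sum>j\<in>A. a j * es j p) (es i) = (\<Sum>j\<in>A. a j * ip (es j) (es i))"
      by (subst ip_sum) (auto intro: L2_scale es_L2 simp: ip_scale)
    also have "\<dots> = (\<Sum>j\<in>A. if j = i then a i else 0)" by (intro sum.cong) (auto simp: es_orth)
    finally show ?thesis using assms that by simp
  qed
  have "ip (\<lambda>p. \<Sum>j\<in>A. a j * es j p) (\<lambda>p. \<Sum>j\<in>A. a j * es j p) = (\<Sum>j\<in>A. a j * ip (es j) (\<lambda>p. \<Sum>j\<in>A. a j * es j p))"
    using L by (subst ip_sum) (auto intro: L2_scale es_L2 simp: ip_scale)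
  also have "\<dots> = (\<Sum>j\<in>A. (a j)^2)" using 1 by (intro sum.cong) (auto simp: ip_commute[of "es _" "\<lambda>p. \<Sum>j\<in>A. a j * es j p"] power2_eq_square)
  finally show ?thesis .
qed

text \<open>At each time the product of F \<tau> and s_m is itself in the domain of the operator
  with an explicit image, so symmetry moves the operator onto the arbitrary test element h.
  Integrating the time derivative of the pairing gives the weak identity.\<close>

lemma modal_identity:
  assumes ms: "mode_sol a b (\<lambda>x. \<nu> m * \<bar>x\<bar> powr (2 * \<gamma>)) lam' T1 T2 v' B F Ft U"
    and A: "is_A \<gamma> h g" and rt: "r \<le> t"
  shows "ip (tensor (F t) (s m)) h - ip (tensor (F r) (s m)) h
     = integral {r..t} (\<lambda>\<tau>. ip (tensor (F \<tau>) (s m)) g + ip (tensor (U \<tau>) (s m)) h)"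
proof -
  note M = mode_solD[OF ms]
  have Lh: "L2 h" "L2 g" using is_A_L2[OF A] by auto
  have der: "ip (tensor (Ft \<tau>) (s m)) h = ip (tensor (F \<tau>) (s m)) g + ip (tensor (U \<tau>) (s m)) h" for \<tau>
  proof -
    obtain Fx Fxx where FF: "C2_on (-1) 1 (F \<tau>) Fx Fxx" "\<And>x. x \<in> {-1..1} \<Longrightarrow> Ft \<tau> x = Fxx x - \<nu> m * \<bar>x\<bar> powr (2 * \<gamma>) * F \<tau> x + U \<tau> x"
      using M(1)[of \<tau>] by blast
    let ?g = "\<lambda>p. Fxx (fst p) * s m (snd p) + weight \<gamma> p * F \<tau> (fst p) * (- \<nu> m * s m (snd p))"
    have isA: "is_A \<gamma> (tensor (F \<tau>) (s m)) ?g"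
      by (rule is_A_tensor[OF gamma FF(1) M(2,3) s_C2 s_0 s_1])
    have LU: "L2 (tensor (U \<tau>) (s m))"
      using time_section_continuous[OF tensor_time_continuous[OF M(7) s_cont], of \<tau> UNIV] by (intro continuous_L2) simp
    have "ip (tensor (Ft \<tau>) (s m)) h = ip (\<lambda>p. ?g p + tensor (U \<tau>) (s m) p) h"
    proof (rule ip_cong)
      fix p assume "p \<in> Omega"
      then have "fst p \<in> {-1..1}" by (auto simp: Omega_def)
      then show "tensor (Ft \<tau>) (s m) p = ?g p + tensor (U \<tau>) (s m) p"
        unfolding tensor_def FF(2)[OF \<open>fst p \<in> {-1..1}\<close>] weight_def by (simp add: algebra_simps)
    qed
    also have "\<dots> = ip ?g h + ip (tensor (U \<tau>) (s m)) h" by (rule ip_add[OF is_A_L2(2)[OF isA] LU Lh(1)])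
    also have "ip ?g h = ip (tensor (F \<tau>) (s m)) g" using is_A_symmetric[OF isA A] by (simp add: ip_commute)
    finally show ?thesis .
  qed
  have "((\<lambda>\<tau>. ip (tensor (Ft \<tau>) (s m)) h) has_integral (ip (tensor (F t) (s m)) h - ip (tensor (F r) (s m)) h)) {r..t}"
  proof (rule fundamental_theorem_of_calculus[OF rt])
    fix \<tau> assume \<tau>: "\<tau> \<in> {r..t}"
    have "((\<lambda>t. ip (tensor (F t) (s m)) h) has_real_derivative ip (tensor (Ft \<tau>) (s m)) h) (at \<tau> within {r..t})"
    proof (rule ip_time_derivative[OF tensor_time_continuous[OF M(5) s_cont] tensor_time_continuous[OF M(6) s_cont] _ Lh(1) \<tau>])
      fix t' p assume "p \<in> box2"
      then have "fst p \<in> {-1..1}" by (simp add: box2_iff)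
      then show "((\<lambda>t. tensor (F t) (s m) p) has_real_derivative tensor (Ft t') (s m) p) (at t' within {r..t})"
        unfolding tensor_def by (intro DERIV_cmult_right has_field_derivative_at_within[OF M(4)])
    qed
    then show "((\<lambda>t. ip (tensor (F t) (s m)) h) has_vector_derivative ip (tensor (Ft \<tau>) (s m)) h) (at \<tau> within {r..t})"
      by (simp add: has_real_derivative_iff_has_vector_derivative)
  qed
  then show ?thesis by (simp add: der integral_unique)
qed

text \<open>Solution and control are the sums of the mode trajectories with the coefficients of f0.
  The series converge uniformly for t \<ge> \<epsilon> > 0, but at t = 0 the expansion of an L2
  function need not converge pointwise. The weak identity is therefore proved on [r,t] with r > 0
  and extended to r = 0 by continuity in L2.\<close>

theorem null_controllable_of_modes:
  assumes ab: "0 < a" "a < b" "b < 1" and T: "0 < T1" "T1 < T2" "T2 \<le> T"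
    and ms: "\<And>j. mode_sol a b (\<lambda>x. \<nu> (fst (prod_decode j)) * \<bar>x\<bar> powr (2 * \<gamma>)) (ls j) T1 T2
        (v (fst (prod_decode j)) (snd (prod_decode j))) (B j) (F j) (Ft j) (U j)"
    and B0: "\<And>j. B j \<ge> 0"
    and sm1: "\<And>\<epsilon>. \<epsilon> > 0 \<Longrightarrow> summable (\<lambda>j. exp (- ls j * \<epsilon>) * sqrt (2 * ls j * \<nu> (fst (prod_decode j))))"
    and sm2: "summable (\<lambda>j. B j * exp (- ls j * T1) * sqrt (\<nu> (fst (prod_decode j))))"
  shows "null_controllable \<gamma> a b T"
  unfolding null_controllable_def
proof (intro allI impI)
  fix f0 assume f0: "L2 f0"
  define c where "c j = ip f0 (es j)" for j
  define N where "N = sqrt (ip f0 f0)"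
  have N: "N \<ge> 0" by (simp add: N_def ip_nonneg)
  have cN: "\<bar>c j\<bar> \<le> N" for j using abs_ip_le[OF f0 es_L2, of j] by (simp add: c_def N_def es_orth)
  define sj where "sj j = s (fst (prod_decode j))" for j
  define \<nu>j where "\<nu>j j = \<nu> (fst (prod_decode j))" for j
  have lsp: "ls j > 0" for j by (simp add: ls_def lam_pos)
  have sjc: "continuous_on {0..1} (sj j)" for j by (simp add: sj_def s_cont)
  have sjb: "\<bar>sj j y\<bar> \<le> sqrt (\<nu>j j)" if "y \<in> {0..1}" for j y
    using s_sup[OF that] by (simp add: sj_def \<nu>j_def real_le_rsqrt)
  note M = mode_solD[OF ms]
  define Fs where "Fs j t = tensor (F j t) (sj j)" for j t
  define Us where "Us j t = tensor (U j t) (sj j)" for j t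
  have cFs: "continuous_on (S \<times> box2) (\<lambda>z. Fs j (fst z) (snd z))" for S j unfolding Fs_def by (rule tensor_time_continuous[OF M(5) sjc])
  have cUs: "continuous_on (S \<times> box2) (\<lambda>z. Us j (fst z) (snd z))" for S j unfolding Us_def by (rule tensor_time_continuous[OF M(7) sjc])
  define \<kappa> where "\<kappa> j = B j * exp (- ls j * T1) * sqrt (\<nu>j j)" for j
  define \<kappa>F where "\<kappa>F \<epsilon> j = \<kappa> j + exp (- ls j * \<epsilon>) * sqrt (2 * ls j * \<nu>j j)" for \<epsilon> j
  have \<nu>j0: "\<nu>j j > 0" for j by (simp add: \<nu>j_def nu_pos)
  have \<kappa>0: "\<kappa> j \<ge> 0" for j using B0[of j] \<nu>j0[of j] by (simp add: \<kappa>_def)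
  have bU: "\<bar>Us j t p\<bar> \<le> \<kappa> j" if "p \<in> box2" for j t p
    unfolding Us_def tensor_def abs_mult \<kappa>_def using that B0[of j] by (intro mult_mono M(12) sjb) (auto simp: box2_iff)
  have bF: "\<bar>Fs j t p\<bar> \<le> \<kappa>F \<epsilon> j" if p: "p \<in> box2" and t: "\<epsilon> \<le> t" and e: "\<epsilon> > 0" for j t p \<epsilon>
  proof (cases "t \<ge> T1")
    case True
    have "\<bar>Fs j t p\<bar> \<le> \<kappa> j" unfolding Fs_def tensor_def abs_mult \<kappa>_def
      using p B0[of j] by (intro mult_mono M(11)[OF True] sjb) (auto simp: box2_iff)
    moreover have "0 \<le> exp (- ls j * \<epsilon>) * sqrt (2 * ls j * \<nu>j j)" using lsp[of j] \<nu>j0[of j] by simp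
    ultimately show ?thesis by (simp add: \<kappa>F_def)
  next
    case False
    have x: "fst p \<in> {-1..1}" using p by (simp add: box2_iff)
    have "\<bar>v (fst (prod_decode j)) (snd (prod_decode j)) (fst p)\<bar> \<le> sqrt (2 * ls j)"
      using v_sup[OF x] by (simp add: ls_def real_le_rsqrt)
    then have "\<bar>F j t (fst p)\<bar> \<le> exp (- ls j * \<epsilon>) * sqrt (2 * ls j)"
      using M(8)[of t "fst p" j] False x t lsp[of j] by (simp add: abs_mult mult_mono mult_left_mono)
    then have "\<bar>Fs j t p\<bar> \<le> (exp (- ls j * \<epsilon>) * sqrt (2 * ls j)) * sqrt (\<nu>j j)"
      unfolding Fs_def tensor_def abs_mult using p lsp[of j] by (intro mult_mono sjb) (auto simp: box2_iff)
    then show ?thesis using \<kappa>0[of j] by (simp add: \<kappa>F_def real_sqrt_mult mult.assoc)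
  qed
  have s\<kappa>: "summable (\<lambda>j. N * \<kappa> j)" unfolding \<kappa>_def \<nu>j_def by (intro summable_mult sm2)
  have s\<kappa>F: "summable (\<lambda>j. N * \<kappa>F \<epsilon> j)" if "\<epsilon> > 0" for \<epsilon>
    unfolding \<kappa>F_def \<kappa>_def \<nu>j_def by (intro summable_mult summable_add sm2 sm1 that)
  have bcU: "\<bar>c j * Us j t p\<bar> \<le> N * \<kappa> j" if "p \<in> box2" for j t p
    unfolding abs_mult by (intro mult_mono cN bU that N) auto
  have bcF: "\<bar>c j * Fs j t p\<bar> \<le> N * \<kappa>F \<epsilon> j" if "p \<in> box2" "\<epsilon> \<le> t" "\<epsilon> > 0" for j t p \<epsilon>
    unfolding abs_mult by (intro mult_mono cN bF that N) auto
  define u where "u t p = (\<Sum>j. c j * Us j t p)" for t p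
  define fs where "fs t p = (\<Sum>j. c j * Fs j t p)" for t p
  \<comment> \<open>At t = 0 the datum itself is taken, since the series \<open>fs\<close> need not
    represent it there.\<close>
  define f where "f t = (if t \<le> 0 then f0 else fs t)" for t
  define S where "S n t p = (\<Sum>j<n. c j * Fs j t p)" for n t p
  define Sn where "Sn n t p = (\<Sum>j<n. c j * Us j t p)" for n t p
  have cu: "continuous_on (UNIV \<times> box2) (\<lambda>z. u (fst z) (snd z))" unfolding u_def
    by (rule continuous_on_suminf[OF _ _ s\<kappa>]) (auto intro!: continuous_on_mult_left cUs bcU)
  have cfs: "continuous_on ({r..} \<times> box2) (\<lambda>z. fs (fst z) (snd z))" if "r > 0" for r unfolding fs_def
    by (rule continuous_on_suminf[OF _ _ s\<kappa>F[OF that]]) (use that in \<open>auto intro!: continuous_on_mult_left cFs bcF\<close>)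
  have cfs': "continuous_on ({r..T'} \<times> box2) (\<lambda>z. fs (fst z) (snd z))" if "r > 0" for r T'
    by (rule continuous_on_subset[OF cfs[OF that]]) auto
  have cu': "continuous_on ({r..T'} \<times> box2) (\<lambda>z. u (fst z) (snd z))" for r T'
    by (rule continuous_on_subset[OF cu]) auto
  have Lu: "L2 (u t)" for t by (intro continuous_L2 time_section_continuous[OF cu]) simp
  have Lfs: "L2 (fs t)" if "t > 0" for t by (intro continuous_L2 time_section_continuous[OF cfs[OF that]]) simp
  have LFs: "L2 (Fs j t)" for j t by (intro continuous_L2 time_section_continuous[OF cFs[of UNIV]]) simp
  have LUs: "L2 (Us j t)" for j t by (intro continuous_L2 time_section_continuous[OF cUs[of UNIV]]) simp
  have LS: "L2 (S n t)" for n t unfolding S_def by (intro L2_sum L2_scale LFs)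
  have LSn: "L2 (Sn n t)" for n t unfolding Sn_def by (intro L2_sum L2_scale LUs)
  have Lf: "L2 (f t)" for t using f0 Lfs by (simp add: f_def)
  have u_supp: "indicator (omega a b) p * u t p = u t p" if "p \<in> Omega" for p t
  proof (cases "p \<in> omega a b")
    case False
    then have "fst p \<notin> {a<..<b}" using that by (auto simp: omega_def Omega_def)
    then have "Us j t p = 0" for j by (simp add: Us_def tensor_def M(10))
    then show ?thesis by (simp add: u_def)
  qed simp
  have ipu: "ip (\<lambda>p. indicator (omega a b) p * u t p) h = ip (u t) h" for t h by (rule ip_cong[OF u_supp])
  have unifF: "uniform_limit ({r..} \<times> box2) (\<lambda>n z. S n (fst z) (snd z)) (\<lambda>z. fs (fst z) (snd z)) sequentially" if "r > 0" for r
    unfolding S_def fs_def by (rule Weierstrass_m_test[OF _ s\<kappa>F[OF that]]) (use that in \<open>auto intro!: bcF\<close>)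
  have unifU: "uniform_limit (UNIV \<times> box2) (\<lambda>n z. Sn n (fst z) (snd z)) (\<lambda>z. u (fst z) (snd z)) sequentially"
    unfolding Sn_def u_def by (rule Weierstrass_m_test[OF _ s\<kappa>]) (auto intro!: bcU)
  have ulim: "uniform_limit A (\<lambda>n t. ip (X n t) h) (\<lambda>t. ip (Y t) h) sequentially"
    if h: "L2 h" and X: "\<And>n t. L2 (X n t)" and Y: "\<And>t. t \<in> A \<Longrightarrow> L2 (Y t)"
      and lim: "uniform_limit (A \<times> box2) (\<lambda>n z. X n (fst z) (snd z)) (\<lambda>z. Y (fst z) (snd z)) sequentially"
    for A :: "real set" and h X and Y :: "real \<Rightarrow> real \<times> real \<Rightarrow> real"
  proof (rule uniform_limitI)
    fix e :: real assume e: "e > 0"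
    define \<eta> where "\<eta> = e / (2 * sqrt (ip h h) + 1)"
    have hn: "2 * sqrt (ip h h) + 1 > 0" using ip_nonneg[of h] by (intro add_nonneg_pos) auto
    have \<eta>: "\<eta> > 0" using divide_pos_pos[OF e hn] by (simp add: \<eta>_def)
    show "\<forall>\<^sub>F n in sequentially. \<forall>t\<in>A. dist (ip (X n t) h) (ip (Y t) h) < e"
      using uniform_limitD[OF lim \<eta>]
    proof eventually_elim
      case (elim n)
      show ?case
      proof
        fix t assume t: "t \<in> A"
        have "\<bar>ip (\<lambda>p. X n t p - Y t p) h\<bar> \<le> \<eta> * (2 * sqrt (ip h h))"
        proof (rule ip_uniform_le[OF L2_diff[OF X Y[OF t]] h])
          show "\<bar>X n t p - Y t p\<bar> \<le> \<eta>" if "p \<in> Omega" for p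
            using elim[rule_format, of "(t, p)"] t that Omega_subset_box2 by (force simp: dist_real_def)
        qed (use \<eta> in simp)
        also have "\<dots> < \<eta> * (2 * sqrt (ip h h) + 1)" using \<eta> by (intro mult_strict_left_mono) auto
        also have "\<dots> = e" unfolding \<eta>_def using less_imp_neq[OF hn] by (intro nonzero_eq_divide_eq[THEN iffD1]) auto
        finally show "dist (ip (X n t) h) (ip (Y t) h) < e" using ip_diff[OF X Y[OF t] h] by (simp add: dist_real_def)
      qed
    qed
  qed
  \<comment> \<open>Partial sums satisfy the identity by \<open>modal_identity\<close>; uniform
    convergence on [r,t] passes it to the limit.\<close>
  have ident: "ip (fs t) h - ip (fs r) h = integral {r..t} (\<lambda>\<tau>. ip (fs \<tau>) g + ip (u \<tau>) h)"
    if A: "is_A \<gamma> h g" and r: "0 < r" "r \<le> t" for h g r t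
  proof -
    have Lh: "L2 h" "L2 g" using is_A_L2[OF A] by auto
    have sub: "uniform_limit ({r..t} \<times> box2) (\<lambda>n z. S n (fst z) (snd z)) (\<lambda>z. fs (fst z) (snd z)) sequentially"
      by (rule uniform_limit_on_subset[OF unifF[OF r(1)]]) auto
    have subU: "uniform_limit ({r..t} \<times> box2) (\<lambda>n z. Sn n (fst z) (snd z)) (\<lambda>z. u (fst z) (snd z)) sequentially"
      by (rule uniform_limit_on_subset[OF unifU]) auto
    have Lfs': "L2 (fs \<tau>)" if "\<tau> \<in> {r..t}" for \<tau> using Lfs[of \<tau>] that r by auto
    have l1: "uniform_limit {r..t} (\<lambda>n \<tau>. ip (S n \<tau>) g) (\<lambda>\<tau>. ip (fs \<tau>) g) sequentially" by (rule ulim[OF Lh(2) LS Lfs' sub])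
    have l2: "uniform_limit {r..t} (\<lambda>n \<tau>. ip (Sn n \<tau>) h) (\<lambda>\<tau>. ip (u \<tau>) h) sequentially" by (rule ulim[OF Lh(1) LSn Lu subU])
    have l3: "uniform_limit {r..t} (\<lambda>n \<tau>. ip (S n \<tau>) h) (\<lambda>\<tau>. ip (fs \<tau>) h) sequentially" by (rule ulim[OF Lh(1) LS Lfs' sub])
    have l12: "uniform_limit {r..t} (\<lambda>n \<tau>. ip (S n \<tau>) g + ip (Sn n \<tau>) h) (\<lambda>\<tau>. ip (fs \<tau>) g + ip (u \<tau>) h) sequentially"
      by (rule uniform_limit_add[OF l1 l2])
    have cS: "continuous_on {r..t} (\<lambda>\<tau>. ip (S n \<tau>) k)" if "L2 k" for n k
      by (rule continuous_ip_time[OF _ that]) (auto simp: S_def intro!: continuous_on_sum continuous_on_mult_left cFs)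
    have cSn: "continuous_on {r..t} (\<lambda>\<tau>. ip (Sn n \<tau>) k)" if "L2 k" for n k
      by (rule continuous_ip_time[OF _ that]) (auto simp: Sn_def intro!: continuous_on_sum continuous_on_mult_left cUs)
    have fin: "ip (S n t) h - ip (S n r) h = integral {r..t} (\<lambda>\<tau>. ip (S n \<tau>) g + ip (Sn n \<tau>) h)" for n
    proof -
      have e1: "ip (S n \<tau>) k = (\<Sum>j<n. c j * ip (Fs j \<tau>) k)" if "L2 k" for \<tau> k
        unfolding S_def using that by (subst ip_sum) (auto intro: L2_scale LFs simp: ip_scale)
      have e2: "ip (Sn n \<tau>) k = (\<Sum>j<n. c j * ip (Us j \<tau>) k)" if "L2 k" for \<tau> k
        unfolding Sn_def using that by (subst ip_sum) (auto intro: L2_scale LUs simp: ip_scale)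
      have "ip (S n t) h - ip (S n r) h = (\<Sum>j<n. c j * (ip (Fs j t) h - ip (Fs j r) h))"
        using Lh by (simp add: e1 sum_subtractf right_diff_distrib)
      also have "\<dots> = (\<Sum>j<n. integral {r..t} (\<lambda>\<tau>. c j * (ip (Fs j \<tau>) g + ip (Us j \<tau>) h)))"
        using modal_identity[OF ms A r(2)] by (simp add: Fs_def Us_def sj_def)
      also have "\<dots> = integral {r..t} (\<lambda>\<tau>. \<Sum>j<n. c j * (ip (Fs j \<tau>) g + ip (Us j \<tau>) h))"
        by (intro Henstock_Kurzweil_Integration.integral_sum[symmetric] integrable_continuous_real continuous_intros
            continuous_ip_time[OF cFs Lh(2)] continuous_ip_time[OF cUs Lh(1)]) auto
      also have "\<dots> = integral {r..t} (\<lambda>\<tau>. ip (S n \<tau>) g + ip (Sn n \<tau>) h)"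
        using Lh by (simp add: e1 e2 sum.distrib distrib_left)
      finally show ?thesis .
    qed
    obtain I J where IJ: "\<And>n. ((\<lambda>\<tau>. ip (S n \<tau>) g + ip (Sn n \<tau>) h) has_integral I n) {r..t}"
      "((\<lambda>\<tau>. ip (fs \<tau>) g + ip (u \<tau>) h) has_integral J) {r..t}" "I \<longlonglongrightarrow> J"
      by (rule uniform_limit_integral[OF l12 continuous_on_add[OF cS[OF Lh(2)] cSn[OF Lh(1)]]]) auto
    have "I n = ip (S n t) h - ip (S n r) h" for n using fin[of n] IJ(1)[of n] by (simp add: integral_unique)
    then have "I = (\<lambda>n. ip (S n t) h - ip (S n r) h)" by (rule ext)
    then have "(\<lambda>n. ip (S n t) h - ip (S n r) h) \<longlonglongrightarrow> J" using IJ(3) by simp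
    moreover have "(\<lambda>n. ip (S n t) h - ip (S n r) h) \<longlonglongrightarrow> ip (fs t) h - ip (fs r) h"
      using r by (intro tendsto_diff tendsto_uniform_limitI[OF l3]) auto
    ultimately have "ip (fs t) h - ip (fs r) h = J" using LIMSEQ_unique by blast
    then show ?thesis using IJ(2) by (simp add: integral_unique)
  qed
  \<comment> \<open>Compare through the partial sum S n: for small t it is close to its initial
    value P n, and P n is close to f0 by Parseval. The tail is controlled uniformly in t because the
    modes are orthogonal and merely decay up to T1.\<close>
  have cont0: "((\<lambda>t. dist2 (f t) (f 0)) \<longlongrightarrow> 0) (at 0 within {0..T})"
  proof (rule tendstoI)
    fix e :: real assume e: "e > 0"
    define P where "P n p = (\<Sum>j<n. c j * es j p)" for n p
    have LP: "L2 (P n)" for n unfolding P_def by (rule comb_L2)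
    have "(\<lambda>n. dist2 f0 (P n)) \<longlonglongrightarrow> 0" using parseval[OF f0] by (simp add: P_def[abs_def] c_def)
    then have "\<forall>\<^sub>F n in sequentially. dist2 f0 (P n) < e / 32" using e by (intro order_tendstoD(2)[of _ 0]) auto
    then obtain n where n: "dist2 f0 (P n) < e / 32" by (auto simp: eventually_sequentially)
    have Fes: "Fs j t p = exp (- ls j * t) * es j p" if "t \<le> T1" "p \<in> Omega" for j t p
    proof -
      have "fst p \<in> {-1..1}" using that by (auto simp: Omega_def)
      then show ?thesis using M(8)[OF that(1)] by (simp add: Fs_def tensor_def es_def ef_def sj_def)
    qed
    have tail: "(\<Sum>j\<in>{n..<k}. (c j)^2) \<le> dist2 f0 (P n)" if "n \<le> k" for k
    proof -
      have "dist2 f0 (P n) = ip f0 f0 - (\<Sum>j<n. (c j)^2)" unfolding P_def by (simp add: dist2_comb[OF f0] c_def)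
      moreover have "(\<Sum>j<k. (c j)^2) \<le> ip f0 f0" unfolding c_def by (rule bessel[OF f0])
      moreover have "(\<Sum>j<k. (c j)^2) = (\<Sum>j<n. (c j)^2) + (\<Sum>j\<in>{n..<k}. (c j)^2)"
        using that by (simp add: sum.atLeastLessThan_concat lessThan_atLeast0)
      ultimately show ?thesis by linarith
    qed
    have d1: "dist2 (fs t) (S n t) \<le> 4 * dist2 f0 (P n) + e / 16" if t: "0 < t" "t \<le> T1" for t
    proof -
      define \<eta> where "\<eta> = sqrt (e / 64)"
      have \<eta>: "\<eta> > 0" "\<eta>^2 = e / 64" using e by (auto simp: \<eta>_def)
      have "\<forall>\<^sub>F k in sequentially. k \<ge> n \<and> (\<forall>z\<in>{t..} \<times> box2. dist (S k (fst z) (snd z)) (fs (fst z) (snd z)) < \<eta>)"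
        by (intro eventually_conj eventually_ge_at_top uniform_limitD[OF unifF[OF t(1)] \<eta>(1)])
      then obtain k where k: "k \<ge> n" "\<And>z. z \<in> {t..} \<times> box2 \<Longrightarrow> dist (S k (fst z) (snd z)) (fs (fst z) (snd z)) < \<eta>"
        by (auto simp: eventually_sequentially)
      have "dist2 (fs t) (S k t) \<le> 2 * \<eta>^2"
      proof (rule dist2_le_of_uniform[OF Lfs[OF t(1)] LS])
        fix p assume "p \<in> Omega"
        then have "(t, p) \<in> {t..} \<times> box2" using Omega_subset_box2 by auto
        from k(2)[OF this] show "\<bar>fs t p - S k t p\<bar> \<le> \<eta>" by (simp add: dist_real_def abs_minus_commute)
      qed
      moreover have "dist2 (S k t) (S n t) \<le> dist2 f0 (P n)"
      proof -
        have "dist2 (S k t) (S n t) = dist2 (\<lambda>p. \<Sum>j\<in>{n..<k}. (c j * exp (- ls j * t)) * es j p) (\<lambda>p. 0)"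
          unfolding dist2_def
        proof (intro Bochner_Integration.integral_cong refl)
          fix p assume "p \<in> space LO"
          then have p: "p \<in> Omega" by simp
          have "S k t p - S n t p = (\<Sum>j\<in>{n..<k}. c j * Fs j t p)"
            unfolding S_def using k(1) by (simp add: sum_diff_nat_ivl lessThan_atLeast0)
          then show "(S k t p - S n t p)^2 = ((\<Sum>j\<in>{n..<k}. (c j * exp (- ls j * t)) * es j p) - 0)^2"
            using Fes[OF t(2) p] by (simp add: mult.assoc)
        qed
        also have "\<dots> = (\<Sum>j\<in>{n..<k}. (c j * exp (- ls j * t))^2)" by (simp add: dist2_ip ip_comb_self)
        also have "\<dots> \<le> (\<Sum>j\<in>{n..<k}. (c j)^2)"
        proof (rule sum_mono)
          fix j
          have "(exp (- ls j * t))^2 \<le> 1^2" using lsp[of j] t by (intro power_mono) auto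
          then show "(c j * exp (- ls j * t))^2 \<le> (c j)^2" unfolding power_mult_distrib by (intro mult_left_le) auto
        qed
        also have "\<dots> \<le> dist2 f0 (P n)" by (rule tail[OF k(1)])
        finally show ?thesis .
      qed
      ultimately have "2 * dist2 (fs t) (S k t) + 2 * dist2 (S k t) (S n t) \<le> 4 * dist2 f0 (P n) + e / 16"
        using \<eta> dist2_nonneg[of f0 "P n"] e by simp
      then show ?thesis using dist2_triangle[OF Lfs[OF t(1)] LS[of k t] LS[of n t]] by linarith
    qed
    have d2: "dist2 (S n t) (P n) = (\<Sum>j<n. (c j * exp (- ls j * t) - c j)^2)" if t: "t \<le> T1" for t
    proof -
      have "dist2 (S n t) (P n) = dist2 (\<lambda>p. \<Sum>j<n. (c j * exp (- ls j * t) - c j) * es j p) (\<lambda>p. 0)"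
        unfolding dist2_def
      proof (intro Bochner_Integration.integral_cong refl)
        fix p assume "p \<in> space LO"
        then show "(S n t p - P n p)^2 = ((\<Sum>j<n. (c j * exp (- ls j * t) - c j) * es j p) - 0)^2"
          using Fes[OF t, of p] by (simp add: S_def P_def sum_subtractf left_diff_distrib mult.assoc)
      qed
      then show ?thesis by (simp add: dist2_ip ip_comb_self)
    qed
    have "((\<lambda>t. \<Sum>j<n. (c j * exp (- ls j * t) - c j)^2) \<longlongrightarrow> (\<Sum>j<n. (c j * exp (- ls j * 0) - c j)^2)) (at 0 within {0..T})"
      by (intro tendsto_intros)
    then have "\<forall>\<^sub>F t in at 0 within {0..T}. (\<Sum>j<n. (c j * exp (- ls j * t) - c j)^2) < e / 32"
      using e by (intro order_tendstoD(2)) auto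
    moreover have "\<forall>\<^sub>F t in at 0 within {0..T}. 0 < t \<and> t \<le> T1"
      unfolding eventually_at using T by (intro exI[of _ T1]) (auto simp: dist_real_def)
    ultimately show "\<forall>\<^sub>F t in at 0 within {0..T}. dist (dist2 (f t) (f 0)) 0 < e"
    proof eventually_elim
      case (elim t)
      have "dist2 (fs t) f0 \<le> 2 * dist2 (fs t) (S n t) + 2 * dist2 (S n t) f0"
        by (intro dist2_triangle Lfs LS f0) (use elim in auto)
      moreover have "dist2 (S n t) f0 \<le> 2 * dist2 (S n t) (P n) + 2 * dist2 (P n) f0" by (intro dist2_triangle LS LP f0)
      ultimately have "dist2 (fs t) f0 < e"
        using d1[of t] d2[of t] elim n dist2_commute[of "P n" f0] e by simp
      then show ?case using elim dist2_nonneg by (simp add: f_def dist_real_def)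
    qed
  qed
  have contt: "((\<lambda>s. dist2 (f s) (f t)) \<longlongrightarrow> 0) (at t within {0..T})" if t: "t \<in> {0..T}" for t
  proof (cases "t = 0")
    case True
    then show ?thesis using cont0 by simp
  next
    case False
    then have tp: "t > 0" using t by simp
    have "((\<lambda>s. dist2 (fs s) (fs t)) \<longlongrightarrow> 0) (at t within {t/2..T})"
      by (rule dist2_time_continuous[OF cfs']) (use tp t in auto)
    also have "at t within {t/2..T} = at t within {0..T}"
      by (rule at_within_nhd[of t "{t/2<..}"]) (use tp in auto)
    finally have "((\<lambda>s. dist2 (fs s) (fs t)) \<longlongrightarrow> 0) (at t within {0..T})" .
    moreover have "\<forall>\<^sub>F s in at t within {0..T}. dist2 (fs s) (fs t) = dist2 (f s) (f t)"
      unfolding eventually_at using tp by (intro exI[of _ t]) (auto simp: f_def dist_real_def)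
    ultimately show ?thesis by (rule Lim_transform_eventually)
  qed
  have ws: "weak_sol \<gamma> a b T f0 u f"
    unfolding weak_sol_def
  proof (intro conjI ballI allI impI)
    show "L2 (f t)" for t by (rule Lf)
    show "((\<lambda>s. dist2 (f s) (f t)) \<longlongrightarrow> 0) (at t within {0..T})" if "t \<in> {0..T}" for t by (rule contt[OF that])
    show "AE p in LO. f 0 p = f0 p" by (simp add: f_def)
    fix h g t assume A: "is_A \<gamma> h g" and t: "t \<in> {0..T}"
    have Lh: "L2 h" "L2 g" using is_A_L2[OF A] by auto
    define \<Phi> where "\<Phi> \<tau> = ip (f \<tau>) g + ip (u \<tau>) h" for \<tau>
    have c\<Phi>: "continuous_on {0..T} \<Phi>" unfolding \<Phi>_def
      by (intro continuous_on_add continuous_ip_of_dist2[OF Lf Lh(2) contt] continuous_ip_time[OF cu' Lh(1)])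
    have c\<Phi>t: "continuous_on {0..t} \<Phi>" by (rule continuous_on_subset[OF c\<Phi>]) (use t in auto)
    have "set_integrable lborel {0..t} \<Phi>" by (rule borel_integrable_atLeastAtMost'[OF c\<Phi>t])
    then show "set_integrable lborel {0..t} (\<lambda>s. ip (f s) g + ip (\<lambda>p. indicator (omega a b) p * u s p) h)"
      unfolding ipu \<Phi>_def .
    have LB: "(LINT s:{0..t}|lborel. ip (f s) g + ip (\<lambda>p. indicator (omega a b) p * u s p) h) = integral {0..t} \<Phi>"
      unfolding ipu using set_borel_integral_eq_integral(2)[OF borel_integrable_atLeastAtMost'[OF c\<Phi>t]] by (simp add: \<Phi>_def)
    have "ip (f t) h = ip f0 h + integral {0..t} \<Phi>"
    proof (cases "t = 0")
      case True
      then show ?thesis by (simp add: f_def)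
    next
      case False
      then have tp: "t > 0" using t by simp
      \<comment> \<open>Constant on (0,t] by \<open>ident\<close> and continuous at 0, hence equal
        to its value at 0; this is the identity from time 0.\<close>
      define W where "W r = ip (f r) h - integral {0..r} \<Phi>" for r
      have Wr: "W r = W t" if r: "0 < r" "r \<le> t" for r
      proof -
        have "ip (f t) h - ip (f r) h = integral {r..t} \<Phi>"
        proof -
          have "integral {r..t} (\<lambda>\<tau>. ip (fs \<tau>) g + ip (u \<tau>) h) = integral {r..t} \<Phi>"
            using r by (intro Henstock_Kurzweil_Integration.integral_cong) (auto simp: \<Phi>_def f_def)
          then show ?thesis using ident[OF A r] r by (simp add: f_def)
        qed
        moreover have "integral {0..r} \<Phi> + integral {r..t} \<Phi> = integral {0..t} \<Phi>"
          using r by (intro Henstock_Kurzweil_Integration.integral_combine integrable_continuous_real c\<Phi>t) auto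
        ultimately show ?thesis by (simp add: W_def)
      qed
      have "continuous_on {0..t} (\<lambda>r. ip (f r) h)"
        by (rule continuous_on_subset[OF continuous_ip_of_dist2[OF Lf Lh(1) contt]]) (use t in auto)
      then have cW: "continuous_on {0..t} W" unfolding W_def
        by (intro continuous_on_diff indefinite_integral_continuous_1 integrable_continuous_real c\<Phi>t)
      have "(W \<longlongrightarrow> W 0) (at 0 within {0..t})" using cW tp by (auto simp: continuous_on_def)
      moreover have "(W \<longlongrightarrow> W t) (at 0 within {0..t})"
      proof (rule tendsto_eventually)
        show "\<forall>\<^sub>F r in at 0 within {0..t}. W r = W t"
          unfolding eventually_at
        proof (rule exI[of _ t], intro conjI ballI impI tp)
          fix r assume "r \<in> {0..t}" "r \<noteq> 0 \<and> dist r 0 < t"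
          then show "W r = W t" by (intro Wr) auto
        qed
      qed
      moreover have "at 0 within {0..t} \<noteq> bot" using tp by (simp add: trivial_limit_within islimpt_Icc)
      ultimately have "W 0 = W t" using tendsto_unique by blast
      then show ?thesis by (simp add: W_def f_def)
    qed
    then show "ip (f t) h = ip f0 h + (LINT s:{0..t}|lborel. ip (f s) g + ip (\<lambda>p. indicator (omega a b) p * u s p) h)"
      unfolding LB .
  qed
  have fT: "f T p = 0" if "p \<in> Omega" for p
  proof -
    have "fst p \<in> {-1..1}" using that by (auto simp: Omega_def)
    then have "Fs j T p = 0" for j using M(9)[OF T(3)] by (simp add: Fs_def tensor_def)
    then show ?thesis using T by (simp add: f_def fs_def)
  qed
  show "\<exists>u. control_L2 T u \<and> (\<exists>f. weak_sol \<gamma> a b T f0 u f) \<and> (\<forall>f. weak_sol \<gamma> a b T f0 u f \<longrightarrow> (AE p in LO. f T p = 0))"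
  proof (rule exI[of _ u], intro conjI allI impI)
    have i1: "integrable (lebesgue_on ({0<..<T} \<times> Omega)) (\<lambda>z. u (fst z) (snd z))" by (rule continuous_time_box_integrable[OF cu])
    have i2: "integrable (lebesgue_on ({0<..<T} \<times> Omega)) (\<lambda>z. (u (fst z) (snd z))^2)"
      by (rule continuous_time_box_integrable[OF continuous_on_power[OF cu]])
    show "control_L2 T u" unfolding control_L2_def case_prod_beta using i2 borel_measurable_integrable[OF i1] by simp
    show "\<exists>f. weak_sol \<gamma> a b T f0 u f" using ws by blast
    fix f' assume f': "weak_sol \<gamma> a b T f0 u f'"
    have "AE p in LO. f' T p = f T p" by (rule weak_sol_unique[OF f' ws]) (use T in auto)
    moreover have "AE p in LO. f T p = 0" using fT by (intro AE_I2) auto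
    ultimately show "AE p in LO. f' T p = 0" by eventually_elim simp
  qed
qed

end

section \<open>Dissipation and cost of the modes\<close>

text \<open>The left side is G' - G^2 + |\<sigma>|^(2\<gamma>) for G = \<sigma> / (2 (1 +
  \<sigma>^2)), the rescaled potential of the Hardy-type bound for the eigenvalues. With y =
  \<sigma>^2, the rational part suffices for small y and the power dominates for larger y; \<gamma>
  \<le> 1 gives y^\<gamma> \<ge> y in the middle range.\<close>

lemma hardy_profile_ge:
  fixes \<sigma> \<gamma> :: real
  assumes g: "0 < \<gamma>" "\<gamma> \<le> 1"
  shows "(2 - 3 * \<sigma>^2) / (4 * (1 + \<sigma>^2)^2) + \<bar>\<sigma>\<bar> powr (2 * \<gamma>) \<ge> 1 / 16"
proof -
  define y where "y = \<sigma>^2"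
  have y: "y \<ge> 0" by (simp add: y_def)
  have pw: "\<bar>\<sigma>\<bar> powr (2 * \<gamma>) = y powr \<gamma>"
  proof (cases "\<sigma> = 0")
    case False
    have yy: "y = \<bar>\<sigma>\<bar> powr 2" using False by (simp add: y_def)
    show ?thesis unfolding yy by (simp only: powr_powr)
  qed (use g in \<open>simp add: y_def\<close>)
  have "(2 - 3 * y) / (4 * (1 + y)^2) + y powr \<gamma> \<ge> 1 / 16"
  proof -
    consider "y \<le> 1/3" | "1/3 \<le> y" "y \<le> 1" | "1 \<le> y" by linarith
    then show ?thesis
    proof cases
      case 1
      have "(1 + y)^2 \<le> (4/3)^2" using 1 y by (intro power_mono) auto
      then have "(1::real) / (64/9) \<le> (2 - 3 * y) / (4 * (1 + y)^2)" using 1 y by (intro frac_le) (auto simp: power2_eq_square)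
      then have "9 / 64 \<le> (2 - 3 * y) / (4 * (1 + y)^2)" by simp
      then show ?thesis using powr_ge_zero[of y \<gamma>] by linarith
    next
      case 2
      have "y powr 1 \<le> y powr \<gamma>" using 2 g by (intro powr_mono') auto
      then have p: "1/3 \<le> y powr \<gamma>" using 2 by simp
      have "(4/3)^2 \<le> (1 + y)^2" using 2 by (intro power_mono) auto
      then have "1 / (4 * (1 + y)^2) \<le> 1 / (64/9)" using 2 by (intro divide_left_mono) (auto simp: power2_eq_square)
      then have "1 / (4 * (1 + y)^2) \<le> 9 / 64" by simp
      moreover have "- (1 / (4 * (1 + y)^2)) \<le> (2 - 3 * y) / (4 * (1 + y)^2)"
        unfolding minus_divide_left using 2 by (intro divide_right_mono) auto
      ultimately show ?thesis using p by linarith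
    next
      case 3
      have p: "1 \<le> y powr \<gamma>" using 3 g by (intro ge_one_powr_ge_zero) auto
      have "4 * y \<le> (1 + y)^2" using zero_le_power2[of "1 - y"] by (simp add: power2_eq_square algebra_simps)
      then have "3 * y / (4 * (1 + y)^2) \<le> 3 * y / (16 * y)" using 3 by (intro divide_left_mono) auto
      then have "3 * y / (4 * (1 + y)^2) \<le> 3 / 16" using 3 by simp
      moreover have "- (3 * y / (4 * (1 + y)^2)) \<le> (2 - 3 * y) / (4 * (1 + y)^2)"
        unfolding minus_divide_left using 3 by (intro divide_right_mono) auto
      ultimately show ?thesis using p by linarith
    qed
  qed
  then show ?thesis by (simp add: pw y_def)
qed

text \<open>The first n codes decode into the square of side n, so bounds on square partial sums
  suffice.\<close>

lemma summable_pairs: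
  fixes f :: "nat \<Rightarrow> nat \<Rightarrow> real"
  assumes nn: "\<And>m k. f m k \<ge> 0" and b: "\<And>n. (\<Sum>m<n. \<Sum>k<n. f m k) \<le> C"
  shows "summable (\<lambda>j. f (fst (prod_decode j)) (snd (prod_decode j)))"
proof (rule summableI_nonneg_bounded)
  fix n
  have sub: "prod_decode ` {..<n} \<subseteq> {..<n} \<times> {..<n}"
  proof
    fix z assume "z \<in> prod_decode ` {..<n}"
    then obtain j where j: "j < n" "z = prod_decode j" by auto
    have "prod_encode (fst z, snd z) = j" using j by simp
    then have "fst z < n" "snd z < n" using le_prod_encode_1[of "fst z" "snd z"] le_prod_encode_2[of "snd z" "fst z"] j by linarith+
    then show "z \<in> {..<n} \<times> {..<n}" by (simp add: mem_Times_iff)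
  qed
  have "(\<Sum>j<n. f (fst (prod_decode j)) (snd (prod_decode j))) = (\<Sum>z\<in>prod_decode ` {..<n}. f (fst z) (snd z))"
    by (subst sum.reindex) (auto intro!: inj_on_subset[OF inj_prod_decode])
  also have "\<dots> \<le> (\<Sum>z\<in>{..<n} \<times> {..<n}. f (fst z) (snd z))" by (intro sum_mono2 sub nn) auto
  also have "\<dots> = (\<Sum>m<n. \<Sum>k<n. f m k)" by (simp add: sum.cartesian_product case_prod_beta)
  also have "\<dots> \<le> C" by (rule b)
  finally show "(\<Sum>j<n. f (fst (prod_decode j)) (snd (prod_decode j))) \<le> C" .
qed (rule nn)

context grushin_modes
begin

text \<open>Expanding the integral of (v' + G v)^2 \<ge> 0 and integrating by parts bounds the
  energy below by the integral of (G' - G^2 + q) v^2. G is a fixed profile at the scale d where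
  \<nu> d^(2\<gamma>) = 1/d^2, that is where potential and second derivative balance; then 1/d^2 =
  \<nu>^(1/(1+\<gamma>)).\<close>

lemma lam_lower_bound:
  assumes g1: "\<gamma> \<le> 1"
  shows "lam m k \<ge> \<nu> m powr (1 / (1 + \<gamma>)) / 16"
proof -
  define \<alpha> where "\<alpha> = 1 / (1 + \<gamma>)"
  have \<alpha>: "\<alpha> * (1 + \<gamma>) = 1" using gamma by (simp add: \<alpha>_def)
  define d where "d = \<nu> m powr (- (\<alpha> / 2))"
  have d: "d > 0" using nu_pos[of m] by (simp add: d_def)
  have d2: "d^2 = \<nu> m powr (- \<alpha>)" unfolding d_def using nu_pos[of m] by (simp add: powr_power)
  have id2: "1 / d^2 = \<nu> m powr \<alpha>" unfolding d2 by (simp add: powr_minus_divide)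
  have \<nu>d: "\<nu> m * d powr (2 * \<gamma>) = 1 / d^2"
  proof -
    have "d powr (2 * \<gamma>) = \<nu> m powr (- (\<alpha> * \<gamma>))" by (simp add: d_def powr_powr)
    moreover have "\<nu> m = \<nu> m powr 1" using nu_pos[of m] by simp
    ultimately have "\<nu> m * d powr (2 * \<gamma>) = \<nu> m powr (1 + - (\<alpha> * \<gamma>))" by (simp only: powr_add)
    also have "1 + - (\<alpha> * \<gamma>) = \<alpha>" using \<alpha> by (simp add: algebra_simps)
    finally show ?thesis by (simp add: id2)
  qed
  define G where "G x = x / (2 * (d^2 + x^2))" for x
  define G1 where "G1 x = (d^2 - x^2) / (2 * (d^2 + x^2)^2)" for x
  have dp: "d^2 + x^2 > 0" for x using d by (simp add: add_pos_nonneg)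
  have dG: "(G has_real_derivative G1 x) (at x within A)" for x A
  proof -
    have "(G has_real_derivative (1 * (2 * (d^2 + x^2)) - x * (2 * (2 * x))) / ((2 * (d^2 + x^2)) * (2 * (d^2 + x^2)))) (at x within A)"
      unfolding G_def using dp[of x] by (auto intro!: derivative_eq_intros)
    also have "(1 * (2 * (d^2 + x^2)) - x * (2 * (2 * x))) / ((2 * (d^2 + x^2)) * (2 * (d^2 + x^2))) = (2 * (d^2 - x^2)) / (2 * (2 * (d^2 + x^2)^2))"
      by (simp add: power2_eq_square algebra_simps)
    also have "\<dots> = G1 x" unfolding G1_def by (rule mult_divide_mult_cancel_left) simp
    finally show ?thesis .
  qed
  have cG1: "continuous_on A G1" for A unfolding G1_def
    using dp by (intro continuous_intros) (auto simp: less_imp_neq[OF dp, symmetric])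
  have cG: "continuous_on A G" for A by (rule DERIV_continuous_on[OF dG])
  have key: "G1 x - (G x)^2 + \<nu> m * \<bar>x\<bar> powr (2 * \<gamma>) \<ge> 1 / (16 * d^2)" for x
  proof -
    define \<sigma> where "\<sigma> = x / d"
    have x: "x = \<sigma> * d" using d by (simp add: \<sigma>_def)
    have "\<nu> m * \<bar>x\<bar> powr (2 * \<gamma>) = (\<nu> m * d powr (2 * \<gamma>)) * \<bar>\<sigma>\<bar> powr (2 * \<gamma>)"
      unfolding x abs_mult using d by (simp add: powr_mult)
    then have 1: "\<nu> m * \<bar>x\<bar> powr (2 * \<gamma>) = \<bar>\<sigma>\<bar> powr (2 * \<gamma>) / d^2" by (simp add: \<nu>d)
    have s: "1 + \<sigma>^2 > 0" by (simp add: add_pos_nonneg)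
    have e: "d^2 + x^2 = d^2 * (1 + \<sigma>^2)" unfolding x by (simp add: power_mult_distrib algebra_simps)
    have "G1 x - (G x)^2 = ((2 - 3 * \<sigma>^2) / (4 * (1 + \<sigma>^2)^2)) / d^2"
    proof -
      have D0: "d^2 \<noteq> 0" using d by simp
      have x2: "x^2 = \<sigma>^2 * d^2" unfolding x by (rule power_mult_distrib)
      have gen: "(D - y * D) / (2 * (D * w)^2) = (1 - y) / (2 * w^2) / D" "(y * D) / (4 * (D * w)^2) = y / (4 * w^2) / D" if "D \<noteq> 0" for D y w :: real
      proof -
        have "(D - y * D) / (2 * (D * w)^2) = (D * (1 - y)) / (D * (2 * w^2 * D))" by (simp add: power2_eq_square algebra_simps)
        then show "(D - y * D) / (2 * (D * w)^2) = (1 - y) / (2 * w^2) / D" using that by simp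
        have "(y * D) / (4 * (D * w)^2) = (D * y) / (D * (4 * w^2 * D))" by (simp add: power2_eq_square algebra_simps)
        then show "(y * D) / (4 * (D * w)^2) = y / (4 * w^2) / D" using that by simp
      qed
      have "G1 x = (1 - \<sigma>^2) / (2 * (1 + \<sigma>^2)^2) / d^2"
        unfolding G1_def e unfolding x2 by (rule gen(1)[OF D0])
      moreover have "(G x)^2 = \<sigma>^2 / (4 * (1 + \<sigma>^2)^2) / d^2"
        unfolding G_def power_divide e power_mult_distrib[of 2] unfolding x2 using gen(2)[OF D0, of "\<sigma>^2" "1 + \<sigma>^2"] by simp
      ultimately have "G1 x - (G x)^2 = ((1 - \<sigma>^2) / (2 * (1 + \<sigma>^2)^2) - \<sigma>^2 / (4 * (1 + \<sigma>^2)^2)) / d^2"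
        by (simp add: diff_divide_distrib)
      also have "(1 - \<sigma>^2) / (2 * (1 + \<sigma>^2)^2) = (2 * (1 - \<sigma>^2)) / (4 * (1 + \<sigma>^2)^2)"
        using mult_divide_mult_cancel_left[of 2 "1 - \<sigma>^2" "2 * (1 + \<sigma>^2)^2"] by simp
      finally show ?thesis by (simp add: diff_divide_distrib[symmetric] algebra_simps)
    qed
    then have "G1 x - (G x)^2 + \<nu> m * \<bar>x\<bar> powr (2 * \<gamma>) = ((2 - 3 * \<sigma>^2) / (4 * (1 + \<sigma>^2)^2) + \<bar>\<sigma>\<bar> powr (2 * \<gamma>)) / d^2"
      using 1 by (simp add: add_divide_distrib)
    also have "\<dots> \<ge> (1 / 16) / d^2" using hardy_profile_ge[OF gamma g1, of \<sigma>] by (intro divide_right_mono) auto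
    finally show ?thesis by simp
  qed
  let ?v = "v m k" and ?v1 = "v1 m k" and ?q = "\<lambda>x. \<nu> m * \<bar>x\<bar> powr (2 * \<gamma>)"
  note V = C2_onD[OF v_C2[of m k]]
  note qc = continuous_on_mult_left[OF weight_1d_continuous[OF gamma], of _ "\<nu> m"]
  have en: "integral {-1..1} (\<lambda>x. (?v1 x)^2 + ?q x * (?v x)^2) = lam m k"
  proof -
    have "integral {-1..1} (\<lambda>x. (?v1 x)^2 + ?q x * (?v x)^2) = integral {-1..1} (\<lambda>x. (?q x * ?v x - (?q x - lam m k) * ?v x) * ?v x)"
      by (rule dirichlet_energy[OF _ qc v_C2 v_l v_r]) simp
    also have "(\<lambda>x. (?q x * ?v x - (?q x - lam m k) * ?v x) * ?v x) = (\<lambda>x. lam m k * (?v x * ?v x))" by (simp add: algebra_simps)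
    finally show ?thesis using v_orth[of m k k] by simp
  qed
  have bp: "integral {-1..1} (\<lambda>x. G1 x * (?v x)^2) = - integral {-1..1} (\<lambda>x. G x * (2 * ?v x * ?v1 x))"
  proof -
    have "((\<lambda>x. (?v x)^2) has_real_derivative 2 * ?v x * ?v1 x) (at x within {-1..1})" if "x \<in> {-1..1}" for x
      by (auto intro!: derivative_eq_intros V(1)[OF that])
    from real_integral_by_parts[of "-1" 1 G G1, OF _ dG this cG1] show ?thesis
      using v_l v_r by (simp add: continuous_intros V)
  qed
  have "0 \<le> integral {-1..1} (\<lambda>x. (?v1 x + G x * ?v x)^2)"
    by (intro Henstock_Kurzweil_Integration.integral_nonneg integrable_continuous_real continuous_intros V cG) auto
  also have "\<dots> = integral {-1..1} (\<lambda>x. ((?v1 x)^2 + (G x)^2 * (?v x)^2) + G x * (2 * ?v x * ?v1 x))"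
    by (simp add: power2_sum power_mult_distrib mult_ac add_ac)
  also have "\<dots> = integral {-1..1} (\<lambda>x. (?v1 x)^2 + (G x)^2 * (?v x)^2) - integral {-1..1} (\<lambda>x. G1 x * (?v x)^2)"
    unfolding bp by (subst Henstock_Kurzweil_Integration.integral_add) (auto intro!: integrable_continuous_real continuous_intros V cG)
  also have "\<dots> = integral {-1..1} (\<lambda>x. ((?v1 x)^2 + (G x)^2 * (?v x)^2) - G1 x * (?v x)^2)"
    by (intro Henstock_Kurzweil_Integration.integral_diff[symmetric] integrable_continuous_real continuous_intros V cG cG1)
  also have "\<dots> \<le> integral {-1..1} (\<lambda>x. ((?v1 x)^2 + ?q x * (?v x)^2) - 1 / (16 * d^2) * (?v x * ?v x))"
  proof (intro integral_le integrable_continuous_real continuous_on_add continuous_on_diff continuous_on_mult continuous_on_power continuous_on_const V cG cG1 weight_1d_continuous gamma)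
    fix x
    have "1 / (16 * d^2) * (?v x)^2 \<le> (G1 x - (G x)^2 + ?q x) * (?v x)^2" using key[of x] by (intro mult_right_mono) auto
    then show "(?v1 x)^2 + (G x)^2 * (?v x)^2 - G1 x * (?v x)^2 \<le> (?v1 x)^2 + ?q x * (?v x)^2 - 1 / (16 * d^2) * (?v x * ?v x)"
      by (simp add: algebra_simps power2_eq_square)
  qed
  also have "\<dots> = lam m k - 1 / (16 * d^2)"
  proof -
    have "integral {-1..1} (\<lambda>x. ((?v1 x)^2 + ?q x * (?v x)^2) - 1 / (16 * d^2) * (?v x * ?v x))
      = integral {-1..1} (\<lambda>x. (?v1 x)^2 + ?q x * (?v x)^2) - integral {-1..1} (\<lambda>x. 1 / (16 * d^2) * (?v x * ?v x))"
      by (intro Henstock_Kurzweil_Integration.integral_diff integrable_continuous_real continuous_on_add continuous_on_mult continuous_on_power continuous_on_const V weight_1d_continuous gamma)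
    then show ?thesis unfolding en Henstock_Kurzweil_Integration.integral_mult_right v_orth by simp
  qed
  finally have "1 / (16 * d^2) \<le> lam m k" by simp
  then show ?thesis using id2 by (simp add: \<alpha>_def)
qed

section \<open>Summability over all modes\<close>

definition nus :: "nat \<Rightarrow> real" where "nus j = \<nu> (fst (prod_decode j))"

lemma nus_pos: "nus j > 0" and ls_pos: "ls j > 0"
  by (simp_all add: nus_def ls_def nu_pos lam_pos)

text \<open>Substitute for eigenvalue asymptotics: the bound on the sum over k of 1/\<lambda> is
  uniform in m, and what remains is the sum of 1/\<nu>.\<close>

lemma summable_inverse_product: "summable (\<lambda>j. 1 / (ls j * nus j))"
  unfolding ls_def nus_def
proof (rule summable_pairs[where f = "\<lambda>m k. 1 / (lam m k * \<nu> m)" and C = 4])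
  show "0 \<le> 1 / (lam m k * \<nu> m)" for m k using lam_pos[of m k] nu_pos[of m] by simp
  fix n
  have "(\<Sum>m<n. \<Sum>k<n. 1 / (lam m k * \<nu> m)) = (\<Sum>m<n. (1 / \<nu> m) * (\<Sum>k<n. 1 / lam m k))"
    unfolding sum_distrib_left by (simp add: mult.commute)
  also have "\<dots> \<le> (\<Sum>m<n. (1 / \<nu> m) * 4)" using nu_pos by (intro sum_mono mult_left_mono lam_trace) (simp add: less_imp_le)
  also have "\<dots> = 4 * (\<Sum>m<n. 1 / \<nu> m)" by (simp add: sum_distrib_left mult.commute)
  also have "\<dots> \<le> 4" using nu_trace[of n] by simp
  finally show "(\<Sum>m<n. \<Sum>k<n. 1 / (lam m k * \<nu> m)) \<le> 4" .
qed

lemma nus_le: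
  assumes "\<gamma> \<le> 1"
  shows "nus j \<le> (16 * ls j) powr (1 + \<gamma>)"
proof -
  have "nus j powr (1 / (1 + \<gamma>)) \<le> 16 * ls j" using lam_lower_bound[OF assms, of "fst (prod_decode j)" "snd (prod_decode j)"] by (simp add: nus_def ls_def)
  then have "(nus j powr (1 / (1 + \<gamma>))) powr (1 + \<gamma>) \<le> (16 * ls j) powr (1 + \<gamma>)"
    using gamma by (intro powr_mono2) auto
  then show ?thesis using gamma nus_pos[of j] by (simp add: powr_powr)
qed

lemma nus_le_square:
  assumes "\<gamma> \<le> 1"
  shows "nus j \<le> (1 + 16 * ls j)^2"
proof -
  have "nus j \<le> (16 * ls j) powr (1 + \<gamma>)" by (rule nus_le[OF assms])
  also have "\<dots> \<le> (1 + 16 * ls j) powr (1 + \<gamma>)" using gamma ls_pos[of j] by (intro powr_mono2) auto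
  also have "\<dots> \<le> (1 + 16 * ls j) powr 2" using assms ls_pos[of j] by (intro powr_mono) auto
  also have "\<dots> = (1 + 16 * ls j)^2" using ls_pos[of j] by (simp add: powr_numeral)
  finally show ?thesis .
qed

lemma poly_exp_bounded:
  assumes "\<epsilon> > 0"
  shows "\<exists>C. \<forall>j. (1 + 16 * ls j) ^ n * exp (- ls j * \<epsilon>) \<le> C"
proof (intro exI allI)
  fix j
  define e where "e = \<epsilon> / 16"
  have e: "e > 0" using assms by (simp add: e_def)
  let ?X = "1 + 16 * ls j"
  have "(e * ?X) ^ n / fact n \<le> exp (e * ?X)" using e ls_pos[of j] by (intro power_over_fact_le_exp) auto
  then have "e ^ n * ?X ^ n \<le> fact n * exp (e * ?X)" unfolding power_mult_distrib by (simp only: pos_divide_le_eq[OF fact_gt_zero] mult.commute)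
  then have "?X ^ n \<le> (fact n / e ^ n) * exp (e * ?X)" using e by (simp only: times_divide_eq_left pos_le_divide_eq[OF zero_less_power] mult.commute)
  then have "?X ^ n * exp (- ls j * \<epsilon>) \<le> (fact n / e ^ n) * exp (e * ?X) * exp (- ls j * \<epsilon>)" by (intro mult_right_mono) auto
  also have "\<dots> = (fact n / e ^ n) * exp e"
    unfolding mult.assoc exp_add[symmetric] by (simp add: e_def algebra_simps)
  finally show "?X ^ n * exp (- ls j * \<epsilon>) \<le> (fact n / e ^ n) * exp e" .
qed

text \<open>\<lambda> \<nu> is at most the cube of 1 + 16 \<lambda>, so three further powers,
  absorbed by the exponential, reduce the claim to summability of 1/(\<lambda> \<nu>).\<close>

lemma summable_modes:
  assumes g1: "\<gamma> \<le> 1" and e: "\<epsilon> > 0" and n: "\<And>j. 0 \<le> w j" "\<And>j. w j \<le> C * (1 + 16 * ls j) ^ n * exp (- ls j * \<epsilon>)" and C: "C \<ge> 0"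
  shows "summable w"
proof -
  obtain D where D: "\<And>j. (1 + 16 * ls j) ^ (n + 3) * exp (- ls j * \<epsilon>) \<le> D" using poly_exp_bounded[OF e] by blast
  show ?thesis
  proof (rule summable_comparison_test'[of "\<lambda>j. (C * D) * (1 / (ls j * nus j))" 0])
    show "summable (\<lambda>j. (C * D) * (1 / (ls j * nus j)))" by (intro summable_mult summable_inverse_product)
    fix j
    let ?X = "1 + 16 * ls j"
    have X: "?X \<ge> 0" "ls j \<le> ?X" using ls_pos[of j] by auto
    have "w j * (ls j * nus j) \<le> (C * ?X ^ n * exp (- ls j * \<epsilon>)) * (?X * ?X^2)"
      using n X nus_le_square[OF g1, of j] ls_pos[of j] nus_pos[of j] C by (intro mult_mono) auto
    also have "\<dots> = C * (?X ^ (n + 3) * exp (- ls j * \<epsilon>))" by (simp add: power_add power_numeral_reduce algebra_simps)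
    also have "\<dots> \<le> C * D" by (intro mult_left_mono D C)
    finally have "w j \<le> (C * D) * (1 / (ls j * nus j))" using ls_pos[of j] nus_pos[of j] by (simp add: field_simps)
    then show "norm (w j) \<le> (C * D) * (1 / (ls j * nus j))" using n(1)[of j] by simp
  qed
qed

text \<open>Half of the exponent \<lambda> T1 pays, up to the constant exp A, for the cost exp(2 K)
  with K = sqrt(\<nu> + \<lambda>); the other half dominates the polynomial factors. The balance
  between time and cost is thus isolated in the last hypothesis.\<close>

theorem null_controllable_if_dissipation_wins:
  assumes g1: "\<gamma> \<le> 1" and ab: "0 < a" "a < b" "b < 1" and T: "0 < T1" "T1 < T2" "T2 \<le> T"
    and H: "\<And>j. 2 * sqrt (nus j + ls j) \<le> A + ls j * T1 / 2"
  shows "null_controllable \<gamma> a b T"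
proof -
  obtain D C R where D: "\<And>j t. (D j has_real_derivative D (Suc j) t) (at t)"
    "\<And>t. t \<le> T1 \<Longrightarrow> D 0 t = 1" "\<And>t. t \<ge> T2 \<Longrightarrow> D 0 t = (0::real)" "\<And>j t. t \<le> T1 \<or> T2 \<le> t \<Longrightarrow> D (Suc j) t = 0"
    "C > 0" "R > 0" "\<And>j t. \<bar>D j t\<bar> \<le> C * R ^ j * (fact j * sqrt (fact j))"
    using gevrey_step_exists[OF T(2)] by metis
  obtain X CX RX where X: "\<And>j t. (X j has_real_derivative X (Suc j) t) (at t)"
    "\<And>t. t \<le> a \<Longrightarrow> X 0 t = 1" "\<And>t. t \<ge> b \<Longrightarrow> X 0 t = (0::real)" "\<And>j t. t \<le> a \<or> b \<le> t \<Longrightarrow> X (Suc j) t = 0"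
    "CX > 0" "RX > 0" "\<And>j t. \<bar>X j t\<bar> \<le> CX * RX ^ j * (fact j * sqrt (fact j))" "\<And>t. 0 \<le> X 0 t" "\<And>t. X 0 t \<le> 1"
    using gevrey_step_exists[OF ab(2)] by metis
  define c where "c = CX * RX ^ 1 * (fact 1 * sqrt (fact 1)) + CX * RX ^ 2 * (fact 2 * sqrt (fact 2))"
  have c: "\<bar>X 1 t\<bar> \<le> c" "\<bar>X 2 t\<bar> \<le> c" "c \<ge> 0" for t
  proof -
    have nn: "0 \<le> CX * RX ^ 1 * (fact 1 * sqrt (fact 1))" "0 \<le> CX * RX ^ 2 * (fact 2 * sqrt (fact 2))"
      using X(5,6) by (intro mult_nonneg_nonneg; simp)+
    then show "\<bar>X 1 t\<bar> \<le> c" "\<bar>X 2 t\<bar> \<le> c" "c \<ge> 0" using X(7)[of 1 t] X(7)[of 2 t] unfolding c_def by linarith+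
  qed
  \<comment> \<open>16 = 4 * 4: one 4 is the growth of the Volterra tower, the other absorbs the
    factor (j + 1)^(3/2) of the derivative of order j + 1. The 1 + R absorbs the additional R of
    that order.\<close>
  define \<beta> where "\<beta> j = (C * (1 + R)) * ((16 * R) ^ j * (fact j * sqrt (fact j)) / fact (2 * j))" for j
  have \<beta>s: "summable \<beta>" unfolding \<beta>_def using D(6) by (intro summable_mult summable_gevrey) auto
  have \<beta>1: "\<bar>D j t\<bar> * (4 ^ j / fact (2 * j)) \<le> \<beta> j" for j t
  proof -
    have "\<bar>D j t\<bar> * (4 ^ j / fact (2 * j)) \<le> (C * R ^ j * (fact j * sqrt (fact j))) * (4 ^ j / fact (2 * j))"
      by (intro mult_right_mono D(7)) auto
    also have "\<dots> = C * ((4 * R) ^ j * (fact j * sqrt (fact j)) / fact (2 * j))" by (simp add: power_mult_distrib)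
    also have "\<dots> \<le> (C * (1 + R)) * ((16 * R) ^ j * (fact j * sqrt (fact j)) / fact (2 * j))"
      using D(5,6) by (intro mult_mono divide_right_mono mult_right_mono power_mono) auto
    finally show ?thesis by (simp add: \<beta>_def)
  qed
  have \<beta>2: "\<bar>D (Suc j) t\<bar> * (4 ^ j / fact (2 * j)) \<le> \<beta> j" for j t
  proof -
    have f: "fact (Suc j) * sqrt (fact (Suc j)) \<le> (4 ^ j * (fact j * sqrt (fact j)) :: real)"
    proof -
      have s: "real (Suc j) \<le> 2 ^ j" using of_nat_mono[OF Suc_leI[OF less_exp[of j]], where 'a = real] by simp
      have "sqrt (real (Suc j)) \<le> real (Suc j)" by (rule sqrt_le_D[THEN order_trans[rotated], OF _ order_refl] | (intro real_le_lsqrt; simp add: power2_eq_square))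
      then have "real (Suc j) * sqrt (real (Suc j)) \<le> 2 ^ j * 2 ^ j" using s by (intro mult_mono) auto
      also have "\<dots> = (4 ^ j :: real)" by (simp add: power_mult_distrib[symmetric])
      finally have "real (Suc j) * sqrt (real (Suc j)) * (fact j * sqrt (fact j)) \<le> 4 ^ j * (fact j * sqrt (fact j))" by (intro mult_right_mono) auto
      then show ?thesis by (simp add: real_sqrt_mult mult_ac)
    qed
    have "\<bar>D (Suc j) t\<bar> * (4 ^ j / fact (2 * j)) \<le> (C * R ^ Suc j * (fact (Suc j) * sqrt (fact (Suc j)))) * (4 ^ j / fact (2 * j))"
      by (intro mult_right_mono D(7)) auto
    also have "\<dots> \<le> (C * R ^ Suc j * (4 ^ j * (fact j * sqrt (fact j)))) * (4 ^ j / fact (2 * j))"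
      using D(5,6) by (intro mult_right_mono mult_left_mono f) auto
    also have "\<dots> = (C * R) * (((4 * 4) * R) ^ j * (fact j * sqrt (fact j)) / fact (2 * j))" unfolding power_mult_distrib by simp
    also have "\<dots> \<le> (C * (1 + R)) * ((16 * R) ^ j * (fact j * sqrt (fact j)) / fact (2 * j))"
      using D(5,6) by (intro mult_mono) auto
    finally show ?thesis by (simp add: \<beta>_def)
  qed
  have S0: "suminf \<beta> \<ge> 0" using D(5,6) by (intro suminf_nonneg \<beta>s) (auto simp: \<beta>_def)
  define K where "K j = sqrt (nus j + ls j)" for j
  have K2: "(K j)^2 = nus j + ls j" "K j \<ge> 0" for j using nus_pos[of j] ls_pos[of j] by (auto simp: K_def)
  define Bj where "Bj j = (2 + 6 * c) * (sqrt (2 * ls j) * exp (2 * K j) * ((2 * (K j)^2 + 2) * suminf \<beta>))" for j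
  have "\<exists>F Ft U. mode_sol a b (\<lambda>x. \<nu> (fst (prod_decode j)) * \<bar>x\<bar> powr (2 * \<gamma>)) (ls j) T1 T2
      (v (fst (prod_decode j)) (snd (prod_decode j))) (Bj j) F Ft U" for j
    unfolding Bj_def
  proof (rule mode_sol_exists[OF D(1-4) \<beta>s \<beta>1 \<beta>2 X(1-4) X(8,9) c(1,2)])
    show "-1 < a" "a < b" "b < 1" using ab by auto
    show "continuous_on {-1..1} (\<lambda>x. \<nu> (fst (prod_decode j)) * \<bar>x\<bar> powr (2 * \<gamma>))" by (intro continuous_intros weight_1d_continuous gamma)
    show "0 \<le> ls j" using ls_pos[of j] by simp
    show "0 \<le> K j" by (rule K2)
    show "\<bar>\<nu> (fst (prod_decode j)) * \<bar>x\<bar> powr (2 * \<gamma>) - ls j\<bar> \<le> (K j)^2" if "x \<in> {-1..1}" for x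
    proof -
      have "\<bar>x\<bar> powr (2 * \<gamma>) \<le> 1" using that gamma by (intro powr_le1) auto
      then have "\<nu> (fst (prod_decode j)) * \<bar>x\<bar> powr (2 * \<gamma>) \<le> nus j" "0 \<le> \<nu> (fst (prod_decode j)) * \<bar>x\<bar> powr (2 * \<gamma>)"
        using nu_pos[of "fst (prod_decode j)"] by (auto simp: nus_def)
      then show ?thesis using K2(1)[of j] ls_pos[of j] nus_pos[of j] by (simp add: abs_le_iff)
    qed
    show "C2_on (-1) 1 (v (fst (prod_decode j)) (snd (prod_decode j))) (v1 (fst (prod_decode j)) (snd (prod_decode j)))
      (\<lambda>x. (\<nu> (fst (prod_decode j)) * \<bar>x\<bar> powr (2 * \<gamma>) - ls j) * v (fst (prod_decode j)) (snd (prod_decode j)) x)"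
      unfolding ls_def by (rule v_C2)
    show "v (fst (prod_decode j)) (snd (prod_decode j)) (- 1) = 0" "v (fst (prod_decode j)) (snd (prod_decode j)) 1 = 0" by (rule v_l v_r)+
    show "0 \<le> sqrt (2 * ls j)" using ls_pos[of j] by simp
    show "\<bar>v (fst (prod_decode j)) (snd (prod_decode j)) x\<bar> \<le> sqrt (2 * ls j)" if "x \<in> {-1..1}" for x
      using v_sup[OF that] by (simp add: ls_def real_le_rsqrt)
  qed auto
  then obtain F Ft U where ms: "\<And>j. mode_sol a b (\<lambda>x. \<nu> (fst (prod_decode j)) * \<bar>x\<bar> powr (2 * \<gamma>)) (ls j) T1 T2
      (v (fst (prod_decode j)) (snd (prod_decode j))) (Bj j) (F j) (Ft j) (U j)" by metis
  have X1: "1 \<le> 1 + 16 * ls j" "ls j \<le> 1 + 16 * ls j" for j using ls_pos[of j] by auto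
  have sl: "sqrt (2 * ls j) \<le> 2 * (1 + 16 * ls j)" for j
  proof (rule real_le_lsqrt)
    have "ls j \<le> (1 + 16 * ls j)^2" using X1[of j] self_le_power[of "1 + 16 * ls j" 2] by linarith
    then have "2 * ls j \<le> 2 * (1 + 16 * ls j)^2" by simp
    also have "\<dots> \<le> (2 * (1 + 16 * ls j))^2" unfolding power_mult_distrib by (intro mult_right_mono) auto
    finally show "2 * ls j \<le> (2 * (1 + 16 * ls j))^2" .
  qed (use ls_pos[of j] in auto)
  have sn: "sqrt (nus j) \<le> 1 + 16 * ls j" for j using nus_le_square[OF g1, of j] ls_pos[of j] by (intro real_le_lsqrt) auto
  show ?thesis
  proof (rule null_controllable_of_modes[OF ab T ms])
    show Bj0: "0 \<le> Bj j" for j unfolding Bj_def using c(3) S0 ls_pos[of j] by (intro mult_nonneg_nonneg add_nonneg_nonneg) auto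
    fix \<epsilon> :: real assume e: "\<epsilon> > 0"
    show "summable (\<lambda>j. exp (- ls j * \<epsilon>) * sqrt (2 * ls j * \<nu> (fst (prod_decode j))))"
    proof (rule summable_modes[OF g1 e, where C = 2 and n = 2])
      fix j
      show "0 \<le> exp (- ls j * \<epsilon>) * sqrt (2 * ls j * \<nu> (fst (prod_decode j)))" using ls_pos[of j] nus_pos[of j] by (simp add: nus_def)
      have "sqrt (2 * ls j * \<nu> (fst (prod_decode j))) = sqrt (2 * ls j) * sqrt (nus j)" by (simp add: real_sqrt_mult nus_def)
      also have "\<dots> \<le> (2 * (1 + 16 * ls j)) * (1 + 16 * ls j)" using ls_pos[of j] nus_pos[of j] by (intro mult_mono sl sn) auto
      finally have "exp (- ls j * \<epsilon>) * sqrt (2 * ls j * \<nu> (fst (prod_decode j))) \<le> exp (- ls j * \<epsilon>) * ((2 * (1 + 16 * ls j)) * (1 + 16 * ls j))"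
        by (intro mult_left_mono) auto
      also have "\<dots> = 2 * (1 + 16 * ls j)^2 * exp (- ls j * \<epsilon>)" by (simp add: power2_eq_square mult_ac)
      finally show "exp (- ls j * \<epsilon>) * sqrt (2 * ls j * \<nu> (fst (prod_decode j))) \<le> 2 * (1 + 16 * ls j)^2 * exp (- ls j * \<epsilon>)" .
    qed simp
  next
    let ?C = "(2 + 6 * c) * (12 * exp A * suminf \<beta>)"
    have T12: "T1 / 2 > 0" using T by simp
    show "summable (\<lambda>j. Bj j * exp (- ls j * T1) * sqrt (\<nu> (fst (prod_decode j))))"
    proof (rule summable_modes[OF g1 T12, where C = ?C and n = 4])
      show "0 \<le> ?C" using c(3) S0 by (intro mult_nonneg_nonneg add_nonneg_nonneg) auto
      fix j
      let ?X = "1 + 16 * ls j"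
      have B0: "0 \<le> Bj j" unfolding Bj_def using c(3) S0 ls_pos[of j] by (intro mult_nonneg_nonneg add_nonneg_nonneg) auto
      then show "0 \<le> Bj j * exp (- ls j * T1) * sqrt (\<nu> (fst (prod_decode j)))" using nus_pos[of j] by (simp add: nus_def)
      have X2: "1 \<le> ?X^2" "ls j \<le> ?X^2" using X1[of j] self_le_power[of ?X 2] by auto
      have k: "2 * (K j)^2 + 2 \<le> 6 * ?X^2" using K2(1)[of j] nus_le_square[OF g1, of j] X2 by linarith
      have ee: "exp (2 * K j) * exp (- ls j * T1) \<le> exp A * exp (- ls j * (T1 / 2))"
        unfolding exp_add[symmetric] using H[of j] by (simp add: K_def algebra_simps)
      have "Bj j * exp (- ls j * T1) * sqrt (\<nu> (fst (prod_decode j)))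
         = (2 + 6 * c) * ((sqrt (2 * ls j) * ((2 * (K j)^2 + 2) * sqrt (nus j))) * ((exp (2 * K j) * exp (- ls j * T1)) * suminf \<beta>))"
        unfolding Bj_def nus_def by (simp only: mult_ac)
      also have "\<dots> \<le> (2 + 6 * c) * ((2 * ?X * (6 * ?X^2 * ?X)) * ((exp A * exp (- ls j * (T1 / 2))) * suminf \<beta>))"
      proof -
        have "(sqrt (2 * ls j) * ((2 * (K j)^2 + 2) * sqrt (nus j))) \<le> 2 * ?X * (6 * ?X^2 * ?X)"
          using ls_pos[of j] nus_pos[of j] by (intro mult_mono sl sn k mult_nonneg_nonneg add_nonneg_nonneg) auto
        moreover have "(exp (2 * K j) * exp (- ls j * T1)) * suminf \<beta> \<le> (exp A * exp (- ls j * (T1 / 2))) * suminf \<beta>"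
          by (rule mult_right_mono[OF ee S0])
        moreover have "0 \<le> (exp (2 * K j) * exp (- ls j * T1)) * suminf \<beta>" using S0 by simp
        moreover have "0 \<le> 2 * ?X * (6 * ?X^2 * ?X)" using ls_pos[of j] by simp
        ultimately show ?thesis using c(3) by (intro mult_left_mono[OF mult_mono]) auto
      qed
      also have "\<dots> = ?C * ?X ^ 4 * exp (- ls j * (T1 / 2))" by (simp add: power_numeral_reduce algebra_simps)
      finally show "Bj j * exp (- ls j * T1) * sqrt (\<nu> (fst (prod_decode j))) \<le> ?C * ?X ^ 4 * exp (- ls j * (T1 / 2))" .
    qed
  qed
qed

lemma sqrt_sum_le: "sqrt (nus j + ls j) \<le> sqrt (nus j) + sqrt (ls j)"
  using nus_pos[of j] ls_pos[of j] by (intro sqrt_add_le_add_sqrt) auto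

text \<open>sqrt \<nu> is at most (16 \<lambda>)^\<theta> with \<theta> = (1 + \<gamma>)/2 < 1,
  which up to a constant lies below any positive multiple of \<lambda>; hence every waiting time
  suffices.\<close>

theorem null_controllable_subcritical:
  assumes g: "\<gamma> < 1" and ab: "0 < a" "a < b" "b < 1" and T: "T > 0"
  shows "null_controllable \<gamma> a b T"
proof -
  define T1 where "T1 = T / 3"
  have T1: "T1 > 0" using T by (simp add: T1_def)
  define \<theta> where "\<theta> = (1 + \<gamma>) / 2"
  have th: "0 < \<theta>" "\<theta> < 1" using g gamma by (auto simp: \<theta>_def)
  \<comment> \<open>\<eta> * 16 \<lambda> = \<lambda> T1/8; with an equal share for sqrt \<lambda>
    and the factor 2 in front, the total is \<lambda> T1/2.\<close>
  define \<eta> where "\<eta> = T1 / 128"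
  have \<eta>: "\<eta> > 0" using T1 by (simp add: \<eta>_def)
  \<comment> \<open>The point where \<eta> y = y^\<theta>.\<close>
  define Y where "Y = \<eta> powr (- 1 / (1 - \<theta>))"
  have Y: "Y > 0" using \<eta> by (simp add: Y_def)
  have young: "y powr \<theta> \<le> \<eta> * y + Y powr \<theta>" if "y > 0" for y
  proof (cases "y \<ge> Y")
    case True
    have "y powr (\<theta> - 1) \<le> Y powr (\<theta> - 1)" using True Y th by (intro powr_mono2') auto
    also have "Y powr (\<theta> - 1) = \<eta>"
    proof -
      have "- 1 / (1 - \<theta>) * (\<theta> - 1) = 1" using th by (simp add: divide_eq_eq)
      then show ?thesis unfolding Y_def powr_powr using \<eta> by simp
    qed
    finally have "y powr (\<theta> - 1) * y \<le> \<eta> * y" using that by (intro mult_right_mono) auto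
    moreover have "y powr (\<theta> - 1) * y = y powr \<theta>" using that powr_add[of y "\<theta> - 1" 1] by simp
    ultimately show ?thesis using powr_ge_zero[of Y \<theta>] by linarith
  next
    case False
    then have "y powr \<theta> \<le> Y powr \<theta>" using that th by (intro powr_mono2) auto
    moreover have "0 \<le> \<eta> * y" using \<eta> that by simp
    ultimately show ?thesis by linarith
  qed
  show ?thesis
  proof (rule null_controllable_if_dissipation_wins[OF less_imp_le[OF g] ab T1, of "2 * T1" T "2 * Y powr \<theta> + 4 / T1"])
    show "T1 < 2 * T1" "2 * T1 \<le> T" using T by (auto simp: T1_def)
    fix j
    have "sqrt (nus j) \<le> sqrt ((16 * ls j) powr (1 + \<gamma>))" using nus_le[of j] g by simp
    also have "\<dots> = (16 * ls j) powr \<theta>" unfolding \<theta>_def using ls_pos[of j] by (simp add: powr_half_sqrt[symmetric] powr_powr)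
    also have "\<dots> \<le> \<eta> * (16 * ls j) + Y powr \<theta>" using young ls_pos[of j] by simp
    finally have 1: "sqrt (nus j) \<le> ls j * T1 / 8 + Y powr \<theta>" by (simp add: \<eta>_def mult.commute)
    have 2: "sqrt (ls j) \<le> ls j * T1 / 8 + 2 / T1"
    proof -
      have "0 \<le> (sqrt (ls j) * T1 / 4 - 1)^2" by simp
      then have "sqrt (ls j) * T1 / 2 \<le> ls j * T1^2 / 16 + 1" using ls_pos[of j] by (simp add: power2_diff power_mult_distrib power_divide mult_ac)
      then have "sqrt (ls j) * T1 / 2 * (2 / T1) \<le> (ls j * T1^2 / 16 + 1) * (2 / T1)" using T1 by (intro mult_right_mono) auto
      then show ?thesis using T1 by (simp add: field_simps power2_eq_square)
    qed
    have "2 * sqrt (nus j + ls j) \<le> 2 * sqrt (nus j) + 2 * sqrt (ls j)" using sqrt_sum_le[of j] by simp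
    then show "2 * sqrt (nus j + ls j) \<le> 2 * Y powr \<theta> + 4 / T1 + ls j * T1 / 2" using 1 2 by linarith
  qed
qed

text \<open>Here sqrt \<nu> \<le> 16 \<lambda>, so 2 sqrt(\<nu> + \<lambda>) \<le> 33 \<lambda> + 1,
  which is 1 + \<lambda> T1/2 for T1 = 66; one unit of time is added for the control itself.\<close>

theorem null_controllable_critical:
  assumes g: "\<gamma> = 1" and ab: "0 < a" "a < b" "b < 1" and T: "T \<ge> 67"
  shows "null_controllable \<gamma> a b T"
proof (rule null_controllable_if_dissipation_wins[of a b 66 67 T 1])
  fix j
  have "nus j \<le> (16 * ls j)^2" using nus_le[of j] g ls_pos[of j] by (simp add: powr_numeral)
  then have 1: "sqrt (nus j) \<le> 16 * ls j" using ls_pos[of j] by (intro real_le_lsqrt) auto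
  have "0 \<le> (sqrt (ls j) - 1)^2" by simp
  then have 2: "2 * sqrt (ls j) \<le> ls j + 1" using ls_pos[of j] by (simp add: power2_diff)
  have "2 * sqrt (nus j + ls j) \<le> 2 * sqrt (nus j) + 2 * sqrt (ls j)" using sqrt_sum_le[of j] by simp
  then show "2 * sqrt (nus j + ls j) \<le> 1 + ls j * 66 / 2" using 1 2 by linarith
qed (use g ab T in auto)

end

section \<open>Decay of the ground states\<close>

lemma C2_on_subinterval:
  assumes "C2_on l r w w1 w2" "l \<le> l'" "r' \<le> r"
  shows "C2_on l' r' w w1 w2"
proof -
  have sub: "{l'..r'} \<subseteq> {l..r}" using assms by auto
  show ?thesis unfolding C2_on_def
    using C2_onD(1,2)[OF assms(1)] continuous_on_subset[OF C2_onD(5)[OF assms(1)] sub] sub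
    by (meson has_field_derivative_subset subsetD)
qed

text \<open>With \<open>Y = Z' + \<kappa> Z\<close> the hypothesis says that \<open>Y e\<^sup>-\<^sup>\<kappa>\<^sup>x\<close> is nondecreasing, while \<open>Y e\<^sup>\<kappa>\<^sup>x\<close> is the derivative of
  \<open>Z e\<^sup>\<kappa>\<^sup>x\<close>, which cannot increase to a positive value and then decrease.\<close>
lemma maximum_principle:
  fixes Z :: "real \<Rightarrow> real"
  assumes Z: "C2_on l r Z Z1 Z2" and ge: "\<And>x. x \<in> {l..r} \<Longrightarrow> Z2 x \<ge> \<kappa>^2 * Z x" and b: "Z l \<le> 0" "Z r \<le> 0" and x: "x \<in> {l..r}"
  shows "Z x \<le> 0"
proof (rule ccontr)
  assume "\<not> Z x \<le> 0"
  then have pos: "Z x > 0" by simp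
  have lx: "l < x" "x < r" using pos b x by (auto simp: less_le)
  define Y where "Y t = Z1 t + \<kappa> * Z t" for t
  have at: "at t within {l..r} = at t" if "l < t" "t < r" for t using that by (intro at_within_interior) auto
  have dZ: "(Z has_real_derivative Z1 t) (at t)" "(Z1 has_real_derivative Z2 t) (at t)" if "l < t" "t < r" for t
    using C2_onD(1,2)[OF Z, of t] that at[OF that] by auto
  have dE: "((\<lambda>t. Z t * exp (\<kappa> * t)) has_real_derivative Y t * exp (\<kappa> * t)) (at t)" if "l < t" "t < r" for t
    unfolding Y_def by (auto intro!: derivative_eq_intros dZ[OF that] simp: algebra_simps)
  have dY: "((\<lambda>t. Y t * exp (- \<kappa> * t)) has_real_derivative (Z2 t - \<kappa>^2 * Z t) * exp (- \<kappa> * t)) (at t)" if "l < t" "t < r" for t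
    unfolding Y_def by (auto intro!: derivative_eq_intros dZ[OF that] simp: algebra_simps power2_eq_square)
  have cE: "continuous_on {l..r} (\<lambda>t. Z t * exp (\<kappa> * t))" by (intro continuous_intros C2_onD[OF Z])
  have mv: "\<exists>\<xi>. p < \<xi> \<and> \<xi> < q \<and> Z q * exp (\<kappa> * q) - Z p * exp (\<kappa> * p) = (q - p) * (Y \<xi> * exp (\<kappa> * \<xi>))"
    if pq: "p < q" "l \<le> p" "q \<le> r" for p q
  proof -
    have c: "continuous_on {p..q} (\<lambda>t. Z t * exp (\<kappa> * t))" by (rule continuous_on_subset[OF cE]) (use pq in auto)
    have df: "(\<lambda>t. Z t * exp (\<kappa> * t)) differentiable (at t)" if "p < t" "t < q" for t
      using dE[of t] that pq unfolding real_differentiable_def by auto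
    obtain L z where z: "p < z" "z < q" "((\<lambda>t. Z t * exp (\<kappa> * t)) has_real_derivative L) (at z)" "Z q * exp (\<kappa> * q) - Z p * exp (\<kappa> * p) = (q - p) * L"
      using MVT[OF pq(1) c df] by blast
    have "L = Y z * exp (\<kappa> * z)" by (rule DERIV_unique[OF z(3) dE]) (use z pq in auto)
    then show ?thesis using z by blast
  qed
  obtain \<xi> where \<xi>: "l < \<xi>" "\<xi> < x" "Z x * exp (\<kappa> * x) - Z l * exp (\<kappa> * l) = (x - l) * (Y \<xi> * exp (\<kappa> * \<xi>))"
    using mv[of l x] lx by auto
  obtain \<zeta> where \<zeta>: "x < \<zeta>" "\<zeta> < r" "Z r * exp (\<kappa> * r) - Z x * exp (\<kappa> * x) = (r - x) * (Y \<zeta> * exp (\<kappa> * \<zeta>))"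
    using mv[of x r] lx by auto
  have zx: "Z x * exp (\<kappa> * x) > 0" "Z l * exp (\<kappa> * l) \<le> 0" "Z r * exp (\<kappa> * r) \<le> 0"
    using pos b by (auto simp: mult_le_0_iff)
  have "(x - l) * (Y \<xi> * exp (\<kappa> * \<xi>)) > 0" using \<xi>(3) zx by linarith
  then have Y1: "Y \<xi> > 0" using lx by (simp add: zero_less_mult_iff)
  have "(r - x) * (Y \<zeta> * exp (\<kappa> * \<zeta>)) < 0" using \<zeta>(3) zx by linarith
  then have Y2: "Y \<zeta> < 0" using lx by (simp add: mult_less_0_iff)
  have "Y \<xi> * exp (- \<kappa> * \<xi>) \<le> Y \<zeta> * exp (- \<kappa> * \<zeta>)"
  proof (rule DERIV_nonneg_imp_nondecreasing[where f = "\<lambda>t. Y t * exp (- \<kappa> * t)"])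
    show "\<xi> \<le> \<zeta>" using \<xi> \<zeta> by simp
    fix t assume t: "\<xi> \<le> t" "t \<le> \<zeta>"
    then have lt: "l < t" "t < r" using \<xi> \<zeta> by auto
    moreover have "0 \<le> (Z2 t - \<kappa>^2 * Z t) * exp (- \<kappa> * t)" using ge[of t] lt by simp
    ultimately show "\<exists>y. ((\<lambda>t. Y t * exp (- \<kappa> * t)) has_real_derivative y) (at t) \<and> 0 \<le> y" using dY by blast
  qed
  moreover have "Y \<xi> * exp (- \<kappa> * \<xi>) > 0" "Y \<zeta> * exp (- \<kappa> * \<zeta>) < 0" using Y1 Y2 by (auto simp: mult_less_0_iff)
  ultimately show False by linarith
qed

lemma max0_power_derivs:
  fixes u :: real
  shows "((\<lambda>u. (max 0 u)^2) has_real_derivative 2 * max 0 u) (at u)"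
    and "((\<lambda>u. (max 0 u) ^ 3) has_real_derivative 3 * (max 0 u)^2) (at u)"
proof -
  show 1: "((\<lambda>u. (max 0 u)^2) has_real_derivative 2 * max 0 u) (at u)" for u :: real
  proof -
    consider "u > 0" | "u = 0" | "u < 0" by linarith
    then show ?thesis
    proof cases
      case 1
      have "((\<lambda>u. u^2) has_real_derivative 2 * max 0 u) (at u)" using 1 by (auto intro!: derivative_eq_intros)
      then show ?thesis by (rule has_field_derivative_transform_within_open[of _ _ _ "{0<..}"]) (use 1 in auto)
    next
      case 2
      have "\<bar>(max 0 x)^2\<bar> \<le> 1 * (x - u)^2" for x :: real using 2 by (auto simp: max_def)
      from has_real_derivative_zero_of_quadratic_bound[OF this] show ?thesis using 2 by simp
    next
      case 3
      have "((\<lambda>u. 0) has_real_derivative 2 * max 0 u) (at u)" using 3 by simp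
      then show ?thesis by (rule has_field_derivative_transform_within_open[of _ _ _ "{..<0}"]) (use 3 in auto)
    qed
  qed
  have "((\<lambda>u. (max 0 u)^2 * u) has_real_derivative 2 * max 0 u * u + (max 0 u)^2 * 1) (at u)"
    by (rule DERIV_cong[OF DERIV_mult[OF 1 DERIV_ident]]) simp
  moreover have "(\<lambda>u. (max 0 u)^2 * u) = (\<lambda>u :: real. (max 0 u) ^ 3)" by (auto simp: max_def power2_eq_square power3_eq_cube)
  moreover have "2 * max 0 u * u + (max 0 u)^2 * 1 = 3 * (max 0 u)^2" by (auto simp: max_def power2_eq_square)
  ultimately show "((\<lambda>u. (max 0 u) ^ 3) has_real_derivative 3 * (max 0 u)^2) (at u)" by (simp only:)
qed

context grushin_modes
begin

text \<open>The test function in \<open>lam_first\<close> is the cube of the positive part of 1 -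
  x^2/d^2: the cube is the least integer power that is C^2, and d is the scale where \<nu>
  d^(2\<gamma>) = 1/d^2. The quotient of the two integrals is then of order 1/d^4. \<nu> \<ge> 1
  keeps the support in [-1,1].\<close>

lemma ground_energy_upper:
  assumes nu1: "\<nu> m \<ge> 1"
  shows "lam m 0 \<le> 120 * \<nu> m powr (1 / (1 + \<gamma>))"
proof -
  define \<alpha> where "\<alpha> = 1 / (1 + \<gamma>)"
  have \<alpha>: "\<alpha> * (1 + \<gamma>) = 1" "\<alpha> > 0" using gamma by (auto simp: \<alpha>_def)
  define d where "d = \<nu> m powr (- (\<alpha> / 2))"
  have d: "d > 0" using nu_pos[of m] by (simp add: d_def)
  have d1: "d \<le> 1" unfolding d_def using powr_mono[of "- (\<alpha> / 2)" 0 "\<nu> m"] nu1 \<alpha> by simp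
  have d2: "d^2 = \<nu> m powr (- \<alpha>)" unfolding d_def using nu_pos[of m] by (simp add: powr_power)
  have id2: "1 / d^2 = \<nu> m powr \<alpha>" unfolding d2 by (simp add: powr_minus_divide)
  have \<nu>d: "\<nu> m * d powr (2 * \<gamma>) = 1 / d^2"
  proof -
    have "d powr (2 * \<gamma>) = \<nu> m powr (- (\<alpha> * \<gamma>))" by (simp add: d_def powr_powr)
    moreover have "\<nu> m = \<nu> m powr 1" using nu_pos[of m] by simp
    ultimately have "\<nu> m * d powr (2 * \<gamma>) = \<nu> m powr (1 + - (\<alpha> * \<gamma>))" by (simp only: powr_add)
    also have "1 + - (\<alpha> * \<gamma>) = \<alpha>" using \<alpha> by (simp add: algebra_simps)
    finally show ?thesis by (simp add: id2)
  qed
  define D where "D = 1 / d^2"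
  have D: "D > 0" using d by (simp add: D_def)
  define U where "U x = 1 - D * x^2" for x
  define w where "w x = (max 0 (U x)) ^ 3" for x
  define w1 where "w1 x = - 6 * D * x * (max 0 (U x))^2" for x
  define w2 where "w2 x = - 6 * D * (max 0 (U x))^2 + 24 * D^2 * x^2 * max 0 (U x)" for x
  have dU: "(U has_real_derivative - 2 * D * x) (at x)" for x unfolding U_def by (auto intro!: derivative_eq_intros)
  have dw: "(w has_real_derivative w1 x) (at x)" for x
    unfolding w_def w1_def by (rule DERIV_cong[OF DERIV_chain2[OF max0_power_derivs(2) dU]]) simp
  have dw1: "(w1 has_real_derivative w2 x) (at x)" for x
  proof -
    have a: "((\<lambda>x. (max 0 (U x))^2) has_real_derivative 2 * max 0 (U x) * (- 2 * D * x)) (at x)"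
      by (rule DERIV_chain2[OF max0_power_derivs(1) dU])
    have b: "((\<lambda>x. - 6 * D * x) has_real_derivative - 6 * D) (at x)" by (auto intro!: derivative_eq_intros)
    show ?thesis unfolding w1_def w2_def
      by (rule DERIV_cong[OF DERIV_mult[OF b a]]) (simp add: power2_eq_square)
  qed
  have cU: "continuous_on A U" for A unfolding U_def by (intro continuous_intros)
  have cw2: "continuous_on A w2" for A unfolding w2_def by (intro continuous_intros cU)
  have W: "C2_on (-1) 1 w w1 w2" unfolding C2_on_def
    using dw dw1 cw2 by (auto intro: has_field_derivative_at_within)
  have U0: "U x \<le> 0" if "\<bar>x\<bar> \<ge> d" for x
  proof -
    have "d^2 \<le> x^2" using that d by (intro abs_le_square_iff[THEN iffD1]) auto
    then have "D * d^2 \<le> D * x^2" using D by (intro mult_left_mono) auto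
    then show ?thesis using d by (simp add: U_def D_def)
  qed
  have U1: "U x \<le> 1" for x using D by (simp add: U_def)
  have zero: "w x = 0" "w2 x = 0" if "\<bar>x\<bar> \<ge> d" for x using U0[OF that] by (auto simp: w_def w2_def max_def)
  have wb: "w (-1) = 0" "w 1 = 0" using zero d1 by auto
  have key: "(lam m 0)^2 * integral {-1..1} (\<lambda>x. (w x)^2) \<le> integral {-1..1} (\<lambda>x. (\<nu> m * \<bar>x\<bar> powr (2 * \<gamma>) * w x - w2 x)^2)"
    by (rule lam_first[OF W wb])
  have cw: "continuous_on A w" for A by (rule DERIV_continuous_on[OF has_field_derivative_at_within[OF dw]])
  define f where "f x = \<nu> m * \<bar>x\<bar> powr (2 * \<gamma>) * w x - w2 x" for x
  have cf: "continuous_on A f" for A unfolding f_def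
    by (intro continuous_on_diff continuous_on_mult continuous_on_const weight_1d_continuous gamma cw cw2)
  have fz: "f x = 0" if "\<bar>x\<bar> \<ge> d" for x using zero[OF that] by (simp add: f_def)
  \<comment> \<open>31 = 1 + 6 + 24: the potential term and the two terms of w2, each in units of
    D.\<close>
  have fb: "(f x)^2 \<le> (31 * D)^2" if "\<bar>x\<bar> \<le> d" for x
  proof -
    have m01: "0 \<le> max 0 (U x)" "max 0 (U x) \<le> 1" using U1[of x] by auto
    have x2: "D * x^2 \<le> 1"
    proof -
      have "x^2 \<le> d^2" using that d by (intro abs_le_square_iff[THEN iffD1]) auto
      then have "D * x^2 \<le> D * d^2" using D by (intro mult_left_mono) auto
      then show ?thesis using d by (simp add: D_def)
    qed
    have "\<nu> m * \<bar>x\<bar> powr (2 * \<gamma>) \<le> \<nu> m * d powr (2 * \<gamma>)" using that gamma nu_pos[of m] by (intro mult_left_mono powr_mono2) auto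
    then have q: "\<nu> m * \<bar>x\<bar> powr (2 * \<gamma>) \<le> D" by (simp add: \<nu>d D_def)
    have w01: "0 \<le> w x" "w x \<le> 1" unfolding w_def using m01 by (auto intro: power_le_one)
    have a: "\<bar>\<nu> m * \<bar>x\<bar> powr (2 * \<gamma>) * w x\<bar> \<le> D * 1"
      unfolding abs_mult using q w01 nu_pos[of m] D by (intro mult_mono) auto
    have "24 * D^2 * x^2 * max 0 (U x) = 24 * D * (D * x^2) * max 0 (U x)" by (simp add: power2_eq_square)
    also have "\<bar>\<dots>\<bar> \<le> 24 * D * 1 * 1"
      unfolding abs_mult using D x2 m01 by (intro mult_mono) auto
    finally have c: "\<bar>24 * D^2 * x^2 * max 0 (U x)\<bar> \<le> 24 * D" by simp
    have "(max 0 (U x))^2 \<le> 1" using m01 by (intro power_le_one) auto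
    then have e: "\<bar>- 6 * D * (max 0 (U x))^2\<bar> \<le> 6 * D" using D by (simp add: abs_mult)
    have "\<bar>w2 x\<bar> \<le> 6 * D + 24 * D" unfolding w2_def by (rule order_trans[OF abs_triangle_ineq add_mono[OF e c]])
    then have "\<bar>f x\<bar> \<le> 31 * D" unfolding f_def using a by linarith
    then show ?thesis using D by (intro abs_le_square_iff[THEN iffD1]) auto
  qed
  have up: "integral {-1..1} (\<lambda>x. (f x)^2) \<le> 2 * d * (31 * D)^2"
  proof -
    let ?g = "\<lambda>x. (f x)^2"
    have i: "?g integrable_on {x..y}" for x y by (intro integrable_continuous_real continuous_intros cf)
    have "integral {-1..1} ?g = integral {-1..-d} ?g + integral {-d..1} ?g"
      using d d1 by (intro Henstock_Kurzweil_Integration.integral_combine[symmetric] i) auto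
    also have "integral {-d..1} ?g = integral {-d..d} ?g + integral {d..1} ?g"
      using d d1 by (intro Henstock_Kurzweil_Integration.integral_combine[symmetric] i) auto
    also have "integral {-1..-d} ?g = 0" using fz d by (intro integral_unique has_integral_is_0) auto
    also have "integral {d..1} ?g = 0" using fz d by (intro integral_unique has_integral_is_0) auto
    also have "integral {-d..d} ?g \<le> (d - (-d)) * (31 * D)^2"
      using d fb by (intro integral_square_le cf) (auto simp: abs_le_iff)
    finally show ?thesis by simp
  qed
  \<comment> \<open>For |x| \<le> d/2 the inner function is at least 3/4, so w \<ge> 27/64. Together
    with \<open>up\<close> the quotient is 2 * 31^2 * (64/27)^2 in units of D^2, below
    120^2.\<close>
  have lo: "d * (27 / 64)^2 \<le> integral {-1..1} (\<lambda>x. (w x)^2)"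
  proof -
    have "integral {-d/2..d/2} (\<lambda>x. (27 / 64 :: real)^2) \<le> integral {-d/2..d/2} (\<lambda>x. (w x)^2)"
    proof (intro integral_le integrable_continuous_real continuous_intros cw)
      fix x assume x: "x \<in> {-d/2..d/2}"
      have "\<bar>x\<bar> \<le> \<bar>d / 2\<bar>" using x by (auto simp: abs_le_iff)
      then have "x^2 \<le> (d / 2)^2" by (simp only: abs_le_square_iff)
      then have "D * x^2 \<le> D * (d / 2)^2" using D by (intro mult_left_mono) auto
      then have "U x \<ge> 3 / 4" using d by (simp add: U_def D_def power_divide)
      then have "(3 / 4) ^ 3 \<le> w x" unfolding w_def by (intro power_mono) auto
      then show "(27 / 64)^2 \<le> (w x)^2" by (intro power_mono) (auto simp: power3_eq_cube)
    qed
    also have "\<dots> \<le> integral {-1..1} (\<lambda>x. (w x)^2)"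
      using d d1 by (intro integral_subset_le integrable_continuous_real continuous_intros cw) auto
    finally show ?thesis using d by simp
  qed
  have "(lam m 0)^2 * (d * (27 / 64)^2) \<le> (lam m 0)^2 * integral {-1..1} (\<lambda>x. (w x)^2)" by (intro mult_left_mono lo) auto
  also have "\<dots> \<le> 2 * d * (31 * D)^2" using key up by (simp add: f_def)
  finally have "d * ((lam m 0)^2 * (27 / 64)^2) \<le> d * (2 * (31 * D)^2)" by (simp add: mult_ac)
  then have "(lam m 0)^2 * (27 / 64)^2 \<le> 2 * (31 * D)^2" using d by (simp add: mult_le_cancel_left)
  then have "(lam m 0)^2 * 729 \<le> 7872512 * D^2" by (simp add: power_mult_distrib power_divide)
  then have "(lam m 0)^2 \<le> 14400 * D^2" using zero_le_power2[of D] by linarith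
  also have "\<dots> = (120 * D)^2" by (simp add: power_mult_distrib)
  finally have "lam m 0 \<le> 120 * D" by (rule power2_le_imp_le) (use D in auto)
  then show ?thesis using id2 by (simp add: D_def \<alpha>_def)
qed

text \<open>Maximum principle on [a/2,1] for v^2 minus an exponential barrier E. There q \<ge>
  \<kappa>^2 and lam \<le> \<kappa>^2/2, so (v^2)'' = 2 v'^2 + 2 (q - lam) v^2 \<ge> \<kappa>^2 v^2,
  while E'' = \<kappa>^2 E. Using the square avoids any discussion of the sign of v; starting at a/2
  keeps q bounded below and leaves a distance a/2 for the decay.\<close>

lemma ground_state_decay:
  assumes a: "0 < a" "a < 1" and sm: "lam m 0 \<le> \<nu> m * (a / 2) powr (2 * \<gamma>) / 2" and x: "x \<in> {a..1}"
  shows "(v m 0 x)^2 \<le> 2 * lam m 0 * exp (- (sqrt (\<nu> m) * (a / 2) powr \<gamma>) * (a / 2))"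
proof -
  define \<kappa> where "\<kappa> = sqrt (\<nu> m) * (a / 2) powr \<gamma>"
  have \<kappa>0: "\<kappa> \<ge> 0" using nu_pos[of m] by (simp add: \<kappa>_def)
  have \<kappa>2: "\<kappa>^2 = \<nu> m * (a / 2) powr (2 * \<gamma>)"
    unfolding \<kappa>_def power_mult_distrib using nu_pos[of m] a by (simp add: powr_power mult.commute)
  define l0 where "l0 = lam m 0"
  have l0: "l0 > 0" by (simp add: l0_def lam_pos)
  note V = C2_onD[OF v_C2[of m 0]]
  let ?v = "v m 0" and ?v1 = "v1 m 0" and ?q = "\<lambda>x. \<nu> m * \<bar>x\<bar> powr (2 * \<gamma>)"
  define E where "E t = 2 * l0 * exp (- \<kappa> * (t - a / 2))" for t
  define Z where "Z t = (?v t)^2 - E t" for t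
  define Z1 where "Z1 t = 2 * ?v t * ?v1 t + \<kappa> * E t" for t
  define Z2 where "Z2 t = 2 * (?v1 t)^2 + 2 * (?q t - l0) * (?v t)^2 - \<kappa>^2 * E t" for t
  have dE: "(E has_real_derivative - \<kappa> * E t) (at t within A)" for t A
    unfolding E_def by (auto intro!: derivative_eq_intros)
  have Zc: "C2_on (-1) 1 Z Z1 Z2"
    unfolding C2_on_def
  proof (intro conjI ballI)
    fix t :: real assume t: "t \<in> {-1..1}"
    show "(Z has_real_derivative Z1 t) (at t within {-1..1})"
      unfolding Z_def Z1_def by (auto intro!: derivative_eq_intros V(1)[OF t] dE)
    show "(Z1 has_real_derivative Z2 t) (at t within {-1..1})"
      unfolding Z1_def Z2_def by (auto intro!: derivative_eq_intros V(1,2)[OF t] dE simp: l0_def power2_eq_square algebra_simps)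
  next
    show "continuous_on {-1..1} Z2" unfolding Z2_def E_def
      by (intro continuous_on_add continuous_on_diff continuous_on_mult continuous_on_power continuous_on_const continuous_on_exp continuous_on_id V weight_1d_continuous gamma)
  qed
  have "Z x \<le> 0"
  proof (rule maximum_principle[of "a / 2" 1 Z Z1 Z2 \<kappa>])
    show "C2_on (a / 2) 1 Z Z1 Z2" by (rule C2_on_subinterval[OF Zc]) (use a in auto)
    show "Z2 t \<ge> \<kappa>^2 * Z t" if t: "t \<in> {a / 2..1}" for t
    proof -
      have "(a / 2) powr (2 * \<gamma>) \<le> \<bar>t\<bar> powr (2 * \<gamma>)" using t a gamma by (intro powr_mono2) auto
      then have "\<kappa>^2 \<le> ?q t" unfolding \<kappa>2 using nu_pos[of m] by (intro mult_left_mono) auto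
      moreover have "l0 \<le> \<kappa>^2 / 2" using sm by (simp add: \<kappa>2 l0_def)
      ultimately have "\<kappa>^2 \<le> 2 * (?q t - l0)" by simp
      then have "\<kappa>^2 * (?v t)^2 \<le> 2 * (?q t - l0) * (?v t)^2" by (intro mult_right_mono) auto
      moreover have "0 \<le> 2 * (?v1 t)^2" by simp
      ultimately have "\<kappa>^2 * (?v t)^2 - \<kappa>^2 * E t \<le> Z2 t" unfolding Z2_def by linarith
      then show ?thesis by (simp add: Z_def right_diff_distrib)
    qed
    show "Z (a / 2) \<le> 0" using v_sup[of "a / 2" m 0] a by (simp add: Z_def E_def l0_def)
    show "Z 1 \<le> 0" using v_r[of m 0] l0 by (simp add: Z_def E_def)
    show "x \<in> {a / 2..1}" using x a by auto
  qed
  then have "(?v x)^2 \<le> E x" by (simp add: Z_def)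
  also have "E x \<le> 2 * l0 * exp (- \<kappa> * (a / 2))"
  proof -
    have "\<kappa> * (a / 2) \<le> \<kappa> * (x - a / 2)" using x \<kappa>0 by (intro mult_left_mono) auto
    then show ?thesis unfolding E_def using l0 by (intro mult_left_mono) auto
  qed
  finally show ?thesis by (simp add: \<kappa>_def l0_def)
qed

end

section \<open>Failure of null controllability\<close>

text \<open>For a non-integrable f the left side is 0 by convention; this lets the estimate be
  applied to sections whose measurability is not known.\<close>

lemma abs_integral_le_nn_integral:
  fixes f :: "'a \<Rightarrow> real"
  shows "ennreal \<bar>integral\<^sup>L M f\<bar> \<le> (\<integral>\<^sup>+x. ennreal \<bar>f x\<bar> \<partial>M)"
  using integral_norm_bound_ennreal[of M f] by (cases "integrable M f") (auto simp: not_integrable_integral_eq)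

text \<open>C is the L1 norm of u and is fixed before h. As u is only Lebesgue measurable on the
  product, its sections need not be measurable at every time: a Borel representative \<phi> is
  taken, Tonelli is applied to it, and almost every section of u agrees with that of \<phi> almost
  everywhere.\<close>

lemma control_pairing_bound:
  assumes u: "control_L2 T u"
  shows "\<exists>C\<ge>0. \<forall>h. \<forall>H\<ge>0. \<forall>t\<in>{0..T}. (\<forall>p\<in>omega a b. \<bar>h p\<bar> \<le> H) \<longrightarrow>
    \<bar>LINT s:{0..t}|lborel. ip (\<lambda>p. indicator (omega a b) p * u s p) h\<bar> \<le> C * H"
proof -
  define D where "D = {0<..<T} \<times> Omega"
  define uu where "uu = (\<lambda>(t, p). u t p)"
  have Db: "D \<in> lmeasurable" unfolding D_def Omega_box
    by (intro lmeasurable_open bounded_Times open_Times) auto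
  then have Ds: "D \<in> sets lebesgue" by (simp add: fmeasurableD)
  have um: "uu \<in> borel_measurable (lebesgue_on D)" "integrable (lebesgue_on D) (\<lambda>z. (uu z)^2)"
    using u unfolding control_L2_def D_def uu_def by (simp_all add: case_prod_unfold)
  have ui: "integrable (lebesgue_on D) uu"
  proof (rule Bochner_Integration.integrable_bound)
    show "integrable (lebesgue_on D) (\<lambda>z. 1 + (uu z)^2)"
      using finite_measure.integrable_const[OF finite_measure_lebesgue_on[OF Db]] um(2) by (rule Bochner_Integration.integrable_add)
    have "\<bar>r\<bar> \<le> 1 + r^2" for r :: real using zero_le_power2[of "\<bar>r\<bar> - 1"] by (simp add: power2_diff) 
    then show "AE z in lebesgue_on D. norm (uu z) \<le> norm (1 + (uu z)^2)" by (auto simp: abs_of_nonneg add_nonneg_nonneg)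
  qed (rule um(1))
  define U where "U z = (if z \<in> D then uu z else 0)" for z
  have Ui: "integrable lebesgue U" unfolding U_def using ui by (simp only: Lebesgue_Measure.integrable_restrict_UNIV[OF Ds])
  obtain \<phi> where \<phi>: "\<phi> \<in> borel_measurable lborel" "AE z in lborel. U z = \<phi> z"
    using completion_ex_borel_measurable_real[of U lborel] Ui by auto
  have \<phi>m: "(\<lambda>z. ennreal \<bar>\<phi> z\<bar>) \<in> borel_measurable (lborel \<Otimes>\<^sub>M lborel)"
    using \<phi>(1) unfolding lborel_prod by measurable
  define I where "I = (\<integral>\<^sup>+z. ennreal \<bar>\<phi> z\<bar> \<partial>lborel)"
  have "I = (\<integral>\<^sup>+z. ennreal \<bar>U z\<bar> \<partial>lborel)" unfolding I_def
    by (rule nn_integral_cong_AE) (use \<phi>(2) in eventually_elim, simp)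
  also have "\<dots> = (\<integral>\<^sup>+z. ennreal \<bar>U z\<bar> \<partial>lebesgue)" by (simp only: nn_integral_completion)
  also have "\<dots> < \<infinity>" using Ui by (simp add: integrable_iff_bounded)
  finally have If: "I < \<infinity>" .
  define C where "C = enn2real I"
  have IC: "I = ennreal C" using If by (simp add: C_def)
  have sec: "AE s in lborel. AE p in lborel. U (s, p) = \<phi> (s, p)"
    by (rule lborel_pair.AE_pair) (unfold lborel_prod, rule \<phi>(2))
  show ?thesis
  proof (intro exI[of _ C] conjI allI impI ballI)
    show "C \<ge> 0" by (simp add: C_def)
    fix h :: "real \<times> real \<Rightarrow> real" and H t :: real
    assume H: "H \<ge> 0" and hb: "\<forall>p\<in>omega a b. \<bar>h p\<bar> \<le> H" and t: "t \<in> {0..T}"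
    let ?w = "\<lambda>s. ip (\<lambda>p. indicator (omega a b) p * u s p) h"
    have wb: "ennreal \<bar>?w s\<bar> \<le> (\<integral>\<^sup>+p. ennreal H * ennreal \<bar>U (s, p)\<bar> \<partial>lborel)" if s: "s \<in> {0<..<T}" for s
    proof -
      have "ennreal \<bar>?w s\<bar> \<le> (\<integral>\<^sup>+p. ennreal \<bar>indicator (omega a b) p * u s p * h p\<bar> \<partial>LO)"
        unfolding ip_def by (rule abs_integral_le_nn_integral)
      also have "\<dots> \<le> (\<integral>\<^sup>+p. ennreal H * ennreal \<bar>u s p\<bar> \<partial>LO)"
      proof (rule nn_integral_mono)
        fix p
        have "\<bar>indicator (omega a b) p * u s p * h p\<bar> \<le> H * \<bar>u s p\<bar>"
          using hb H by (auto simp: indicator_def abs_mult mult.commute[of H] intro: mult_left_mono)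
        then show "ennreal \<bar>indicator (omega a b) p * u s p * h p\<bar> \<le> ennreal H * ennreal \<bar>u s p\<bar>"
          using H by (simp add: ennreal_mult[symmetric] ennreal_leI)
      qed
      also have "\<dots> = (\<integral>\<^sup>+p. ennreal H * ennreal \<bar>u s p\<bar> * indicator Omega p \<partial>lebesgue)"
        by (rule nn_integral_restrict_space) simp
      also have "\<dots> = (\<integral>\<^sup>+p. ennreal H * ennreal \<bar>U (s, p)\<bar> \<partial>lborel)"
        unfolding nn_integral_completion
        by (intro nn_integral_cong) (use s in \<open>auto simp: U_def uu_def D_def indicator_def\<close>)
      finally show ?thesis .
    qed
    have "ennreal \<bar>LINT s:{0..t}|lborel. ?w s\<bar> \<le> (\<integral>\<^sup>+s. ennreal \<bar>indicator {0..t} s *\<^sub>R ?w s\<bar> \<partial>lborel)"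
      unfolding set_lebesgue_integral_def by (rule abs_integral_le_nn_integral)
    also have "\<dots> \<le> (\<integral>\<^sup>+s. (\<integral>\<^sup>+p. ennreal H * ennreal \<bar>\<phi> (s, p)\<bar> \<partial>lborel) \<partial>lborel)"
    proof (rule nn_integral_mono_AE)
      \<comment> \<open>U agrees with u only on the open interval (0,T), so the endpoints of the
        time integral are discarded.\<close>
      have "AE s in lborel. s \<noteq> (0::real)" "AE s in lborel. s \<noteq> T" by (rule AE_lborel_singleton)+
      then show "AE s in lborel. ennreal \<bar>indicator {0..t} s *\<^sub>R ?w s\<bar> \<le> (\<integral>\<^sup>+p. ennreal H * ennreal \<bar>\<phi> (s, p)\<bar> \<partial>lborel)"
        using sec
      proof eventually_elim
        case (elim s)
        show ?case
        proof (cases "s \<in> {0..t}")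
          case True
          then have "s \<in> {0<..<T}" using elim(1,2) t by auto
          from wb[OF this] have "ennreal \<bar>?w s\<bar> \<le> (\<integral>\<^sup>+p. ennreal H * ennreal \<bar>U (s, p)\<bar> \<partial>lborel)" .
          also have "\<dots> = (\<integral>\<^sup>+p. ennreal H * ennreal \<bar>\<phi> (s, p)\<bar> \<partial>lborel)"
            by (rule nn_integral_cong_AE) (use elim(3) in eventually_elim, simp)
          finally show ?thesis using True by simp
        qed simp
      qed
    qed
    also have "\<dots> = integral\<^sup>N (lborel \<Otimes>\<^sub>M lborel) (\<lambda>z. ennreal H * ennreal \<bar>\<phi> z\<bar>)"
      by (rule lborel.nn_integral_fst) (use \<phi>m in measurable)
    also have "\<dots> = ennreal H * I" unfolding I_def using \<phi>m unfolding lborel_prod by (rule nn_integral_cmult)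
    also have "\<dots> = ennreal (H * C)" unfolding IC using H by (simp add: ennreal_mult C_def)
    finally show "\<bar>LINT s:{0..t}|lborel. ?w s\<bar> \<le> C * H"
      using H by (simp add: C_def mult.commute)
  qed
qed

text \<open>Split the coefficient c into the integrated control term, bounded by B, and the rest d,
  which is differentiable with d' = -\<mu> c. Then exp(\<mu> t) (d + B) is nondecreasing; it starts
  at \<open>ip f0 h\<close> + B and, since c vanishes at T, ends at most at 2 B exp(\<mu> T).
  Smallness of the control term is thus required only after integration in time.\<close>

lemma weak_sol_initial_coefficient_le:
  assumes f: "weak_sol \<gamma> a b T f0 u f" and T: "T > 0" and h: "is_A \<gamma> h (\<lambda>p. - \<mu> * h p)" and \<mu>: "\<mu> \<ge> 0"
    and fT: "AE p in LO. f T p = 0"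
    and B: "\<And>t. t \<in> {0..T} \<Longrightarrow> \<bar>LINT s:{0..t}|lborel. ip (\<lambda>p. indicator (omega a b) p * u s p) h\<bar> \<le> B"
  shows "ip f0 h \<le> 2 * B * exp (\<mu> * T)"
proof -
  note F = weak_solD[OF f]
  have Lh: "L2 h" using is_A_L2[OF h] by simp
  let ?w = "\<lambda>s. ip (\<lambda>p. indicator (omega a b) p * u s p) h"
  define c where "c t = ip (f t) h" for t
  have cc: "continuous_on {0..T} c" unfolding c_def by (rule continuous_ip_of_dist2[OF F(1) Lh F(2)])
  have sc: "ip k (\<lambda>p. - \<mu> * h p) = - \<mu> * ip k h" for k
    using ip_scale[of "- \<mu>" h k] by (simp add: ip_commute)
  define J where "J t = integral {0..t} c" for t
  define d where "d t = ip f0 h - \<mu> * J t" for t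
  have W: "(LINT s:{0..t}|lborel. ?w s) = c t - d t" if t: "t \<in> {0..T}" for t
  proof -
    have ci: "set_integrable lborel {0..t} c"
      by (intro borel_integrable_atLeastAtMost' continuous_on_subset[OF cc]) (use t in auto)
    then have mi: "set_integrable lborel {0..t} (\<lambda>s. - \<mu> * c s)" by (rule set_integrable_mult_right)
    have "(LINT s:{0..t}|lborel. (- \<mu> * c s + ?w s) - (- \<mu> * c s)) = (LINT s:{0..t}|lborel. - \<mu> * c s + ?w s) - (LINT s:{0..t}|lborel. - \<mu> * c s)"
      using F(4)[OF h t] mi unfolding sc c_def by (rule set_integral_diff(2))
    moreover have "(LINT s:{0..t}|lborel. - \<mu> * c s + ?w s) = c t - ip f0 h" using F(5)[OF h t] unfolding sc c_def by simp
    moreover have "(LINT s:{0..t}|lborel. - \<mu> * c s) = - \<mu> * J t"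
      unfolding J_def set_borel_integral_eq_integral(2)[OF ci, symmetric] by (rule set_integral_mult_right)
    ultimately show ?thesis by (simp add: d_def)
  qed
  define \<phi> where "\<phi> t = exp (\<mu> * t) * (d t + B)" for t
  have dJ: "(J has_real_derivative c t) (at t within {0..T})" if "t \<in> {0..T}" for t
    unfolding J_def by (rule integral_has_real_derivative[OF cc that])
  have d\<phi>: "(\<phi> has_real_derivative \<mu> * exp (\<mu> * t) * (B - (c t - d t))) (at t within {0..T})" if "t \<in> {0..T}" for t
    unfolding \<phi>_def d_def by (auto intro!: derivative_eq_intros dJ[OF that] simp: algebra_simps)
  have "\<phi> 0 \<le> \<phi> T"
  proof (rule DERIV_nonneg_imp_increasing_open[where f = \<phi>])
    show "0 \<le> T" using T by simp
    show "continuous_on {0..T} \<phi>" by (rule DERIV_continuous_on[OF d\<phi>])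
    fix t assume t: "0 < t" "t < T"
    have "c t - d t \<le> B" using B[of t] W[of t] t by auto
    then have "\<mu> * exp (\<mu> * t) * (B - (c t - d t)) \<ge> 0" using \<mu> by simp
    moreover have "at t within {0..T} = at t" using t by (intro at_within_interior) auto
    ultimately show "\<exists>y. (\<phi> has_real_derivative y) (at t) \<and> 0 \<le> y" using d\<phi>[of t] t by auto
  qed
  moreover have "\<phi> 0 = ip f0 h + B" by (simp add: \<phi>_def d_def J_def)
  moreover have "c T = 0" unfolding c_def ip_def
    by (rule integral_eq_zero_AE) (use fT in eventually_elim, simp)
  then have "d T + B \<le> 2 * B" using B[of T] W[of T] T by auto
  then have "\<phi> T \<le> exp (\<mu> * T) * (2 * B)" unfolding \<phi>_def by (intro mult_left_mono) auto
  moreover have "B \<ge> 0" using B[of 0] T by auto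
  ultimately show ?thesis by (simp add: mult_ac)
qed

context grushin_modes
begin

lemma abs_ef_le:
  assumes "p \<in> box2"
  shows "\<bar>ef m k p\<bar> \<le> sqrt (2 * lam m k) * sqrt (\<nu> m)"
proof -
  have "\<bar>v m k (fst p)\<bar> \<le> sqrt (2 * lam m k)" using v_sup[of "fst p" m k] assms by (intro real_le_rsqrt) (simp add: box2_iff)
  moreover have "\<bar>s m (snd p)\<bar> \<le> sqrt (\<nu> m)" using s_sup[of "snd p" m] assms by (intro real_le_rsqrt) (simp add: box2_iff)
  ultimately show ?thesis unfolding ef_def tensor_def abs_mult using lam_pos[of m k] by (intro mult_mono) auto
qed

text \<open>A single initial datum has to defeat its control for all large m at once, as the
  constant in the pairing bound depends on the control. Prescribing all its ground coefficients
  replaces an observability inequality.\<close>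

lemma ground_series_exists:
  assumes c: "\<And>m. c m \<ge> 0" "summable (\<lambda>m. c m * (sqrt (2 * lam m 0) * sqrt (\<nu> m)))"
  shows "\<exists>f0. L2 f0 \<and> (\<forall>m. ip f0 (ef m 0) = c m)"
proof -
  define g where "g n p = (\<Sum>m<n. c m * ef m 0 p)" for n p
  define f0 where "f0 p = (\<Sum>m. c m * ef m 0 p)" for p
  have b: "\<bar>c m * ef m 0 p\<bar> \<le> c m * (sqrt (2 * lam m 0) * sqrt (\<nu> m))" if "p \<in> box2" for m p
    using abs_ef_le[OF that, of m 0] c(1)[of m] by (simp add: abs_mult mult_left_mono)
  have L: "L2 f0" unfolding f0_def
    by (intro continuous_L2 continuous_on_suminf[OF _ b c(2)] continuous_intros ef_continuous)
  have gL: "L2 (g n)" for n unfolding g_def by (intro L2_sum L2_scale ef_L2)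
  have ul: "uniform_limit box2 g f0 sequentially" unfolding g_def f0_def
    by (rule Weierstrass_m_test[OF _ c(2)]) (simp add: b)
  have "(\<lambda>n. dist2 (g n) f0) \<longlonglongrightarrow> 0"
  proof (rule tendstoI)
    fix e :: real assume e: "e > 0"
    have "sqrt (e / 4) > 0" using e by simp
    from uniform_limitD[OF ul this] show "\<forall>\<^sub>F n in sequentially. dist (dist2 (g n) f0) 0 < e"
    proof eventually_elim
      case (elim n)
      have "dist2 (g n) f0 \<le> 2 * (sqrt (e / 4))^2"
        by (rule dist2_le_of_uniform[OF gL L]) (use elim Omega_subset_box2 in \<open>force simp: dist_real_def\<close>)
      then show ?case using e dist2_nonneg[of "g n" f0] by (simp add: dist_real_def)
    qed
  qed
  then have lim: "(\<lambda>n. ip (g n) (ef m 0)) \<longlonglongrightarrow> ip f0 (ef m 0)" for m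
    by (intro tendsto_ip_of_dist2 gL L ef_L2)
  have "ip (g n) (ef m 0) = (if m < n then c m else 0)" for m n
    unfolding g_def by (subst ip_sum) (auto simp: L2_scale ef_L2 ip_scale ef_orth if_distrib sum.delta cong: if_cong)
  then have "(\<lambda>n. ip (g n) (ef m 0)) \<longlonglongrightarrow> c m" for m
    by (intro tendsto_eventually eventually_sequentiallyI[of "Suc m"]) simp
  then have "ip f0 (ef m 0) = c m" for m using lim LIMSEQ_unique by blast
  with L show ?thesis by blast
qed

lemma nu_at_top: "filterlim \<nu> at_top sequentially"
proof -
  have "summable (\<lambda>m. 1 / \<nu> m)"
    by (rule summableI_nonneg_bounded[where x = 1]) (use nu_pos nu_trace in \<open>auto simp: less_imp_le\<close>)
  then have "(\<lambda>m. 1 / \<nu> m) \<longlonglongrightarrow> 0" by (rule summable_LIMSEQ_zero)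
  then have "filterlim (\<lambda>m. inverse (1 / \<nu> m)) at_top sequentially"
    by (rule filterlim_inverse_at_top) (simp add: nu_pos)
  then show ?thesis by (simp add: field_simps)
qed

lemma sqrt_nu_at_top: "filterlim (\<lambda>m. sqrt (\<nu> m)) at_top sequentially"
  by (rule filterlim_compose[OF sqrt_at_top nu_at_top])

text \<open>On the strip the m-th ground state is at most of size exp(-2 c1 z) up to powers of z =
  sqrt \<nu>_m, so c1 is half its decay rate. If exp(lam T) \<le> exp(c1 z), the coefficient of f0
  would have to be O(exp(-c1 z)) up to powers, but it is chosen with only polynomial decay.\<close>

lemma not_null_controllable_of_ground_energy:
  assumes g: "\<gamma> \<ge> 1" and a: "0 < a" "a < b" "b < 1" and T: "T > 0"
    and ev: "\<forall>\<^sub>F m in sequentially. lam m 0 * T \<le> (a / 2) powr \<gamma> * (a / 8) * sqrt (\<nu> m)"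
  shows "\<not> null_controllable \<gamma> a b T"
proof
  assume nc: "null_controllable \<gamma> a b T"
  define c1 where "c1 = (a / 2) powr \<gamma> * (a / 8)"
  have c1: "c1 > 0" using a by (simp add: c1_def)
  define A where "A m = sqrt (2 * lam m 0) * sqrt (\<nu> m)" for m
  have A0: "A m \<ge> 0" for m using lam_pos[of m 0] nu_pos[of m] by (simp add: A_def)
  \<comment> \<open>The factor 1 + A m compensates the sup bound of the eigenfunction, so that the
    series for f0 is dominated by the sum of 1/\<nu>.\<close>
  define c where "c m = 1 / (\<nu> m * (1 + A m))" for m
  have c0: "c m \<ge> 0" for m using A0[of m] nu_pos[of m] by (simp add: c_def less_imp_le)
  have "summable (\<lambda>m. c m * A m)"
  proof (rule summable_comparison_test'[where N = 0])
    show "summable (\<lambda>m. 1 / \<nu> m)"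
      by (rule summableI_nonneg_bounded[where x = 1]) (use nu_pos nu_trace in \<open>auto simp: less_imp_le\<close>)
    fix m :: nat
    have "c m * A m = (1 / \<nu> m) * (A m / (1 + A m))" by (simp add: c_def)
    also have "\<dots> \<le> (1 / \<nu> m) * 1" using A0[of m] nu_pos[of m] by (intro mult_left_mono) auto
    finally show "norm (c m * A m) \<le> 1 / \<nu> m" using c0[of m] A0[of m] by simp
  qed
  then have "summable (\<lambda>m. c m * (sqrt (2 * lam m 0) * sqrt (\<nu> m)))" by (simp only: A_def)
  then obtain f0 where f0: "L2 f0" "\<And>m. ip f0 (ef m 0) = c m"
    using ground_series_exists[of c, OF c0] by blast
  obtain u f where u: "control_L2 T u" and f: "weak_sol \<gamma> a b T f0 u f" and fT: "AE p in LO. f T p = 0"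
    using nc f0(1) unfolding null_controllable_def by blast
  obtain C where C: "C \<ge> 0"
    "\<forall>h. \<forall>H\<ge>0. \<forall>t\<in>{0..T}. (\<forall>p\<in>omega a b. \<bar>h p\<bar> \<le> H) \<longrightarrow>
       \<bar>LINT s:{0..t}|lborel. ip (\<lambda>p. indicator (omega a b) p * u s p) h\<bar> \<le> C * H"
    using control_pairing_bound[OF u] by blast
  define k where "k = (a / 2) powr (2 * \<gamma>) / 2"
  have k: "k > 0" using a by (simp add: k_def)
  \<comment> \<open>240 comes from the bound H, 2 from the coefficient estimate, 241 from 1 + A m
    \<le> 241 z^2.\<close>
  define K where "K = 241 * 240 * 2 * C"
  have "\<forall>\<^sub>F m in sequentially. 1 \<le> K * (sqrt (\<nu> m) ^ 6 * exp (- c1 * sqrt (\<nu> m)))"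
    using ev filterlim_at_top[THEN iffD1, OF nu_at_top, rule_format, of 1] filterlim_at_top[THEN iffD1, OF sqrt_nu_at_top, rule_format, of "120 / k"]
  proof eventually_elim
    case (elim m)
    define z where "z = sqrt (\<nu> m)"
    have z: "z \<ge> 1" "z^2 = \<nu> m" using elim(2) by (auto simp: z_def)
    have z2: "z \<le> z^2" by (rule self_le_power) (use z(1) in auto)
    define l where "l = lam m 0"
    have l0: "l > 0" by (simp add: l_def lam_pos)
    have "l \<le> 120 * \<nu> m powr (1 / (1 + \<gamma>))" unfolding l_def by (rule ground_energy_upper[OF elim(2)])
    \<comment> \<open>\<gamma> \<ge> 1 makes the ground energy at most of order z, hence below half
      of \<nu> (a/2)^(2\<gamma>) for large m, as the decay estimate demands.\<close>
    also have "\<nu> m powr (1 / (1 + \<gamma>)) \<le> \<nu> m powr (1 / 2)" using elim(2) g by (intro powr_mono) (auto simp: field_simps)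
    finally have l: "l \<le> 120 * z" using elim(2) by (simp add: z_def powr_half_sqrt)
    have "120 \<le> z * k" using elim(3) k by (simp add: z_def pos_divide_le_eq)
    then have "120 * z \<le> z * k * z" using z by (intro mult_right_mono) auto
    then have sm: "lam m 0 \<le> \<nu> m * (a / 2) powr (2 * \<gamma>) / 2" using l by (simp add: l_def k_def z(2)[symmetric] power2_eq_square mult_ac)
    have sl: "sqrt (2 * l) \<le> 240 * z"
    proof -
      have "2 * l \<le> 240 * z" using l by simp
      also have "\<dots> \<le> (240 * z)^2" using z2 z by (simp add: power_mult_distrib)
      finally show ?thesis using z by (intro real_le_lsqrt) (use l0 in auto)
    qed
    define H where "H = 240 * z * exp (- (2 * c1) * z) * z"
    have H0: "H \<ge> 0" using z by (simp add: H_def)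
    have "\<bar>LINT s:{0..t}|lborel. ip (\<lambda>p. indicator (omega a b) p * u s p) (ef m 0)\<bar> \<le> C * H" if "t \<in> {0..T}" for t
    proof (rule C(2)[rule_format, OF H0 that])
      fix p assume "p \<in> omega a b"
      then have p: "fst p \<in> {a..1}" "snd p \<in> {0..1}" using a by (auto simp: omega_def)
      have a1: "a < 1" using a by simp
      have "exp (- (2 * c1) * z) ^ 2 = exp (- (sqrt (\<nu> m) * (a / 2) powr \<gamma>) * (a / 2))"
        unfolding exp_double[symmetric] by (simp add: c1_def z_def)
      then have "(v m 0 (fst p))^2 \<le> (sqrt (2 * l) * exp (- (2 * c1) * z))^2"
        using ground_state_decay[OF a(1) a1 sm p(1)] l0 unfolding power_mult_distrib by (simp add: l_def)
      then have "\<bar>v m 0 (fst p)\<bar> \<le> \<bar>sqrt (2 * l) * exp (- (2 * c1) * z)\<bar>" by (simp only: abs_le_square_iff)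
      also have "\<dots> = sqrt (2 * l) * exp (- (2 * c1) * z)" using l0 by simp
      also have "\<dots> \<le> 240 * z * exp (- (2 * c1) * z)" using sl by (intro mult_right_mono) auto
      finally have vb: "\<bar>v m 0 (fst p)\<bar> \<le> 240 * z * exp (- (2 * c1) * z)" .
      have "\<bar>s m (snd p)\<bar> \<le> z" using s_sup[of "snd p" m] p unfolding z_def by (intro real_le_rsqrt) simp
      with vb show "\<bar>ef m 0 p\<bar> \<le> H" unfolding ef_def tensor_def abs_mult H_def using z by (intro mult_mono) auto
    qed
    from weak_sol_initial_coefficient_le[OF f T is_A_ef _ fT this]
    have "c m \<le> 2 * (C * H) * exp (l * T)" using l0 f0(2) by (simp add: l_def)
    also have "\<dots> \<le> 2 * (C * H) * exp (c1 * z)" using elim(1) C(1) H0 by (intro mult_left_mono) (auto simp: l_def c1_def z_def)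
    also have "\<dots> = 240 * 2 * C * (z^2 * (exp (- (2 * c1) * z) * exp (c1 * z)))" by (simp add: H_def power2_eq_square)
    also have "exp (- (2 * c1) * z) * exp (c1 * z) = exp (- c1 * z)" by (simp add: exp_add[symmetric])
    finally have c1': "c m \<le> 240 * 2 * C * (z^2 * exp (- c1 * z))" .
    have "A m \<le> 240 * z * z" unfolding A_def using sl z by (intro mult_mono) (auto simp: l_def z_def)
    then have "1 + A m \<le> 241 * z^2" using z z2 by (simp add: power2_eq_square)
    then have X: "\<nu> m * (1 + A m) \<le> z^2 * (241 * z^2)" unfolding z(2)[symmetric] by (intro mult_left_mono) auto
    have X0: "\<nu> m * (1 + A m) > 0" using A0[of m] nu_pos[of m] by (intro mult_pos_pos add_pos_nonneg) auto
    have "c m * (\<nu> m * (1 + A m)) \<le> (240 * 2 * C * (z^2 * exp (- c1 * z))) * (z^2 * (241 * z^2))"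
      by (rule mult_mono[OF c1' X]) (use C(1) X0 in auto)
    moreover have "c m * (\<nu> m * (1 + A m)) = 1" unfolding c_def times_divide_eq_left mult_1
      by (rule divide_self[OF less_imp_neq[OF X0, symmetric]])
    moreover have "z ^ 6 = z^2 * z^2 * z^2" by (simp flip: power_add)
    then have "(240 * 2 * C * (z^2 * exp (- c1 * z))) * (z^2 * (241 * z^2)) = K * (z ^ 6 * exp (- c1 * z))"
      unfolding K_def by (simp only: mult_ac)
    ultimately show ?case unfolding z_def[symmetric] by (simp only:)
  qed
  moreover have "(\<lambda>m. K * (sqrt (\<nu> m) ^ 6 * exp (- c1 * sqrt (\<nu> m)))) \<longlonglongrightarrow> 0"
  proof -
    have "filterlim (\<lambda>m. c1 * sqrt (\<nu> m)) at_top sequentially"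
      by (rule filterlim_tendsto_pos_mult_at_top[OF tendsto_const c1 sqrt_nu_at_top])
    from filterlim_compose[OF tendsto_power_div_exp_0 this, of 6]
    have "(\<lambda>m. K / c1 ^ 6 * ((c1 * sqrt (\<nu> m)) ^ 6 / exp (c1 * sqrt (\<nu> m)))) \<longlonglongrightarrow> K / c1 ^ 6 * 0"
      by (intro tendsto_mult tendsto_const)
    moreover have "K / c1 ^ 6 * ((c1 * z) ^ 6 / exp (c1 * z)) = K * (z ^ 6 * exp (- c1 * z))" for z
      using c1 by (simp add: power_mult_distrib exp_minus divide_inverse)
    ultimately show ?thesis by simp
  qed
  ultimately show False using tendsto_lowerbound[of _ 0 sequentially 1] by force
qed

text \<open>For \<gamma> = 1 the rate c1 is a^2/16 and lam \<le> 120 sqrt \<nu>, so lam T stays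
  below c1 sqrt \<nu> once 120 T \<le> a^2/16.\<close>

lemma not_null_controllable_critical:
  assumes "\<gamma> = 1" "0 < a" "a < b" "b < 1" "T > 0" "T \<le> a^2 / 1920"
  shows "\<not> null_controllable \<gamma> a b T"
proof (rule not_null_controllable_of_ground_energy)
  have "\<forall>\<^sub>F m in sequentially. \<nu> m \<ge> 1" using nu_at_top by (simp add: filterlim_at_top)
  then show "\<forall>\<^sub>F m in sequentially. lam m 0 * T \<le> (a / 2) powr \<gamma> * (a / 8) * sqrt (\<nu> m)"
  proof eventually_elim
    case (elim m)
    have "lam m 0 \<le> 120 * sqrt (\<nu> m)" using ground_energy_upper[OF elim] elim assms(1) by (simp add: powr_half_sqrt)
    then have "lam m 0 * T \<le> 120 * sqrt (\<nu> m) * (a^2 / 1920)" using assms elim by (intro mult_mono) auto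
    then show ?case using assms by (simp add: power2_eq_square mult_ac)
  qed
qed (use assms in auto)

text \<open>The ground energy is at most of order \<nu>^(1/2 - \<epsilon>), so a fixed T is beaten
  by sqrt \<nu> for large m.\<close>

lemma not_null_controllable_supercritical:
  assumes g: "\<gamma> > 1" and a: "0 < a" "a < b" "b < 1" and T: "T > 0"
  shows "\<not> null_controllable \<gamma> a b T"
proof (rule not_null_controllable_of_ground_energy)
  define \<epsilon> where "\<epsilon> = 1 / 2 - 1 / (1 + \<gamma>)"
  have \<epsilon>: "\<epsilon> > 0" using g by (simp add: \<epsilon>_def field_simps)
  define c1 where "c1 = (a / 2) powr \<gamma> * (a / 8)"
  have c1: "c1 > 0" using a by (simp add: c1_def)
  define R where "R = 120 * T / c1"
  have R: "R > 0" using T c1 by (simp add: R_def)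
  have "\<forall>\<^sub>F m in sequentially. \<nu> m \<ge> 1" "\<forall>\<^sub>F m in sequentially. \<nu> m \<ge> R powr (1 / \<epsilon>)" using nu_at_top by (simp_all add: filterlim_at_top)
  then show "\<forall>\<^sub>F m in sequentially. lam m 0 * T \<le> (a / 2) powr \<gamma> * (a / 8) * sqrt (\<nu> m)"
  proof eventually_elim
    case (elim m)
    have "(R powr (1 / \<epsilon>)) powr \<epsilon> \<le> \<nu> m powr \<epsilon>" using elim \<epsilon> by (intro powr_mono2) auto
    then have "R \<le> \<nu> m powr \<epsilon>" using \<epsilon> R by (simp add: powr_powr)
    then have "120 * T \<le> c1 * \<nu> m powr \<epsilon>" using c1 by (simp add: R_def pos_divide_le_eq mult.commute)
    then have "120 * T * \<nu> m powr (1 / (1 + \<gamma>)) \<le> c1 * \<nu> m powr \<epsilon> * \<nu> m powr (1 / (1 + \<gamma>))" by (intro mult_right_mono) auto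
    also have "\<dots> = c1 * sqrt (\<nu> m)" using elim(1) by (simp add: mult.assoc powr_add[symmetric] \<epsilon>_def powr_half_sqrt)
    finally have "120 * \<nu> m powr (1 / (1 + \<gamma>)) * T \<le> c1 * sqrt (\<nu> m)" by (simp add: mult_ac)
    moreover have "lam m 0 * T \<le> 120 * \<nu> m powr (1 / (1 + \<gamma>)) * T" using ground_energy_upper[OF elim(1)] T by (intro mult_right_mono) auto
    ultimately show ?case by (simp add: c1_def)
  qed
qed (use assms in auto)

end

section \<open>Monotonicity in time\<close>

lemma control_L2_extend:
  assumes u: "control_L2 T' u" and T: "T' \<le> T"
  shows "control_L2 T (\<lambda>t p. if t < T' then u t p else 0)"
proof -
  define D where "D T = {0<..<T} \<times> Omega" for T :: real
  have D: "D T \<in> sets lebesgue" for T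
  proof -
    have "open (D T)" unfolding D_def Omega_box by (intro open_Times open_greaterThanLessThan open_box)
    then have "D T \<in> sets lborel" unfolding sets_lborel by (rule borel_open)
    then show ?thesis by (rule sets_completionI_sets)
  qed
  define uu where "uu = (\<lambda>(t, p). u t p)"
  have u': "uu \<in> borel_measurable (lebesgue_on (D T'))" "integrable (lebesgue_on (D T')) (\<lambda>z. (uu z)^2)"
    using u unfolding control_L2_def D_def uu_def by (simp_all add: case_prod_unfold)
  have eq: "(\<lambda>(t, p). if t < T' then u t p else 0) z = (if z \<in> D T' then uu z else 0)" if "z \<in> D T" for z
    using that by (auto simp: D_def uu_def split: if_splits)
  have "(\<lambda>z. if z \<in> D T' then uu z else 0) \<in> borel_measurable lebesgue"
    using u'(1) borel_measurable_if[OF D] by blast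
  then have "(\<lambda>z. if z \<in> D T' then uu z else 0) \<in> borel_measurable (lebesgue_on (D T))" by (rule measurable_restrict_space1)
  then have 1: "(\<lambda>(t, p). if t < T' then u t p else 0) \<in> borel_measurable (lebesgue_on (D T))"
    by (subst measurable_cong[OF eq]) auto
  have "integrable lebesgue (\<lambda>z. if z \<in> D T' then (uu z)^2 else 0)"
    using u'(2) by (simp only: Lebesgue_Measure.integrable_restrict_UNIV[OF D])
  also have "(\<lambda>z. if z \<in> D T' then (uu z)^2 else 0) = (\<lambda>z. if z \<in> D T then (\<lambda>(t, p). (if t < T' then u t p else 0)^2) z else 0)"
    using T by (auto simp: D_def uu_def fun_eq_iff)
  finally have "integrable (lebesgue_on (D T)) (\<lambda>(t, p). (if t < T' then u t p else 0)^2)"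
    by (simp only: Lebesgue_Measure.integrable_restrict_UNIV[OF D])
  with 1 show ?thesis unfolding control_L2_def D_def by blast
qed

lemma at_within_closed_eq_bot:
  fixes x :: "'a::t1_space"
  assumes "closed S" "x \<notin> S"
  shows "at x within S = bot"
  using assms closed_limpt[of S] trivial_limit_within[of x S] by blast

text \<open>A state at rest stays at rest without control. State and control are glued with
  different inequalities at T', so the new integrand of the weak identity may differ from the old
  one at that single time.\<close>

lemma weak_sol_extend_zero:
  assumes f: "weak_sol \<gamma> a b T' f0 u f" and T': "0 < T'" "T' \<le> T" and z: "AE p in LO. f T' p = 0"
  shows "weak_sol \<gamma> a b T f0 (\<lambda>t p. if t < T' then u t p else 0) (\<lambda>t. if t \<le> T' then f t else (\<lambda>p. 0))" (is "weak_sol \<gamma> a b T f0 ?u ?f")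
proof -
  note F = weak_solD[OF f]
  have ipz: "ip (f T') h = 0" for h unfolding ip_def by (rule integral_eq_zero_AE) (use z in eventually_elim, simp)
  have late: "AE p in LO. ?f t p = 0" if "t \<ge> T'" for t using that z by (cases "t = T'") auto
  have cont: "((\<lambda>s. dist2 (?f s) (?f t)) \<longlongrightarrow> 0) (at t within {0..T})" if t: "t \<in> {0..T}" for t
  proof -
    have "((\<lambda>s. dist2 (?f s) (?f t)) \<longlongrightarrow> 0) (at t within {0..T'})"
    proof (cases "t \<le> T'")
      case True
      then have "((\<lambda>s. dist2 (f s) (f t)) \<longlongrightarrow> 0) (at t within {0..T'})" using F(2) t by simp
      then show ?thesis by (rule Lim_transform_within[OF _ zero_less_one]) (use True in auto)
    next
      case False
      then show ?thesis by (subst at_within_closed_eq_bot) auto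
    qed
    moreover have "((\<lambda>s. dist2 (?f s) (?f t)) \<longlongrightarrow> 0) (at t within {T'..T})"
    proof (cases "t \<ge> T'")
      case True
      have "dist2 (?f s) (?f t) = 0" if "s \<ge> T'" for s
        unfolding dist2_def by (rule integral_eq_zero_AE) (use late[OF True] late[OF that] in eventually_elim, simp)
      then have d0: "0 = dist2 (?f s) (?f t)" if "s \<in> {T'..T}" for s using that by (metis atLeastAtMost_iff)
      show ?thesis by (rule Lim_transform_within[OF tendsto_const zero_less_one]) (rule d0)
    next
      case False
      then show ?thesis by (subst at_within_closed_eq_bot) auto
    qed
    moreover have "{0..T} = {0..T'} \<union> {T'..T}" using T' by auto
    ultimately show ?thesis by (simp only: Lim_within_Un)
  qed
  have id: "set_integrable lborel {0..t} (\<lambda>s. ip (?f s) g + ip (\<lambda>p. indicator (omega a b) p * ?u s p) h)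
      \<and> ip (?f t) h = ip f0 h + (LINT s:{0..t}|lborel. ip (?f s) g + ip (\<lambda>p. indicator (omega a b) p * ?u s p) h)"
    if A: "is_A \<gamma> h g" and t: "t \<in> {0..T}" for h g t
  proof -
    define i where "i s = ip (?f s) g + ip (\<lambda>p. indicator (omega a b) p * ?u s p) h" for s
    define i' where "i' s = ip (f s) g + ip (\<lambda>p. indicator (omega a b) p * u s p) h" for s
    \<comment> \<open>Corrects the integrand at T', where the state is still f but the control is
      already 0; its integral vanishes.\<close>
    define e where "e s = indicator {T'} s * (i T' - i' T')" for s :: real
    define \<tau> where "\<tau> = min t T'"
    have \<tau>: "\<tau> \<in> {0..T'}" using t T' by (auto simp: \<tau>_def)
    have i'i: "set_integrable lborel {0..\<tau>} i'" and i'e: "ip (f \<tau>) h = ip f0 h + (LINT s:{0..\<tau>}|lborel. i' s)"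
      using F(4,5)[OF A \<tau>] unfolding i'_def by auto
    have ee: "indicator S s *\<^sub>R e s = indicator (S \<inter> {T'}) s *\<^sub>R (i T' - i' T')" for S s
      by (auto simp: e_def indicator_def)
    have ei: "set_integrable lborel {0..\<tau>} e" unfolding set_integrable_def ee
      by (intro integrable_real_indicator integrable_scaleR_left) (auto simp: Int_insert_right)
    have e0: "(LINT s:{0..\<tau>}|lborel. e s) = 0" unfolding set_lebesgue_integral_def
      by (rule integral_eq_zero_AE) (use AE_lborel_singleton[of T'] in eventually_elim, simp add: e_def)
    have eq: "indicator {0..t} s *\<^sub>R i s = indicator {0..\<tau>} s *\<^sub>R (i' s + e s)" for s
    proof -
      have "i s = 0" if "s > T'" using that by (simp add: i_def ip_def)
      moreover have "i s = i' s" if "s < T'" using that by (simp add: i_def i'_def)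
      ultimately show ?thesis by (cases s T' rule: linorder_cases) (auto simp: \<tau>_def e_def indicator_def)
    qed
    have "set_integrable lborel {0..t} i"
      using set_integral_add(1)[OF i'i ei] unfolding set_integrable_def eq .
    moreover have "(LINT s:{0..t}|lborel. i s) = (LINT s:{0..\<tau>}|lborel. i' s)"
      using set_integral_add(2)[OF i'i ei] e0 unfolding set_lebesgue_integral_def eq by simp
    moreover have "ip (?f t) h = ip (f \<tau>) h"
    proof (cases "t \<le> T'")
      case False
      then show ?thesis using ipz by (simp add: \<tau>_def) (simp add: ip_def)
    qed (simp add: \<tau>_def)
    ultimately show ?thesis using i'e unfolding i_def by simp
  qed
  have L: "L2 (?f t)" if "t \<in> {0..T}" for t using F(1)[of t] that L2_zero by simp
  have "AE p in LO. ?f 0 p = f0 p" using F(3) T' by simp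
  with L cont id show ?thesis unfolding weak_sol_def by blast
qed

lemma (in grushin_modes) null_controllable_mono:
  assumes nc: "null_controllable \<gamma> a b T'" and T': "0 < T'" "T' < T"
  shows "null_controllable \<gamma> a b T"
  unfolding null_controllable_def
proof (intro allI impI)
  fix f0 assume "L2 f0"
  then obtain u f where u: "control_L2 T' u" and f: "weak_sol \<gamma> a b T' f0 u f" and fT: "AE p in LO. f T' p = 0"
    using nc unfolding null_controllable_def by blast
  note ext = weak_sol_extend_zero[OF f T'(1) less_imp_le[OF T'(2)] fT]
  have "AE p in LO. g T p = 0" if g: "weak_sol \<gamma> a b T f0 (\<lambda>t p. if t < T' then u t p else 0) g" for g
    using weak_sol_unique[OF g ext, of T] T' by simp
  with ext control_L2_extend[OF u less_imp_le[OF T'(2)]]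
  show "\<exists>u. control_L2 T u \<and> (\<exists>f. weak_sol \<gamma> a b T f0 u f) \<and> (\<forall>f. weak_sol \<gamma> a b T f0 u f \<longrightarrow> (AE p in LO. f T p = 0))"
    by blast
qed

theorem theorem1p1:
  fixes \<gamma> a b :: real
  assumes "\<gamma> > 0" and "0 < a" and "a < b" and "b < 1"
  shows "(\<gamma> < 1 \<longrightarrow> (\<forall>T>0. null_controllable \<gamma> a b T))
    \<and> (\<gamma> = 1 \<longrightarrow> (\<exists>Tstar>0. (\<forall>T>Tstar. null_controllable \<gamma> a b T)
                          \<and> (\<forall>T. 0 < T \<and> T < Tstar \<longrightarrow> \<not> null_controllable \<gamma> a b T)))
    \<and> (\<gamma> > 1 \<longrightarrow> (\<forall>T>0. \<not> null_controllable \<gamma> a b T))"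
proof -
  obtain s s1 \<nu> v v1 lam where "grushin_modes \<gamma> s s1 \<nu> v v1 lam" using grushin_modes_exists[OF assms(1)] by blast
  then interpret grushin_modes \<gamma> s s1 \<nu> v v1 lam .
  have "\<exists>Tstar>0. (\<forall>T>Tstar. null_controllable \<gamma> a b T) \<and> (\<forall>T. 0 < T \<and> T < Tstar \<longrightarrow> \<not> null_controllable \<gamma> a b T)" if g: "\<gamma> = 1"
  proof -
    \<comment> \<open>Its infimum is the critical time: 67 belongs to N, a^2/1920 is a lower bound,
      and \<open>null_controllable_mono\<close> fills in every time above the infimum.\<close>
    define N where "N = {T. T > 0 \<and> null_controllable \<gamma> a b T}"
    have "67 \<in> N" using null_controllable_critical[OF g assms(2-4)] by (simp add: N_def)
    have lb: "a^2 / 1920 \<le> T" if "T \<in> N" for T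
      using not_null_controllable_critical[OF g assms(2-4), of T] that by (cases "T \<le> a^2 / 1920") (auto simp: N_def)
    then have bdd: "bdd_below N" by (rule bdd_belowI)
    have "a^2 / 1920 \<le> Inf N" using \<open>67 \<in> N\<close> lb by (intro cInf_greatest) auto
    moreover have "a^2 / 1920 > 0" using assms by simp
    ultimately have "Inf N > 0" by linarith
    moreover have "null_controllable \<gamma> a b T" if "T > Inf N" for T
    proof -
      have "\<exists>T'\<in>N. T' < T" by (rule cInf_lessD) (use \<open>67 \<in> N\<close> that in auto)
      then obtain T' where "T' \<in> N" "T' < T" by blast
      then show ?thesis using null_controllable_mono[of a b T' T] by (simp add: N_def)
    qed
    moreover have "\<not> null_controllable \<gamma> a b T" if "0 < T" "T < Inf N" for T
      using that cInf_lower[OF _ bdd, of T] by (auto simp: N_def)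
    ultimately show ?thesis by blast
  qed
  then show ?thesis
    using null_controllable_subcritical not_null_controllable_supercritical assms by blast
qed

end
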